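(* Let $\mathcal{C}$ be an Abelian category and $X\in\mathcal{C}^{\Delta^{\mathrm{op}}\times\Delta^{\mathrm{op}}}$ (equivalently, by Dold–Kan, a double complex). Let $\mathfrak{Aw}:\delta^*X\to\mathrm{dec}_*X$ and $\mathfrak{Ez}:\mathrm{dec}_*X\to\delta^*X$ be the morphisms defined in the context. 1. The square with top row $(\delta^*X)_{[n]}=X_{[n],[n]}\to\bigoplus_{i+j=n}X_{[i],[j]}$ given by $\sum_{i+j=n}(\delta_{i,l},\delta_{j,r})$, bottom row $\mathfrak{Aw}:(\delta^*X)_n\to(\mathrm{dec}_*X)_n=\bigoplus_{i+j=n}X_{i,j}$, and vertical arrows the projections to non-degenerate quotients, commutes. On the smallest filtration step of $(\delta^*X)_n$ and on its factor $X_{i,j}$ corresponding to a shuffle $(\sigma,\tau)$ the map $\mathfrak{Aw}$ is zero unless $\sigma=s^l$ and $\tau=s^r$. 2. The square with top row $\bigoplus_{i+j=n}X_{[i],[j]}\to X_{[n],[n]}=(\delta^*X)_{[n]}$ given by $\sum_{\sigma,\tau}\mathrm{sgn}(\sigma,\tau)(\sigma,\tau)$, where the sum runs over all shuffles $\sigma:[n]\twoheadrightarrow[i]$, $\tau:[n]\twoheadrightarrow[j]$ (jointly injective, $i+j=n$), bottom row $\mathfrak{Ez}:(\mathrm{dec}_*X)_n=\bigoplus_{i+j=n}X_{i,j}\to(\delta^*X)_n$, and vertical arrows the projections to non-degenerate quotients, commutes. The morphism $\mathfrak{Ez}$ has image in the smallest filtration step, and on the factor $X_{i,j}$ corresponding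 to the shuffle $(\sigma,\tau)$ the map is thus given by $\mathrm{sgn}(\sigma,\tau)$.
   Context: $\mathrm{dec}^*:\mathcal{C}^{\Delta^{\mathrm{op}}}\to\mathcal{C}^{\Delta^{\mathrm{op}}\times\Delta^{\mathrm{op}}}$, $(\mathrm{dec}^*A)_{[i],[j]}=A_{[i]\ast[j]}$ with $[i]\ast[j]=[i+j+1]$; $\mathrm{dec}_*$ its right adjoint; $\delta^*$ restriction to the diagonal. For a simplicial object $A$, $A_n$ denotes the quotient of $A_{[n]}$ by degenerate elements (normalized chains), similarly $X_{i,j}$ for bisimplicial objects. The identification $(\mathrm{dec}_*X)_n\cong\bigoplus_{i+j=n}X_{i,j}$ ($\mathrm{dec}_*$ is the total complex with differential $d_l+(-1)^id_r$) has as $(i,j)$-component the map induced by $(\mathrm{dec}_*X)_{[n]}\xrightarrow{s_{\mathrm{can}}}(\mathrm{dec}_*X)_{[i]\ast[j]}=(\mathrm{dec}^*\mathrm{dec}_*X)_{[i],[j]}\to X_{[i],[j]}$ (degeneracy identifying the last point of $[i]$ with the first of $[j]$, then counit). Definition of $\mathfrak{Aw}$ and $\mathfrak{Ez}$: $\mathfrak{Aw}$ is adjoint to $\mathrm{dec}^*\delta^*X\to X$, $X_{[i]\ast[j],[i]\ast[j]}\to X_{[i],[j]}$, induced by the inclusions $[i]\hookrightarrow[i]\ast[j]\hookleftarrow[j]$. Let $\iota:\Delta\to\mathrm{FinSet}$ be the forgetful functor to non-empty finite sets, $\mathrm{dec}_s=\coprod$ and $\delta_s$ the diagonal on $\mathrm{FinSet}$,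 and $\mathfrak{C}(A)_{[n]}=\mathrm{Hom}(\Delta^\circ_n,A)$ ($A$ viewed as a complex), where $\Delta_n^\circ$ is the normalized chain complex of the standard simplex, with basis the non-empty subsets of $\{0,\dots,n\}$, and a map of finite sets sends a subset to its image with the sign of the induced permutation if it is injective on it, and to $0$ otherwise; $\mathrm{id}\cong\iota^*\mathfrak{C}$ canonically. The fold maps $S\coprod S\to S$ induce $\mathfrak{C}\to\delta_s^*\mathrm{dec}_s^*\mathfrak{C}$ and hence $\gamma:\mathrm{id}\cong\iota^*\mathfrak{C}\to\iota^*\delta_s^*\mathrm{dec}_s^*\mathfrak{C}=\delta^*\mathrm{dec}^*\iota^*\mathfrak{C}\cong\delta^*\mathrm{dec}^*$. $\mathfrak{Ez}$ is $\mathrm{dec}_*\xrightarrow{\gamma}\delta^*\mathrm{dec}^*\mathrm{dec}_*\to\delta^*$ (counit). $\delta_{i,l}$ is the action of the inclusion of $[i]$ as the first $i+1$ elements of $[n]$, $\delta_{j,r}$ that of $[j]$ as the last $j+1$ elements. An $(i,j)$-shuffle, $i+j=n$, is a jointly injective pair of surjections $\sigma:[n]\twoheadrightarrow[i]$, $\tau:[n]\twoheadrightarrow[j]$. Indexing the elementary intervals $\{k-1<k\}$ of $[n]$ by $k\in\{1,\dots,n\}$, the set $I'$ of intervals contracted by $\tau$ and the set $J'$ of intervals contracted by $\sigma$ are complementary, and $\mathrm{sgn}(\sigma,\tau)$ is the sign of the permutation bringing the concatenation of $I'$ and $J'$ (each in increasing order) into increasing order. $s^l:[n]\twoheadrightarrow[i]$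 is the surjection contracting the intervals $i+1,\dots,n$ and $s^r:[n]\twoheadrightarrow[j]$ the one contracting $1,\dots,i$. Filtration: $\delta^*X$ carries the two-index filtration $F^{i,j}\delta^*X=\delta^*F^{i,j}X$ induced by the skeletal filtrations of $X$ in its two variables. The smallest (non-zero) filtration steps in degree $n$ are those with $i+j=n$, and $(F^{i,n-i}\delta^*X)_n\cong\bigoplus_{(\sigma,\tau)}X_{i,n-i}$, the sum over $(i,n-i)$-shuffles, where the inclusion of the summand of $(\sigma,\tau)$ is induced by $(\sigma,\tau):X_{[i],[n-i]}\to X_{[n],[n]}$. *)

theory Defs
  imports "HOL-Algebra.Ring" "HOL-Library.FuncSet" "HOL-Combinatorics.Permutations"
begin

section \<open>Abelian categories\<close>

record ('o, 'm) additive_data =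
  Obj :: "'o set"
  Arr :: "'m set"
  Dom :: "'m \<Rightarrow> 'o"
  Cod :: "'m \<Rightarrow> 'o"
  Ide :: "'o \<Rightarrow> 'm"
  Cmp :: "'m \<Rightarrow> 'm \<Rightarrow> 'm" (infixr "\<bullet>\<index>" 70)
  Add :: "'m \<Rightarrow> 'm \<Rightarrow> 'm"
  Zer :: "'o \<Rightarrow> 'o \<Rightarrow> 'm"

definition Homs :: "('o, 'm) additive_data \<Rightarrow> 'o \<Rightarrow> 'o \<Rightarrow> 'm set" where
  "Homs C a b = {f \<in> Arr C. Dom C f = a \<and> Cod C f = b}"

text \<open>The library treats abelian groups as the additive part of a ring record; the
  multiplicative fields play no role here.\<close>

definition hom_group :: "('o, 'm) additive_data \<Rightarrow> 'o \<Rightarrow> 'o \<Rightarrow> 'm ring" where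
  "hom_group C a b =
     \<lparr>carrier = Homs C a b, monoid.mult = undefined, monoid.one = undefined,
      zero = Zer C a b, add = Add C\<rparr>"

locale category =
  fixes C :: "('o, 'm) additive_data"
  assumes dom_obj: "f \<in> Arr C \<Longrightarrow> Dom C f \<in> Obj C"
    and cod_obj: "f \<in> Arr C \<Longrightarrow> Cod C f \<in> Obj C"
    and ide_hom: "a \<in> Obj C \<Longrightarrow> Ide C a \<in> Homs C a a"
    and cmp_hom: "f \<in> Homs C a b \<Longrightarrow> g \<in> Homs C b c \<Longrightarrow> g \<bullet>\<^bsub>C\<^esub> f \<in> Homs C a c"
    and cmp_ide: "f \<in> Homs C a b \<Longrightarrow> f \<bullet>\<^bsub>C\<^esub> Ide C a = f"
    and ide_cmp: "f \<in> Homs C a b \<Longrightarrow> Ide C b \<bullet>\<^bsub>C\<^esub> f = f"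
    and cmp_assoc: "f \<in> Homs C a b \<Longrightarrow> g \<in> Homs C b c \<Longrightarrow> h \<in> Homs C c d \<Longrightarrow>
       (h \<bullet>\<^bsub>C\<^esub> g) \<bullet>\<^bsub>C\<^esub> f = h \<bullet>\<^bsub>C\<^esub> (g \<bullet>\<^bsub>C\<^esub> f)"

locale preadditive_category = category +
  assumes hom_abelian_group: "a \<in> Obj C \<Longrightarrow> b \<in> Obj C \<Longrightarrow> abelian_group (hom_group C a b)"
    and cmp_add_right: "f \<in> Homs C a b \<Longrightarrow> f' \<in> Homs C a b \<Longrightarrow> g \<in> Homs C b c \<Longrightarrow>
       g \<bullet>\<^bsub>C\<^esub> Add C f f' = Add C (g \<bullet>\<^bsub>C\<^esub> f) (g \<bullet>\<^bsub>C\<^esub> f')"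
    and cmp_add_left: "f \<in> Homs C a b \<Longrightarrow> g \<in> Homs C b c \<Longrightarrow> g' \<in> Homs C b c \<Longrightarrow>
       Add C g g' \<bullet>\<^bsub>C\<^esub> f = Add C (g \<bullet>\<^bsub>C\<^esub> f) (g' \<bullet>\<^bsub>C\<^esub> f)"

definition monic :: "('o, 'm) additive_data \<Rightarrow> 'm \<Rightarrow> bool" where
  "monic C f \<longleftrightarrow> f \<in> Arr C \<and>
     (\<forall>a g h. g \<in> Homs C a (Dom C f) \<longrightarrow> h \<in> Homs C a (Dom C f) \<longrightarrow>
        f \<bullet>\<^bsub>C\<^esub> g = f \<bullet>\<^bsub>C\<^esub> h \<longrightarrow> g = h)"

definition epic :: "('o, 'm) additive_data \<Rightarrow> 'm \<Rightarrow> bool" where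
  "epic C f \<longleftrightarrow> f \<in> Arr C \<and>
     (\<forall>b g h. g \<in> Homs C (Cod C f) b \<longrightarrow> h \<in> Homs C (Cod C f) b \<longrightarrow>
        g \<bullet>\<^bsub>C\<^esub> f = h \<bullet>\<^bsub>C\<^esub> f \<longrightarrow> g = h)"

definition is_kernel :: "('o, 'm) additive_data \<Rightarrow> 'm \<Rightarrow> 'm \<Rightarrow> bool" where
  "is_kernel C f k \<longleftrightarrow> k \<in> Homs C (Dom C k) (Dom C f) \<and>
     f \<bullet>\<^bsub>C\<^esub> k = Zer C (Dom C k) (Cod C f) \<and>
     (\<forall>t a. t \<in> Homs C a (Dom C f) \<and> f \<bullet>\<^bsub>C\<^esub> t = Zer C a (Cod C f) \<longrightarrow>
        (\<exists>!v. v \<in> Homs C a (Dom C k) \<and> k \<bullet>\<^bsub>C\<^esub> v = t))"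

definition is_cokernel :: "('o, 'm) additive_data \<Rightarrow> 'm \<Rightarrow> 'm \<Rightarrow> bool" where
  "is_cokernel C f p \<longleftrightarrow> p \<in> Homs C (Cod C f) (Cod C p) \<and>
     p \<bullet>\<^bsub>C\<^esub> f = Zer C (Dom C f) (Cod C p) \<and>
     (\<forall>t b. t \<in> Homs C (Cod C f) b \<and> t \<bullet>\<^bsub>C\<^esub> f = Zer C (Dom C f) b \<longrightarrow>
        (\<exists>!v. v \<in> Homs C (Cod C p) b \<and> v \<bullet>\<^bsub>C\<^esub> p = t))"

definition is_biproduct ::
  "('o, 'm) additive_data \<Rightarrow> 'i set \<Rightarrow> ('i \<Rightarrow> 'o) \<Rightarrow> 'o \<Rightarrow> ('i \<Rightarrow> 'm) \<Rightarrow> ('i \<Rightarrow> 'm) \<Rightarrow> bool" where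
  "is_biproduct C I x b inc prj \<longleftrightarrow> finite I \<and> b \<in> Obj C \<and>
     (\<forall>i\<in>I. inc i \<in> Homs C (x i) b \<and> prj i \<in> Homs C b (x i)) \<and>
     (\<forall>i\<in>I. \<forall>j\<in>I. prj j \<bullet>\<^bsub>C\<^esub> inc i = (if i = j then Ide C (x i) else Zer C (x i) (x j))) \<and>
     finsum (hom_group C b b) (\<lambda>i. inc i \<bullet>\<^bsub>C\<^esub> prj i) I = Ide C b"

locale abelian_category = preadditive_category +
  assumes zero_object: "\<exists>z \<in> Obj C. Ide C z = Zer C z z"
    and binary_biproducts: "a \<in> Obj C \<Longrightarrow> b \<in> Obj C \<Longrightarrow>
       \<exists>s inc prj. is_biproduct C {False, True} (\<lambda>c. if c then b else a) s inc prj"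
    and kernels: "f \<in> Arr C \<Longrightarrow> \<exists>k. is_kernel C f k"
    and cokernels: "f \<in> Arr C \<Longrightarrow> \<exists>p. is_cokernel C f p"
    and monic_normal: "monic C f \<Longrightarrow> \<exists>g \<in> Arr C. is_kernel C g f"
    and epic_normal: "epic C f \<Longrightarrow> \<exists>g \<in> Arr C. is_cokernel C g f"

subsection \<open>Choices of direct sums, quotients and induced arrows\<close>

definition inverse_arr :: "('o, 'm) additive_data \<Rightarrow> 'm \<Rightarrow> 'm" where
  "inverse_arr C f = (THE g. g \<in> Homs C (Cod C f) (Dom C f) \<and>
     g \<bullet>\<^bsub>C\<^esub> f = Ide C (Dom C f) \<and> f \<bullet>\<^bsub>C\<^esub> g = Ide C (Cod C f))"

definition direct_sum ::
  "('o, 'm) additive_data \<Rightarrow> 'i set \<Rightarrow> ('i \<Rightarrow> 'o) \<Rightarrow> 'o \<times> ('i \<Rightarrow> 'm) \<times> ('i \<Rightarrow> 'm)" where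
  "direct_sum C I x = (SOME (b, inc, prj). is_biproduct C I x b inc prj)"

definition dsum :: "('o, 'm) additive_data \<Rightarrow> 'i set \<Rightarrow> ('i \<Rightarrow> 'o) \<Rightarrow> 'o" where
  "dsum C I x = fst (direct_sum C I x)"

definition dsum_inj :: "('o, 'm) additive_data \<Rightarrow> 'i set \<Rightarrow> ('i \<Rightarrow> 'o) \<Rightarrow> 'i \<Rightarrow> 'm" where
  "dsum_inj C I x = fst (snd (direct_sum C I x))"

definition dsum_prj :: "('o, 'm) additive_data \<Rightarrow> 'i set \<Rightarrow> ('i \<Rightarrow> 'o) \<Rightarrow> 'i \<Rightarrow> 'm" where
  "dsum_prj C I x = snd (snd (direct_sum C I x))"

text \<open>The arrow into (out of) a direct sum with given components.\<close>

definition into_dsum ::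
  "('o, 'm) additive_data \<Rightarrow> 'i set \<Rightarrow> ('i \<Rightarrow> 'o) \<Rightarrow> 'o \<Rightarrow> ('i \<Rightarrow> 'm) \<Rightarrow> 'm" where
  "into_dsum C I x t f =
     finsum (hom_group C t (dsum C I x)) (\<lambda>i. dsum_inj C I x i \<bullet>\<^bsub>C\<^esub> f i) I"

definition from_dsum ::
  "('o, 'm) additive_data \<Rightarrow> 'i set \<Rightarrow> ('i \<Rightarrow> 'o) \<Rightarrow> 'o \<Rightarrow> ('i \<Rightarrow> 'm) \<Rightarrow> 'm" where
  "from_dsum C I x t f =
     finsum (hom_group C (dsum C I x) t) (\<lambda>i. f i \<bullet>\<^bsub>C\<^esub> dsum_prj C I x i) I"

definition dsum_map ::
  "('o, 'm) additive_data \<Rightarrow> 'i set \<Rightarrow> ('i \<Rightarrow> 'o) \<Rightarrow> ('i \<Rightarrow> 'o) \<Rightarrow> ('i \<Rightarrow> 'm) \<Rightarrow> 'm" where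
  "dsum_map C I x y f = into_dsum C I y (dsum C I x) (\<lambda>i. f i \<bullet>\<^bsub>C\<^esub> dsum_prj C I x i)"

text \<open>\<open>is_quotient C a S p\<close>: \<open>p\<close> is the projection of \<open>a\<close> onto its quotient by the
  subobject generated by the images of the arrows \<open>s \<in> S\<close>.\<close>

definition is_quotient :: "('o, 'm) additive_data \<Rightarrow> 'o \<Rightarrow> 'm set \<Rightarrow> 'm \<Rightarrow> bool" where
  "is_quotient C a S p \<longleftrightarrow> p \<in> Homs C a (Cod C p) \<and>
     (\<forall>s\<in>S. p \<bullet>\<^bsub>C\<^esub> s = Zer C (Dom C s) (Cod C p)) \<and>
     (\<forall>t b. t \<in> Homs C a b \<and> (\<forall>s\<in>S. t \<bullet>\<^bsub>C\<^esub> s = Zer C (Dom C s) b) \<longrightarrow>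
        (\<exists>!v. v \<in> Homs C (Cod C p) b \<and> v \<bullet>\<^bsub>C\<^esub> p = t))"

definition quotient_prj :: "('o, 'm) additive_data \<Rightarrow> 'o \<Rightarrow> 'm set \<Rightarrow> 'm" where
  "quotient_prj C a S = (SOME p. is_quotient C a S p)"

definition descend :: "('o, 'm) additive_data \<Rightarrow> 'm \<Rightarrow> 'm \<Rightarrow> 'm" where
  "descend C p f = (THE g. g \<in> Homs C (Cod C p) (Cod C f) \<and> g \<bullet>\<^bsub>C\<^esub> p = f)"

definition lift_along :: "('o, 'm) additive_data \<Rightarrow> 'm \<Rightarrow> 'm \<Rightarrow> 'm" where
  "lift_along C u f = (THE g. g \<in> Homs C (Dom C f) (Dom C u) \<and> u \<bullet>\<^bsub>C\<^esub> g = f)"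

definition is_generated_subobject :: "('o, 'm) additive_data \<Rightarrow> 'o \<Rightarrow> 'm set \<Rightarrow> 'm \<Rightarrow> bool" where
  "is_generated_subobject C a S u \<longleftrightarrow> monic C u \<and> Cod C u = a \<and>
     (\<forall>s\<in>S. \<exists>g \<in> Homs C (Dom C s) (Dom C u). u \<bullet>\<^bsub>C\<^esub> g = s) \<and>
     (\<forall>v. monic C v \<and> Cod C v = a \<and>
          (\<forall>s\<in>S. \<exists>g \<in> Homs C (Dom C s) (Dom C v). v \<bullet>\<^bsub>C\<^esub> g = s) \<longrightarrow>
        (\<exists>w \<in> Homs C (Dom C u) (Dom C v). v \<bullet>\<^bsub>C\<^esub> w = u))"

section \<open>Simplicial and bisimplicial objects\<close>

text \<open>The object \<open>[n]\<close> of the simplex category is \<open>{..n}\<close>; a morphism \<open>[m] \<rightarrow> [n]\<close> is an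
  extensional monotone function, so that the hom-sets are finite.\<close>

definition Delta :: "nat \<Rightarrow> nat \<Rightarrow> (nat \<Rightarrow> nat) set" where
  "Delta m n = {f \<in> {..m} \<rightarrow>\<^sub>E {..n}. mono_on {..m} f}"

definition Delta_surj :: "nat \<Rightarrow> nat \<Rightarrow> (nat \<Rightarrow> nat) set" where
  "Delta_surj m n = {f \<in> Delta m n. f ` {..m} = {..n}}"

text \<open>\<open>sact A m n f : A\<^sub>[\<^sub>n\<^sub>] \<rightarrow> A\<^sub>[\<^sub>m\<^sub>]\<close> for \<open>f : [m] \<rightarrow> [n]\<close>, and
  \<open>bact X m m' f n n' g : X\<^sub>[\<^sub>m\<^sub>'\<^sub>]\<^sub>,\<^sub>[\<^sub>n\<^sub>'\<^sub>] \<rightarrow> X\<^sub>[\<^sub>m\<^sub>]\<^sub>,\<^sub>[\<^sub>n\<^sub>]\<close> for \<open>f : [m] \<rightarrow> [m']\<close>,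
  \<open>g : [n] \<rightarrow> [n']\<close>.\<close>

record ('o, 'm) simplicial =
  sob :: "nat \<Rightarrow> 'o"
  sact :: "nat \<Rightarrow> nat \<Rightarrow> (nat \<Rightarrow> nat) \<Rightarrow> 'm"

record ('o, 'm) bisimplicial =
  bob :: "nat \<Rightarrow> nat \<Rightarrow> 'o"
  bact :: "nat \<Rightarrow> nat \<Rightarrow> (nat \<Rightarrow> nat) \<Rightarrow> nat \<Rightarrow> nat \<Rightarrow> (nat \<Rightarrow> nat) \<Rightarrow> 'm"

definition simplicial_object :: "('o, 'm) additive_data \<Rightarrow> ('o, 'm) simplicial \<Rightarrow> bool" where
  "simplicial_object C A \<longleftrightarrow>
     (\<forall>n. sob A n \<in> Obj C) \<and>
     (\<forall>m n. \<forall>f \<in> Delta m n. sact A m n f \<in> Homs C (sob A n) (sob A m)) \<and>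
     (\<forall>n. sact A n n (restrict id {..n}) = Ide C (sob A n)) \<and>
     (\<forall>l m n. \<forall>f \<in> Delta l m. \<forall>g \<in> Delta m n.
        sact A l n (compose {..l} g f) = sact A l m f \<bullet>\<^bsub>C\<^esub> sact A m n g)"

definition simplicial_mor ::
  "('o, 'm) additive_data \<Rightarrow> ('o, 'm) simplicial \<Rightarrow> ('o, 'm) simplicial \<Rightarrow> (nat \<Rightarrow> 'm) \<Rightarrow> bool" where
  "simplicial_mor C A B \<phi> \<longleftrightarrow>
     (\<forall>n. \<phi> n \<in> Homs C (sob A n) (sob B n)) \<and>
     (\<forall>m n. \<forall>f \<in> Delta m n. \<phi> m \<bullet>\<^bsub>C\<^esub> sact A m n f = sact B m n f \<bullet>\<^bsub>C\<^esub> \<phi> n)"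

definition bisimplicial_object :: "('o, 'm) additive_data \<Rightarrow> ('o, 'm) bisimplicial \<Rightarrow> bool" where
  "bisimplicial_object C X \<longleftrightarrow>
     (\<forall>m n. bob X m n \<in> Obj C) \<and>
     (\<forall>m m' n n'. \<forall>f \<in> Delta m m'. \<forall>g \<in> Delta n n'.
        bact X m m' f n n' g \<in> Homs C (bob X m' n') (bob X m n)) \<and>
     (\<forall>m n. bact X m m (restrict id {..m}) n n (restrict id {..n}) = Ide C (bob X m n)) \<and>
     (\<forall>m m' m'' n n' n''.
        \<forall>f \<in> Delta m m'. \<forall>f' \<in> Delta m' m''. \<forall>g \<in> Delta n n'. \<forall>g' \<in> Delta n' n''.
        bact X m m'' (compose {..m} f' f) n n'' (compose {..n} g' g) =
          bact X m m' f n n' g \<bullet>\<^bsub>C\<^esub> bact X m' m'' f' n' n'' g')"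

definition bisimplicial_mor ::
  "('o, 'm) additive_data \<Rightarrow> ('o, 'm) bisimplicial \<Rightarrow> ('o, 'm) bisimplicial \<Rightarrow>
     (nat \<Rightarrow> nat \<Rightarrow> 'm) \<Rightarrow> bool" where
  "bisimplicial_mor C X Y \<phi> \<longleftrightarrow>
     (\<forall>m n. \<phi> m n \<in> Homs C (bob X m n) (bob Y m n)) \<and>
     (\<forall>m m' n n'. \<forall>f \<in> Delta m m'. \<forall>g \<in> Delta n n'.
        \<phi> m n \<bullet>\<^bsub>C\<^esub> bact X m m' f n n' g = bact Y m m' f n n' g \<bullet>\<^bsub>C\<^esub> \<phi> m' n')"

definition diag :: "('o, 'm) bisimplicial \<Rightarrow> ('o, 'm) simplicial" where
  "diag X = \<lparr>sob = (\<lambda>n. bob X n n), sact = (\<lambda>m n f. bact X m n f m n f)\<rparr>"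

text \<open>\<open>[i] * [j] = [i + j + 1]\<close>: \<open>[i]\<close> sits in it as the first \<open>i + 1\<close> and \<open>[j]\<close> as the last
  \<open>j + 1\<close> elements.\<close>

definition join_map :: "nat \<Rightarrow> nat \<Rightarrow> (nat \<Rightarrow> nat) \<Rightarrow> nat \<Rightarrow> (nat \<Rightarrow> nat) \<Rightarrow> nat \<Rightarrow> nat" where
  "join_map i i' f j g =
     (\<lambda>k\<in>{..i + j + 1}. if k \<le> i then f k else i' + 1 + g (k - (i + 1)))"

definition dec :: "('o, 'm) simplicial \<Rightarrow> ('o, 'm) bisimplicial" where
  "dec A = \<lparr>bob = (\<lambda>i j. sob A (i + j + 1)),
     bact = (\<lambda>i i' f j j' g. sact A (i + j + 1) (i' + j' + 1) (join_map i i' f j g))\<rparr>"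

text \<open>\<open>(D, \<epsilon>)\<close> is the value at \<open>X\<close> of the right adjoint of \<^const>\<open>dec\<close>, with \<open>\<epsilon>\<close> the counit
  at \<open>X\<close>; this determines \<open>(D, \<epsilon>)\<close> up to unique isomorphism.\<close>

definition is_dec_right_adjoint ::
  "('o, 'm) additive_data \<Rightarrow> ('o, 'm) bisimplicial \<Rightarrow> ('o, 'm) simplicial \<Rightarrow>
     (nat \<Rightarrow> nat \<Rightarrow> 'm) \<Rightarrow> bool" where
  "is_dec_right_adjoint C X D \<epsilon> \<longleftrightarrow>
     simplicial_object C D \<and> bisimplicial_mor C (dec D) X \<epsilon> \<and>
     (\<forall>A \<alpha>. simplicial_object C A \<and> bisimplicial_mor C (dec A) X \<alpha> \<longrightarrow>
        (\<exists>!\<phi>. simplicial_mor C A D \<phi> \<and> (\<forall>i j. \<epsilon> i j \<bullet>\<^bsub>C\<^esub> \<phi> (i + j + 1) = \<alpha> i j)))"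

subsection \<open>Quotients by degenerate elements\<close>

definition degeneracies :: "('o, 'm) simplicial \<Rightarrow> nat \<Rightarrow> 'm set" where
  "degeneracies A n = {sact A n m s | m s. m < n \<and> s \<in> Delta_surj n m}"

definition nd_prj :: "('o, 'm) additive_data \<Rightarrow> ('o, 'm) simplicial \<Rightarrow> nat \<Rightarrow> 'm" where
  "nd_prj C A n = quotient_prj C (sob A n) (degeneracies A n)"

definition nd :: "('o, 'm) additive_data \<Rightarrow> ('o, 'm) simplicial \<Rightarrow> nat \<Rightarrow> 'o" where
  "nd C A n = Cod C (nd_prj C A n)"

definition nd_map ::
  "('o, 'm) additive_data \<Rightarrow> ('o, 'm) simplicial \<Rightarrow> ('o, 'm) simplicial \<Rightarrow> (nat \<Rightarrow> 'm) \<Rightarrow> nat \<Rightarrow> 'm" where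
  "nd_map C A B \<phi> n = descend C (nd_prj C A n) (nd_prj C B n \<bullet>\<^bsub>C\<^esub> \<phi> n)"

definition bidegeneracies :: "('o, 'm) bisimplicial \<Rightarrow> nat \<Rightarrow> nat \<Rightarrow> 'm set" where
  "bidegeneracies X i j =
     {bact X i k s j l t | k l s t.
        s \<in> Delta_surj i k \<and> t \<in> Delta_surj j l \<and> (k < i \<or> l < j)}"

definition bnd_prj :: "('o, 'm) additive_data \<Rightarrow> ('o, 'm) bisimplicial \<Rightarrow> nat \<Rightarrow> nat \<Rightarrow> 'm" where
  "bnd_prj C X i j = quotient_prj C (bob X i j) (bidegeneracies X i j)"

definition bnd :: "('o, 'm) additive_data \<Rightarrow> ('o, 'm) bisimplicial \<Rightarrow> nat \<Rightarrow> nat \<Rightarrow> 'o" where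
  "bnd C X i j = Cod C (bnd_prj C X i j)"

definition bidegrees :: "nat \<Rightarrow> (nat \<times> nat) set" where
  "bidegrees n = {(i, j). i + j = n}"

definition bidegree_prj :: "('o, 'm) additive_data \<Rightarrow> ('o, 'm) bisimplicial \<Rightarrow> nat \<Rightarrow> 'm" where
  "bidegree_prj C X n =
     dsum_map C (bidegrees n) (\<lambda>(i, j). bob X i j) (\<lambda>(i, j). bnd C X i j) (\<lambda>(i, j). bnd_prj C X i j)"

subsection \<open>The identification of the chains of the right adjoint\<close>

definition s_can :: "nat \<Rightarrow> nat \<Rightarrow> nat \<Rightarrow> nat" where
  "s_can i j = (\<lambda>k\<in>{..i + j + 1}. if k \<le> i then k else k - 1)"

definition total_ident ::
  "('o, 'm) additive_data \<Rightarrow> ('o, 'm) bisimplicial \<Rightarrow> ('o, 'm) simplicial \<Rightarrow>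
     (nat \<Rightarrow> nat \<Rightarrow> 'm) \<Rightarrow> nat \<Rightarrow> 'm" where
  "total_ident C X D \<epsilon> n =
     into_dsum C (bidegrees n) (\<lambda>(i, j). bnd C X i j) (nd C D n)
       (\<lambda>(i, j). descend C (nd_prj C D n)
          (bnd_prj C X i j \<bullet>\<^bsub>C\<^esub> \<epsilon> i j \<bullet>\<^bsub>C\<^esub> sact D (i + j + 1) n (s_can i j)))"

section \<open>Signs\<close>

text \<open>The sign of the permutation that brings a list of distinct numbers into increasing
  order.\<close>

definition sort_sign :: "nat list \<Rightarrow> int" where
  "sort_sign xs = sign (THE p. p permutes {..<length xs} \<and> permute_list p xs = sort xs)"

definition shuffles_of :: "nat \<Rightarrow> nat \<Rightarrow> ((nat \<Rightarrow> nat) \<times> (nat \<Rightarrow> nat)) set" where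
  "shuffles_of i j =
     {(\<sigma>, \<tau>). \<sigma> \<in> Delta_surj (i + j) i \<and> \<tau> \<in> Delta_surj (i + j) j \<and>
        inj_on (\<lambda>k. (\<sigma> k, \<tau> k)) {..i + j}}"

definition contracted :: "nat \<Rightarrow> (nat \<Rightarrow> nat) \<Rightarrow> nat set" where
  "contracted n \<rho> = {k \<in> {1..n}. \<rho> (k - 1) = \<rho> k}"

definition shuffle_sgn :: "nat \<Rightarrow> (nat \<Rightarrow> nat) \<Rightarrow> (nat \<Rightarrow> nat) \<Rightarrow> int" where
  "shuffle_sgn n \<sigma> \<tau> =
     sort_sign (sorted_list_of_set (contracted n \<tau>) @ sorted_list_of_set (contracted n \<sigma>))"

definition s_left :: "nat \<Rightarrow> nat \<Rightarrow> nat \<Rightarrow> nat" where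
  "s_left i j = (\<lambda>k\<in>{..i + j}. min k i)"

definition s_right :: "nat \<Rightarrow> nat \<Rightarrow> nat \<Rightarrow> nat" where
  "s_right i j = (\<lambda>k\<in>{..i + j}. k - i)"

section \<open>The map \<open>\<AA>\<ww>\<close>\<close>

definition first_incl :: "nat \<Rightarrow> nat \<Rightarrow> nat" where
  "first_incl i = (\<lambda>k\<in>{..i}. k)"

definition last_incl :: "nat \<Rightarrow> nat \<Rightarrow> nat \<Rightarrow> nat" where
  "last_incl n j = (\<lambda>k\<in>{..j}. n - j + k)"

definition Aw ::
  "('o, 'm) additive_data \<Rightarrow> ('o, 'm) bisimplicial \<Rightarrow> ('o, 'm) simplicial \<Rightarrow>
     (nat \<Rightarrow> nat \<Rightarrow> 'm) \<Rightarrow> nat \<Rightarrow> 'm" where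
  "Aw C X D \<epsilon> = (THE \<phi>. simplicial_mor C (diag X) D \<phi> \<and>
     (\<forall>i j. \<epsilon> i j \<bullet>\<^bsub>C\<^esub> \<phi> (i + j + 1) =
        bact X i (i + j + 1) (first_incl i) j (i + j + 1) (last_incl (i + j + 1) j)))"

definition Aw_chain ::
  "('o, 'm) additive_data \<Rightarrow> ('o, 'm) bisimplicial \<Rightarrow> ('o, 'm) simplicial \<Rightarrow>
     (nat \<Rightarrow> nat \<Rightarrow> 'm) \<Rightarrow> nat \<Rightarrow> 'm" where
  "Aw_chain C X D \<epsilon> n = total_ident C X D \<epsilon> n \<bullet>\<^bsub>C\<^esub> nd_map C (diag X) D (Aw C X D \<epsilon>) n"

definition Aw_top :: "('o, 'm) additive_data \<Rightarrow> ('o, 'm) bisimplicial \<Rightarrow> nat \<Rightarrow> 'm" where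
  "Aw_top C X n =
     into_dsum C (bidegrees n) (\<lambda>(i, j). bob X i j) (bob X n n)
       (\<lambda>(i, j). bact X i n (first_incl i) j n (last_incl n j))"

section \<open>The map \<open>\<EE>\<zz>\<close>\<close>

subsection \<open>Chain maps out of the complex of a standard simplex\<close>

definition faces :: "nat \<Rightarrow> nat set set" where
  "faces n = {S. S \<subseteq> {..n} \<and> S \<noteq> {}}"

definition coface :: "nat \<Rightarrow> nat \<Rightarrow> nat \<Rightarrow> nat" where
  "coface n k = (\<lambda>x\<in>{..n}. if x < k then x else x + 1)"

text \<open>The differential \<open>A\<^sub>n\<^sub>+\<^sub>1 \<rightarrow> A\<^sub>n\<close> of the normalized chain complex.\<close>

definition nd_diff :: "('o, 'm) additive_data \<Rightarrow> ('o, 'm) simplicial \<Rightarrow> nat \<Rightarrow> 'm" where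
  "nd_diff C A n = descend C (nd_prj C A (n + 1))
     (finsum (hom_group C (sob A (n + 1)) (nd C A n))
        (\<lambda>k. [((-1) ^ k :: int)] \<cdot>\<^bsub>hom_group C (sob A (n + 1)) (nd C A n)\<^esub>
               (nd_prj C A n \<bullet>\<^bsub>C\<^esub> sact A n (n + 1) (coface n k)))
        {..n + 1})"

text \<open>The chain maps from \<open>\<Delta>\<degree>\<^sub>n\<close> to the complex \<open>Hom(T, A)\<close>: such a map is given by the
  images \<open>c S : T \<rightarrow> A\<^sub>|\<^sub>S\<^sub>|\<^sub>-\<^sub>1\<close> of the basis elements \<open>S\<close>.\<close>

definition simplex_chain_maps ::
  "('o, 'm) additive_data \<Rightarrow> ('o, 'm) simplicial \<Rightarrow> nat \<Rightarrow> 'o \<Rightarrow> (nat set \<Rightarrow> 'm) set" where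
  "simplex_chain_maps C A n T =
     {c. \<forall>S \<in> faces n. c S \<in> Homs C T (nd C A (card S - 1)) \<and>
        (card S \<ge> 2 \<longrightarrow>
           nd_diff C A (card S - 2) \<bullet>\<^bsub>C\<^esub> c S =
           finsum (hom_group C T (nd C A (card S - 2)))
             (\<lambda>k. [((-1) ^ k :: int)] \<cdot>\<^bsub>hom_group C T (nd C A (card S - 2))\<^esub>
                    c (S - {sorted_list_of_set S ! k}))
             {..<card S})}"

text \<open>\<open>H\<close> is the object \<open>Hom(\<Delta>\<degree>\<^sub>n, A)\<close> of the abelian category, i.e. it represents the functor
  of chain maps above, with universal chain map \<open>h\<close>.\<close>

definition is_simplex_Hom ::
  "('o, 'm) additive_data \<Rightarrow> ('o, 'm) simplicial \<Rightarrow> nat \<Rightarrow> 'o \<Rightarrow> (nat set \<Rightarrow> 'm) \<Rightarrow> bool" where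
  "is_simplex_Hom C A n H h \<longleftrightarrow> H \<in> Obj C \<and> h \<in> simplex_chain_maps C A n H \<and>
     (\<forall>T \<in> Obj C. \<forall>c \<in> simplex_chain_maps C A n T.
        \<exists>!t. t \<in> Homs C T H \<and> (\<forall>S \<in> faces n. h S \<bullet>\<^bsub>C\<^esub> t = c S))"

definition simplex_Hom ::
  "('o, 'm) additive_data \<Rightarrow> ('o, 'm) simplicial \<Rightarrow> nat \<Rightarrow> 'o \<times> (nat set \<Rightarrow> 'm)" where
  "simplex_Hom C A n = (SOME (H, h). is_simplex_Hom C A n H h)"

definition simplex_classify ::
  "('o, 'm) additive_data \<Rightarrow> ('o, 'm) simplicial \<Rightarrow> nat \<Rightarrow> 'o \<Rightarrow> (nat set \<Rightarrow> 'm) \<Rightarrow> 'm" where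
  "simplex_classify C A n T c =
     (THE t. t \<in> Homs C T (fst (simplex_Hom C A n)) \<and>
        (\<forall>S \<in> faces n. snd (simplex_Hom C A n) S \<bullet>\<^bsub>C\<^esub> t = c S))"

text \<open>Composition of a chain map with the map of complexes \<open>\<Delta>\<degree>\<^sub>m \<rightarrow> \<Delta>\<degree>\<^sub>n\<close> given by a (not
  necessarily monotone) map of sets \<open>\<theta> : {..m} \<rightarrow> {..n}\<close>.\<close>

definition simplex_pull ::
  "('o, 'm) additive_data \<Rightarrow> ('o, 'm) simplicial \<Rightarrow> (nat \<Rightarrow> nat) \<Rightarrow> 'o \<Rightarrow>
     (nat set \<Rightarrow> 'm) \<Rightarrow> nat set \<Rightarrow> 'm" where
  "simplex_pull C A \<theta> T c = (\<lambda>S.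
     if inj_on \<theta> S
     then [sort_sign (map \<theta> (sorted_list_of_set S))] \<cdot>\<^bsub>hom_group C T (nd C A (card S - 1))\<^esub> c (\<theta> ` S)
     else Zer C T (nd C A (card S - 1)))"

text \<open>\<open>\<CC>(A)\<^sub>[\<^sub>n\<^sub>] \<rightarrow> \<CC>(A)\<^sub>[\<^sub>m\<^sub>]\<close> for \<open>\<theta> : {..m} \<rightarrow> {..n}\<close>.\<close>

definition simplex_Hom_act ::
  "('o, 'm) additive_data \<Rightarrow> ('o, 'm) simplicial \<Rightarrow> nat \<Rightarrow> nat \<Rightarrow> (nat \<Rightarrow> nat) \<Rightarrow> 'm" where
  "simplex_Hom_act C A m n \<theta> =
     simplex_classify C A m (fst (simplex_Hom C A n))
       (simplex_pull C A \<theta> (fst (simplex_Hom C A n)) (snd (simplex_Hom C A n)))"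

text \<open>The canonical isomorphism \<open>A\<^sub>[\<^sub>n\<^sub>] \<rightarrow> Hom(\<Delta>\<degree>\<^sub>n, A)\<close>: its component at \<open>S\<close> restricts to the
  face spanned by \<open>S\<close> and projects to the nondegenerate quotient.\<close>

definition simplex_canon :: "('o, 'm) additive_data \<Rightarrow> ('o, 'm) simplicial \<Rightarrow> nat \<Rightarrow> 'm" where
  "simplex_canon C A n = simplex_classify C A n (sob A n)
     (\<lambda>S. nd_prj C A (card S - 1) \<bullet>\<^bsub>C\<^esub>
          sact A (card S - 1) n (\<lambda>k\<in>{..card S - 1}. sorted_list_of_set S ! k))"

text \<open>The fold map \<open>[n] \<squnion> [n] \<rightarrow> [n]\<close>, where \<open>[n] \<squnion> [n]\<close> is the set underlying \<open>[n] * [n]\<close>.\<close>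

definition fold_map :: "nat \<Rightarrow> nat \<Rightarrow> nat" where
  "fold_map n = (\<lambda>k\<in>{..n + n + 1}. if k \<le> n then k else k - (n + 1))"

definition Ez_gamma :: "('o, 'm) additive_data \<Rightarrow> ('o, 'm) simplicial \<Rightarrow> nat \<Rightarrow> 'm" where
  "Ez_gamma C A n =
     inverse_arr C (simplex_canon C A (n + n + 1)) \<bullet>\<^bsub>C\<^esub>
     simplex_Hom_act C A (n + n + 1) n (fold_map n) \<bullet>\<^bsub>C\<^esub> simplex_canon C A n"

definition Ez ::
  "('o, 'm) additive_data \<Rightarrow> ('o, 'm) simplicial \<Rightarrow> (nat \<Rightarrow> nat \<Rightarrow> 'm) \<Rightarrow> nat \<Rightarrow> 'm" where
  "Ez C D \<epsilon> n = \<epsilon> n n \<bullet>\<^bsub>C\<^esub> Ez_gamma C D n"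

definition Ez_chain ::
  "('o, 'm) additive_data \<Rightarrow> ('o, 'm) bisimplicial \<Rightarrow> ('o, 'm) simplicial \<Rightarrow>
     (nat \<Rightarrow> nat \<Rightarrow> 'm) \<Rightarrow> nat \<Rightarrow> 'm" where
  "Ez_chain C X D \<epsilon> n = nd_map C D (diag X) (Ez C D \<epsilon>) n \<bullet>\<^bsub>C\<^esub> inverse_arr C (total_ident C X D \<epsilon> n)"

definition Ez_top :: "('o, 'm) additive_data \<Rightarrow> ('o, 'm) bisimplicial \<Rightarrow> nat \<Rightarrow> 'm" where
  "Ez_top C X n =
     from_dsum C (bidegrees n) (\<lambda>(i, j). bob X i j) (bob X n n)
       (\<lambda>(i, j). finsum (hom_group C (bob X i j) (bob X n n))
          (\<lambda>(\<sigma>, \<tau>). [shuffle_sgn n \<sigma> \<tau>] \<cdot>\<^bsub>hom_group C (bob X i j) (bob X n n)\<^esub> bact X n i \<sigma> n j \<tau>)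
          (shuffles_of i j))"

section \<open>The skeletal filtration\<close>

text \<open>\<open>u : F \<rightarrow> X\<close> is the inclusion of the step \<open>F\<^sup>i\<^sup>,\<^sup>jX\<close>: the \<open>i\<close>-skeleton in the first variable
  of the \<open>j\<close>-skeleton in the second, i.e. the subobject generated by all \<open>X\<^sub>[\<^sub>k\<^sub>]\<^sub>,\<^sub>[\<^sub>l\<^sub>]\<close> with
  \<open>k \<le> i\<close> and \<open>l \<le> j\<close>.\<close>

definition is_skeletal_step ::
  "('o, 'm) additive_data \<Rightarrow> ('o, 'm) bisimplicial \<Rightarrow> nat \<Rightarrow> nat \<Rightarrow> ('o, 'm) bisimplicial \<Rightarrow>
     (nat \<Rightarrow> nat \<Rightarrow> 'm) \<Rightarrow> bool" where
  "is_skeletal_step C X i j F u \<longleftrightarrow>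
     bisimplicial_object C F \<and> bisimplicial_mor C F X u \<and>
     (\<forall>m n. is_generated_subobject C (bob X m n)
        {bact X m k f n l g | k l f g. k \<le> i \<and> l \<le> j \<and> f \<in> Delta m k \<and> g \<in> Delta n l} (u m n))"

text \<open>The inclusion of the step \<open>(F\<^sup>i\<^sup>,\<^sup>j\<delta>\<^sup>*X)\<^sub>n = (\<delta>\<^sup>*F\<^sup>i\<^sup>,\<^sup>jX)\<^sub>n\<close> into \<open>(\<delta>\<^sup>*X)\<^sub>n\<close>.\<close>

definition step_incl ::
  "('o, 'm) additive_data \<Rightarrow> ('o, 'm) bisimplicial \<Rightarrow> ('o, 'm) bisimplicial \<Rightarrow>
     (nat \<Rightarrow> nat \<Rightarrow> 'm) \<Rightarrow> nat \<Rightarrow> 'm" where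
  "step_incl C X F u n = nd_map C (diag F) (diag X) (\<lambda>m. u m m) n"

text \<open>The inclusion \<open>X\<^sub>i\<^sub>,\<^sub>j \<rightarrow> (F\<^sup>i\<^sup>,\<^sup>j\<delta>\<^sup>*X)\<^sub>i\<^sub>+\<^sub>j\<close> of the summand of a shuffle.\<close>

definition shuffle_incl ::
  "('o, 'm) additive_data \<Rightarrow> ('o, 'm) bisimplicial \<Rightarrow> nat \<Rightarrow> nat \<Rightarrow> ('o, 'm) bisimplicial \<Rightarrow>
     (nat \<Rightarrow> nat \<Rightarrow> 'm) \<Rightarrow> (nat \<Rightarrow> nat) \<times> (nat \<Rightarrow> nat) \<Rightarrow> 'm" where
  "shuffle_incl C X i j F u = (\<lambda>(\<sigma>, \<tau>).
     descend C (bnd_prj C X i j)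
       (nd_prj C (diag F) (i + j) \<bullet>\<^bsub>C\<^esub>
        lift_along C (u (i + j) (i + j)) (bact X (i + j) i \<sigma> (i + j) j \<tau>)))"

text \<open>The identification of \<open>\<Oplus> X\<^sub>i\<^sub>,\<^sub>j\<close>, the sum over all \<open>(i, j)\<close>-shuffles, with
  \<open>(F\<^sup>i\<^sup>,\<^sup>j\<delta>\<^sup>*X)\<^sub>i\<^sub>+\<^sub>j\<close>.\<close>

definition step_ident ::
  "('o, 'm) additive_data \<Rightarrow> ('o, 'm) bisimplicial \<Rightarrow> nat \<Rightarrow> nat \<Rightarrow> ('o, 'm) bisimplicial \<Rightarrow>
     (nat \<Rightarrow> nat \<Rightarrow> 'm) \<Rightarrow> 'm" where
  "step_ident C X i j F u =
     from_dsum C (shuffles_of i j) (\<lambda>_. bnd C X i j) (nd C (diag F) (i + j)) (shuffle_incl C X i j F u)"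

end

theory Submission
  imports Defs "Jordan_Normal_Form.Determinant"
begin

text \<open>The right adjoint \<open>dec\<^sub>*X\<close> is probed by maps out of the decalage of \<open>T \<otimes> \<Delta>\<^sub>n\<close>. Hence its
  \<open>n\<close>-simplices are glued from components in \<open>X\<^sub>[\<^sub>i\<^sub>]\<^sub>,\<^sub>[\<^sub>j\<^sub>]\<close> with \<open>i + j = n\<close>, and splitting the
  nondegenerate quotients by normalization shows that its chains are the total complex. The component
  of \<open>\<AA>\<ww>\<close> at \<open>(i, j)\<close> is then a restriction to a front and a back face, which is degenerate on the
  summand of a shuffle unless the shuffle is \<open>(s\<^sup>l, s\<^sup>r)\<close>.

  For \<open>\<EE>\<zz>\<close>, the Dold--Kan isomorphism \<open>A\<^sub>[\<^sub>n\<^sub>] \<cong> Hom(\<Delta>\<degree>\<^sub>n, A)\<close> turns \<open>\<gamma>\<close> into an integral combination of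
  degeneracies \<open>[n] * [n] \<rightarrow> [n]\<close>, up to simplices that factor through the \<open>(n - 1)\<close>-skeleton. Restricting
  to the \<open>n\<close>-dimensional faces identifies the coefficients as determinants. The counit followed by the
  projection to chains kills the skeleton and every degeneracy that does not come from a shuffle, and
  for a shuffle the determinant is its sign.\<close>

section \<open>Preadditive categories\<close>

text \<open>An abelian category has no elements, and the right adjoint is given only by its
  universal property, so equations are tested on generalized elements, that is, arrows from a test
  object T into an object of simplices. The hom-sets of the simplex category are finite; hence all
  direct sums and quotients that occur are finite. The obstacle for \<EE>\<zz> is that the fold map
  is not monotone. It does not act on A, only on chain complexes, where reordering vertices costs a
  sign, so \<gamma> is known through its faces alone. To match the faces g of dimension n by
  degeneracies, one needs integers attached to the \<eta> whose sum over all \<eta> with \<eta> g =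
  id is the sign of the list of folded vertices of g, or 0 if two of them agree. Such an \<eta> is a
  free choice of one jump between each two consecutive vertices of g. A determinant whose i-th row
  depends on the i-th jump only is additive in each choice, and its rows telescope along g. This
  dictates the formula for the coefficients.\<close>

lemma hom_group_simps [simp]:
  "carrier (hom_group C a b) = Homs C a b"
  "add (hom_group C a b) = Add C"
  "zero (hom_group C a b) = Zer C a b"
  by (simp_all add: hom_group_def)

lemma Homs_Dom_Cod: "f \<in> Homs C a b \<Longrightarrow> Dom C f = a \<and> Cod C f = b \<and> f \<in> Arr C"
  by (simp add: Homs_def)

lemma (in category) Homs_obj: "f \<in> Homs C a b \<Longrightarrow> a \<in> Obj C \<and> b \<in> Obj C"
  by (auto simp: Homs_def dom_obj cod_obj)

context preadditive_category
begin

abbreviation H where "H \<equiv> hom_group C"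

text \<open>The hom-group is read off from the first argument, so that a difference of arrows can be
  written and rewritten without an annotation, just like \<open>Add C\<close>.\<close>

definition minus_arr :: "'b \<Rightarrow> 'b \<Rightarrow> 'b" where
  "minus_arr f g = f \<ominus>\<^bsub>H (Dom C f) (Cod C f)\<^esub> g"

lemma H_abelian: "f \<in> Homs C a b \<Longrightarrow> abelian_group (H a b)"
  using Homs_obj hom_abelian_group by blast

lemma minus_arr_eq: "f \<in> Homs C a b \<Longrightarrow> minus_arr f g = f \<ominus>\<^bsub>H a b\<^esub> g"
  by (auto simp: minus_arr_def Homs_def)

lemma Zer_hom: "a \<in> Obj C \<Longrightarrow> b \<in> Obj C \<Longrightarrow> Zer C a b \<in> Homs C a b"
  using abelian_group.axioms(1)[OF hom_abelian_group] abelian_monoid.zero_closed by fastforce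

lemma Add_hom: "f \<in> Homs C a b \<Longrightarrow> g \<in> Homs C a b \<Longrightarrow> Add C f g \<in> Homs C a b"
  using abelian_monoid.a_closed[OF abelian_group.axioms(1)[OF H_abelian]] by fastforce

lemma minus_hom: "f \<in> Homs C a b \<Longrightarrow> g \<in> Homs C a b \<Longrightarrow> minus_arr f g \<in> Homs C a b"
  using abelian_group.minus_closed[OF H_abelian] minus_arr_eq by fastforce

lemma minus_self: "f \<in> Homs C a b \<Longrightarrow> minus_arr f f = Zer C a b"
  using abelian_group.r_neg[OF H_abelian] by (simp add: minus_arr_eq a_minus_def)

lemma minus_add_cancel:
  assumes "f \<in> Homs C a b" "g \<in> Homs C a b"
  shows "Add C (minus_arr f g) g = f"
proof -
  interpret abelian_group "H a b" using assms H_abelian by blast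
  have "\<ominus>\<^bsub>H a b\<^esub> g \<in> Homs C a b" using a_inv_closed[of g] assms by simp
  moreover have "Add C (\<ominus>\<^bsub>H a b\<^esub> g) g = Zer C a b" using l_neg[of g] assms by simp
  ultimately show ?thesis using assms minus_arr_eq[of f a b g] a_assoc[of f "\<ominus>\<^bsub>H a b\<^esub> g" g] r_zero[of f]
    by (simp add: a_minus_def)
qed

lemma add_zero: 
  assumes "f \<in> Homs C a b"
  shows "Add C f (Zer C a b) = f" "Add C (Zer C a b) f = f"
proof -
  interpret abelian_group "H a b" using assms H_abelian by blast
  show "Add C f (Zer C a b) = f" "Add C (Zer C a b) f = f"
    using assms r_zero[of f] l_zero[of f] by simp_all
qed

lemma minus_zero: "f \<in> Homs C a b \<Longrightarrow> minus_arr f (Zer C a b) = f"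
  using minus_add_cancel[of f a b "Zer C a b"] add_zero[of "minus_arr f (Zer C a b)" a b]
    minus_hom Zer_hom Homs_obj by metis

lemma minus_eq_zero_iff:
  assumes "f \<in> Homs C a b" "g \<in> Homs C a b"
  shows "minus_arr f g = Zer C a b \<longleftrightarrow> f = g"
  using minus_add_cancel[OF assms] minus_self[OF assms(1)] add_zero(2)[OF assms(2)] by auto

lemma group_hom_cmp_left:
  assumes "g \<in> Homs C b c" "a \<in> Obj C"
  shows "group_hom (add_monoid (H a b)) (add_monoid (H a c)) (\<lambda>f. g \<bullet>\<^bsub>C\<^esub> f)"
proof -
  have ob: "b \<in> Obj C" "c \<in> Obj C" using assms Homs_obj by auto
  interpret A: abelian_group "H a b" by (rule hom_abelian_group) (use assms ob in auto)
  interpret B: abelian_group "H a c" by (rule hom_abelian_group) (use assms ob in auto)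
  show ?thesis
    by (intro group_hom.intro group_hom_axioms.intro A.a_group B.a_group)
       (use assms in \<open>auto simp: hom_def cmp_hom cmp_add_right\<close>)
qed

lemma group_hom_cmp_right:
  assumes "f \<in> Homs C a b" "c \<in> Obj C"
  shows "group_hom (add_monoid (H b c)) (add_monoid (H a c)) (\<lambda>g. g \<bullet>\<^bsub>C\<^esub> f)"
proof -
  have ob: "b \<in> Obj C" "a \<in> Obj C" using assms Homs_obj by auto
  interpret A: abelian_group "H b c" by (rule hom_abelian_group) (use assms ob in auto)
  interpret B: abelian_group "H a c" by (rule hom_abelian_group) (use assms ob in auto)
  show ?thesis
    by (intro group_hom.intro group_hom_axioms.intro A.a_group B.a_group)
       (use assms in \<open>auto simp: hom_def cmp_hom cmp_add_left\<close>)
qed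

lemma cmp_zero_right: "g \<in> Homs C b c \<Longrightarrow> a \<in> Obj C \<Longrightarrow> g \<bullet>\<^bsub>C\<^esub> Zer C a b = Zer C a c"
  using group_hom.hom_one[OF group_hom_cmp_left] by fastforce

lemma cmp_zero_left: "f \<in> Homs C a b \<Longrightarrow> c \<in> Obj C \<Longrightarrow> Zer C b c \<bullet>\<^bsub>C\<^esub> f = Zer C a c"
  using group_hom.hom_one[OF group_hom_cmp_right] by fastforce

lemma cmp_minus_right:
  assumes "f \<in> Homs C a b" "f' \<in> Homs C a b" "g \<in> Homs C b c"
  shows "g \<bullet>\<^bsub>C\<^esub> minus_arr f f' = minus_arr (g \<bullet>\<^bsub>C\<^esub> f) (g \<bullet>\<^bsub>C\<^esub> f')"
proof -
  have ob: "a \<in> Obj C" using assms Homs_obj by auto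
  interpret G: group_hom "add_monoid (H a b)" "add_monoid (H a c)" "\<lambda>f. g \<bullet>\<^bsub>C\<^esub> f"
    using group_hom_cmp_left[OF assms(3) ob] .
  interpret A: abelian_group "H a b" using assms H_abelian by blast
  have inv: "g \<bullet>\<^bsub>C\<^esub> (\<ominus>\<^bsub>H a b\<^esub> f') = \<ominus>\<^bsub>H a c\<^esub> (g \<bullet>\<^bsub>C\<^esub> f')"
    using G.hom_inv[of f'] assms by (simp add: a_inv_def)
  have "g \<bullet>\<^bsub>C\<^esub> f \<in> Homs C a c" "\<ominus>\<^bsub>H a b\<^esub> f' \<in> Homs C a b"
    using assms cmp_hom A.a_inv_closed[of f'] by auto
  then show ?thesis
    using assms by (simp add: minus_arr_eq a_minus_def cmp_add_right inv)
qed

lemma cmp_minus_left: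
  assumes "f \<in> Homs C a b" "g \<in> Homs C b c" "g' \<in> Homs C b c"
  shows "minus_arr g g' \<bullet>\<^bsub>C\<^esub> f = minus_arr (g \<bullet>\<^bsub>C\<^esub> f) (g' \<bullet>\<^bsub>C\<^esub> f)"
proof -
  have ob: "c \<in> Obj C" using assms Homs_obj by auto
  interpret G: group_hom "add_monoid (H b c)" "add_monoid (H a c)" "\<lambda>g. g \<bullet>\<^bsub>C\<^esub> f"
    using group_hom_cmp_right[OF assms(1) ob] .
  interpret A: abelian_group "H b c" using assms H_abelian by blast
  have inv: "(\<ominus>\<^bsub>H b c\<^esub> g') \<bullet>\<^bsub>C\<^esub> f = \<ominus>\<^bsub>H a c\<^esub> (g' \<bullet>\<^bsub>C\<^esub> f)"
    using G.hom_inv[of g'] assms by (simp add: a_inv_def)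
  have "g \<bullet>\<^bsub>C\<^esub> f \<in> Homs C a c" "\<ominus>\<^bsub>H b c\<^esub> g' \<in> Homs C b c"
    using assms cmp_hom A.a_inv_closed[of g'] by auto
  then show ?thesis
    using assms by (simp add: minus_arr_eq a_minus_def cmp_add_left inv)
qed

lemma finsum_hom:
  "a \<in> Obj C \<Longrightarrow> b \<in> Obj C \<Longrightarrow> (\<And>i. i \<in> I \<Longrightarrow> f i \<in> Homs C a b) \<Longrightarrow> finsum (H a b) f I \<in> Homs C a b"
  using abelian_monoid.finsum_closed[OF abelian_group.axioms(1)[OF hom_abelian_group], of a b f I] by auto

lemma finsum_Zer:
  assumes "a \<in> Obj C" "b \<in> Obj C" "\<And>i. i \<in> I \<Longrightarrow> f i = Zer C a b"
  shows "finsum (H a b) f I = Zer C a b"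
proof -
  interpret A: abelian_group "H a b" using assms hom_abelian_group by blast
  show ?thesis using A.add.finprod_one_eqI[of I f] assms by simp
qed

lemma finsum_single:
  assumes "finite I" "i \<in> I" "f i \<in> Homs C a b" "\<And>j. j \<in> I \<Longrightarrow> j \<noteq> i \<Longrightarrow> f j = Zer C a b"
  shows "finsum (H a b) f I = f i"
proof -
  interpret A: abelian_group "H a b" using assms H_abelian by blast
  have mem: "f j \<in> Homs C a b" if "j \<in> I" for j
    using that assms Zer_hom[of a b] Homs_obj[of "f i" a b] by (cases "j = i") auto
  have "finsum (H a b) f I = finsum (H a b) (\<lambda>j. if i = j then f j else \<zero>\<^bsub>H a b\<^esub>) I"
    by (rule A.finsum_cong') (use assms Zer_hom[of a b] Homs_obj[of "f i" a b] in \<open>force+\<close>)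
  also have "\<dots> = f i"
    using A.add.finprod_singleton[of i I f] assms mem by auto
  finally show ?thesis .
qed

lemma finsum_eqI:
  assumes "a \<in> Obj C" "b \<in> Obj C" "\<And>i. i \<in> I \<Longrightarrow> f i = g i" "\<And>i. i \<in> I \<Longrightarrow> g i \<in> Homs C a b"
  shows "finsum (H a b) f I = finsum (H a b) g I"
  by (rule abelian_monoid.finsum_cong'[OF abelian_group.axioms(1)[OF hom_abelian_group]])
     (use assms in auto)

lemma cmp_finsum_right:
  assumes "g \<in> Homs C b c" "a \<in> Obj C" "\<And>i. i \<in> I \<Longrightarrow> f i \<in> Homs C a b"
  shows "g \<bullet>\<^bsub>C\<^esub> finsum (H a b) f I = finsum (H a c) (\<lambda>i. g \<bullet>\<^bsub>C\<^esub> f i) I"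
proof -
  have ob: "b \<in> Obj C" "c \<in> Obj C" using assms Homs_obj by auto
  interpret A: abelian_group "H a b" by (rule hom_abelian_group) (use assms ob in auto)
  interpret B: abelian_group "H a c" by (rule hom_abelian_group) (use assms ob in auto)
  show ?thesis using assms(3)
  proof (induction I rule: infinite_finite_induct)
    case (insert i I)
    have "finsum (H a b) f I \<in> Homs C a b" using insert by (intro finsum_hom) (use assms ob in auto)
    moreover have "finsum (H a b) f (insert i I) = f i \<oplus>\<^bsub>H a b\<^esub> finsum (H a b) f I"
      using insert by (intro A.finsum_insert) auto
    moreover have "finsum (H a c) (\<lambda>i. g \<bullet>\<^bsub>C\<^esub> f i) (insert i I)
        = g \<bullet>\<^bsub>C\<^esub> f i \<oplus>\<^bsub>H a c\<^esub> finsum (H a c) (\<lambda>i. g \<bullet>\<^bsub>C\<^esub> f i) I"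
      using insert assms(1) by (intro B.finsum_insert) (auto intro: cmp_hom)
    ultimately show ?case using insert assms(1) cmp_add_right[of "f i" a b "finsum (H a b) f I" g c] by simp
  qed (use assms cmp_zero_right in \<open>simp_all add: A.finsum_empty B.finsum_empty\<close>)
qed

lemma cmp_finsum_left:
  assumes "f \<in> Homs C a b" "c \<in> Obj C" "\<And>i. i \<in> I \<Longrightarrow> g i \<in> Homs C b c"
  shows "finsum (H b c) g I \<bullet>\<^bsub>C\<^esub> f = finsum (H a c) (\<lambda>i. g i \<bullet>\<^bsub>C\<^esub> f) I"
proof -
  have ob: "b \<in> Obj C" "a \<in> Obj C" using assms Homs_obj by auto
  interpret A: abelian_group "H b c" by (rule hom_abelian_group) (use assms ob in auto)
  interpret B: abelian_group "H a c" by (rule hom_abelian_group) (use assms ob in auto)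
  show ?thesis using assms(3)
  proof (induction I rule: infinite_finite_induct)
    case (insert i I)
    have "finsum (H b c) g I \<in> Homs C b c" using insert by (intro finsum_hom) (use assms ob in auto)
    moreover have "finsum (H b c) g (insert i I) = g i \<oplus>\<^bsub>H b c\<^esub> finsum (H b c) g I"
      using insert by (intro A.finsum_insert) auto
    moreover have "finsum (H a c) (\<lambda>i. g i \<bullet>\<^bsub>C\<^esub> f) (insert i I)
        = g i \<bullet>\<^bsub>C\<^esub> f \<oplus>\<^bsub>H a c\<^esub> finsum (H a c) (\<lambda>i. g i \<bullet>\<^bsub>C\<^esub> f) I"
      using insert assms(1) by (intro B.finsum_insert) (auto intro: cmp_hom)
    ultimately show ?case using insert assms(1) cmp_add_left[of f a b "g i" c "finsum (H b c) g I"] by simp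
  qed (use assms cmp_zero_left in \<open>simp_all add: A.finsum_empty B.finsum_empty\<close>)
qed

lemma scal_hom: "f \<in> Homs C a b \<Longrightarrow> [(k::int)] \<cdot>\<^bsub>H a b\<^esub> f \<in> Homs C a b"
  using group.int_pow_closed[OF abelian_group.a_group[OF H_abelian], of f a b f k]
  by (simp add: add_pow_def)

lemma cmp_scal_right:
  assumes "f \<in> Homs C a b" "g \<in> Homs C b c"
  shows "g \<bullet>\<^bsub>C\<^esub> ([(k::int)] \<cdot>\<^bsub>H a b\<^esub> f) = [k] \<cdot>\<^bsub>H a c\<^esub> (g \<bullet>\<^bsub>C\<^esub> f)"
  using group_hom.hom_int_pow[OF group_hom_cmp_left[OF assms(2)], of a f k] assms Homs_obj
  by (auto simp: add_pow_def)

lemma cmp_scal_left: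
  assumes "f \<in> Homs C a b" "g \<in> Homs C b c"
  shows "([(k::int)] \<cdot>\<^bsub>H b c\<^esub> g) \<bullet>\<^bsub>C\<^esub> f = [k] \<cdot>\<^bsub>H a c\<^esub> (g \<bullet>\<^bsub>C\<^esub> f)"
  using group_hom.hom_int_pow[OF group_hom_cmp_right[OF assms(1)], of c g k] assms Homs_obj
  by (auto simp: add_pow_def)

lemma scal_zero: "a \<in> Obj C \<Longrightarrow> b \<in> Obj C \<Longrightarrow> [(k::int)] \<cdot>\<^bsub>H a b\<^esub> Zer C a b = Zer C a b"
  using group.int_pow_one[OF abelian_group.a_group[OF hom_abelian_group], of a b k]
  by (simp add: add_pow_def)

lemma scal_0: "[(0::int)] \<cdot>\<^bsub>H a b\<^esub> f = Zer C a b"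
  by (simp add: add_pow_def)

lemma scal_1: "f \<in> Homs C a b \<Longrightarrow> [(1::int)] \<cdot>\<^bsub>H a b\<^esub> f = f"
  using group.int_pow_1[OF abelian_group.a_group[OF H_abelian], of f a b f] by (simp add: add_pow_def)

lemma scal_scal:
  "f \<in> Homs C a b \<Longrightarrow> [(k::int)] \<cdot>\<^bsub>H a b\<^esub> ([(l::int)] \<cdot>\<^bsub>H a b\<^esub> f) = [(k * l)] \<cdot>\<^bsub>H a b\<^esub> f"
  using group.int_pow_pow[OF abelian_group.a_group[OF H_abelian], of f a b f l k]
  by (simp add: add_pow_def mult.commute)

lemma scal_add:
  "f \<in> Homs C a b \<Longrightarrow>
     [(k + l::int)] \<cdot>\<^bsub>H a b\<^esub> f = Add C ([k] \<cdot>\<^bsub>H a b\<^esub> f) ([l] \<cdot>\<^bsub>H a b\<^esub> f)"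
  using group.int_pow_mult[OF abelian_group.a_group[OF H_abelian], of f a b f k l]
  by (simp add: add_pow_def)

lemma scal_finsum:
  assumes "a \<in> Obj C" "b \<in> Obj C" "\<And>i. i \<in> I \<Longrightarrow> f i \<in> Homs C a b"
  shows "[(k::int)] \<cdot>\<^bsub>H a b\<^esub> finsum (H a b) f I = finsum (H a b) (\<lambda>i. [k] \<cdot>\<^bsub>H a b\<^esub> f i) I"
proof -
  \<comment> \<open>Multiplication by k is composition with k times the identity, which turns the
    claim into distributivity of composition.\<close>
  have m: "[k] \<cdot>\<^bsub>H b b\<^esub> Ide C b \<in> Homs C b b" using ide_hom assms scal_hom by auto
  have *: "([k] \<cdot>\<^bsub>H b b\<^esub> Ide C b) \<bullet>\<^bsub>C\<^esub> f = [k] \<cdot>\<^bsub>H a b\<^esub> f" if "f \<in> Homs C a b" for f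
    using that ide_hom assms by (simp add: cmp_scal_left ide_cmp)
  show ?thesis
    using cmp_finsum_right[OF m assms(1), of I f] assms
    by (simp add: * finsum_hom) (intro finsum_eqI, auto simp: * scal_hom)
qed

lemma finsum_scal:
  assumes "f \<in> Homs C a b" "finite I"
  shows "finsum (H a b) (\<lambda>i. [(k i::int)] \<cdot>\<^bsub>H a b\<^esub> f) I = [(sum k I)] \<cdot>\<^bsub>H a b\<^esub> f"
proof -
  interpret A: abelian_group "H a b" using assms H_abelian by blast
  show ?thesis using assms(2)
  proof induction
    case empty then show ?case using scal_0[of a b f] by (simp add: A.finsum_empty)
  next
    case (insert i I)
    have "finsum (H a b) (\<lambda>i. [(k i::int)] \<cdot>\<^bsub>H a b\<^esub> f) (insert i I)
       = [k i] \<cdot>\<^bsub>H a b\<^esub> f \<oplus>\<^bsub>H a b\<^esub> finsum (H a b) (\<lambda>i. [(k i::int)] \<cdot>\<^bsub>H a b\<^esub> f) I"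
      using insert assms scal_hom by (intro A.finsum_insert) auto
    then show ?case using insert assms by (simp add: scal_add)
  qed
qed

text \<open>From here on the laws are restated with \<open>Arr\<close>, \<open>Dom\<close> and
  \<open>Cod\<close>. Their side conditions are then equations that the simplifier can solve,
  whereas the versions with \<open>Homs\<close> would have to guess the intermediate object.\<close>

lemma arr_cmp:
  assumes "f \<in> Arr C" "g \<in> Arr C" "Dom C g = Cod C f"
  shows "g \<bullet>\<^bsub>C\<^esub> f \<in> Arr C" "Dom C (g \<bullet>\<^bsub>C\<^esub> f) = Dom C f" "Cod C (g \<bullet>\<^bsub>C\<^esub> f) = Cod C g"
  using cmp_hom[of f "Dom C f" "Cod C f" g "Cod C g"] assms by (auto simp: Homs_def)

lemma arr_assoc:
  assumes "f \<in> Arr C" "g \<in> Arr C" "h \<in> Arr C" "Dom C g = Cod C f" "Dom C h = Cod C g"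
  shows "(h \<bullet>\<^bsub>C\<^esub> g) \<bullet>\<^bsub>C\<^esub> f = h \<bullet>\<^bsub>C\<^esub> (g \<bullet>\<^bsub>C\<^esub> f)"
  using cmp_assoc[of f "Dom C f" "Cod C f" g "Cod C g" h "Cod C h"] assms by (auto simp: Homs_def)

lemma arr_ide: 
  assumes "a \<in> Obj C"
  shows "Ide C a \<in> Arr C" "Dom C (Ide C a) = a" "Cod C (Ide C a) = a"
  using ide_hom[OF assms] by (auto simp: Homs_def)

lemma arr_ide_cmp: "f \<in> Arr C \<Longrightarrow> Cod C f = a \<Longrightarrow> Ide C a \<bullet>\<^bsub>C\<^esub> f = f"
  and arr_cmp_ide: "f \<in> Arr C \<Longrightarrow> Dom C f = a \<Longrightarrow> f \<bullet>\<^bsub>C\<^esub> Ide C a = f"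
  using ide_cmp[of f "Dom C f" a] cmp_ide[of f a "Cod C f"] by (auto simp: Homs_def)

lemma arr_Zer:
  assumes "a \<in> Obj C" "b \<in> Obj C"
  shows "Zer C a b \<in> Arr C" "Dom C (Zer C a b) = a" "Cod C (Zer C a b) = b"
  using Zer_hom[OF assms] by (auto simp: Homs_def)

lemma arr_cmp_zero: 
  "f \<in> Arr C \<Longrightarrow> a \<in> Obj C \<Longrightarrow> Dom C f = b \<Longrightarrow> f \<bullet>\<^bsub>C\<^esub> Zer C a b = Zer C a (Cod C f)"
  "f \<in> Arr C \<Longrightarrow> c \<in> Obj C \<Longrightarrow> Cod C f = b \<Longrightarrow> Zer C b c \<bullet>\<^bsub>C\<^esub> f = Zer C (Dom C f) c"
  using cmp_zero_right[of f b "Cod C f" a] cmp_zero_left[of f "Dom C f" b c] by (auto simp: Homs_def)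

lemma arr_minus:
  assumes "f \<in> Arr C" "g \<in> Arr C" "Dom C f = Dom C g" "Cod C f = Cod C g"
  shows "minus_arr f g \<in> Arr C" "Dom C (minus_arr f g) = Dom C g" "Cod C (minus_arr f g) = Cod C g"
  using minus_hom[of f "Dom C f" "Cod C f" g] assms by (auto simp: Homs_def)

lemma arr_Add:
  assumes "f \<in> Arr C" "g \<in> Arr C" "Dom C f = Dom C g" "Cod C f = Cod C g"
  shows "Add C f g \<in> Arr C" "Dom C (Add C f g) = Dom C g" "Cod C (Add C f g) = Cod C g"
  using Add_hom[of f "Dom C f" "Cod C f" g] assms by (auto simp: Homs_def)

lemma arr_cmp_minus:
  assumes "f \<in> Arr C" "f' \<in> Arr C" "Dom C f = Dom C f'" "Cod C f = Cod C f'" "g \<in> Arr C"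
  shows "Dom C g = Cod C f' \<Longrightarrow> g \<bullet>\<^bsub>C\<^esub> minus_arr f f' = minus_arr (g \<bullet>\<^bsub>C\<^esub> f) (g \<bullet>\<^bsub>C\<^esub> f')"
    "Cod C g = Dom C f' \<Longrightarrow> minus_arr f f' \<bullet>\<^bsub>C\<^esub> g = minus_arr (f \<bullet>\<^bsub>C\<^esub> g) (f' \<bullet>\<^bsub>C\<^esub> g)"
  using cmp_minus_right[of f "Dom C f" "Cod C f" f' g "Cod C g"]
    cmp_minus_left[of g "Dom C g" "Cod C g" f "Cod C f" f'] assms by (auto simp: Homs_def)

lemma arr_cmp_Add:
  assumes "f \<in> Arr C" "f' \<in> Arr C" "Dom C f = Dom C f'" "Cod C f = Cod C f'" "g \<in> Arr C"
  shows "Dom C g = Cod C f' \<Longrightarrow> g \<bullet>\<^bsub>C\<^esub> Add C f f' = Add C (g \<bullet>\<^bsub>C\<^esub> f) (g \<bullet>\<^bsub>C\<^esub> f')"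
    "Cod C g = Dom C f' \<Longrightarrow> Add C f f' \<bullet>\<^bsub>C\<^esub> g = Add C (f \<bullet>\<^bsub>C\<^esub> g) (f' \<bullet>\<^bsub>C\<^esub> g)"
  using cmp_add_right[of f "Dom C f" "Cod C f" f' g "Cod C g"]
    cmp_add_left[of g "Dom C g" "Cod C g" f "Cod C f" f'] assms by (auto simp: Homs_def)

lemma arr_minus_zero:
  "f \<in> Arr C \<Longrightarrow> Dom C f = a \<Longrightarrow> Cod C f = b \<Longrightarrow> minus_arr f (Zer C a b) = f"
  "f \<in> Arr C \<Longrightarrow> minus_arr f f = Zer C (Dom C f) (Cod C f)"
  "f \<in> Arr C \<Longrightarrow> Dom C f = a \<Longrightarrow> Cod C f = b \<Longrightarrow> Add C f (Zer C a b) = f"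
  "f \<in> Arr C \<Longrightarrow> Dom C f = a \<Longrightarrow> Cod C f = b \<Longrightarrow> Add C (Zer C a b) f = f"
  using minus_zero[of f a b] minus_self[of f "Dom C f" "Cod C f"] add_zero[of f a b]
  by (auto simp: Homs_def)

lemmas arr_simps = arr_cmp arr_assoc arr_ide arr_ide_cmp arr_cmp_ide arr_Zer arr_cmp_zero
  arr_minus arr_Add arr_cmp_minus arr_cmp_Add arr_minus_zero dom_obj cod_obj

end

section \<open>Quotients and direct sums\<close>

lemma is_quotientD:
  assumes "is_quotient C a S p"
  shows "p \<in> Homs C a (Cod C p)" "\<And>s. s \<in> S \<Longrightarrow> p \<bullet>\<^bsub>C\<^esub> s = Zer C (Dom C s) (Cod C p)"
    "\<And>t b. t \<in> Homs C a b \<Longrightarrow> (\<And>s. s \<in> S \<Longrightarrow> t \<bullet>\<^bsub>C\<^esub> s = Zer C (Dom C s) b) \<Longrightarrow>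
      \<exists>!v. v \<in> Homs C (Cod C p) b \<and> v \<bullet>\<^bsub>C\<^esub> p = t"
  using assms unfolding is_quotient_def by blast+

context category
begin

lemma inverse_arr_eqI:
  assumes f: "f \<in> Homs C a b" and g: "g \<in> Homs C b a"
    and gf: "g \<bullet>\<^bsub>C\<^esub> f = Ide C a" and fg: "f \<bullet>\<^bsub>C\<^esub> g = Ide C b"
  shows "inverse_arr C f = g"
  unfolding inverse_arr_def
proof (rule the_equality)
  show "g \<in> Homs C (Cod C f) (Dom C f) \<and> g \<bullet>\<^bsub>C\<^esub> f = Ide C (Dom C f) \<and> f \<bullet>\<^bsub>C\<^esub> g = Ide C (Cod C f)"
    using assms by (auto simp: Homs_def)
next
  fix h assume h: "h \<in> Homs C (Cod C f) (Dom C f) \<and> h \<bullet>\<^bsub>C\<^esub> f = Ide C (Dom C f) \<and> f \<bullet>\<^bsub>C\<^esub> h = Ide C (Cod C f)"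
  then have h': "h \<in> Homs C b a" "h \<bullet>\<^bsub>C\<^esub> f = Ide C a" using f by (auto simp: Homs_def)
  have "h = (h \<bullet>\<^bsub>C\<^esub> f) \<bullet>\<^bsub>C\<^esub> g" using cmp_assoc[OF g f h'(1)] fg cmp_ide[OF h'(1)] by simp
  then show "h = g" using h'(2) ide_cmp[OF g] by simp
qed

lemma quotient_descend:
  assumes "is_quotient C a S p" "t \<in> Homs C a b"
    "\<And>s. s \<in> S \<Longrightarrow> t \<bullet>\<^bsub>C\<^esub> s = Zer C (Dom C s) b"
  shows "descend C p t \<in> Homs C (Cod C p) b" "descend C p t \<bullet>\<^bsub>C\<^esub> p = t"
proof -
  have "Cod C t = b" using assms by (simp add: Homs_def)
  then have "descend C p t \<in> Homs C (Cod C p) b \<and> descend C p t \<bullet>\<^bsub>C\<^esub> p = t"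
    unfolding descend_def using theI'[OF is_quotientD(3)[OF assms]] by simp
  then show "descend C p t \<in> Homs C (Cod C p) b" "descend C p t \<bullet>\<^bsub>C\<^esub> p = t" by auto
qed

end

section \<open>Existence of finite quotients and finite direct sums\<close>

context abelian_category
begin

text \<open>Uniqueness in the universal property is applied to the common composite, which kills S
  because p does.\<close>

lemma quotient_epic:
  assumes q: "is_quotient C a S p" and S: "\<And>s. s \<in> S \<Longrightarrow> s \<in> Arr C \<and> Cod C s = a"
    and g: "g \<in> Homs C (Cod C p) b" and h: "h \<in> Homs C (Cod C p) b"
    and eq: "g \<bullet>\<^bsub>C\<^esub> p = h \<bullet>\<^bsub>C\<^esub> p"
  shows "g = h"
proof -
  note p = is_quotientD[OF q]
  have t: "g \<bullet>\<^bsub>C\<^esub> p \<in> Homs C a b" using cmp_hom[OF p(1) g] .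
  have "(g \<bullet>\<^bsub>C\<^esub> p) \<bullet>\<^bsub>C\<^esub> s = Zer C (Dom C s) b" if "s \<in> S" for s
    using p(1,2) g S[OF that] that Homs_obj[OF g] by (auto simp: Homs_def arr_simps)
  then have "\<exists>!v. v \<in> Homs C (Cod C p) b \<and> v \<bullet>\<^bsub>C\<^esub> p = g \<bullet>\<^bsub>C\<^esub> p" by (rule p(3)[OF t])
  then show ?thesis using g h eq by metis
qed

text \<open>A quotient by finitely many arrows is an iterated cokernel: after p has killed S,
  composing with a cokernel of p s kills s as well. Finiteness is available in the applications
  because only finitely many degeneracies leave a given [n].\<close>

lemma quotient_exists:
  assumes "finite S" "a \<in> Obj C" "\<And>s. s \<in> S \<Longrightarrow> s \<in> Arr C \<and> Cod C s = a"
  shows "\<exists>p. is_quotient C a S p"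
  using assms(1,3)
proof (induction S)
  case empty
  have "is_quotient C a {} (Ide C a)"
    using assms(2) by (auto simp: is_quotient_def Homs_def arr_simps)
  then show ?case by blast
next
  case (insert s S)
  then obtain p where p: "is_quotient C a S p" by auto
  note pD = is_quotientD[OF p]
  have s: "s \<in> Arr C" "Cod C s = a" using insert by auto
  have pA: "p \<in> Arr C" "Dom C p = a" using pD(1) by (auto simp: Homs_def)
  obtain q where q: "is_cokernel C (p \<bullet>\<^bsub>C\<^esub> s) q"
    using cokernels[of "p \<bullet>\<^bsub>C\<^esub> s"] s pA by (auto simp: arr_simps)
  have qh: "q \<in> Homs C (Cod C p) (Cod C q)" "q \<bullet>\<^bsub>C\<^esub> (p \<bullet>\<^bsub>C\<^esub> s) = Zer C (Dom C s) (Cod C q)"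
    and qu: "\<And>t b. t \<in> Homs C (Cod C p) b \<Longrightarrow> t \<bullet>\<^bsub>C\<^esub> (p \<bullet>\<^bsub>C\<^esub> s) = Zer C (Dom C s) b \<Longrightarrow>
        \<exists>!v. v \<in> Homs C (Cod C q) b \<and> v \<bullet>\<^bsub>C\<^esub> q = t"
    using q s pA by (auto simp: is_cokernel_def arr_simps)
  have qA: "q \<in> Arr C" "Dom C q = Cod C p" using qh(1) by (auto simp: Homs_def)
  have "is_quotient C a (insert s S) (q \<bullet>\<^bsub>C\<^esub> p)"
    unfolding is_quotient_def
  proof (intro conjI ballI allI impI)
    show "q \<bullet>\<^bsub>C\<^esub> p \<in> Homs C a (Cod C (q \<bullet>\<^bsub>C\<^esub> p))" using pA qA by (auto simp: Homs_def arr_simps)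
  next
    fix r assume r: "r \<in> insert s S"
    then have rA: "r \<in> Arr C" "Cod C r = a" using insert by auto
    show "(q \<bullet>\<^bsub>C\<^esub> p) \<bullet>\<^bsub>C\<^esub> r = Zer C (Dom C r) (Cod C (q \<bullet>\<^bsub>C\<^esub> p))"
      using r qh(2) pD(2) rA pA qA by (auto simp: arr_simps)
  next
    fix t b assume t: "t \<in> Homs C a b \<and> (\<forall>r\<in>insert s S. t \<bullet>\<^bsub>C\<^esub> r = Zer C (Dom C r) b)"
    then have "\<exists>!v. v \<in> Homs C (Cod C p) b \<and> v \<bullet>\<^bsub>C\<^esub> p = t" by (intro pD(3)) auto
    then obtain v where v: "v \<in> Homs C (Cod C p) b" "v \<bullet>\<^bsub>C\<^esub> p = t"
      and v_uniq: "\<And>v'. v' \<in> Homs C (Cod C p) b \<Longrightarrow> v' \<bullet>\<^bsub>C\<^esub> p = t \<Longrightarrow> v' = v" by blast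
    have "v \<bullet>\<^bsub>C\<^esub> (p \<bullet>\<^bsub>C\<^esub> s) = Zer C (Dom C s) b"
      using cmp_assoc[of s "Dom C s" a p "Cod C p" v b] v t s pA by (auto simp: Homs_def)
    from qu[OF v(1) this] obtain w where w: "w \<in> Homs C (Cod C q) b" "w \<bullet>\<^bsub>C\<^esub> q = v"
      and w_uniq: "\<And>w'. w' \<in> Homs C (Cod C q) b \<Longrightarrow> w' \<bullet>\<^bsub>C\<^esub> q = v \<Longrightarrow> w' = w" by blast
    have as: "w' \<bullet>\<^bsub>C\<^esub> (q \<bullet>\<^bsub>C\<^esub> p) = (w' \<bullet>\<^bsub>C\<^esub> q) \<bullet>\<^bsub>C\<^esub> p" if "w' \<in> Homs C (Cod C q) b" for w'
      using that pA qA by (auto simp: Homs_def arr_simps)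
    show "\<exists>!w. w \<in> Homs C (Cod C (q \<bullet>\<^bsub>C\<^esub> p)) b \<and> w \<bullet>\<^bsub>C\<^esub> (q \<bullet>\<^bsub>C\<^esub> p) = t"
    proof (rule ex1I[of _ w])
      show "w \<in> Homs C (Cod C (q \<bullet>\<^bsub>C\<^esub> p)) b \<and> w \<bullet>\<^bsub>C\<^esub> (q \<bullet>\<^bsub>C\<^esub> p) = t"
        using w v as pA qA by (auto simp: arr_simps)
    next
      fix w' assume "w' \<in> Homs C (Cod C (q \<bullet>\<^bsub>C\<^esub> p)) b \<and> w' \<bullet>\<^bsub>C\<^esub> (q \<bullet>\<^bsub>C\<^esub> p) = t"
      then have w': "w' \<in> Homs C (Cod C q) b" "(w' \<bullet>\<^bsub>C\<^esub> q) \<bullet>\<^bsub>C\<^esub> p = t"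
        using as[of w'] pA qA by (auto simp: arr_simps)
      then show "w' = w" using v_uniq[of "w' \<bullet>\<^bsub>C\<^esub> q"] w_uniq cmp_hom[OF qh(1) w'(1)] by blast
    qed
  qed
  then show ?case by blast
qed

lemma quotient_prj:
  assumes "finite S" "a \<in> Obj C" "\<And>s. s \<in> S \<Longrightarrow> s \<in> Arr C \<and> Cod C s = a"
  shows "is_quotient C a S (quotient_prj C a S)"
  using quotient_exists[OF assms] unfolding quotient_prj_def by (rule someI_ex)

text \<open>Binary biproducts are iterated, starting from a zero object. In the induction step the
  index \<open>True\<close> carries the new summand and \<open>False\<close> the sum of the old
  ones, so old inclusions are composed with \<open>ii False\<close> and old projections with
  \<open>pp False\<close>.\<close>

lemma biproduct_exists:
  assumes "finite I" "\<And>i. i \<in> I \<Longrightarrow> x i \<in> Obj C"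
  shows "\<exists>b inc prj. is_biproduct C I x b inc prj"
  using assms
proof (induction I)
  case empty
  obtain z where z: "z \<in> Obj C" "Ide C z = Zer C z z" using zero_object by blast
  interpret A: abelian_group "H z z" using z hom_abelian_group by blast
  have "is_biproduct C {} x z (\<lambda>_. Ide C z) (\<lambda>_. Ide C z)"
    using z by (auto simp: is_biproduct_def A.finsum_empty)
  then show ?case by blast
next
  case (insert i I)
  then obtain b inc prj where b: "is_biproduct C I x b inc prj" by auto
  have bo: "b \<in> Obj C" using b by (simp add: is_biproduct_def)
  have bh: "inc j \<in> Arr C" "Dom C (inc j) = x j" "Cod C (inc j) = b"
    "prj j \<in> Arr C" "Dom C (prj j) = b" "Cod C (prj j) = x j" if "j \<in> I" for j
    using b that by (auto simp: is_biproduct_def Homs_def)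
  have be: "prj k \<bullet>\<^bsub>C\<^esub> inc j = (if j = k then Ide C (x j) else Zer C (x j) (x k))"
    if "j \<in> I" "k \<in> I" for j k using b that by (simp add: is_biproduct_def)
  have bs: "finsum (H b b) (\<lambda>j. inc j \<bullet>\<^bsub>C\<^esub> prj j) I = Ide C b"
    using b by (simp add: is_biproduct_def)
  have xi: "x i \<in> Obj C" and xo: "\<And>j. j \<in> I \<Longrightarrow> x j \<in> Obj C" using insert by auto
  obtain s ii pp where s: "is_biproduct C {False, True} (\<lambda>c. if c then x i else b) s ii pp"
    using binary_biproducts[OF bo xi] by blast
  have so: "s \<in> Obj C" using s by (simp add: is_biproduct_def)
  have sh: "ii False \<in> Arr C" "Dom C (ii False) = b" "Cod C (ii False) = s"
    "pp False \<in> Arr C" "Dom C (pp False) = s" "Cod C (pp False) = b"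
    "ii True \<in> Arr C" "Dom C (ii True) = x i" "Cod C (ii True) = s"
    "pp True \<in> Arr C" "Dom C (pp True) = s" "Cod C (pp True) = x i"
    using s by (auto simp: is_biproduct_def Homs_def)
  have se: "pp False \<bullet>\<^bsub>C\<^esub> ii False = Ide C b" "pp True \<bullet>\<^bsub>C\<^esub> ii True = Ide C (x i)"
    "pp True \<bullet>\<^bsub>C\<^esub> ii False = Zer C b (x i)" "pp False \<bullet>\<^bsub>C\<^esub> ii True = Zer C (x i) b"
    using s by (auto simp: is_biproduct_def)
  interpret S: abelian_group "H s s" using so hom_abelian_group by blast
  have ss: "Add C (ii True \<bullet>\<^bsub>C\<^esub> pp True) (ii False \<bullet>\<^bsub>C\<^esub> pp False) = Ide C s"
  proof -
    have "finsum (H s s) (\<lambda>c. ii c \<bullet>\<^bsub>C\<^esub> pp c) {True, False} = Ide C s"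
      using s by (simp add: is_biproduct_def insert_commute)
    moreover have "ii c \<bullet>\<^bsub>C\<^esub> pp c \<in> Homs C s s" for c
      using sh by (cases c) (auto simp: Homs_def arr_simps)
    ultimately show ?thesis using S.finsum_insert[of "{False}" True "\<lambda>c. ii c \<bullet>\<^bsub>C\<^esub> pp c"]
      S.finsum_insert[of "{}" False "\<lambda>c. ii c \<bullet>\<^bsub>C\<^esub> pp c"]
      by (auto simp: S.finsum_empty add_zero)
  qed
  let ?inc = "\<lambda>j. if j = i then ii True else ii False \<bullet>\<^bsub>C\<^esub> inc j"
  let ?prj = "\<lambda>j. if j = i then pp True else prj j \<bullet>\<^bsub>C\<^esub> pp False"
  have comp: "(prj k \<bullet>\<^bsub>C\<^esub> pp False) \<bullet>\<^bsub>C\<^esub> (ii False \<bullet>\<^bsub>C\<^esub> inc j) = prj k \<bullet>\<^bsub>C\<^esub> inc j"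
    if "j \<in> I" "k \<in> I" for j k
  proof -
    have "(prj k \<bullet>\<^bsub>C\<^esub> pp False) \<bullet>\<^bsub>C\<^esub> (ii False \<bullet>\<^bsub>C\<^esub> inc j) = prj k \<bullet>\<^bsub>C\<^esub> (pp False \<bullet>\<^bsub>C\<^esub> ii False) \<bullet>\<^bsub>C\<^esub> inc j"
      using that bh sh by (simp add: arr_simps del: se)
    then show ?thesis using that bh sh se by (simp add: arr_simps)
  qed
  have compT: "pp True \<bullet>\<^bsub>C\<^esub> (ii False \<bullet>\<^bsub>C\<^esub> inc j) = Zer C (x j) (x i)" if "j \<in> I" for j
    using cmp_assoc[of "inc j" "x j" b "ii False" s "pp True" "x i"] that bh sh se xi xo
    by (auto simp: Homs_def arr_simps)
  have compF: "(prj k \<bullet>\<^bsub>C\<^esub> pp False) \<bullet>\<^bsub>C\<^esub> ii True = Zer C (x i) (x k)" if "k \<in> I" for k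
    using that bh sh se xi xo by (simp add: arr_simps)
  have "finsum (H s s) (\<lambda>j. ?inc j \<bullet>\<^bsub>C\<^esub> ?prj j) I
      = finsum (H s s) (\<lambda>j. ii False \<bullet>\<^bsub>C\<^esub> ((inc j \<bullet>\<^bsub>C\<^esub> prj j) \<bullet>\<^bsub>C\<^esub> pp False)) I"
    by (rule finsum_eqI) (use insert bh sh so in \<open>auto simp: Homs_def arr_simps\<close>)
  also have "\<dots> = ii False \<bullet>\<^bsub>C\<^esub> finsum (H s b) (\<lambda>j. (inc j \<bullet>\<^bsub>C\<^esub> prj j) \<bullet>\<^bsub>C\<^esub> pp False) I"
    by (rule cmp_finsum_right[symmetric]) (use bh sh so bo in \<open>auto simp: Homs_def arr_simps\<close>)
  also have "finsum (H s b) (\<lambda>j. (inc j \<bullet>\<^bsub>C\<^esub> prj j) \<bullet>\<^bsub>C\<^esub> pp False) I =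
      finsum (H b b) (\<lambda>j. inc j \<bullet>\<^bsub>C\<^esub> prj j) I \<bullet>\<^bsub>C\<^esub> pp False"
    by (rule cmp_finsum_left[symmetric]) (use bh sh so bo in \<open>auto simp: Homs_def arr_simps\<close>)
  finally have sumI: "finsum (H s s) (\<lambda>j. ?inc j \<bullet>\<^bsub>C\<^esub> ?prj j) I = ii False \<bullet>\<^bsub>C\<^esub> pp False"
    using bs sh by (simp add: arr_simps)
  have "is_biproduct C (insert i I) x s ?inc ?prj"
    unfolding is_biproduct_def
  proof (intro conjI ballI)
    show "finite (insert i I)" "s \<in> Obj C" using insert so by auto
  next
    fix j assume "j \<in> insert i I"
    then show "?inc j \<in> Homs C (x j) s" "?prj j \<in> Homs C s (x j)"
      using bh sh by (auto simp: Homs_def arr_simps)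
  next
    fix j k assume "j \<in> insert i I" "k \<in> insert i I"
    then show "?prj k \<bullet>\<^bsub>C\<^esub> ?inc j = (if j = k then Ide C (x j) else Zer C (x j) (x k))"
      using insert.hyps comp compT compF se be by auto
  next
    have "finsum (H s s) (\<lambda>j. ?inc j \<bullet>\<^bsub>C\<^esub> ?prj j) (insert i I) =
        (?inc i \<bullet>\<^bsub>C\<^esub> ?prj i) \<oplus>\<^bsub>H s s\<^esub> finsum (H s s) (\<lambda>j. ?inc j \<bullet>\<^bsub>C\<^esub> ?prj j) I"
      by (rule S.finsum_insert) (use insert bh sh in \<open>auto simp: Homs_def arr_simps\<close>)
    then show "finsum (H s s) (\<lambda>j. ?inc j \<bullet>\<^bsub>C\<^esub> ?prj j) (insert i I) = Ide C s"
      using sumI ss by simp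
  qed
  then show ?case by blast
qed

lemma dsum_biproduct:
  assumes "finite I" "\<And>i. i \<in> I \<Longrightarrow> x i \<in> Obj C"
  shows "is_biproduct C I x (dsum C I x) (dsum_inj C I x) (dsum_prj C I x)"
proof -
  obtain b inc prj where "is_biproduct C I x b inc prj" using biproduct_exists[where x=x, OF assms] by blast
  then have "case (b, inc, prj) of (b, inc, prj) \<Rightarrow> is_biproduct C I x b inc prj" by simp
  then have "case direct_sum C I x of (b, inc, prj) \<Rightarrow> is_biproduct C I x b inc prj"
    unfolding direct_sum_def by (rule someI)
  then show ?thesis by (simp add: dsum_def dsum_inj_def dsum_prj_def split: prod.splits)
qed

context
  fixes I :: "'i set" and x :: "'i \<Rightarrow> 'a"
  assumes fin: "finite I" and ob: "\<And>i. i \<in> I \<Longrightarrow> x i \<in> Obj C"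
begin

lemma dsum_obj: "dsum C I x \<in> Obj C"
  using dsum_biproduct[where x=x, OF fin ob] by (simp add: is_biproduct_def)

lemma dsum_inj_hom: "i \<in> I \<Longrightarrow> dsum_inj C I x i \<in> Homs C (x i) (dsum C I x)"
  and dsum_prj_hom: "i \<in> I \<Longrightarrow> dsum_prj C I x i \<in> Homs C (dsum C I x) (x i)"
  and dsum_prj_inj: "i \<in> I \<Longrightarrow> j \<in> I \<Longrightarrow> dsum_prj C I x j \<bullet>\<^bsub>C\<^esub> dsum_inj C I x i =
     (if i = j then Ide C (x i) else Zer C (x i) (x j))"
  and dsum_sum: "finsum (H (dsum C I x) (dsum C I x))
     (\<lambda>i. dsum_inj C I x i \<bullet>\<^bsub>C\<^esub> dsum_prj C I x i) I = Ide C (dsum C I x)"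
  using dsum_biproduct[where x=x, OF fin ob] by (simp_all add: is_biproduct_def)

lemma into_dsum_hom:
  assumes "t \<in> Obj C" "\<And>i. i \<in> I \<Longrightarrow> f i \<in> Homs C t (x i)"
  shows "into_dsum C I x t f \<in> Homs C t (dsum C I x)"
  unfolding into_dsum_def
  by (rule finsum_hom) (use assms dsum_obj dsum_inj_hom in \<open>auto intro: cmp_hom\<close>)

lemma prj_into_dsum:
  assumes "t \<in> Obj C" "\<And>i. i \<in> I \<Longrightarrow> f i \<in> Homs C t (x i)" "j \<in> I"
  shows "dsum_prj C I x j \<bullet>\<^bsub>C\<^esub> into_dsum C I x t f = f j"
proof -
  let ?s = "dsum C I x"
  have "dsum_prj C I x j \<bullet>\<^bsub>C\<^esub> into_dsum C I x t f
     = finsum (H t (x j)) (\<lambda>i. dsum_prj C I x j \<bullet>\<^bsub>C\<^esub> (dsum_inj C I x i \<bullet>\<^bsub>C\<^esub> f i)) I"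
    unfolding into_dsum_def
    by (rule cmp_finsum_right[of _ ?s]) (use assms dsum_prj_hom dsum_inj_hom in \<open>auto intro: cmp_hom\<close>)
  also have "\<dots> = finsum (H t (x j)) (\<lambda>i. if i = j then f j else Zer C t (x j)) I"
  proof (rule finsum_eqI)
    fix i assume i: "i \<in> I"
    show "dsum_prj C I x j \<bullet>\<^bsub>C\<^esub> (dsum_inj C I x i \<bullet>\<^bsub>C\<^esub> f i) = (if i = j then f j else Zer C t (x j))"
      using cmp_assoc[OF assms(2)[OF i] dsum_inj_hom[OF i] dsum_prj_hom[OF assms(3)]]
        dsum_prj_inj[OF i assms(3)] ide_cmp[OF assms(2)[OF i]] cmp_zero_left[OF assms(2)[OF i]] ob[OF assms(3)]
      by auto
  qed (use assms ob Zer_hom in auto)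
  also have "\<dots> = f j" 
    using finsum_single[OF fin assms(3), of "\<lambda>i. if i = j then f j else Zer C t (x j)" t "x j"] assms by auto
  finally show ?thesis .
qed

lemma into_dsum_prj:
  assumes "f \<in> Homs C t (dsum C I x)"
  shows "into_dsum C I x t (\<lambda>i. dsum_prj C I x i \<bullet>\<^bsub>C\<^esub> f) = f"
proof -
  let ?s = "dsum C I x"
  have t: "t \<in> Obj C" using assms Homs_obj by blast
  have "into_dsum C I x t (\<lambda>i. dsum_prj C I x i \<bullet>\<^bsub>C\<^esub> f)
      = finsum (H t ?s) (\<lambda>i. (dsum_inj C I x i \<bullet>\<^bsub>C\<^esub> dsum_prj C I x i) \<bullet>\<^bsub>C\<^esub> f) I"
    unfolding into_dsum_def
    by (rule finsum_eqI)
       (use t dsum_obj dsum_prj_hom dsum_inj_hom assms in \<open>force simp: Homs_def arr_simps\<close>)+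
  also have "\<dots> = finsum (H ?s ?s) (\<lambda>i. dsum_inj C I x i \<bullet>\<^bsub>C\<^esub> dsum_prj C I x i) I \<bullet>\<^bsub>C\<^esub> f"
    by (rule cmp_finsum_left[symmetric, OF assms dsum_obj])
       (use dsum_prj_hom dsum_inj_hom in \<open>auto intro: cmp_hom\<close>)
  finally show ?thesis using dsum_sum ide_cmp[OF assms] by simp
qed

lemma dsum_eqI_prj:
  assumes "f \<in> Homs C t (dsum C I x)" "g \<in> Homs C t (dsum C I x)"
    "\<And>i. i \<in> I \<Longrightarrow> dsum_prj C I x i \<bullet>\<^bsub>C\<^esub> f = dsum_prj C I x i \<bullet>\<^bsub>C\<^esub> g"
  shows "f = g"
proof -
  have t: "t \<in> Obj C" using assms Homs_obj by blast
  have "into_dsum C I x t (\<lambda>i. dsum_prj C I x i \<bullet>\<^bsub>C\<^esub> f) = into_dsum C I x t (\<lambda>i. dsum_prj C I x i \<bullet>\<^bsub>C\<^esub> g)"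
    unfolding into_dsum_def
    by (rule finsum_eqI) (use t assms dsum_obj dsum_prj_hom dsum_inj_hom in \<open>auto intro: cmp_hom\<close>)
  then show ?thesis using into_dsum_prj assms by metis
qed

lemma from_dsum_hom:
  assumes "t \<in> Obj C" "\<And>i. i \<in> I \<Longrightarrow> f i \<in> Homs C (x i) t"
  shows "from_dsum C I x t f \<in> Homs C (dsum C I x) t"
  unfolding from_dsum_def
  by (rule finsum_hom) (use assms dsum_obj dsum_prj_hom in \<open>auto intro: cmp_hom\<close>)

lemma from_dsum_inj:
  assumes "t \<in> Obj C" "\<And>i. i \<in> I \<Longrightarrow> f i \<in> Homs C (x i) t" "j \<in> I"
  shows "from_dsum C I x t f \<bullet>\<^bsub>C\<^esub> dsum_inj C I x j = f j"
proof -
  let ?s = "dsum C I x"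
  have "from_dsum C I x t f \<bullet>\<^bsub>C\<^esub> dsum_inj C I x j
     = finsum (H (x j) t) (\<lambda>i. (f i \<bullet>\<^bsub>C\<^esub> dsum_prj C I x i) \<bullet>\<^bsub>C\<^esub> dsum_inj C I x j) I"
    unfolding from_dsum_def
    by (rule cmp_finsum_left[of _ _ ?s]) (use assms dsum_prj_hom dsum_inj_hom in \<open>auto intro: cmp_hom\<close>)
  also have "\<dots> = finsum (H (x j) t) (\<lambda>i. if i = j then f j else Zer C (x j) t) I"
  proof (rule finsum_eqI)
    fix i assume i: "i \<in> I"
    show "(f i \<bullet>\<^bsub>C\<^esub> dsum_prj C I x i) \<bullet>\<^bsub>C\<^esub> dsum_inj C I x j = (if i = j then f j else Zer C (x j) t)"
      using cmp_assoc[OF dsum_inj_hom[OF assms(3)] dsum_prj_hom[OF i] assms(2)[OF i]]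
        dsum_prj_inj[OF assms(3) i] cmp_ide[OF assms(2)[OF i]] cmp_zero_right[OF assms(2)[OF i]] ob[OF assms(3)]
      by auto
  qed (use assms ob Zer_hom in auto)
  also have "\<dots> = f j" 
    using finsum_single[OF fin assms(3), of "\<lambda>i. if i = j then f j else Zer C (x j) t" "x j" t] assms by auto
  finally show ?thesis .
qed

lemma from_dsum_of_inj:
  assumes "f \<in> Homs C (dsum C I x) t"
  shows "from_dsum C I x t (\<lambda>i. f \<bullet>\<^bsub>C\<^esub> dsum_inj C I x i) = f"
proof -
  let ?s = "dsum C I x"
  have t: "t \<in> Obj C" using assms Homs_obj by blast
  have "from_dsum C I x t (\<lambda>i. f \<bullet>\<^bsub>C\<^esub> dsum_inj C I x i)
      = finsum (H ?s t) (\<lambda>i. f \<bullet>\<^bsub>C\<^esub> (dsum_inj C I x i \<bullet>\<^bsub>C\<^esub> dsum_prj C I x i)) I"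
    unfolding from_dsum_def
    by (rule finsum_eqI)
       (use t dsum_obj dsum_prj_hom dsum_inj_hom assms in \<open>force simp: Homs_def arr_simps\<close>)+
  also have "\<dots> = f \<bullet>\<^bsub>C\<^esub> finsum (H ?s ?s) (\<lambda>i. dsum_inj C I x i \<bullet>\<^bsub>C\<^esub> dsum_prj C I x i) I"
    by (rule cmp_finsum_right[symmetric, OF assms dsum_obj])
       (use dsum_prj_hom dsum_inj_hom in \<open>auto intro: cmp_hom\<close>)
  finally show ?thesis using dsum_sum cmp_ide[OF assms] by simp
qed

lemma dsum_eqI_inj:
  assumes "f \<in> Homs C (dsum C I x) t" "g \<in> Homs C (dsum C I x) t"
    "\<And>i. i \<in> I \<Longrightarrow> f \<bullet>\<^bsub>C\<^esub> dsum_inj C I x i = g \<bullet>\<^bsub>C\<^esub> dsum_inj C I x i"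
  shows "f = g"
proof -
  have t: "t \<in> Obj C" using assms Homs_obj by blast
  have "from_dsum C I x t (\<lambda>i. f \<bullet>\<^bsub>C\<^esub> dsum_inj C I x i) = from_dsum C I x t (\<lambda>i. g \<bullet>\<^bsub>C\<^esub> dsum_inj C I x i)"
    unfolding from_dsum_def
    by (rule finsum_eqI)
       (use t assms dsum_obj in \<open>auto intro!: cmp_hom[OF dsum_prj_hom] cmp_hom[OF dsum_inj_hom]\<close>)
  then show ?thesis using from_dsum_of_inj assms by metis
qed

lemma from_dsum_into_dsum:
  assumes "t \<in> Obj C" "\<And>i. i \<in> I \<Longrightarrow> f i \<in> Homs C (x i) t"
    "s \<in> Obj C" "\<And>i. i \<in> I \<Longrightarrow> g i \<in> Homs C s (x i)"
  shows "from_dsum C I x t f \<bullet>\<^bsub>C\<^esub> into_dsum C I x s g = finsum (H s t) (\<lambda>i. f i \<bullet>\<^bsub>C\<^esub> g i) I"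
proof -
  have "from_dsum C I x t f \<bullet>\<^bsub>C\<^esub> into_dsum C I x s g
      = finsum (H s t) (\<lambda>i. (f i \<bullet>\<^bsub>C\<^esub> dsum_prj C I x i) \<bullet>\<^bsub>C\<^esub> into_dsum C I x s g) I"
    unfolding from_dsum_def
    by (rule cmp_finsum_left)
       (use assms into_dsum_hom in \<open>auto intro!: cmp_hom[OF dsum_prj_hom]\<close>)
  also have "\<dots> = finsum (H s t) (\<lambda>i. f i \<bullet>\<^bsub>C\<^esub> g i) I"
  proof (rule finsum_eqI)
    fix i assume i: "i \<in> I"
    have "(f i \<bullet>\<^bsub>C\<^esub> dsum_prj C I x i) \<bullet>\<^bsub>C\<^esub> into_dsum C I x s g
        = f i \<bullet>\<^bsub>C\<^esub> (dsum_prj C I x i \<bullet>\<^bsub>C\<^esub> into_dsum C I x s g)"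
      by (rule cmp_assoc) (use assms into_dsum_hom dsum_prj_hom i in auto)
    then show "(f i \<bullet>\<^bsub>C\<^esub> dsum_prj C I x i) \<bullet>\<^bsub>C\<^esub> into_dsum C I x s g = f i \<bullet>\<^bsub>C\<^esub> g i"
      using prj_into_dsum[OF assms(3,4) i] by simp
  qed (use assms in \<open>auto intro: cmp_hom\<close>)
  finally show ?thesis .
qed

end

lemma dsum_map_prj:
  assumes "finite I" "\<And>i. i \<in> I \<Longrightarrow> f i \<in> Homs C (x i) (y i)"
  shows "dsum_map C I x y f \<in> Homs C (dsum C I x) (dsum C I y)"
    and "j \<in> I \<Longrightarrow> dsum_prj C I y j \<bullet>\<^bsub>C\<^esub> dsum_map C I x y f = f j \<bullet>\<^bsub>C\<^esub> dsum_prj C I x j"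
proof -
  have xo: "x i \<in> Obj C" and yo: "y i \<in> Obj C" if "i \<in> I" for i using assms that Homs_obj by blast+
  have m: "f i \<bullet>\<^bsub>C\<^esub> dsum_prj C I x i \<in> Homs C (dsum C I x) (y i)" if "i \<in> I" for i
    using dsum_prj_hom[where x=x, OF assms(1) xo that] assms(2)[OF that] by (rule cmp_hom)
  note xO = dsum_obj[where x=x, OF assms(1) xo]
  show "dsum_map C I x y f \<in> Homs C (dsum C I x) (dsum C I y)"
    unfolding dsum_map_def by (rule into_dsum_hom[where x=y, OF assms(1) yo xO m])
  show "dsum_prj C I y j \<bullet>\<^bsub>C\<^esub> dsum_map C I x y f = f j \<bullet>\<^bsub>C\<^esub> dsum_prj C I x j" if "j \<in> I"
    unfolding dsum_map_def by (rule prj_into_dsum[where x=y, OF assms(1) yo xO m that])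
qed

text \<open>\<open>dsum_map\<close> is built from projections. Testing both sides against each
  projection gives its values on the inclusions, where only the diagonal term survives.\<close>

lemma dsum_map_inj:
  assumes "finite I" "\<And>i. i \<in> I \<Longrightarrow> f i \<in> Homs C (x i) (y i)" "j \<in> I"
  shows "dsum_map C I x y f \<bullet>\<^bsub>C\<^esub> dsum_inj C I x j = dsum_inj C I y j \<bullet>\<^bsub>C\<^esub> f j"
proof -
  have xo: "x i \<in> Obj C" and yo: "y i \<in> Obj C" if "i \<in> I" for i using assms that Homs_obj by blast+
  have m: "dsum_map C I x y f \<in> Homs C (dsum C I x) (dsum C I y)"
    by (rule dsum_map_prj(1)[OF assms(1,2)])
  have m2: "dsum_prj C I y k \<bullet>\<^bsub>C\<^esub> dsum_map C I x y f = f k \<bullet>\<^bsub>C\<^esub> dsum_prj C I x k" if "k \<in> I" for k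
    by (rule dsum_map_prj(2)[OF assms(1,2) that])
  have ix: "dsum_inj C I x i \<in> Homs C (x i) (dsum C I x)" if "i \<in> I" for i
    by (rule dsum_inj_hom[where x=x, OF assms(1) xo that])
  have iy: "dsum_inj C I y i \<in> Homs C (y i) (dsum C I y)" if "i \<in> I" for i
    by (rule dsum_inj_hom[where x=y, OF assms(1) yo that])
  have px: "dsum_prj C I x i \<in> Homs C (dsum C I x) (x i)" if "i \<in> I" for i
    by (rule dsum_prj_hom[where x=x, OF assms(1) xo that])
  have py: "dsum_prj C I y i \<in> Homs C (dsum C I y) (y i)" if "i \<in> I" for i
    by (rule dsum_prj_hom[where x=y, OF assms(1) yo that])
  show ?thesis
  proof (rule dsum_eqI_prj[where x=y, OF assms(1) yo])
    fix k assume k: "k \<in> I"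
    have "dsum_prj C I y k \<bullet>\<^bsub>C\<^esub> dsum_map C I x y f \<bullet>\<^bsub>C\<^esub> dsum_inj C I x j
        = (f k \<bullet>\<^bsub>C\<^esub> dsum_prj C I x k) \<bullet>\<^bsub>C\<^esub> dsum_inj C I x j"
      using cmp_assoc[OF ix[OF assms(3)] m py[OF k]] m2[OF k] by simp
    also have "\<dots> = f k \<bullet>\<^bsub>C\<^esub> (if j = k then Ide C (x j) else Zer C (x j) (x k))"
      using cmp_assoc[OF ix[OF assms(3)] px[OF k] assms(2)[OF k]] 
        dsum_prj_inj[where x=x, OF assms(1) xo assms(3) k, simplified] by simp
    also have "\<dots> = (if j = k then Ide C (y j) else Zer C (y j) (y k)) \<bullet>\<^bsub>C\<^esub> f j"
      using assms(2)[OF k] assms(2)[OF assms(3)] xo[OF assms(3)] yo[OF k]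
      by (auto simp: Homs_def arr_simps)
    also have "\<dots> = dsum_prj C I y k \<bullet>\<^bsub>C\<^esub> dsum_inj C I y j \<bullet>\<^bsub>C\<^esub> f j"
      using cmp_assoc[OF assms(2)[OF assms(3)] iy[OF assms(3)] py[OF k]]
        dsum_prj_inj[where x=y, OF assms(1) yo assms(3) k, simplified] by simp
    finally show "dsum_prj C I y k \<bullet>\<^bsub>C\<^esub> dsum_map C I x y f \<bullet>\<^bsub>C\<^esub> dsum_inj C I x j =
       dsum_prj C I y k \<bullet>\<^bsub>C\<^esub> dsum_inj C I y j \<bullet>\<^bsub>C\<^esub> f j" .
  qed (use cmp_hom[OF ix[OF assms(3)] m] cmp_hom[OF assms(2)[OF assms(3)] iy[OF assms(3)]] in auto)
qed

end

section \<open>Monotone maps\<close>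

lemma Delta_iff:
  "f \<in> Delta m n \<longleftrightarrow> f \<in> extensional {..m} \<and> (\<forall>x\<le>m. f x \<le> n) \<and> (\<forall>x y. x \<le> y \<and> y \<le> m \<longrightarrow> f x \<le> f y)"
  by (force simp: Delta_def PiE_iff mono_on_def)

lemma restrict_Delta:
  "(\<And>x. x \<le> m \<Longrightarrow> f x \<le> n) \<Longrightarrow> (\<And>x y. x \<le> y \<Longrightarrow> y \<le> m \<Longrightarrow> f x \<le> f y) \<Longrightarrow> restrict f {..m} \<in> Delta m n"
  by (auto simp: Delta_iff)

lemma Delta_le: "f \<in> Delta m n \<Longrightarrow> x \<le> m \<Longrightarrow> f x \<le> n"
  by (simp add: Delta_iff)

lemma Delta_mono: "f \<in> Delta m n \<Longrightarrow> x \<le> y \<Longrightarrow> y \<le> m \<Longrightarrow> f x \<le> f y"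
  by (simp add: Delta_iff)

lemma Delta_eqI: "f \<in> Delta m n \<Longrightarrow> g \<in> Delta m n' \<Longrightarrow> (\<And>x. x \<le> m \<Longrightarrow> f x = g x) \<Longrightarrow> f = g"
  by (auto simp: Delta_iff intro: extensionalityI)

lemma Delta_compose: "f \<in> Delta l m \<Longrightarrow> g \<in> Delta m n \<Longrightarrow> compose {..l} g f \<in> Delta l n"
  by (auto simp: Delta_iff compose_def)

lemma Delta_id: "restrict id {..n} \<in> Delta n n"
  by (rule restrict_Delta) auto

lemma finite_Delta: "finite (Delta m n)"
  unfolding Delta_def by (rule finite_subset[of _ "{..m} \<rightarrow>\<^sub>E {..n}"]) (auto intro: finite_PiE)

lemma Delta_compose_id: "f \<in> Delta m n \<Longrightarrow> compose {..m} (restrict id {..n}) f = f"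
  "f \<in> Delta m n \<Longrightarrow> compose {..m} f (restrict id {..m}) = f"
  by (rule Delta_eqI[OF Delta_compose[OF _ Delta_id]] Delta_eqI[OF Delta_compose[OF Delta_id]];
      auto simp: compose_def Delta_iff)+

lemma compose_Delta_assoc:
  "f \<in> Delta k l \<Longrightarrow> compose {..k} (compose {..l} h g) f = compose {..k} h (compose {..k} g f)"
  by (auto simp: compose_def Delta_iff intro!: restrict_ext)

lemma Delta_surjD: "f \<in> Delta_surj m n \<Longrightarrow> f \<in> Delta m n" "f \<in> Delta_surj m n \<Longrightarrow> f ` {..m} = {..n}"
  by (auto simp: Delta_surj_def)

lemma Delta_inj_le: "f \<in> Delta m n \<Longrightarrow> inj_on f {..m} \<Longrightarrow> m \<le> n"
  using card_inj_on_le[of f "{..m}" "{..n}"] by (auto simp: Delta_iff)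

lemma Delta_surj_le: "f \<in> Delta_surj m n \<Longrightarrow> n \<le> m"
  using card_image_le[of "{..m}" f] by (auto simp: Delta_surj_def)

lemma Delta_strict:
  assumes "f \<in> Delta m n" "inj_on f {..m}" "x < y" "y \<le> m"
  shows "f x < f y"
  using Delta_mono[OF assms(1), of x y] inj_onD[OF assms(2), of x y] assms by (force simp: le_less)

text \<open>A strictly increasing self-map of [n] is squeezed: induction from 0 upwards gives x
  \<le> f x, and induction from n downwards gives f x \<le> x.\<close>

lemma Delta_inj_id:
  assumes "f \<in> Delta n n" "inj_on f {..n}"
  shows "f = restrict id {..n}"
proof (rule Delta_eqI[OF assms(1) Delta_id])
  have ge: "x \<le> f x" if "x \<le> n" for x
    using that
  proof (induction x)
    case (Suc x)
    then show ?case using Delta_strict[OF assms, of x "Suc x"] by auto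
  qed simp
  have le: "f (n - k) \<le> n - k" if "k \<le> n" for k
    using that
  proof (induction k)
    case 0 then show ?case using assms by (auto simp: Delta_iff)
  next
    case (Suc k)
    then have "f (n - Suc k) < f (n - k)" by (intro Delta_strict[OF assms]) auto
    then show ?case using Suc by auto
  qed
  show "f x = restrict id {..n} x" if "x \<le> n" for x
    using ge[OF that] le[of "n - x"] that by simp
qed

lemma coface_Delta: "coface n k \<in> Delta n (Suc n)"
  unfolding coface_def by (rule restrict_Delta) auto

definition codeg :: "nat \<Rightarrow> nat \<Rightarrow> nat \<Rightarrow> nat" where
  "codeg n a = (\<lambda>x\<in>{..Suc n}. if x \<le> a then x else x - 1)"

lemma codeg_Delta: "a \<le> n \<Longrightarrow> codeg n a \<in> Delta_surj (Suc n) n"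
proof -
  assume a: "a \<le> n"
  have d: "codeg n a \<in> Delta (Suc n) n" unfolding codeg_def by (rule restrict_Delta) (use a in auto)
  moreover have "y \<in> codeg n a ` {..Suc n}" if "y \<le> n" for y
    by (rule image_eqI[of _ _ "if y \<le> a then y else Suc y"]) (use that a in \<open>auto simp: codeg_def\<close>)
  ultimately show ?thesis by (auto simp: Delta_surj_def Delta_iff)
qed

text \<open>A monotone map with equal values at the ends of an interval is constant on it. So both
  maps collapse the first step of that interval, and they do it at the same place.\<close>

lemma not_inj_adjacent:
  assumes "f \<in> Delta n m" "g \<in> Delta n m'" "x < y" "y \<le> n" "f x = f y" "g x = g y"
  shows "\<exists>a<n. f a = f (Suc a) \<and> g a = g (Suc a)"
proof (intro exI[of _ x] conjI)
  show "x < n" using assms by auto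
  show "f x = f (Suc x)" "g x = g (Suc x)"
    using assms Delta_mono[OF assms(1), of x "Suc x"] Delta_mono[OF assms(1), of "Suc x" y]
      Delta_mono[OF assms(2), of x "Suc x"] Delta_mono[OF assms(2), of "Suc x" y] by auto
qed

lemma not_inj_adjacent1:
  assumes "f \<in> Delta n m" "\<not> inj_on f {..n}"
  shows "\<exists>a<n. f a = f (Suc a)"
proof -
  obtain x y where "x < y" "y \<le> n" "f x = f y"
    using assms(2) by (auto simp: inj_on_def) (metis linorder_neqE_nat)
  then show ?thesis using not_inj_adjacent[OF assms(1) assms(1)] by blast
qed

text \<open>The coface omitting \<open>Suc a\<close> is a section of the degeneracy
  \<open>codeg n a\<close>, and f does not notice when \<open>Suc a\<close> is replaced by
  a.\<close>

lemma factor_codeg: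
  assumes "f \<in> Delta (Suc n) m" "a \<le> n" "f a = f (Suc a)"
  shows "f = compose {..Suc n} (compose {..n} f (coface n (Suc a))) (codeg n a)"
proof (rule Delta_eqI[OF assms(1)])
  show "compose {..Suc n} (compose {..n} f (coface n (Suc a))) (codeg n a) \<in> Delta (Suc n) m"
    by (rule Delta_compose[OF Delta_surjD(1)[OF codeg_Delta[OF assms(2)]] Delta_compose[OF coface_Delta assms(1)]])
  fix x assume "x \<le> Suc n"
  then show "f x = compose {..Suc n} (compose {..n} f (coface n (Suc a))) (codeg n a) x"
    using assms by (cases "x = Suc a") (auto simp: compose_def codeg_def coface_def)
qed

lemma factor_coface:
  assumes "g \<in> Delta m (Suc n)" "i \<le> Suc n" "i \<notin> g ` {..m}"
  shows "\<exists>h \<in> Delta m n. g = compose {..m} (coface n i) h"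
proof
  have ne: "g x \<noteq> i" if "x \<le> m" for x using assms(3) that by auto
  let ?h = "\<lambda>x\<in>{..m}. if g x < i then g x else g x - 1"
  show h: "?h \<in> Delta m n"
  proof (rule restrict_Delta)
    fix x assume x: "x \<le> m"
    show "(if g x < i then g x else g x - 1) \<le> n"
      using Delta_le[OF assms(1) x] ne[OF x] assms(2) by auto
  next
    fix x y assume "x \<le> y" "y \<le> m"
    then show "(if g x < i then g x else g x - 1) \<le> (if g y < i then g y else g y - 1)"
      using Delta_mono[OF assms(1), of x y] by auto
  qed
  show "g = compose {..m} (coface n i) ?h"
  proof (rule Delta_eqI[OF assms(1) Delta_compose[OF h coface_Delta]])
    fix x assume x: "x \<le> m"
    have "g x \<le> Suc n" using Delta_le[OF assms(1) x] .
    then show "g x = compose {..m} (coface n i) ?h x"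
      using x ne[OF x] assms(2) by (auto simp: compose_def coface_def)
  qed
qed

text \<open>For neighbours i and j this is the idempotent endomorphism of [n] that omits i and takes
  the value j twice. The normalization is a product of factors
  \<open>1 - act n n (mv n i j)\<close>.\<close>

definition mv :: "nat \<Rightarrow> nat \<Rightarrow> nat \<Rightarrow> nat \<Rightarrow> nat" where
  "mv n i j = (\<lambda>x\<in>{..n}. if x = i then j else x)"

lemma mv_Delta: "i \<le> n \<Longrightarrow> j \<le> n \<Longrightarrow> Suc j = i \<or> j = Suc i \<Longrightarrow> mv n i j \<in> Delta n n"
  unfolding mv_def by (rule restrict_Delta) auto

lemma mv_not_inj: "i \<le> n \<Longrightarrow> j \<le> n \<Longrightarrow> Suc j = i \<or> j = Suc i \<Longrightarrow> \<not> inj_on (mv n i j) {..n}"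
  using inj_onD[of "mv n i j" "{..n}" i j] by (auto simp: mv_def)

section \<open>Normalization of simplicial objects\<close>

lemma simplicial_morD:
  assumes "simplicial_mor C A B \<phi>"
  shows "\<phi> n \<in> Homs C (sob A n) (sob B n)"
    "f \<in> Delta m n \<Longrightarrow> \<phi> m \<bullet>\<^bsub>C\<^esub> sact A m n f = sact B m n f \<bullet>\<^bsub>C\<^esub> \<phi> n"
  using assms by (auto simp: simplicial_mor_def)

text \<open>Vertex i is to be moved to its neighbour \<open>\<tau> i\<close>. The condition on the
  tail ensures that this move never restores a vertex that the tail has dealt with;
  \<open>norm_missing\<close> rests on it. The lists in use are 1, ..., n with the predecessor, and
  l - 1, ..., 0 with the successor.\<close>

fun admissible :: "nat \<Rightarrow> (nat \<Rightarrow> nat) \<Rightarrow> nat list \<Rightarrow> bool" where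
  "admissible n \<tau> [] \<longleftrightarrow> True"
| "admissible n \<tau> (i # is) \<longleftrightarrow> i \<le> n \<and> \<tau> i \<le> n \<and> (Suc (\<tau> i) = i \<or> \<tau> i = Suc i) \<and> \<tau> i \<notin> set is \<and>
     admissible n \<tau> is"

context abelian_category
begin

text \<open>The product of the idempotents \<open>1 - act n n (mv n i (\<tau> i))\<close>, with the
  head of the list as leftmost factor. The recursion lets every property below be proved by adding
  one factor.\<close>

fun norm_arr :: "('a, 'b) simplicial \<Rightarrow> nat \<Rightarrow> (nat \<Rightarrow> nat) \<Rightarrow> nat list \<Rightarrow> 'b" where
  "norm_arr A n \<tau> [] = Ide C (sob A n)"
| "norm_arr A n \<tau> (i # is) =
     minus_arr (norm_arr A n \<tau> is) (sact A n n (mv n i (\<tau> i)) \<bullet>\<^bsub>C\<^esub> norm_arr A n \<tau> is)"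

end

locale simplicial_obj = abelian_category C for C :: "('o, 'm) additive_data" +
  fixes A :: "('o, 'm) simplicial"
  assumes A: "simplicial_object C A"
begin

abbreviation act where "act \<equiv> sact A"

lemma sob_obj: "sob A n \<in> Obj C"
  using A by (simp add: simplicial_object_def)

lemma act_hom: "f \<in> Delta m n \<Longrightarrow> act m n f \<in> Homs C (sob A n) (sob A m)"
  using A by (simp add: simplicial_object_def)

lemma act_arr [simp]: 
  "f \<in> Delta m n \<Longrightarrow> act m n f \<in> Arr C"
  "f \<in> Delta m n \<Longrightarrow> Dom C (act m n f) = sob A n"
  "f \<in> Delta m n \<Longrightarrow> Cod C (act m n f) = sob A m"
  using act_hom[of f m n] by (auto simp: Homs_def)

lemma act_id: "act n n (restrict id {..n}) = Ide C (sob A n)"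
  using A by (simp add: simplicial_object_def)

lemma act_compose:
  "f \<in> Delta l m \<Longrightarrow> g \<in> Delta m n \<Longrightarrow> act l n (compose {..l} g f) = act l m f \<bullet>\<^bsub>C\<^esub> act m n g"
  using A by (simp add: simplicial_object_def)

lemma act_act:
  assumes "f \<in> Delta l m" "g \<in> Delta m n" "t \<in> Homs C T (sob A n)"
  shows "act l m f \<bullet>\<^bsub>C\<^esub> act m n g \<bullet>\<^bsub>C\<^esub> t = act l n (compose {..l} g f) \<bullet>\<^bsub>C\<^esub> t"
  using assms by (simp add: act_compose Homs_def arr_simps)

lemma norm_hom: "admissible n \<tau> is \<Longrightarrow> norm_arr A n \<tau> is \<in> Homs C (sob A n) (sob A n)"
proof (induction "is")
  case Nil then show ?case by (simp add: ide_hom sob_obj)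
next
  case (Cons i "is")
  then show ?case by (auto intro!: minus_hom intro: cmp_hom act_hom mv_Delta)
qed

lemma norm_Cons:
  assumes "admissible n \<tau> (i # is)" "t \<in> Homs C T (sob A n)"
  shows "norm_arr A n \<tau> (i # is) \<bullet>\<^bsub>C\<^esub> t = 
    minus_arr (norm_arr A n \<tau> is \<bullet>\<^bsub>C\<^esub> t) (act n n (mv n i (\<tau> i)) \<bullet>\<^bsub>C\<^esub> norm_arr A n \<tau> is \<bullet>\<^bsub>C\<^esub> t)"
  using norm_hom[of n \<tau> "is"] assms mv_Delta[of i n "\<tau> i"] by (simp add: Homs_def arr_simps)

text \<open>If g omits the head i, then moving i does not change g, and the leftmost factor gives 0.
  Otherwise the omitted vertex j belongs to the tail; it is still omitted after i has been moved to
  \<open>\<tau> i\<close>, and both terms of the difference vanish by induction.\<close>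

lemma norm_missing:
  assumes "admissible n \<tau> is" "g \<in> Delta m n" "j \<in> set is" "j \<notin> g ` {..m}" "t \<in> Homs C T (sob A n)"
  shows "act m n g \<bullet>\<^bsub>C\<^esub> norm_arr A n \<tau> is \<bullet>\<^bsub>C\<^esub> t = Zer C T (sob A m)"
  using assms
proof (induction "is" arbitrary: g j)
  case (Cons i "is")
  let ?N = "norm_arr A n \<tau> is" and ?f = "mv n i (\<tau> i)"
  have adm: "admissible n \<tau> is" and f: "?f \<in> Delta n n" using Cons.prems mv_Delta[of i n "\<tau> i"] by auto
  note g = Cons.prems(2) and t = Cons.prems(5)
  have N: "?N \<bullet>\<^bsub>C\<^esub> t \<in> Homs C T (sob A n)" using norm_hom[OF adm] cmp_hom t by blast
  have gN: "act m n g \<bullet>\<^bsub>C\<^esub> ?N \<bullet>\<^bsub>C\<^esub> t \<in> Homs C T (sob A m)" using N act_hom g cmp_hom by blast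
  have fg: "compose {..m} ?f g \<in> Delta m n" using g f by (rule Delta_compose)
  have *: "act m n g \<bullet>\<^bsub>C\<^esub> norm_arr A n \<tau> (i # is) \<bullet>\<^bsub>C\<^esub> t
      = minus_arr (act m n g \<bullet>\<^bsub>C\<^esub> ?N \<bullet>\<^bsub>C\<^esub> t) (act m n (compose {..m} ?f g) \<bullet>\<^bsub>C\<^esub> ?N \<bullet>\<^bsub>C\<^esub> t)"
    using norm_Cons[OF Cons.prems(1) t] cmp_minus_right[OF N _ act_hom[OF g], of "act n n ?f \<bullet>\<^bsub>C\<^esub> ?N \<bullet>\<^bsub>C\<^esub> t"]
      cmp_hom[OF N act_hom[OF f]] act_act[OF g f N] by simp
  show ?case
  proof (cases "i \<in> g ` {..m}")
    case False
    then have "compose {..m} ?f g = g"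
      by (intro Delta_eqI[OF fg g]) (use Delta_le[OF g] in \<open>auto simp: compose_def mv_def\<close>)
    then show ?thesis using * gN minus_self by simp
  next
    case True
    then have j: "j \<in> set is" using Cons.prems by auto
    have nj: "j \<notin> compose {..m} ?f g ` {..m}"
      using Cons.prems j Delta_le[OF g] by (auto simp: compose_def mv_def split: if_splits)
    show ?thesis
      using * Cons.IH[OF adm g j Cons.prems(4) t] Cons.IH[OF adm fg j nj t]
        minus_self[OF Zer_hom[of T "sob A m"]] Homs_obj[OF gN] by simp
  qed
qed simp

text \<open>An arrow that kills the degenerate endomorphisms sees every factor of the product as the
  identity.\<close>

lemma norm_absorb:
  assumes "admissible n \<tau> is" "p \<in> Homs C (sob A n) b"
    "\<And>f. f \<in> Delta n n \<Longrightarrow> \<not> inj_on f {..n} \<Longrightarrow> p \<bullet>\<^bsub>C\<^esub> act n n f = Zer C (sob A n) b"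
  shows "p \<bullet>\<^bsub>C\<^esub> norm_arr A n \<tau> is = p"
  using assms(1)
proof (induction "is")
  case Nil then show ?case using assms(2) by (simp add: cmp_ide)
next
  case (Cons i "is")
  let ?f = "mv n i (\<tau> i)"
  have f: "?f \<in> Delta n n" "\<not> inj_on ?f {..n}" using Cons mv_Delta mv_not_inj by auto
  have N: "norm_arr A n \<tau> is \<in> Homs C (sob A n) (sob A n)" using norm_hom Cons by auto
  have "p \<bullet>\<^bsub>C\<^esub> act n n ?f \<bullet>\<^bsub>C\<^esub> norm_arr A n \<tau> is = Zer C (sob A n) b"
    using cmp_assoc[OF N act_hom[OF f(1)] assms(2)] assms(3)[OF f] cmp_zero_left[OF N, of b] Homs_obj[OF assms(2)]
    by simp
  then show ?case
    using Cons cmp_minus_right[OF N cmp_hom[OF N act_hom[OF f(1)]] assms(2)] minus_zero[OF assms(2)] by simp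
qed

lemma norm_fix:
  assumes "admissible n \<tau> is" "t \<in> Homs C T (sob A n)"
    "\<And>i. i \<in> set is \<Longrightarrow> act n n (mv n i (\<tau> i)) \<bullet>\<^bsub>C\<^esub> t = Zer C T (sob A n)"
  shows "norm_arr A n \<tau> is \<bullet>\<^bsub>C\<^esub> t = t"
  using assms(1,3)
proof (induction "is")
  case Nil then show ?case using assms(2) by (simp add: ide_cmp)
next
  case (Cons i "is")
  then show ?case using norm_Cons[OF Cons.prems(1) assms(2)] minus_zero[OF assms(2)] by simp
qed

text \<open>Let f collapse i onto i - 1, and g collapse some j > i onto j - 1. The identity f g f =
  f g of monotone maps shows that the factor at j preserves elements fixed by f.\<close>

lemma norm_collapse_stable:
  assumes "admissible n (\<lambda>i. i - 1) is" "\<And>j. j \<in> set is \<Longrightarrow> i < j" "0 < i" "i \<le> n"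
    "t \<in> Homs C T (sob A n)" "act n n (mv n i (i - 1)) \<bullet>\<^bsub>C\<^esub> t = t"
  shows "act n n (mv n i (i - 1)) \<bullet>\<^bsub>C\<^esub> norm_arr A n (\<lambda>i. i - 1) is \<bullet>\<^bsub>C\<^esub> t
     = norm_arr A n (\<lambda>i. i - 1) is \<bullet>\<^bsub>C\<^esub> t"
  using assms(1,2)
proof (induction "is")
  case Nil then show ?case using assms by (simp add: ide_cmp)
next
  case (Cons j "is")
  let ?N = "norm_arr A n (\<lambda>i. i - 1) is" and ?f = "mv n i (i - 1)" and ?g = "mv n j (j - 1)"
  have f: "?f \<in> Delta n n" and g: "?g \<in> Delta n n" and adm: "admissible n (\<lambda>i. i - 1) is" and ij: "i < j"
    using Cons.prems assms(3,4) by (auto intro!: mv_Delta)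
  have IH: "act n n ?f \<bullet>\<^bsub>C\<^esub> ?N \<bullet>\<^bsub>C\<^esub> t = ?N \<bullet>\<^bsub>C\<^esub> t" using Cons adm by auto
  have N: "?N \<bullet>\<^bsub>C\<^esub> t \<in> Homs C T (sob A n)" using norm_hom[OF adm] cmp_hom assms(5) by blast
  have gN: "act n n ?g \<bullet>\<^bsub>C\<^esub> ?N \<bullet>\<^bsub>C\<^esub> t \<in> Homs C T (sob A n)" using N act_hom[OF g] cmp_hom by blast
  have fgf: "compose {..n} (compose {..n} ?f ?g) ?f = compose {..n} ?f ?g"
    by (rule Delta_eqI[of _ n n _ n]) (use f g ij assms(3) in \<open>auto intro!: Delta_compose\<close>, auto simp: compose_def mv_def)
  have "act n n ?f \<bullet>\<^bsub>C\<^esub> act n n ?g \<bullet>\<^bsub>C\<^esub> ?N \<bullet>\<^bsub>C\<^esub> t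
      = act n n ?f \<bullet>\<^bsub>C\<^esub> act n n (compose {..n} ?f ?g) \<bullet>\<^bsub>C\<^esub> ?N \<bullet>\<^bsub>C\<^esub> t"
    using act_act[OF g f N] IH by simp
  also have "\<dots> = act n n (compose {..n} ?f ?g) \<bullet>\<^bsub>C\<^esub> ?N \<bullet>\<^bsub>C\<^esub> t"
    using act_act[OF f Delta_compose[OF g f] N] fgf by simp
  also have "\<dots> = act n n ?g \<bullet>\<^bsub>C\<^esub> ?N \<bullet>\<^bsub>C\<^esub> t" using act_act[OF g f N] IH by simp
  finally show ?case
    using norm_Cons[OF Cons.prems(1) assms(5)] cmp_minus_right[OF N gN act_hom[OF f]] IH by simp
qed

text \<open>The arrow \<open>act n m s\<close> is fixed by the collapse at i. The list increases, so
  the factors to the right of the one at i belong to larger vertices and keep it fixed; the factor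
  at i then annihilates it.\<close>

lemma norm_degenerate:
  assumes "admissible n (\<lambda>i. i - 1) is" "sorted_wrt (<) is" "i \<in> set is" "0 < i"
    "s \<in> Delta n m" "s (i - 1) = s i"
  shows "norm_arr A n (\<lambda>i. i - 1) is \<bullet>\<^bsub>C\<^esub> act n m s = Zer C (sob A m) (sob A n)"
  using assms(1-3)
proof (induction "is")
  case (Cons j "is")
  let ?N = "norm_arr A n (\<lambda>i. i - 1) is"
  have adm: "admissible n (\<lambda>i. i - 1) is" using Cons.prems by simp
  have j: "mv n j (j - 1) \<in> Delta n n" using Cons.prems by (auto intro!: mv_Delta)
  note s = act_hom[OF assms(5)]
  show ?case
  proof (cases "i \<in> set is")
    case True
    then have "?N \<bullet>\<^bsub>C\<^esub> act n m s = Zer C (sob A m) (sob A n)" using Cons adm by auto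
    then show ?thesis
      using norm_Cons[OF Cons.prems(1) s] cmp_zero_right[OF act_hom[OF j] sob_obj]
        minus_self Zer_hom sob_obj by simp
  next
    case False
    then have ij: "i = j" using Cons.prems by auto
    have "compose {..n} s (mv n i (i - 1)) = s"
      by (rule Delta_eqI[OF Delta_compose[OF j[folded ij] assms(5)] assms(5)])
         (use assms(6) in \<open>auto simp: compose_def mv_def\<close>)
    then have "act n n (mv n i (i - 1)) \<bullet>\<^bsub>C\<^esub> act n m s = act n m s"
      using act_compose[OF j assms(5)] ij by simp
    then have "act n n (mv n i (i - 1)) \<bullet>\<^bsub>C\<^esub> ?N \<bullet>\<^bsub>C\<^esub> act n m s = ?N \<bullet>\<^bsub>C\<^esub> act n m s"
      using Cons.prems ij by (intro norm_collapse_stable[OF adm _ assms(4) _ s]) auto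
    then show ?thesis
      using norm_Cons[OF Cons.prems(1) s] ij minus_self cmp_hom[OF s norm_hom[OF adm]] by simp
  qed
qed simp

lemma norm_natural:
  assumes "simplicial_object C B" "simplicial_mor C A B \<phi>" "admissible n \<tau> is"
  shows "\<phi> n \<bullet>\<^bsub>C\<^esub> norm_arr A n \<tau> is = norm_arr B n \<tau> is \<bullet>\<^bsub>C\<^esub> \<phi> n"
  using assms(3)
proof (induction "is")
  case Nil
  interpret B: simplicial_obj C B by unfold_locales (fact assms)
  show ?case using simplicial_morD(1)[OF assms(2), of n] by (simp add: cmp_ide ide_cmp)
next
  case (Cons i "is")
  interpret B: simplicial_obj C B by unfold_locales (fact assms)
  let ?f = "mv n i (\<tau> i)"
  have adm: "admissible n \<tau> is" and f: "?f \<in> Delta n n" using Cons.prems by (auto intro!: mv_Delta)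
  note \<phi> = simplicial_morD(1)[OF assms(2), of n]
  note N = norm_hom[OF adm] and NB = B.norm_hom[OF adm]
  have "\<phi> n \<bullet>\<^bsub>C\<^esub> act n n ?f \<bullet>\<^bsub>C\<^esub> norm_arr A n \<tau> is = (sact B n n ?f \<bullet>\<^bsub>C\<^esub> \<phi> n) \<bullet>\<^bsub>C\<^esub> norm_arr A n \<tau> is"
    using cmp_assoc[OF N act_hom[OF f] \<phi>] simplicial_morD(2)[OF assms(2) f] by simp
  also have "\<dots> = sact B n n ?f \<bullet>\<^bsub>C\<^esub> norm_arr B n \<tau> is \<bullet>\<^bsub>C\<^esub> \<phi> n"
    using cmp_assoc[OF N \<phi> B.act_hom[OF f]] Cons adm by simp
  finally show ?case
    using Cons adm cmp_minus_right[OF N cmp_hom[OF N act_hom[OF f]] \<phi>]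
      B.norm_Cons[OF Cons.prems \<phi>] by simp
qed

text \<open>Membership in a family \<open>P\<close> of subgroups closed under the simplicial operators can be tested
  on the normalization, because the two differ by elements that factor through proper faces.\<close>

lemma norm_closed:
  assumes adm: "admissible n \<tau> is" and t: "t \<in> Homs C T (sob A n)"
    and P_sub: "P \<subseteq> Homs C T (sob A n)"
    and P_add: "\<And>x y. x \<in> P \<Longrightarrow> y \<in> P \<Longrightarrow> Add C x y \<in> P"
    and P_minus: "\<And>x y. x \<in> P \<Longrightarrow> y \<in> P \<Longrightarrow> minus_arr x y \<in> P"
    and faces: "\<And>g. g \<in> Delta n n \<Longrightarrow> g ` {..n} \<noteq> {..n} \<Longrightarrow> act n n g \<bullet>\<^bsub>C\<^esub> t \<in> P"
    and norm: "norm_arr A n \<tau> is \<bullet>\<^bsub>C\<^esub> t \<in> P"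
  shows "t \<in> P"
proof -
  have f: "mv n i (\<tau> i) \<in> Delta n n" if "admissible n \<tau> (i # js)" for i js
    using that by (auto intro!: mv_Delta)
  \<comment> \<open>A factor subtracts from the term for g the term for g followed by a move that
    omits i. Neither map is onto, so partial normalizations have all their proper faces in
    P.\<close>
  have face: "act n n g \<bullet>\<^bsub>C\<^esub> norm_arr A n \<tau> js \<bullet>\<^bsub>C\<^esub> t \<in> P"
    if "admissible n \<tau> js" "g \<in> Delta n n" "g ` {..n} \<noteq> {..n}" for g js
    using that
  proof (induction js arbitrary: g)
    case Nil then show ?case using faces t by (simp add: ide_cmp)
  next
    case (Cons i js)
    let ?N = "norm_arr A n \<tau> js" and ?f = "mv n i (\<tau> i)"
    note f = f[OF Cons.prems(1)] and g = Cons.prems(2)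
    have adm: "admissible n \<tau> js" using Cons.prems by auto
    have N: "?N \<bullet>\<^bsub>C\<^esub> t \<in> Homs C T (sob A n)" using norm_hom[OF adm] cmp_hom t by blast
    have "i \<notin> compose {..n} ?f g ` {..n}"
      using Cons.prems Delta_le[OF g] by (auto simp: compose_def mv_def split: if_splits)
    then have "compose {..n} ?f g ` {..n} \<noteq> {..n}" using Cons.prems by auto
    then have "act n n (compose {..n} ?f g) \<bullet>\<^bsub>C\<^esub> ?N \<bullet>\<^bsub>C\<^esub> t \<in> P"
      using Cons.IH[OF adm Delta_compose[OF g f]] by auto
    moreover have "act n n g \<bullet>\<^bsub>C\<^esub> ?N \<bullet>\<^bsub>C\<^esub> t \<in> P" using Cons.IH[OF adm] Cons.prems by auto
    moreover have "act n n g \<bullet>\<^bsub>C\<^esub> norm_arr A n \<tau> (i # js) \<bullet>\<^bsub>C\<^esub> t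
        = minus_arr (act n n g \<bullet>\<^bsub>C\<^esub> ?N \<bullet>\<^bsub>C\<^esub> t) (act n n (compose {..n} ?f g) \<bullet>\<^bsub>C\<^esub> ?N \<bullet>\<^bsub>C\<^esub> t)"
      using norm_Cons[OF Cons.prems(1) t] cmp_minus_right[OF N cmp_hom[OF N act_hom[OF f]] act_hom[OF g]]
        act_act[OF g f N] by simp
    ultimately show ?case using P_minus by simp
  qed
  show ?thesis using adm norm
  proof (induction "is")
    case Nil then show ?case using t by (simp add: ide_cmp)
  next
    case (Cons i js)
    let ?N = "norm_arr A n \<tau> js" and ?f = "mv n i (\<tau> i)"
    note f = f[OF Cons.prems(1)]
    have adm: "admissible n \<tau> js" using Cons.prems by auto
    have N: "?N \<bullet>\<^bsub>C\<^esub> t \<in> Homs C T (sob A n)" using norm_hom[OF adm] cmp_hom t by blast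
    have fN: "act n n ?f \<bullet>\<^bsub>C\<^esub> ?N \<bullet>\<^bsub>C\<^esub> t \<in> P"
    proof (rule face[OF adm f])
      have "i \<notin> ?f ` {..n}" "i \<le> n" using Cons.prems by (auto simp: mv_def)
      then show "?f ` {..n} \<noteq> {..n}" by auto
    qed
    \<comment> \<open>One factor is undone: \<open>?N\<close> applied to t is the sum of its
      difference with the collapsed term, known to lie in P, and the collapsed term, which is a
      proper face.\<close>
    have "Add C (minus_arr (?N \<bullet>\<^bsub>C\<^esub> t) (act n n ?f \<bullet>\<^bsub>C\<^esub> ?N \<bullet>\<^bsub>C\<^esub> t)) (act n n ?f \<bullet>\<^bsub>C\<^esub> ?N \<bullet>\<^bsub>C\<^esub> t) \<in> P"
      by (rule P_add) (use fN Cons.prems norm_Cons[OF Cons.prems(1) t] in auto)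
    then have "?N \<bullet>\<^bsub>C\<^esub> t \<in> P" using minus_add_cancel[OF N] fN P_sub by auto
    then show ?case using Cons.IH adm by simp
  qed
qed

text \<open>The vertices 1, ..., n are collapsed onto their predecessors. This is the projector onto
  the Moore complex: its image consists of the elements whose faces omitting a positive vertex
  vanish, and its kernel is the degenerate part.\<close>

definition nrm :: "nat \<Rightarrow> 'm" where
  "nrm n = norm_arr A n (\<lambda>i. i - 1) [1..<Suc n]"

lemma admissible_up: "admissible n (\<lambda>i. i - 1) [1..<Suc n]"
proof -
  have "admissible n (\<lambda>i. i - 1) is" if "sorted_wrt (<) is" "set is \<subseteq> {1..n}" for "is"
    using that by (induction "is") auto
  from this[of "[1..<Suc n]"] show ?thesis by (simp del: upt_Suc add: atLeastLessThanSuc_atLeastAtMost)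
qed

lemma nrm_hom: "nrm n \<in> Homs C (sob A n) (sob A n)"
  unfolding nrm_def by (rule norm_hom[OF admissible_up])

lemma nrm_degenerate:
  assumes "s \<in> Delta n m" "\<not> inj_on s {..n}"
  shows "nrm n \<bullet>\<^bsub>C\<^esub> act n m s = Zer C (sob A m) (sob A n)"
proof -
  obtain a where "a < n" "s a = s (Suc a)" using not_inj_adjacent1[OF assms] by blast
  then show ?thesis unfolding nrm_def
    by (intro norm_degenerate[OF admissible_up _ _ _ assms(1), of "Suc a"]) (auto simp del: upt_Suc)
qed

lemma nrm_missing:
  assumes "g \<in> Delta m n" "j \<notin> g ` {..m}" "0 < j" "j \<le> n"
  shows "act m n g \<bullet>\<^bsub>C\<^esub> nrm n = Zer C (sob A n) (sob A m)"
proof -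
  have "j \<in> set [1..<Suc n]" using assms by auto
  from norm_missing[OF admissible_up assms(1) this assms(2) ide_hom[OF sob_obj]]
  show ?thesis using cmp_ide[OF nrm_hom[of n]] by (simp add: nrm_def del: upt_Suc)
qed

lemma nrm_fix:
  assumes "t \<in> Homs C T (sob A n)"
    "\<And>g j. g \<in> Delta n n \<Longrightarrow> 0 < j \<Longrightarrow> j \<le> n \<Longrightarrow> j \<notin> g ` {..n} \<Longrightarrow> act n n g \<bullet>\<^bsub>C\<^esub> t = Zer C T (sob A n)"
  shows "nrm n \<bullet>\<^bsub>C\<^esub> t = t"
  unfolding nrm_def
proof (rule norm_fix[OF admissible_up assms(1)])
  fix i assume "i \<in> set [1..<Suc n]"
  then have i: "0 < i" "i \<le> n" by auto
  show "act n n (mv n i (i - 1)) \<bullet>\<^bsub>C\<^esub> t = Zer C T (sob A n)"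
    by (rule assms(2)[OF mv_Delta i]) (use i in \<open>auto simp: mv_def\<close>)
qed

subsection \<open>The nondegenerate quotient splits\<close>

lemma nd_quotient: "is_quotient C (sob A n) (degeneracies A n) (nd_prj C A n)"
  unfolding nd_prj_def
proof (rule quotient_prj)
  have "degeneracies A n \<subseteq> (\<Union>m<n. (\<lambda>s. act n m s) ` Delta n m)"
    by (auto simp: degeneracies_def Delta_surj_def)
  then show "finite (degeneracies A n)" by (rule finite_subset) (auto intro: finite_Delta)
qed (auto simp: sob_obj degeneracies_def dest: Delta_surjD)

lemma nd_prj_hom: "nd_prj C A n \<in> Homs C (sob A n) (nd C A n)"
  using is_quotientD(1)[OF nd_quotient] by (simp add: nd_def)

lemma nd_obj: "nd C A n \<in> Obj C"
  using Homs_obj[OF nd_prj_hom] by blast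

lemma nd_arr [simp]:
  "nd_prj C A n \<in> Arr C" "Dom C (nd_prj C A n) = sob A n" "Cod C (nd_prj C A n) = nd C A n"
  using nd_prj_hom[of n] by (auto simp: Homs_def)

lemma nd_epic:
  assumes "g \<in> Homs C (nd C A n) b" "h \<in> Homs C (nd C A n) b"
    "g \<bullet>\<^bsub>C\<^esub> nd_prj C A n = h \<bullet>\<^bsub>C\<^esub> nd_prj C A n"
  shows "g = h"
  by (rule quotient_epic[OF nd_quotient[of n]])
     (use assms in \<open>auto simp: degeneracies_def nd_def[symmetric] dest: Delta_surjD\<close>)

text \<open>The quotient was formed by surjections onto smaller [m] only. A monotone map that is not
  injective factors through an elementary one of these and is therefore killed too.\<close>

lemma nd_degenerate:
  assumes "s \<in> Delta n m" "\<not> inj_on s {..n}"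
  shows "nd_prj C A n \<bullet>\<^bsub>C\<^esub> act n m s = Zer C (sob A m) (nd C A n)"
proof -
  obtain a where a: "a < n" "s a = s (Suc a)" using not_inj_adjacent1[OF assms] by blast
  then obtain k where n: "n = Suc k" by (cases n) auto
  have c: "codeg k a \<in> Delta_surj n k" using codeg_Delta[of a k] a n by auto
  have s: "compose {..k} s (coface k (Suc a)) \<in> Delta k m"
    using assms n by (auto intro!: Delta_compose coface_Delta)
  have "s = compose {..n} (compose {..k} s (coface k (Suc a))) (codeg k a)"
    using factor_codeg[of s k m a] assms(1) a n by simp
  then have eq: "act n m s = act n k (codeg k a) \<bullet>\<^bsub>C\<^esub> act k m (compose {..k} s (coface k (Suc a)))"
    using act_compose[OF Delta_surjD(1)[OF c] s] by metis
  have "nd_prj C A n \<bullet>\<^bsub>C\<^esub> act n k (codeg k a) = Zer C (sob A k) (nd C A n)"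
  proof -
    have "act n k (codeg k a) \<in> degeneracies A n" using c n by (auto simp: degeneracies_def)
    from is_quotientD(2)[OF nd_quotient this] show ?thesis using Delta_surjD(1)[OF c] by simp
  qed
  then show ?thesis
    unfolding eq using cmp_assoc[OF act_hom[OF s] act_hom[OF Delta_surjD(1)[OF c]] nd_prj_hom] 
      cmp_zero_left[OF act_hom[OF s] nd_obj] by metis
qed

lemma degeneracies_not_inj: "s \<in> Delta_surj n m \<Longrightarrow> m < n \<Longrightarrow> \<not> inj_on s {..n}"
  using Delta_inj_le Delta_surjD(1) by fastforce

lemma nd_descend:
  assumes "t \<in> Homs C (sob A n) b"
    "\<And>m s. s \<in> Delta n m \<Longrightarrow> \<not> inj_on s {..n} \<Longrightarrow> t \<bullet>\<^bsub>C\<^esub> act n m s = Zer C (sob A m) b"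
  shows "descend C (nd_prj C A n) t \<in> Homs C (nd C A n) b"
    "descend C (nd_prj C A n) t \<bullet>\<^bsub>C\<^esub> nd_prj C A n = t"
proof -
  have "t \<bullet>\<^bsub>C\<^esub> s = Zer C (Dom C s) b" if "s \<in> degeneracies A n" for s
    using that assms(2) Delta_surjD(1) degeneracies_not_inj by (force simp: degeneracies_def)
  from quotient_descend[OF nd_quotient assms(1) this]
  show "descend C (nd_prj C A n) t \<in> Homs C (nd C A n) b"
    "descend C (nd_prj C A n) t \<bullet>\<^bsub>C\<^esub> nd_prj C A n = t" by simp_all
qed

text \<open>The Moore projector kills degenerate elements, so it descends to the quotient, and the
  descended arrow splits the projection. This identifies the nondegenerate quotient with the
  normalized elements and allows lifting from it.\<close>

definition nd_sec :: "nat \<Rightarrow> 'm" where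
  "nd_sec n = descend C (nd_prj C A n) (nrm n)"

lemma nd_sec_hom: "nd_sec n \<in> Homs C (nd C A n) (sob A n)"
  and nd_sec_prj: "nd_sec n \<bullet>\<^bsub>C\<^esub> nd_prj C A n = nrm n"
  unfolding nd_sec_def using nd_descend[of "nrm n", OF nrm_hom] nrm_degenerate by blast+

lemma nd_prj_nrm: "nd_prj C A n \<bullet>\<^bsub>C\<^esub> nrm n = nd_prj C A n"
  unfolding nrm_def by (rule norm_absorb[OF admissible_up nd_prj_hom nd_degenerate])

lemma nd_prj_sec: "nd_prj C A n \<bullet>\<^bsub>C\<^esub> nd_sec n = Ide C (nd C A n)"
proof (rule nd_epic)
  have "(nd_prj C A n \<bullet>\<^bsub>C\<^esub> nd_sec n) \<bullet>\<^bsub>C\<^esub> nd_prj C A n = nd_prj C A n"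
    using cmp_assoc[OF nd_prj_hom nd_sec_hom nd_prj_hom] nd_sec_prj nd_prj_nrm by simp
  then show "(nd_prj C A n \<bullet>\<^bsub>C\<^esub> nd_sec n) \<bullet>\<^bsub>C\<^esub> nd_prj C A n = Ide C (nd C A n) \<bullet>\<^bsub>C\<^esub> nd_prj C A n"
    using ide_cmp[OF nd_prj_hom] by simp
qed (use cmp_hom[OF nd_sec_hom nd_prj_hom] ide_hom nd_obj in auto)

lemma nd_sec_missing:
  assumes "g \<in> Delta m n" "j \<notin> g ` {..m}" "0 < j" "j \<le> n"
  shows "act m n g \<bullet>\<^bsub>C\<^esub> nd_sec n = Zer C (nd C A n) (sob A m)"
proof (rule nd_epic)
  show "(act m n g \<bullet>\<^bsub>C\<^esub> nd_sec n) \<bullet>\<^bsub>C\<^esub> nd_prj C A n = Zer C (nd C A n) (sob A m) \<bullet>\<^bsub>C\<^esub> nd_prj C A n"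
    using cmp_assoc[OF nd_prj_hom nd_sec_hom act_hom[OF assms(1)]] nd_sec_prj nrm_missing[OF assms]
      cmp_zero_left[OF nd_prj_hom sob_obj] by simp
qed (use cmp_hom[OF nd_sec_hom act_hom[OF assms(1)]] Zer_hom nd_obj sob_obj in auto)

lemma nrm_kernel:
  assumes "t \<in> Homs C T (sob A n)" "nd_prj C A n \<bullet>\<^bsub>C\<^esub> t = Zer C T (nd C A n)"
  shows "nrm n \<bullet>\<^bsub>C\<^esub> t = Zer C T (sob A n)"
  using cmp_assoc[OF assms(1) nd_prj_hom nd_sec_hom] nd_sec_prj[of n] assms(2)
    cmp_zero_right[OF nd_sec_hom] Homs_obj[OF assms(1)] by simp

end

section \<open>The Dold--Kan correspondence\<close>

lemma Delta_surj_inj_id: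
  assumes "h \<in> Delta l n" "inj_on h {..l}" "h ` {..l} = {..n}"
  shows "l = n" "h = restrict id {..n}"
proof -
  show "l = n" using card_image[OF assms(2)] assms(3) by simp
  then show "h = restrict id {..n}" using assms Delta_inj_id by blast
qed

lemma inj_compose_Delta:
  assumes "f \<in> Delta l m" "inj_on f {..l}" "inj_on g {..m}"
  shows "inj_on (compose {..l} g f) {..l}"
  using assms by (auto simp: inj_on_def compose_def Delta_iff)

lemma not_inj_compose_Delta:
  assumes "f \<in> Delta l m" "\<not> inj_on f {..l}"
  shows "\<not> inj_on (compose {..l} g f) {..l}"
  using assms by (auto simp: inj_on_def compose_def) (metis atMost_iff)

lemma inj_coface: "inj_on (coface n k) {..n}"
  by (auto simp: inj_on_def coface_def split: if_splits)

lemma coface_image: "k \<le> Suc n \<Longrightarrow> coface n k ` {..n} = {..Suc n} - {k}"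
proof (intro equalityI subsetI)
  fix y assume "y \<in> {..Suc n} - {k}" "k \<le> Suc n"
  then show "y \<in> coface n k ` {..n}"
    by (intro image_eqI[of _ _ "if y < k then y else y - 1"]) (auto simp: coface_def)
qed (auto simp: coface_def split: if_splits)

lemma not_surj_misses:
  assumes "g \<in> Delta l n" "g ` {..l} \<noteq> {..n}"
  obtains i where "i \<le> n" "i \<notin> g ` {..l}"
  using assms Delta_le[OF assms(1)] by (metis antisym atMost_iff image_subsetI subsetI)

section \<open>The differential of the normalized complex, and detection of elements by
  faces\<close>

context simplicial_obj
begin

text \<open>The usual cancellation: if s identifies a and a + 1, then the faces a and a + 1 coincide
  and carry opposite signs, and every other face is degenerate again.\<close>

lemma nd_diff_kills:
  assumes s: "s \<in> Delta (Suc n) m" and ni: "\<not> inj_on s {..Suc n}"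
  shows "finsum (H (sob A (Suc n)) (nd C A n))
      (\<lambda>k. [((-1) ^ k :: int)] \<cdot>\<^bsub>H (sob A (Suc n)) (nd C A n)\<^esub> (nd_prj C A n \<bullet>\<^bsub>C\<^esub> act n (Suc n) (coface n k)))
      {..Suc n} \<bullet>\<^bsub>C\<^esub> act (Suc n) m s = Zer C (sob A m) (nd C A n)"
proof -
  obtain a where a: "a \<le> n" "s a = s (Suc a)" using not_inj_adjacent1[OF s ni] less_Suc_eq_le by blast
  let ?H = "H (sob A m) (nd C A n)"
  let ?x = "nd_prj C A n \<bullet>\<^bsub>C\<^esub> act n m (compose {..n} s (coface n a))"
  \<comment> \<open>The two surviving signs are written as coefficients of one and the same arrow
    \<open>?x\<close>, so that the whole sum becomes a multiple of \<open>?x\<close> with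
    coefficient 0.\<close>
  let ?c = "\<lambda>k. (if k = a then (-1) ^ a else 0) + (if k = Suc a then - ((-1) ^ a) else 0) :: int"
  have cs: "compose {..n} s (coface n k) \<in> Delta n m" for k by (rule Delta_compose[OF coface_Delta s])
  have x: "?x \<in> Homs C (sob A m) (nd C A n)" using cs act_hom nd_prj_hom cmp_hom by blast
  have term_hom: "nd_prj C A n \<bullet>\<^bsub>C\<^esub> act n (Suc n) (coface n k) \<in> Homs C (sob A (Suc n)) (nd C A n)" for k
    using coface_Delta act_hom nd_prj_hom cmp_hom by blast
  have "finsum (H (sob A (Suc n)) (nd C A n))
      (\<lambda>k. [((-1) ^ k :: int)] \<cdot>\<^bsub>H (sob A (Suc n)) (nd C A n)\<^esub> (nd_prj C A n \<bullet>\<^bsub>C\<^esub> act n (Suc n) (coface n k)))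
      {..Suc n} \<bullet>\<^bsub>C\<^esub> act (Suc n) m s
    = finsum ?H (\<lambda>k. ([((-1) ^ k :: int)] \<cdot>\<^bsub>H (sob A (Suc n)) (nd C A n)\<^esub>
        (nd_prj C A n \<bullet>\<^bsub>C\<^esub> act n (Suc n) (coface n k))) \<bullet>\<^bsub>C\<^esub> act (Suc n) m s) {..Suc n}"
    by (rule cmp_finsum_left[OF act_hom[OF s] nd_obj scal_hom[OF term_hom]])
  also have "\<dots> = finsum ?H (\<lambda>k. [(?c k)] \<cdot>\<^bsub>?H\<^esub> ?x) {..Suc n}"
  proof (rule finsum_eqI[OF sob_obj nd_obj])
    fix k assume k: "k \<in> {..Suc n}"
    have "([((-1) ^ k :: int)] \<cdot>\<^bsub>H (sob A (Suc n)) (nd C A n)\<^esub>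
        (nd_prj C A n \<bullet>\<^bsub>C\<^esub> act n (Suc n) (coface n k))) \<bullet>\<^bsub>C\<^esub> act (Suc n) m s
      = [((-1) ^ k :: int)] \<cdot>\<^bsub>?H\<^esub> (nd_prj C A n \<bullet>\<^bsub>C\<^esub> act n m (compose {..n} s (coface n k)))"
      using cmp_scal_left[OF act_hom[OF s] term_hom] act_compose[OF coface_Delta s]
        cmp_assoc[OF act_hom[OF s] act_hom[OF coface_Delta] nd_prj_hom] by simp
    also have "\<dots> = [(?c k)] \<cdot>\<^bsub>?H\<^esub> ?x"
    proof (cases "k = a \<or> k = Suc a")
      case True
      have "compose {..n} s (coface n (Suc a)) = compose {..n} s (coface n a)"
        by (rule Delta_eqI[OF cs cs]) (use a in \<open>auto simp: compose_def coface_def less_Suc_eq\<close>)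
      then show ?thesis using True by auto
    next
      case False
      \<comment> \<open>Omitting a vertex k other than a and a + 1 keeps the identified pair; its
        first member now has index a - 1 if k < a, and a otherwise.\<close>
      have eq: "coface n k (if k < a then a - 1 else a) = a"
        "coface n k (Suc (if k < a then a - 1 else a)) = Suc a"
        using False k a by (auto simp: coface_def)
      have le: "Suc (if k < a then a - 1 else a) \<le> n" using False k a by auto
      have "\<not> inj_on (compose {..n} s (coface n k)) {..n}"
        using inj_onD[of "compose {..n} s (coface n k)" "{..n}" "if k < a then a - 1 else a" "Suc (if k < a then a - 1 else a)"]
          eq le a by (auto simp: compose_def split: if_splits)
      then show ?thesis using False nd_degenerate[OF cs] scal_zero sob_obj nd_obj
        by (auto simp: scal_0)
    qed
    finally show "([((-1) ^ k :: int)] \<cdot>\<^bsub>H (sob A (Suc n)) (nd C A n)\<^esub>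
        (nd_prj C A n \<bullet>\<^bsub>C\<^esub> act n (Suc n) (coface n k))) \<bullet>\<^bsub>C\<^esub> act (Suc n) m s = [(?c k)] \<cdot>\<^bsub>?H\<^esub> ?x" .
  qed (rule scal_hom[OF x])
  also have "\<dots> = [(sum ?c {..Suc n})] \<cdot>\<^bsub>?H\<^esub> ?x" by (rule finsum_scal[OF x]) simp
  also have "sum ?c {..Suc n} = 0"
    unfolding sum.distrib using a by (simp del: sum.atMost_Suc)
  finally show ?thesis by (simp add: scal_0)
qed

lemma nd_diff_hom: "nd_diff C A n \<in> Homs C (nd C A (Suc n)) (nd C A n)"
  and nd_diff_prj: "nd_diff C A n \<bullet>\<^bsub>C\<^esub> nd_prj C A (Suc n) =
    finsum (H (sob A (Suc n)) (nd C A n))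
      (\<lambda>k. [((-1) ^ k :: int)] \<cdot>\<^bsub>H (sob A (Suc n)) (nd C A n)\<^esub> (nd_prj C A n \<bullet>\<^bsub>C\<^esub> act n (Suc n) (coface n k)))
      {..Suc n}"
proof -
  have "finsum (H (sob A (Suc n)) (nd C A n))
      (\<lambda>k. [((-1) ^ k :: int)] \<cdot>\<^bsub>H (sob A (Suc n)) (nd C A n)\<^esub> (nd_prj C A n \<bullet>\<^bsub>C\<^esub> act n (Suc n) (coface n k)))
      {..Suc n} \<in> Homs C (sob A (Suc n)) (nd C A n)"
    by (intro finsum_hom sob_obj nd_obj scal_hom cmp_hom[OF act_hom[OF coface_Delta] nd_prj_hom])
  from nd_descend[OF this nd_diff_kills]
  show "nd_diff C A n \<in> Homs C (nd C A (Suc n)) (nd C A n)"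
    "nd_diff C A n \<bullet>\<^bsub>C\<^esub> nd_prj C A (Suc n) =
    finsum (H (sob A (Suc n)) (nd C A n))
      (\<lambda>k. [((-1) ^ k :: int)] \<cdot>\<^bsub>H (sob A (Suc n)) (nd C A n)\<^esub> (nd_prj C A n \<bullet>\<^bsub>C\<^esub> act n (Suc n) (coface n k)))
      {..Suc n}" unfolding nd_diff_def Suc_eq_plus1 by blast+
qed

lemma nd_diff_prj_cmp:
  assumes t: "t \<in> Homs C T (sob A (Suc n))"
  shows "nd_diff C A n \<bullet>\<^bsub>C\<^esub> nd_prj C A (Suc n) \<bullet>\<^bsub>C\<^esub> t =
    finsum (H T (nd C A n))
      (\<lambda>k. [((-1) ^ k :: int)] \<cdot>\<^bsub>H T (nd C A n)\<^esub> (nd_prj C A n \<bullet>\<^bsub>C\<^esub> act n (Suc n) (coface n k) \<bullet>\<^bsub>C\<^esub> t)) {..Suc n}"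
proof -
  have T: "T \<in> Obj C" using Homs_obj[OF t] by blast
  have term_hom: "nd_prj C A n \<bullet>\<^bsub>C\<^esub> act n (Suc n) (coface n k) \<in> Homs C (sob A (Suc n)) (nd C A n)" for k
    using coface_Delta act_hom nd_prj_hom cmp_hom by blast
  have as: "(nd_prj C A n \<bullet>\<^bsub>C\<^esub> act n (Suc n) (coface n k)) \<bullet>\<^bsub>C\<^esub> t
      = nd_prj C A n \<bullet>\<^bsub>C\<^esub> act n (Suc n) (coface n k) \<bullet>\<^bsub>C\<^esub> t" for k
    by (rule cmp_assoc[OF t act_hom[OF coface_Delta] nd_prj_hom])
  have th: "nd_prj C A n \<bullet>\<^bsub>C\<^esub> act n (Suc n) (coface n k) \<bullet>\<^bsub>C\<^esub> t \<in> Homs C T (nd C A n)" for k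
    using cmp_hom[OF t term_hom] as by simp
  show ?thesis
    unfolding cmp_assoc[OF t nd_prj_hom nd_diff_hom, symmetric] nd_diff_prj
      cmp_finsum_left[OF t nd_obj scal_hom[OF term_hom]]
    by (rule finsum_eqI[OF T nd_obj]) (use cmp_scal_left[OF t term_hom] as scal_hom[OF th] in auto)
qed

text \<open>A sub-simplicial abelian group \<open>P\<close> of the generalized elements with domain \<open>T\<close> contains an
  element as soon as all its nondegenerate faces either vanish in the nondegenerate quotient or lie
  in \<open>P\<close>. With \<open>P = 0\<close>, the nondegenerate faces are jointly monic; with the elements that factor
  through a skeleton, they detect the skeletal filtration.\<close>

lemma mem_by_faces:
  assumes P_sub: "\<And>m. P m \<subseteq> Homs C T (sob A m)"
    and P_zero: "\<And>m. Zer C T (sob A m) \<in> P m"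
    and P_add: "\<And>m x y. x \<in> P m \<Longrightarrow> y \<in> P m \<Longrightarrow> Add C x y \<in> P m"
    and P_minus: "\<And>m x y. x \<in> P m \<Longrightarrow> y \<in> P m \<Longrightarrow> minus_arr x y \<in> P m"
    and P_act: "\<And>l m g x. x \<in> P m \<Longrightarrow> g \<in> Delta l m \<Longrightarrow> act l m g \<bullet>\<^bsub>C\<^esub> x \<in> P l"
    and t: "t \<in> Homs C T (sob A m)"
    and faces: "\<And>l g. g \<in> Delta l m \<Longrightarrow> inj_on g {..l} \<Longrightarrow>
      nd_prj C A l \<bullet>\<^bsub>C\<^esub> act l m g \<bullet>\<^bsub>C\<^esub> t = Zer C T (nd C A l) \<or> act l m g \<bullet>\<^bsub>C\<^esub> t \<in> P l"
  shows "t \<in> P m"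
  using t faces
proof (induction m arbitrary: t)
  case (0 t)
  have "nd_prj C A 0 \<bullet>\<^bsub>C\<^esub> t = Zer C T (nd C A 0) \<or> t \<in> P 0"
    using 0(2)[OF Delta_id] unfolding act_id ide_cmp[OF 0(1)] by simp
  then have "t \<in> P 0 \<or> nrm 0 \<bullet>\<^bsub>C\<^esub> t = Zer C T (sob A 0)" using nrm_kernel[OF 0(1)] by blast
  moreover have "nrm 0 \<bullet>\<^bsub>C\<^esub> t = t" by (rule nrm_fix[OF 0(1)]) auto
  ultimately show ?case using P_zero by auto
next
  case (Suc m t)
  note t = Suc.prems(1)
  have "nd_prj C A (Suc m) \<bullet>\<^bsub>C\<^esub> t = Zer C T (nd C A (Suc m)) \<or> t \<in> P (Suc m)"
    using Suc.prems(2)[OF Delta_id inj_on_restrict_eq[THEN iffD2, OF inj_on_id]] unfolding act_id ide_cmp[OF t] .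
  then show ?case
  proof
    assume "nd_prj C A (Suc m) \<bullet>\<^bsub>C\<^esub> t = Zer C T (nd C A (Suc m))"
    then have "nrm (Suc m) \<bullet>\<^bsub>C\<^esub> t \<in> P (Suc m)" using nrm_kernel[OF t] P_zero by simp
    \<comment> \<open>A map that is not onto factors through some coface. The hypothesis on faces is
      inherited there, because an injection followed by a coface stays injective.\<close>
    moreover have "act (Suc m) (Suc m) g \<bullet>\<^bsub>C\<^esub> t \<in> P (Suc m)"
      if g: "g \<in> Delta (Suc m) (Suc m)" "g ` {..Suc m} \<noteq> {..Suc m}" for g
    proof -
      obtain i where i: "i \<le> Suc m" "i \<notin> g ` {..Suc m}" using not_surj_misses[OF g] .
      obtain h where h: "h \<in> Delta (Suc m) m" "g = compose {..Suc m} (coface m i) h"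
        using factor_coface[OF g(1) i] by blast
      have th: "act m (Suc m) (coface m i) \<bullet>\<^bsub>C\<^esub> t \<in> Homs C T (sob A m)"
        by (rule cmp_hom[OF t act_hom[OF coface_Delta]])
      have "act m (Suc m) (coface m i) \<bullet>\<^bsub>C\<^esub> t \<in> P m"
      proof (rule Suc.IH[OF th])
        fix l f assume f: "f \<in> Delta l m" "inj_on f {..l}"
        show "nd_prj C A l \<bullet>\<^bsub>C\<^esub> act l m f \<bullet>\<^bsub>C\<^esub> act m (Suc m) (coface m i) \<bullet>\<^bsub>C\<^esub> t = Zer C T (nd C A l) \<or>
          act l m f \<bullet>\<^bsub>C\<^esub> act m (Suc m) (coface m i) \<bullet>\<^bsub>C\<^esub> t \<in> P l"
          unfolding act_act[OF f(1) coface_Delta t]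
          by (rule Suc.prems(2)[OF Delta_compose[OF f(1) coface_Delta] inj_compose_Delta[OF f inj_coface]])
      qed
      then have "act (Suc m) m h \<bullet>\<^bsub>C\<^esub> act m (Suc m) (coface m i) \<bullet>\<^bsub>C\<^esub> t \<in> P (Suc m)"
        by (rule P_act[OF _ h(1)])
      then show ?thesis unfolding act_act[OF h(1) coface_Delta t] h(2) .
    qed
    ultimately show "t \<in> P (Suc m)"
      unfolding nrm_def by (intro norm_closed[OF admissible_up t P_sub P_add P_minus]) auto
  qed
qed

lemma faces_jointly_monic:
  assumes t: "t \<in> Homs C T (sob A m)" "t' \<in> Homs C T (sob A m)"
    and faces: "\<And>l g. g \<in> Delta l m \<Longrightarrow> inj_on g {..l} \<Longrightarrow>
      nd_prj C A l \<bullet>\<^bsub>C\<^esub> act l m g \<bullet>\<^bsub>C\<^esub> t = nd_prj C A l \<bullet>\<^bsub>C\<^esub> act l m g \<bullet>\<^bsub>C\<^esub> t'"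
  shows "t = t'"
proof -
  have T: "T \<in> Obj C" using Homs_obj[OF t(1)] by blast
  have "minus_arr t t' \<in> {Zer C T (sob A m)}"
  proof (rule mem_by_faces[of "\<lambda>m. {Zer C T (sob A m)}"])
    fix l g assume g: "g \<in> Delta l m" "inj_on g {..l}"
    have gt: "act l m g \<bullet>\<^bsub>C\<^esub> x \<in> Homs C T (sob A l)" if "x \<in> Homs C T (sob A m)" for x
      by (rule cmp_hom[OF that act_hom[OF g(1)]])
    have "nd_prj C A l \<bullet>\<^bsub>C\<^esub> act l m g \<bullet>\<^bsub>C\<^esub> minus_arr t t' = Zer C T (nd C A l)"
      using cmp_minus_right[OF t act_hom[OF g(1)]] cmp_minus_right[OF gt[OF t(1)] gt[OF t(2)] nd_prj_hom]
        faces[OF g] minus_self[OF cmp_hom[OF gt[OF t(2)] nd_prj_hom]] by simp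
    then show "nd_prj C A l \<bullet>\<^bsub>C\<^esub> act l m g \<bullet>\<^bsub>C\<^esub> minus_arr t t' = Zer C T (nd C A l) \<or>
        act l m g \<bullet>\<^bsub>C\<^esub> minus_arr t t' \<in> {Zer C T (sob A l)}" by blast
  next
    fix l m g x assume "x \<in> {Zer C T (sob A m)}" "g \<in> Delta l m"
    then show "act l m g \<bullet>\<^bsub>C\<^esub> x \<in> {Zer C T (sob A l)}" using cmp_zero_right[OF act_hom T] by simp
  qed (use t T sob_obj in \<open>auto simp: minus_hom Zer_hom minus_zero add_zero\<close>)
  then show ?thesis using minus_eq_zero_iff[OF t] by simp
qed

lemma act_add_minus:
  assumes "f \<in> Delta m n" "x \<in> Homs C T (sob A n)" "y \<in> Homs C T (sob A n)"
  shows "act m n f \<bullet>\<^bsub>C\<^esub> Add C x y = Add C (act m n f \<bullet>\<^bsub>C\<^esub> x) (act m n f \<bullet>\<^bsub>C\<^esub> y)"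
    "act m n f \<bullet>\<^bsub>C\<^esub> minus_arr x y = minus_arr (act m n f \<bullet>\<^bsub>C\<^esub> x) (act m n f \<bullet>\<^bsub>C\<^esub> y)"
  using cmp_add_right[OF assms(2,3) act_hom[OF assms(1)]] cmp_minus_right[OF assms(2,3) act_hom[OF assms(1)]]
  by auto

lemma act_cmp_hom: "f \<in> Delta m n \<Longrightarrow> x \<in> Homs C T (sob A n) \<Longrightarrow> act m n f \<bullet>\<^bsub>C\<^esub> x \<in> Homs C T (sob A m)"
  by (rule cmp_hom[OF _ act_hom])

text \<open>Horn filling for the horn that lacks the zeroth face.\<close>

lemma horn_fill:
  assumes T: "T \<in> Obj C"
    and Y: "\<And>l g. g \<in> Delta l n \<Longrightarrow> g ` {..l} \<noteq> {..n} \<Longrightarrow> Y l g \<in> Homs C T (sob A l)"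
    and compat: "\<And>k l g h. g \<in> Delta l n \<Longrightarrow> g ` {..l} \<noteq> {..n} \<Longrightarrow> h \<in> Delta k l \<Longrightarrow>
      act k l h \<bullet>\<^bsub>C\<^esub> Y l g = Y k (compose {..k} g h)"
  shows "\<exists>t \<in> Homs C T (sob A n). \<forall>l g j. g \<in> Delta l n \<and> j \<notin> g ` {..l} \<and> 0 < j \<and> j \<le> n \<longrightarrow>
     act l n g \<bullet>\<^bsub>C\<^esub> t = Y l g"
proof -
  \<comment> \<open>Induction on d: after d corrections the faces omitting one of the last d
    vertices have the prescribed values.\<close>
  have "\<exists>t \<in> Homs C T (sob A n). \<forall>l g j. g \<in> Delta l n \<and> j \<notin> g ` {..l} \<and> n - d < j \<and> j \<le> n \<longrightarrow>
     act l n g \<bullet>\<^bsub>C\<^esub> t = Y l g" if "d \<le> n" for d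
    using that
  proof (induction d)
    case 0
    show ?case by (intro bexI[OF _ Zer_hom[OF T sob_obj]]) auto
  next
    case (Suc d)
    then have "d \<le> n" by simp
    from Suc.IH[OF this] obtain t where t: "t \<in> Homs C T (sob A n)"
      and tY: "\<And>l g j. g \<in> Delta l n \<Longrightarrow> j \<notin> g ` {..l} \<Longrightarrow> n - d < j \<Longrightarrow> j \<le> n \<Longrightarrow>
        act l n g \<bullet>\<^bsub>C\<^esub> t = Y l g" by blast
    define i where "i = n - d"
    have i: "0 < i" "i \<le> n" using Suc.prems by (auto simp: i_def)
    let ?f = "mv n i (i - 1)"
    have f: "?f \<in> Delta n n" using i by (intro mv_Delta) auto
    have fi: "i \<notin> ?f ` {..n}" using i by (auto simp: mv_def)
    then have fs: "?f ` {..n} \<noteq> {..n}" using i by blast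
    note ft = act_cmp_hom[OF f t] and Yf = Y[OF f fs]
    \<comment> \<open>Moore's correction at i. On a face that omits i, the difference vanishes and Y
      takes over. On a face that was right before, t also agrees with Y after the move, and the two
      changes cancel.\<close>
    let ?t = "Add C (minus_arr t (act n n ?f \<bullet>\<^bsub>C\<^esub> t)) (Y n ?f)"
    have val: "act l n g \<bullet>\<^bsub>C\<^esub> ?t = Add C (minus_arr (act l n g \<bullet>\<^bsub>C\<^esub> t) (act l n (compose {..l} ?f g) \<bullet>\<^bsub>C\<^esub> t))
        (Y l (compose {..l} ?f g))" if "g \<in> Delta l n" for l g
      using act_add_minus[OF that] minus_hom[OF t ft] t ft Yf act_act[OF that f t] compat[OF f fs that] by simp
    have "act l n g \<bullet>\<^bsub>C\<^esub> ?t = Y l g"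
      if g: "g \<in> Delta l n" and j: "j \<notin> g ` {..l}" "n - Suc d < j" "j \<le> n" for l g j
    proof -
      have gs: "g ` {..l} \<noteq> {..n}" using j by blast
      have fg: "compose {..l} ?f g \<in> Delta l n" by (rule Delta_compose[OF g f])
      show ?thesis
      proof (cases "j = i")
        case True
        then have "compose {..l} ?f g = g"
          by (intro Delta_eqI[OF fg g]) (use j Delta_le[OF g] in \<open>auto simp: compose_def mv_def\<close>)
        then show ?thesis
          using val[OF g] minus_self[OF act_cmp_hom[OF g t]] add_zero(2)[OF Y[OF g gs]] by simp
      next
        case False
        then have j': "n - d < j" using j by (auto simp: i_def)
        have "j \<notin> compose {..l} ?f g ` {..l}"
          using j j' i Delta_le[OF g] by (auto simp: compose_def mv_def i_def split: if_splits)
        then have "act l n (compose {..l} ?f g) \<bullet>\<^bsub>C\<^esub> t = Y l (compose {..l} ?f g)"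
          "act l n g \<bullet>\<^bsub>C\<^esub> t = Y l g" using tY fg g j j' by auto
        then show ?thesis
          using val[OF g] minus_add_cancel[OF act_cmp_hom[OF g t] act_cmp_hom[OF fg t]] by simp
      qed
    qed
    moreover have "?t \<in> Homs C T (sob A n)" by (rule Add_hom[OF minus_hom[OF t ft] Yf])
    ultimately show ?case by blast
  qed
  from this[of n] show ?thesis by simp
qed

section \<open>Every chain map out of a simplex comes from an element\<close>

lemma finsum_cancel_first:
  assumes f: "\<And>k. k \<le> Suc n \<Longrightarrow> f k \<in> Homs C a b" and g0: "g 0 \<in> Homs C a b"
    and eq: "\<And>k. 0 < k \<Longrightarrow> k \<le> Suc n \<Longrightarrow> f k = g k"
    and sum: "finsum (H a b) f {..Suc n} = finsum (H a b) g {..Suc n}"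
  shows "f 0 = g 0"
proof -
  interpret A: abelian_group "H a b" using H_abelian[OF g0] .
  have I: "{..Suc n} = insert 0 {1..Suc n}" by auto
  have fc: "f \<in> {1..Suc n} \<rightarrow> carrier (H a b)" "g \<in> {1..Suc n} \<rightarrow> carrier (H a b)"
    using f eq by (force simp: Pi_iff)+
  have "finsum (H a b) f {1..Suc n} = finsum (H a b) g {1..Suc n}"
    by (rule A.finsum_cong') (use fc eq in auto)
  then have "f 0 \<oplus>\<^bsub>H a b\<^esub> finsum (H a b) g {1..Suc n} = g 0 \<oplus>\<^bsub>H a b\<^esub> finsum (H a b) g {1..Suc n}"
    using sum A.finsum_insert[of "{1..Suc n}" 0 f] A.finsum_insert[of "{1..Suc n}" 0 g] fc f[of 0] g0
    unfolding I by simp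
  then show ?thesis
    using f[of 0] g0 A.finsum_closed[OF fc(2)] group.right_cancel[OF A.a_group, of "finsum (H a b) g {1..Suc n}" "f 0" "g 0"] by simp
qed

text \<open>Induction on the dimension r of k. The values on the proper faces of an injective k are
  realized by induction, and they are compatible because an element is determined by its components.
  Filling the horn without the zeroth face and adding a normalized element achieves everything but
  the zeroth face. That face is forced: its deviation is normalized, and the chain condition makes
  it vanish in the nondegenerate quotient.\<close>

lemma chain_realized:
  fixes c :: "nat \<Rightarrow> (nat \<Rightarrow> nat) \<Rightarrow> 'm"
  assumes T: "T \<in> Obj C"
    and c: "\<And>l g. g \<in> Delta l N \<Longrightarrow> c l g \<in> Homs C T (nd C A l)"
    and c0: "\<And>l g. g \<in> Delta l N \<Longrightarrow> \<not> inj_on g {..l} \<Longrightarrow> c l g = Zer C T (nd C A l)"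
    and chain: "\<And>l g. g \<in> Delta (Suc l) N \<Longrightarrow> inj_on g {..Suc l} \<Longrightarrow>
       nd_diff C A l \<bullet>\<^bsub>C\<^esub> c (Suc l) g =
       finsum (H T (nd C A l)) (\<lambda>k. [((-1) ^ k :: int)] \<cdot>\<^bsub>H T (nd C A l)\<^esub> c l (compose {..l} g (coface l k))) {..Suc l}"
    and k: "k \<in> Delta r N"
  shows "\<exists>t \<in> Homs C T (sob A r). \<forall>l h. h \<in> Delta l r \<longrightarrow>
     nd_prj C A l \<bullet>\<^bsub>C\<^esub> act l r h \<bullet>\<^bsub>C\<^esub> t = c l (compose {..l} k h)"
proof -
  define real where "real r k t \<longleftrightarrow> t \<in> Homs C T (sob A r) \<and>
    (\<forall>l h. h \<in> Delta l r \<longrightarrow> nd_prj C A l \<bullet>\<^bsub>C\<^esub> act l r h \<bullet>\<^bsub>C\<^esub> t = c l (compose {..l} k h))" for r k t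
  have real_unique: "t = t'" if "real r k t" "real r k t'" for r k t t'
    using that faces_jointly_monic[of t T r t'] unfolding real_def by metis
  have real_act: "real l (compose {..l} k h) (act l r h \<bullet>\<^bsub>C\<^esub> t)"
    if "real r k t" "h \<in> Delta l r" for r k t l h
    unfolding real_def
  proof (intro conjI allI impI)
    have t: "t \<in> Homs C T (sob A r)" using that real_def by blast
    show "act l r h \<bullet>\<^bsub>C\<^esub> t \<in> Homs C T (sob A l)" by (rule act_cmp_hom[OF that(2) t])
    fix l' h' assume h': "h' \<in> Delta l' l"
    show "nd_prj C A l' \<bullet>\<^bsub>C\<^esub> act l' l h' \<bullet>\<^bsub>C\<^esub> act l r h \<bullet>\<^bsub>C\<^esub> t = c l' (compose {..l'} (compose {..l} k h) h')"
      using act_act[OF h' that(2) t] that(1) Delta_compose[OF h' that(2)] compose_Delta_assoc[OF h', of k h]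
      unfolding real_def by simp
  qed
  have deg: "nd_prj C A l \<bullet>\<^bsub>C\<^esub> act l r h \<bullet>\<^bsub>C\<^esub> t = c l (compose {..l} k h)"
    if "h \<in> Delta l r" "\<not> inj_on h {..l}" "k \<in> Delta r N" "t \<in> Homs C T (sob A r)" for l r h k t
    using that c0[OF Delta_compose[OF that(1,3)] not_inj_compose_Delta[OF that(1,2)]]
      cmp_assoc[OF that(4) act_hom[OF that(1)] nd_prj_hom] nd_degenerate[OF that(1,2)] cmp_zero_left[OF that(4) nd_obj]
    by simp
  have "\<exists>t. real r k t" using k
  proof (induction r arbitrary: k)
    case (0 k)
    let ?t = "nd_sec 0 \<bullet>\<^bsub>C\<^esub> c 0 k"
    have t: "?t \<in> Homs C T (sob A 0)" by (rule cmp_hom[OF c[OF 0] nd_sec_hom])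
    have "real 0 k ?t" unfolding real_def
    proof (intro conjI allI impI t)
      fix l h assume h: "h \<in> Delta l 0"
      show "nd_prj C A l \<bullet>\<^bsub>C\<^esub> act l 0 h \<bullet>\<^bsub>C\<^esub> ?t = c l (compose {..l} k h)"
      proof (cases "inj_on h {..l}")
        case True
        then have l: "l = 0" using Delta_inj_le[OF h] by simp
        then have "h = restrict id {..0}" using Delta_inj_id h True by blast
        then show ?thesis
          using l act_id[of 0] ide_cmp[OF t] cmp_assoc[OF c[OF 0] nd_sec_hom nd_prj_hom] nd_prj_sec[of 0]
            ide_cmp[OF c[OF 0]] Delta_compose_id(2)[OF 0] by (simp del: atMost_0)
      qed (rule deg[OF h _ 0 t])
    qed
    then show ?case by blast
  next
    case (Suc r k)
    note k = Suc.prems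
    show ?case
    proof (cases "inj_on k {..Suc r}")
      case False
      then obtain a where a: "a \<le> r" "k a = k (Suc a)"
        using not_inj_adjacent1[OF k] less_Suc_eq_le by blast
      obtain t where "real r (compose {..r} k (coface r (Suc a))) t"
        using Suc.IH[OF Delta_compose[OF coface_Delta k]] by blast
      then have "real (Suc r) k (act (Suc r) r (codeg r a) \<bullet>\<^bsub>C\<^esub> t)"
        using real_act[OF _ Delta_surjD(1)[OF codeg_Delta[OF a(1)]]] factor_codeg[OF k a] by fastforce
      then show ?thesis by blast
    next
      case True
      have ex: "\<exists>t. real l (compose {..l} k g) t"
        if g: "g \<in> Delta l (Suc r)" "g ` {..l} \<noteq> {..Suc r}" for l g
      proof -
        obtain i where i: "i \<le> Suc r" "i \<notin> g ` {..l}" using not_surj_misses[OF g] .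
        obtain h where h: "h \<in> Delta l r" "g = compose {..l} (coface r i) h"
          using factor_coface[OF g(1) i] by blast
        obtain t where "real r (compose {..r} k (coface r i)) t"
          using Suc.IH[OF Delta_compose[OF coface_Delta k]] by blast
        from real_act[OF this h(1)] show ?thesis using compose_Delta_assoc[OF h(1), of k "coface r i"] h(2) by auto
      qed
      \<comment> \<open>Realizations of the proper faces are chosen freely; their uniqueness makes
        the choice commute with the simplicial operators.\<close>
      define Y where "Y l g = (SOME t. real l (compose {..l} k g) t)" for l g
      have Yr: "real l (compose {..l} k g) (Y l g)" if "g \<in> Delta l (Suc r)" "g ` {..l} \<noteq> {..Suc r}" for l g
        unfolding Y_def by (rule someI_ex[OF ex[OF that]])
      have Y: "Y l g \<in> Homs C T (sob A l)" if "g \<in> Delta l (Suc r)" "g ` {..l} \<noteq> {..Suc r}" for l g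
        using Yr[OF that] real_def by blast
      have ns: "compose {..l'} g h ` {..l'} \<noteq> {..Suc r}"
        if gs: "g \<in> Delta l (Suc r)" "g ` {..l} \<noteq> {..Suc r}" and h: "h \<in> Delta l' l" for l g l' h
      proof -
        obtain i where "i \<le> Suc r" "i \<notin> g ` {..l}" using not_surj_misses[OF gs] .
        moreover have "compose {..l'} g h ` {..l'} \<subseteq> g ` {..l}"
          using Delta_le[OF h] by (auto simp: compose_def)
        ultimately show ?thesis by blast
      qed
      have compat: "act l' l h \<bullet>\<^bsub>C\<^esub> Y l g = Y l' (compose {..l'} g h)"
        if "g \<in> Delta l (Suc r)" "g ` {..l} \<noteq> {..Suc r}" "h \<in> Delta l' l" for l' l g h
        using real_unique[OF real_act[OF Yr[OF that(1,2)] that(3), unfolded compose_Delta_assoc[OF that(3)]]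
          Yr[OF Delta_compose[OF that(3,1)] ns[OF that]]] .
      obtain t1 where t1: "t1 \<in> Homs C T (sob A (Suc r))" and t1Y: "\<And>l g j. g \<in> Delta l (Suc r) \<Longrightarrow>
          j \<notin> g ` {..l} \<Longrightarrow> 0 < j \<Longrightarrow> j \<le> Suc r \<Longrightarrow> act l (Suc r) g \<bullet>\<^bsub>C\<^esub> t1 = Y l g"
        using horn_fill[OF T Y compat] by blast
      let ?p = "nd_prj C A (Suc r)"
      \<comment> \<open>The lift of u by \<open>nd_sec\<close> vanishes on all faces that omit a
        positive vertex, so it corrects the top component without disturbing the horn.\<close>
      define u where "u = minus_arr (c (Suc r) k) (?p \<bullet>\<^bsub>C\<^esub> t1)"
      have pt1: "?p \<bullet>\<^bsub>C\<^esub> t1 \<in> Homs C T (nd C A (Suc r))" by (rule cmp_hom[OF t1 nd_prj_hom])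
      have u: "u \<in> Homs C T (nd C A (Suc r))" unfolding u_def by (rule minus_hom[OF c[OF k] pt1])
      have su: "nd_sec (Suc r) \<bullet>\<^bsub>C\<^esub> u \<in> Homs C T (sob A (Suc r))" by (rule cmp_hom[OF u nd_sec_hom])
      define t where "t = Add C (nd_sec (Suc r) \<bullet>\<^bsub>C\<^esub> u) t1"
      have t: "t \<in> Homs C T (sob A (Suc r))" unfolding t_def by (rule Add_hom[OF su t1])
      have pt: "?p \<bullet>\<^bsub>C\<^esub> t = c (Suc r) k"
        unfolding t_def cmp_add_right[OF su t1 nd_prj_hom] cmp_assoc[OF u nd_sec_hom nd_prj_hom, symmetric]
          nd_prj_sec ide_cmp[OF u] unfolding u_def by (rule minus_add_cancel[OF c[OF k] pt1])
      have tY: "act l (Suc r) g \<bullet>\<^bsub>C\<^esub> t = Y l g"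
        if g: "g \<in> Delta l (Suc r)" and j: "j \<notin> g ` {..l}" "0 < j" "j \<le> Suc r" for l g j
      proof -
        have "act l (Suc r) g \<bullet>\<^bsub>C\<^esub> nd_sec (Suc r) \<bullet>\<^bsub>C\<^esub> u = Zer C T (sob A l)"
          using cmp_assoc[OF u nd_sec_hom act_hom[OF g]] nd_sec_missing[OF g j] cmp_zero_left[OF u sob_obj] by simp
        then show ?thesis
          unfolding t_def using act_add_minus(1)[OF g su t1] t1Y[OF g j] add_zero(2)[OF Y[OF g]] j by force
      qed
      have cs: "coface r i ` {..r} \<noteq> {..Suc r}" if "i \<le> Suc r" for i
        using coface_image[OF that] that by blast
      have pY: "nd_prj C A r \<bullet>\<^bsub>C\<^esub> Y r (coface r i) = c r (compose {..r} k (coface r i))" if "i \<le> Suc r" for i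
      proof -
        have y: "real r (compose {..r} k (coface r i)) (Y r (coface r i))" by (rule Yr[OF coface_Delta cs[OF that]])
        then have "nd_prj C A r \<bullet>\<^bsub>C\<^esub> act r r (restrict id {..r}) \<bullet>\<^bsub>C\<^esub> Y r (coface r i)
            = c r (compose {..r} (compose {..r} k (coface r i)) (restrict id {..r}))"
          using Delta_id unfolding real_def by blast
        then show ?thesis
          using act_id ide_cmp[OF Y[OF coface_Delta cs[OF that]]]
            Delta_compose_id(2)[OF Delta_compose[OF coface_Delta k]] by simp
      qed
      \<comment> \<open>The deviation of the zeroth face. Its faces omitting a positive vertex j
        come from faces of t omitting \<open>Suc j\<close>, where t is already correct, so
        \<open>?z\<close> is fixed by the normalization.\<close>
      let ?z = "minus_arr (act r (Suc r) (coface r 0) \<bullet>\<^bsub>C\<^esub> t) (Y r (coface r 0))"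
      note d0t = act_cmp_hom[OF coface_Delta[of r 0] t] and Y0 = Y[OF coface_Delta[of r 0] cs[of 0, simplified]]
      have z: "?z \<in> Homs C T (sob A r)" by (rule minus_hom[OF d0t Y0])
      have "nrm r \<bullet>\<^bsub>C\<^esub> ?z = ?z"
      proof (rule nrm_fix[OF z])
        fix g j assume g: "g \<in> Delta r r" and j: "0 < j" "j \<le> r" "j \<notin> g ` {..r}"
        have "Suc j \<notin> compose {..r} (coface r 0) g ` {..r}"
          using j Delta_le[OF g] by (auto simp: compose_def coface_def)
        then have "act r r g \<bullet>\<^bsub>C\<^esub> act r (Suc r) (coface r 0) \<bullet>\<^bsub>C\<^esub> t = Y r (compose {..r} (coface r 0) g)"
          unfolding act_act[OF g coface_Delta t] using j
          by (intro tY[where j = "Suc j", OF Delta_compose[OF g coface_Delta]]) auto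
        then show "act r r g \<bullet>\<^bsub>C\<^esub> ?z = Zer C T (sob A r)"
          using act_add_minus(2)[OF g d0t Y0] compat[OF coface_Delta cs[of 0, simplified] g]
            minus_self[OF act_cmp_hom[OF g Y0]] by simp
      qed
      moreover have "nd_prj C A r \<bullet>\<^bsub>C\<^esub> ?z = Zer C T (nd C A r)"
      proof -
        let ?f = "\<lambda>i. [((-1) ^ i :: int)] \<cdot>\<^bsub>H T (nd C A r)\<^esub> (nd_prj C A r \<bullet>\<^bsub>C\<^esub> act r (Suc r) (coface r i) \<bullet>\<^bsub>C\<^esub> t)"
        let ?g = "\<lambda>i. [((-1) ^ i :: int)] \<cdot>\<^bsub>H T (nd C A r)\<^esub> c r (compose {..r} k (coface r i))"
        have ft: "nd_prj C A r \<bullet>\<^bsub>C\<^esub> act r (Suc r) (coface r i) \<bullet>\<^bsub>C\<^esub> t \<in> Homs C T (nd C A r)" for i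
          by (rule cmp_hom[OF act_cmp_hom[OF coface_Delta t] nd_prj_hom])
        have gt: "c r (compose {..r} k (coface r i)) \<in> Homs C T (nd C A r)" for i
          by (rule c[OF Delta_compose[OF coface_Delta k]])
        \<comment> \<open>Both alternating sums equal the differential of the top component, and
          their terms of positive index agree.\<close>
        have "?f 0 = ?g 0"
        proof (rule finsum_cancel_first[of r])
          show "finsum (H T (nd C A r)) ?f {..Suc r} = finsum (H T (nd C A r)) ?g {..Suc r}"
            using nd_diff_prj_cmp[OF t] pt chain[OF k True] by simp
          fix i assume i: "0 < i" "i \<le> Suc r"
          then have "i \<notin> coface r i ` {..r}" using coface_image[of i r] by auto
          then show "?f i = ?g i" using tY[OF coface_Delta _ i] pY[of i] i(2) by simp
        qed (use ft gt scal_hom in auto)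
        then show ?thesis
          using scal_1[OF ft[of 0]] scal_1[OF gt[of 0]] pY[of 0] cmp_minus_right[OF d0t Y0 nd_prj_hom]
            minus_self[OF gt[of 0]] by simp
      qed
      ultimately have "?z = Zer C T (sob A r)" using nrm_kernel[OF z] by simp
      then have t0: "act r (Suc r) (coface r 0) \<bullet>\<^bsub>C\<^esub> t = Y r (coface r 0)"
        using minus_eq_zero_iff[OF d0t Y0] by simp
      have tYall: "act l (Suc r) g \<bullet>\<^bsub>C\<^esub> t = Y l g" if g: "g \<in> Delta l (Suc r)" "g ` {..l} \<noteq> {..Suc r}" for l g
      proof -
        obtain i where i: "i \<le> Suc r" "i \<notin> g ` {..l}" using not_surj_misses[OF g] .
        show ?thesis
        proof (cases "i = 0")
          case True
          obtain h where h: "h \<in> Delta l r" "g = compose {..l} (coface r 0) h"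
            using factor_coface[OF g(1) i] True by blast
          show ?thesis
            unfolding h(2) act_act[OF h(1) coface_Delta[of r 0] t, symmetric] t0
            by (rule compat[OF coface_Delta cs[of 0, simplified] h(1)])
        qed (use tY[OF g(1) i(2)] i in simp)
      qed
      have "real (Suc r) k t" unfolding real_def
      proof (intro conjI allI impI t)
        fix l h assume h: "h \<in> Delta l (Suc r)"
        show "nd_prj C A l \<bullet>\<^bsub>C\<^esub> act l (Suc r) h \<bullet>\<^bsub>C\<^esub> t = c l (compose {..l} k h)"
        proof (cases "inj_on h {..l}")
          case inj: True
          show ?thesis
          proof (cases "h ` {..l} = {..Suc r}")
            case True
            then show ?thesis using Delta_surj_inj_id[OF h inj True] pt act_id ide_cmp[OF t] Delta_compose_id(2)[OF k]
              by simp
          next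
            case False
            have y: "real l (compose {..l} k h) (Y l h)" by (rule Yr[OF h False])
            then have "nd_prj C A l \<bullet>\<^bsub>C\<^esub> act l l (restrict id {..l}) \<bullet>\<^bsub>C\<^esub> Y l h
                = c l (compose {..l} (compose {..l} k h) (restrict id {..l}))"
              using Delta_id unfolding real_def by blast
            then show ?thesis
              using tYall[OF h False] act_id ide_cmp[OF Y[OF h False]]
                Delta_compose_id(2)[OF Delta_compose[OF h k]] by simp
          qed
        qed (rule deg[OF h _ k t])
      qed
      then show ?thesis by blast
    qed
  qed
  then show ?thesis unfolding real_def by blast
qed

end

subsection \<open>Representability of chain maps out of a simplex\<close>

definition face_map :: "nat set \<Rightarrow> nat \<Rightarrow> nat" where
  "face_map S = (\<lambda>k\<in>{..card S - 1}. sorted_list_of_set S ! k)"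

lemma facesD:
  assumes "S \<in> faces n"
  shows "finite S" "S \<noteq> {}" "S \<subseteq> {..n}" "0 < card S"
  using assms finite_subset[of S "{..n}"] by (auto simp: faces_def card_gt_0_iff)

lemma face_map:
  assumes "S \<in> faces n"
  shows "face_map S \<in> Delta (card S - 1) n" "inj_on (face_map S) {..card S - 1}"
    "face_map S ` {..card S - 1} = S"
proof -
  let ?L = "sorted_list_of_set S"
  note S = facesD[OF assms]
  have L: "length ?L = card S" "set ?L = S" "sorted ?L" "distinct ?L" using S by auto
  have I: "{..card S - 1} = {..<length ?L}" using S(4) L by auto
  show "face_map S \<in> Delta (card S - 1) n"
    unfolding face_map_def
  proof (rule restrict_Delta)
    fix x assume "x \<le> card S - 1"
    then show "?L ! x \<le> n" using L S nth_mem[of x ?L] by fastforce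
  next
    fix x y assume "x \<le> y" "y \<le> card S - 1"
    then show "?L ! x \<le> ?L ! y" using L S by (intro sorted_nth_mono) auto
  qed
  show "inj_on (face_map S) {..card S - 1}"
    unfolding face_map_def inj_on_restrict_eq I using L by (auto simp: inj_on_def nth_eq_iff_index_eq)
  show "face_map S ` {..card S - 1} = S"
    unfolding face_map_def I using L by (auto simp: set_conv_nth)
qed

lemma sorted_list_of_image:
  assumes "g \<in> Delta l n" "inj_on g {..l}"
  shows "sorted_list_of_set (g ` {..l}) = map g [0..<Suc l]"
proof -
  have "sorted_wrt (<) (map g [0..<Suc l])"
    unfolding sorted_wrt_map
    by (rule sorted_wrt_mono_rel[of _ "(<)"])
       (use Delta_strict[OF assms] in \<open>auto simp del: upt_Suc\<close>)
  then have "sorted_wrt (<) (map g [0..<Suc l]) \<and> set (map g [0..<Suc l]) = g ` {..l} \<and>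
      length (map g [0..<Suc l]) = card (g ` {..l})"
    using assms(2) by (auto simp: card_image atLeast0LessThan lessThan_Suc_atMost simp del: upt_Suc)
  then show ?thesis using sorted_list_of_set_unique[of "g ` {..l}" "map g [0..<Suc l]"] by blast
qed

lemma face_of_map:
  assumes "g \<in> Delta l n" "inj_on g {..l}"
  shows "g ` {..l} \<in> faces n" "card (g ` {..l}) = Suc l" "face_map (g ` {..l}) = g"
proof -
  show "g ` {..l} \<in> faces n" using Delta_le[OF assms(1)] by (auto simp: faces_def)
  show c: "card (g ` {..l}) = Suc l" using assms(2) by (simp add: card_image)
  show "face_map (g ` {..l}) = g"
    unfolding face_map_def c sorted_list_of_image[OF assms]
    using assms(1) by (intro ext) (auto simp: Delta_iff extensional_def less_Suc_eq_le simp del: upt_Suc)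
qed

lemma face_remove:
  assumes "g \<in> Delta (Suc l) n" "inj_on g {..Suc l}" "k \<le> Suc l"
  shows "g ` {..Suc l} - {sorted_list_of_set (g ` {..Suc l}) ! k} = compose {..l} g (coface l k) ` {..l}"
proof -
  have "sorted_list_of_set (g ` {..Suc l}) ! k = g k"
    unfolding sorted_list_of_image[OF assms(1,2)] using assms(3) by (simp del: upt_Suc)
  moreover have "compose {..l} g (coface l k) ` {..l} = g ` (coface l k ` {..l})"
    by (auto simp: compose_def)
  moreover have "g ` ({..Suc l} - {k}) = g ` {..Suc l} - {g k}"
    using inj_on_image_set_diff[OF assms(2), of "{..Suc l}" "{k}"] assms(3) by auto
  ultimately show ?thesis using coface_image[OF assms(3)] by simp
qed

lemma face_mapE:
  assumes "S \<in> faces n"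
  obtains l g where "g \<in> Delta l n" "inj_on g {..l}" "S = g ` {..l}" "card S = Suc l" "g = face_map S"
  using that[OF face_map(1,2)[OF assms] face_map(3)[OF assms, symmetric] Suc_pred'[OF facesD(4)[OF assms]] refl] .

context simplicial_obj
begin

definition canon :: "nat \<Rightarrow> nat set \<Rightarrow> 'm" where
  "canon n S = nd_prj C A (card S - 1) \<bullet>\<^bsub>C\<^esub> act (card S - 1) n (face_map S)"

lemma canon_face:
  assumes "g \<in> Delta l n" "inj_on g {..l}"
  shows "canon n (g ` {..l}) = nd_prj C A l \<bullet>\<^bsub>C\<^esub> act l n g"
  using face_of_map[OF assms] by (simp add: canon_def)

lemma canon_hom: "S \<in> faces n \<Longrightarrow> canon n S \<in> Homs C (sob A n) (nd C A (card S - 1))"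
  unfolding canon_def by (rule cmp_hom[OF act_hom[OF face_map(1)] nd_prj_hom])

text \<open>The operators of A are indexed by maps, so subsets are replaced by the monotone
  injections that enumerate them. Removing the k-th vertex then becomes composition with a
  coface.\<close>

lemma simplex_chain_maps_iff:
  "c \<in> simplex_chain_maps C A n T \<longleftrightarrow>
     (\<forall>S \<in> faces n. c S \<in> Homs C T (nd C A (card S - 1))) \<and>
     (\<forall>l g. g \<in> Delta (Suc l) n \<and> inj_on g {..Suc l} \<longrightarrow>
        nd_diff C A l \<bullet>\<^bsub>C\<^esub> c (g ` {..Suc l}) =
        finsum (H T (nd C A l)) (\<lambda>k. [((-1) ^ k :: int)] \<cdot>\<^bsub>H T (nd C A l)\<^esub> c (compose {..l} g (coface l k) ` {..l})) {..Suc l})"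
  (is "?L \<longleftrightarrow> ?R1 \<and> ?R2")
proof -
  have sum_eq: "finsum (H T (nd C A (card S - 2)))
       (\<lambda>k. [((-1) ^ k :: int)] \<cdot>\<^bsub>H T (nd C A (card S - 2))\<^esub> c (S - {sorted_list_of_set S ! k})) {..<card S} =
     finsum (H T (nd C A l)) (\<lambda>k. [((-1) ^ k :: int)] \<cdot>\<^bsub>H T (nd C A l)\<^esub> c (compose {..l} g (coface l k) ` {..l})) {..Suc l}"
    if c: ?R1 and g: "g \<in> Delta (Suc l) n" "inj_on g {..Suc l}" and S: "S = g ` {..Suc l}" for l g S
  proof -
    have cS: "card S = Suc (Suc l)" using face_of_map[OF g] S by simp
    have T: "T \<in> Obj C" using c face_of_map(1)[OF g] Homs_obj by blast
    have co: "compose {..l} g (coface l k) \<in> Delta l n" "inj_on (compose {..l} g (coface l k)) {..l}" for k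
      using Delta_compose[OF coface_Delta g(1)] inj_compose_Delta[OF coface_Delta inj_coface g(2)] by auto
    have ch: "c (compose {..l} g (coface l k) ` {..l}) \<in> Homs C T (nd C A l)" for k
      using c face_of_map(1,2)[OF co] by fastforce
    have I: "{..<card S} = {..Suc l}" "card S - 2 = l" using cS by auto
    show ?thesis unfolding I
      by (rule finsum_eqI[OF T nd_obj]) (use scal_hom[OF ch] face_remove[OF g] S in auto)
  qed
  show ?thesis
  proof
    assume L: ?L
    then have R1: ?R1 by (auto simp: simplex_chain_maps_def)
    have LS: "nd_diff C A (card S - 2) \<bullet>\<^bsub>C\<^esub> c S = finsum (H T (nd C A (card S - 2)))
       (\<lambda>k. [((-1) ^ k :: int)] \<cdot>\<^bsub>H T (nd C A (card S - 2))\<^esub> c (S - {sorted_list_of_set S ! k})) {..<card S}"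
      if "S \<in> faces n" "2 \<le> card S" for S using L that unfolding simplex_chain_maps_def by blast
    have ?R2
    proof (intro allI impI)
      fix l g assume g: "g \<in> Delta (Suc l) n \<and> inj_on g {..Suc l}"
      then have f: "g ` {..Suc l} \<in> faces n" "card (g ` {..Suc l}) = Suc (Suc l)" using face_of_map by auto
      have "nd_diff C A (card (g ` {..Suc l}) - 2) \<bullet>\<^bsub>C\<^esub> c (g ` {..Suc l}) =
        finsum (H T (nd C A (card (g ` {..Suc l}) - 2)))
       (\<lambda>k. [((-1) ^ k :: int)] \<cdot>\<^bsub>H T (nd C A (card (g ` {..Suc l}) - 2))\<^esub>
          c (g ` {..Suc l} - {sorted_list_of_set (g ` {..Suc l}) ! k})) {..<card (g ` {..Suc l})}"
        by (rule LS[OF f(1)]) (simp add: f(2))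
      then show "nd_diff C A l \<bullet>\<^bsub>C\<^esub> c (g ` {..Suc l}) =
        finsum (H T (nd C A l)) (\<lambda>k. [((-1) ^ k :: int)] \<cdot>\<^bsub>H T (nd C A l)\<^esub> c (compose {..l} g (coface l k) ` {..l})) {..Suc l}"
        using sum_eq[OF R1 _ _ refl, of g l] g f(2) by simp
    qed
    with R1 show "?R1 \<and> ?R2" ..
  next
    assume R: "?R1 \<and> ?R2"
    show ?L unfolding simplex_chain_maps_def
    proof (intro CollectI ballI conjI impI)
      fix S assume S: "S \<in> faces n"
      show "c S \<in> Homs C T (nd C A (card S - 1))" using R S by blast
      assume c2: "2 \<le> card S"
      obtain m g where g: "g \<in> Delta m n" "inj_on g {..m}" "S = g ` {..m}" "card S = Suc m"
        using face_mapE[OF S] by metis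
      then obtain l where m: "m = Suc l" using c2 by (cases m) auto
      have "card S - 2 = l" using g m by simp
      then show "nd_diff C A (card S - 2) \<bullet>\<^bsub>C\<^esub> c S = finsum (H T (nd C A (card S - 2)))
       (\<lambda>k. [((-1) ^ k :: int)] \<cdot>\<^bsub>H T (nd C A (card S - 2))\<^esub> c (S - {sorted_list_of_set S ! k})) {..<card S}"
        using sum_eq[of g l S] R g unfolding m by auto
    qed
  qed
qed

text \<open>The heart of the Dold-Kan correspondence: \<open>sob A n\<close> itself represents the
  chain maps out of the simplex. The classifying arrow exists by \<open>chain_realized\<close> for
  the identity of [n], and it is unique because the nondegenerate faces are jointly monic.\<close>

lemma canon_simplex_Hom: "is_simplex_Hom C A n (sob A n) (canon n)"
  unfolding is_simplex_Hom_def
proof (intro conjI ballI sob_obj)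
  show "canon n \<in> simplex_chain_maps C A n (sob A n)"
    unfolding simplex_chain_maps_iff
  proof (intro conjI ballI allI impI canon_hom)
    fix l g assume g: "g \<in> Delta (Suc l) n \<and> inj_on g {..Suc l}"
    have co: "compose {..l} g (coface l k) \<in> Delta l n" "inj_on (compose {..l} g (coface l k)) {..l}" for k
      using Delta_compose[OF coface_Delta] inj_compose_Delta[OF coface_Delta inj_coface] g by auto
    have "canon n (compose {..l} g (coface l k) ` {..l}) =
        nd_prj C A l \<bullet>\<^bsub>C\<^esub> act l (Suc l) (coface l k) \<bullet>\<^bsub>C\<^esub> act (Suc l) n g" for k
      using canon_face[OF co] act_compose[OF coface_Delta] g by simp
    then show "nd_diff C A l \<bullet>\<^bsub>C\<^esub> canon n (g ` {..Suc l}) = finsum (H (sob A n) (nd C A l))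
        (\<lambda>k. [((-1) ^ k :: int)] \<cdot>\<^bsub>H (sob A n) (nd C A l)\<^esub> canon n (compose {..l} g (coface l k) ` {..l})) {..Suc l}"
      using nd_diff_prj_cmp[OF act_hom] canon_face g by simp
  qed
next
  fix T c assume T: "T \<in> Obj C" and c: "c \<in> simplex_chain_maps C A n T"
  \<comment> \<open>\<open>chain_realized\<close> asks for a value on every monotone map; maps that
    are not injective get 0.\<close>
  define c' where "c' l g = (if inj_on g {..l} then c (g ` {..l}) else Zer C T (nd C A l))" for l g
  have c1: "\<And>S. S \<in> faces n \<Longrightarrow> c S \<in> Homs C T (nd C A (card S - 1))"
    and c2: "\<And>l g. g \<in> Delta (Suc l) n \<Longrightarrow> inj_on g {..Suc l} \<Longrightarrow>
        nd_diff C A l \<bullet>\<^bsub>C\<^esub> c (g ` {..Suc l}) =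
        finsum (H T (nd C A l)) (\<lambda>k. [((-1) ^ k :: int)] \<cdot>\<^bsub>H T (nd C A l)\<^esub> c (compose {..l} g (coface l k) ` {..l})) {..Suc l}"
    using c unfolding simplex_chain_maps_iff by auto
  have co: "inj_on (compose {..l} g (coface l k)) {..l}" if "g \<in> Delta (Suc l) n" "inj_on g {..Suc l}" for g l k
    using inj_compose_Delta[OF coface_Delta inj_coface that(2)] .
  have "\<exists>t \<in> Homs C T (sob A n). \<forall>l h. h \<in> Delta l n \<longrightarrow>
     nd_prj C A l \<bullet>\<^bsub>C\<^esub> act l n h \<bullet>\<^bsub>C\<^esub> t = c' l (compose {..l} (restrict id {..n}) h)"
  proof (rule chain_realized[OF T _ _ _ Delta_id])
    fix l g assume "g \<in> Delta l n"
    then show "c' l g \<in> Homs C T (nd C A l)"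
      using c1[OF face_of_map(1)] face_of_map(2) Zer_hom[OF T nd_obj] by (fastforce simp: c'_def)
  next
    fix l g assume "g \<in> Delta (Suc l) n" "inj_on g {..Suc l}"
    then show "nd_diff C A l \<bullet>\<^bsub>C\<^esub> c' (Suc l) g = finsum (H T (nd C A l))
        (\<lambda>k. [((-1) ^ k :: int)] \<cdot>\<^bsub>H T (nd C A l)\<^esub> c' l (compose {..l} g (coface l k))) {..Suc l}"
      using c2 co by (simp add: c'_def)
  qed (simp add: c'_def)
  then obtain t where t: "t \<in> Homs C T (sob A n)"
    and tc: "\<And>l h. h \<in> Delta l n \<Longrightarrow> nd_prj C A l \<bullet>\<^bsub>C\<^esub> act l n h \<bullet>\<^bsub>C\<^esub> t = c' l h"
    using Delta_compose_id(1) by metis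
  have cf: "canon n (h ` {..l}) \<bullet>\<^bsub>C\<^esub> s = nd_prj C A l \<bullet>\<^bsub>C\<^esub> act l n h \<bullet>\<^bsub>C\<^esub> s"
    if "h \<in> Delta l n" "inj_on h {..l}" "s \<in> Homs C T (sob A n)" for h l s
    using canon_face[OF that(1,2)] cmp_assoc[OF that(3) act_hom[OF that(1)] nd_prj_hom] by simp
  show "\<exists>!t. t \<in> Homs C T (sob A n) \<and> (\<forall>S \<in> faces n. canon n S \<bullet>\<^bsub>C\<^esub> t = c S)"
  proof (rule ex1I[of _ t])
    show "t \<in> Homs C T (sob A n) \<and> (\<forall>S \<in> faces n. canon n S \<bullet>\<^bsub>C\<^esub> t = c S)"
    proof (intro conjI ballI t)
      fix S assume "S \<in> faces n"
      then obtain l g where g: "g \<in> Delta l n" "inj_on g {..l}" "S = g ` {..l}" by (rule face_mapE)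
      show "canon n S \<bullet>\<^bsub>C\<^esub> t = c S" using cf[OF g(1,2) t] tc[OF g(1)] g(2,3) by (simp add: c'_def)
    qed
  next
    fix s assume s: "s \<in> Homs C T (sob A n) \<and> (\<forall>S \<in> faces n. canon n S \<bullet>\<^bsub>C\<^esub> s = c S)"
    show "s = t"
    proof (rule faces_jointly_monic[OF _ t])
      fix l g assume g: "g \<in> Delta l n" "inj_on g {..l}"
      have "canon n (g ` {..l}) \<bullet>\<^bsub>C\<^esub> s = c (g ` {..l})" using s face_of_map(1)[OF g] by blast
      then show "nd_prj C A l \<bullet>\<^bsub>C\<^esub> act l n g \<bullet>\<^bsub>C\<^esub> s = nd_prj C A l \<bullet>\<^bsub>C\<^esub> act l n g \<bullet>\<^bsub>C\<^esub> t"
        using cf[OF g] s tc[OF g(1)] g(2) by (simp add: c'_def)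
    qed (use s in blast)
  qed
qed

section \<open>The chosen Hom object and its canonical isomorphism\<close>

abbreviation "Hob n \<equiv> fst (simplex_Hom C A n)"
abbreviation "Huniv n \<equiv> snd (simplex_Hom C A n)"

lemma simplex_Hom: "is_simplex_Hom C A n (Hob n) (Huniv n)"
proof -
  have "case (sob A n, canon n) of (W, h) \<Rightarrow> is_simplex_Hom C A n W h" using canon_simplex_Hom by simp
  then have "case simplex_Hom C A n of (W, h) \<Rightarrow> is_simplex_Hom C A n W h"
    unfolding simplex_Hom_def by (rule someI)
  then show ?thesis by (simp split: prod.splits)
qed

lemma simplex_classify:
  assumes "T \<in> Obj C" "c \<in> simplex_chain_maps C A n T"
  shows "simplex_classify C A n T c \<in> Homs C T (Hob n)"
    "S \<in> faces n \<Longrightarrow> Huniv n S \<bullet>\<^bsub>C\<^esub> simplex_classify C A n T c = c S"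
proof -
  have "\<exists>!t. t \<in> Homs C T (Hob n) \<and> (\<forall>S \<in> faces n. Huniv n S \<bullet>\<^bsub>C\<^esub> t = c S)"
    using simplex_Hom assms unfolding is_simplex_Hom_def by blast
  from theI'[OF this] show "simplex_classify C A n T c \<in> Homs C T (Hob n)"
    "S \<in> faces n \<Longrightarrow> Huniv n S \<bullet>\<^bsub>C\<^esub> simplex_classify C A n T c = c S"
    unfolding simplex_classify_def by auto
qed

text \<open>Both objects represent the same functor. The claim \<open>comp\<close> says that
  compatible arrows back and forth between two representing objects compose to the identity; it is
  used in both directions.\<close>

lemma simplex_canon_iso:
  shows "simplex_canon C A n \<in> Homs C (sob A n) (Hob n)"
    and "S \<in> faces n \<Longrightarrow> Huniv n S \<bullet>\<^bsub>C\<^esub> simplex_canon C A n = canon n S"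
    and "inverse_arr C (simplex_canon C A n) \<in> Homs C (Hob n) (sob A n)"
    and "S \<in> faces n \<Longrightarrow> canon n S \<bullet>\<^bsub>C\<^esub> inverse_arr C (simplex_canon C A n) = Huniv n S"
proof -
  have U: "\<And>T c. T \<in> Obj C \<Longrightarrow> c \<in> simplex_chain_maps C A n T \<Longrightarrow>
      \<exists>!t. t \<in> Homs C T W \<and> (\<forall>S \<in> faces n. h S \<bullet>\<^bsub>C\<^esub> t = c S)"
    and Uc: "h \<in> simplex_chain_maps C A n W" and Uo: "W \<in> Obj C"
    if "is_simplex_Hom C A n W h" for W h using that unfolding is_simplex_Hom_def by blast+
  have Uh: "h S \<in> Homs C W (nd C A (card S - 1))" if "is_simplex_Hom C A n W h" "S \<in> faces n" for W h S
    using Uc[OF that(1)] that(2) unfolding simplex_chain_maps_def by blast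
  have comp: "b \<bullet>\<^bsub>C\<^esub> a = Ide C W"
    if W: "is_simplex_Hom C A n W h" and W': "is_simplex_Hom C A n W' h'"
      and a: "a \<in> Homs C W W'" "\<And>S. S \<in> faces n \<Longrightarrow> h' S \<bullet>\<^bsub>C\<^esub> a = h S"
      and b: "b \<in> Homs C W' W" "\<And>S. S \<in> faces n \<Longrightarrow> h S \<bullet>\<^bsub>C\<^esub> b = h' S" for W h W' h' a b
  proof -
    have "h S \<bullet>\<^bsub>C\<^esub> (b \<bullet>\<^bsub>C\<^esub> a) = h S" "h S \<bullet>\<^bsub>C\<^esub> Ide C W = h S" if "S \<in> faces n" for S
      using cmp_assoc[OF a(1) b(1) Uh[OF W that]] a(2)[OF that] b(2)[OF that] cmp_ide[OF Uh[OF W that]] by auto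
    then show ?thesis using U[OF W Uo[OF W] Uc[OF W]] cmp_hom[OF a(1) b(1)] ide_hom[OF Uo[OF W]] by blast
  qed
  note c = canon_simplex_Hom[of n] and s = simplex_Hom[of n]
  have eq: "simplex_canon C A n = simplex_classify C A n (sob A n) (canon n)"
    unfolding simplex_canon_def canon_def face_map_def by simp
  have k: "simplex_canon C A n \<in> Homs C (sob A n) (Hob n)"
    "\<And>S. S \<in> faces n \<Longrightarrow> Huniv n S \<bullet>\<^bsub>C\<^esub> simplex_canon C A n = canon n S"
    unfolding eq using simplex_classify[OF sob_obj Uc[OF c]] by auto
  obtain l where l: "l \<in> Homs C (Hob n) (sob A n)" "\<And>S. S \<in> faces n \<Longrightarrow> canon n S \<bullet>\<^bsub>C\<^esub> l = Huniv n S"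
    using U[OF c Uo[OF s] Uc[OF s]] by blast
  have inv: "inverse_arr C (simplex_canon C A n) = l"
    by (rule inverse_arr_eqI[OF k(1) l(1) comp[OF c s k l] comp[OF s c l k]])
  show "simplex_canon C A n \<in> Homs C (sob A n) (Hob n)"
    "S \<in> faces n \<Longrightarrow> Huniv n S \<bullet>\<^bsub>C\<^esub> simplex_canon C A n = canon n S" using k by auto
  show "inverse_arr C (simplex_canon C A n) \<in> Homs C (Hob n) (sob A n)"
    "S \<in> faces n \<Longrightarrow> canon n S \<bullet>\<^bsub>C\<^esub> inverse_arr C (simplex_canon C A n) = Huniv n S" using l inv by auto
qed

end

section \<open>Signs\<close>

lemma sorting_permutation_unique:
  assumes "distinct xs" "p permutes {..<length xs}" "q permutes {..<length xs}"
    "permute_list p xs = permute_list q xs"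
  shows "p = q"
proof
  fix i show "p i = q i"
  proof (cases "i < length xs")
    case True
    then have "xs ! p i = xs ! q i"
      using assms(4) permute_list_nth[OF assms(2) True] permute_list_nth[OF assms(3) True] by simp
    moreover have "p i < length xs" "q i < length xs"
      using True permutes_in_image[OF assms(2), of i] permutes_in_image[OF assms(3), of i] by auto
    ultimately show ?thesis using assms(1) by (simp add: nth_eq_iff_index_eq)
  next
    case False
    then show ?thesis using assms(2,3) by (simp add: permutes_def)
  qed
qed

lemma sort_sign_eqI:
  assumes "distinct xs" "p permutes {..<length xs}" "permute_list p xs = sort xs"
  shows "sort_sign xs = sign p"
proof -
  have "(THE p. p permutes {..<length xs} \<and> permute_list p xs = sort xs) = p"
  proof (rule the_equality)
    fix q assume q: "q permutes {..<length xs} \<and> permute_list q xs = sort xs"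
    show "q = p" by (rule sorting_permutation_unique[OF assms(1)]) (use q assms in simp_all)
  qed (use assms in simp)
  then show ?thesis by (simp add: sort_sign_def)
qed

text \<open>If p sorts xs, then the composite of p with the inverse of q sorts the permuted list.
  Signs are multiplicative and invariant under inversion.\<close>

lemma sort_sign_permute:
  assumes "distinct xs" "q permutes {..<length xs}"
  shows "sort_sign (permute_list q xs) = sign q * sort_sign xs"
proof -
  obtain p where p: "p permutes {..<length xs}" "permute_list p xs = sort xs"
    using mset_eq_permutation[of "sort xs" xs] by auto
  have iq: "inv_into UNIV q permutes {..<length xs}" by (rule permutes_inv[OF assms(2)])
  have "permute_list (inv_into UNIV q \<circ> p) (permute_list q xs) = permute_list (q \<circ> (inv_into UNIV q \<circ> p)) xs"
    using permute_list_compose[OF permutes_compose[OF p(1) iq], of q] by simp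
  also have "q \<circ> (inv_into UNIV q \<circ> p) = p" using permutes_surj[OF assms(2)] by (simp add: surj_f_inv_f fun_eq_iff)
  finally have "permute_list (inv_into UNIV q \<circ> p) (permute_list q xs) = sort (permute_list q xs)"
    using p(2) assms(2) by (metis mset_permute_list sorted_list_of_multiset_mset)
  then have "sort_sign (permute_list q xs) = sign (inv_into UNIV q \<circ> p)"
    using assms permutes_compose[OF p(1) iq] by (intro sort_sign_eqI) auto
  also have "\<dots> = sign q * sign p"
  proof -
    have "permutation p" "permutation q" "permutation (inv_into UNIV q)"
      using p(1) assms(2) iq unfolding permutation_permutes by blast+
    then show ?thesis by (simp add: sign_compose sign_inverse)
  qed
  finally show ?thesis using sort_sign_eqI[OF assms(1) p] by simp
qed

lemma sort_sign_sorted: "sorted xs \<Longrightarrow> distinct xs \<Longrightarrow> sort_sign xs = 1"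
  using sort_sign_eqI[of xs id] by (simp add: sorted_sort_id)

section \<open>Adjacent transpositions and bubble sort\<close>

lemma sort_sign_swap:
  assumes "distinct (xs @ a # b # ys)"
  shows "sort_sign (xs @ b # a # ys) = - sort_sign (xs @ a # b # ys)"
proof -
  let ?l = "xs @ a # b # ys" and ?q = "Transposition.transpose (length xs) (Suc (length xs))"
  have q: "?q permutes {..<length ?l}" by (rule permutes_swap_id) auto
  have "permute_list ?q ?l = xs @ b # a # ys"
    by (rule nth_equalityI)
       (use permute_list_nth[OF q] in \<open>auto simp: nth_append nth_Cons' transpose_def\<close>)
  then show ?thesis using sort_sign_permute[OF assms q] by (simp add: sign_swap_id)
qed

text \<open>A measure for bubble sort: earlier entries count with larger factors, so exchanging an
  adjacent descent lowers it.\<close>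

fun weight :: "nat list \<Rightarrow> nat" where
  "weight [] = 0"
| "weight (x # xs) = Suc (length xs) * x + weight xs"

lemma weight_swap: "b < a \<Longrightarrow> weight (xs @ b # a # ys) < weight (xs @ a # b # ys)"
proof (induction xs)
  case Nil
  then obtain d where "a = b + Suc d" using less_imp_Suc_add by auto
  then show ?case by (simp add: algebra_simps)
qed simp

lemma not_sorted_descent: "\<not> sorted (ws :: nat list) \<Longrightarrow> \<exists>xs a b ys. ws = xs @ a # b # ys \<and> b < a"
proof (induction ws)
  case (Cons w ws)
  show ?case
  proof (cases "sorted ws")
    case False
    then show ?thesis using Cons.IH by (metis append_Cons)
  next
    case True
    then obtain b ys where "ws = b # ys" "b < w" using Cons.prems by (cases ws) force+
    then show ?thesis by (metis append_Nil)
  qed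
qed simp

text \<open>Bubble sort as an induction principle. It reduces statements whose two sides change in
  the same way under an adjacent exchange to sorted lists.\<close>

lemma bubble_induct [case_names sorted swap]:
  assumes "\<And>ws. sorted ws \<Longrightarrow> P ws"
    and "\<And>xs a b ys. b < a \<Longrightarrow> P (xs @ b # a # ys) \<Longrightarrow> P (xs @ a # b # ys)"
  shows "P (ws :: nat list)"
proof (induction "weight ws" arbitrary: ws rule: less_induct)
  case less
  show ?case
  proof (cases "sorted ws")
    case False
    then obtain xs a b ys where "ws = xs @ a # b # ys" "b < a" using not_sorted_descent by blast
    then show ?thesis using less weight_swap assms(2) by blast
  qed (rule assms(1))
qed

lemma sort_sign_Cons_0: "0 \<notin> set ws \<Longrightarrow> distinct ws \<Longrightarrow> sort_sign (0 # ws) = sort_sign ws"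
proof (induction ws rule: bubble_induct)
  case (sorted ws)
  then show ?case by (simp add: sort_sign_sorted)
next
  case (swap xs a b ys)
  then show ?case using sort_sign_swap[of xs b a ys] sort_sign_swap[of "0 # xs" b a ys] by auto
qed

text \<open>The positions of an omitted index k relative to the adjacent pair at i and i + 1. The
  last case has the shape that \<open>drop_nth_append\<close> and \<open>drop_nth_Cons\<close> can
  rewrite.\<close>

lemma adjacent_cases:
  fixes k i :: nat
  obtains "k = i" | "k = Suc i" | "k < i" | m where "k = i + Suc (Suc m)"
proof -
  have "k = i \<or> k = Suc i \<or> k < i \<or> k = i + Suc (Suc (k - i - 2))" by arith
  then show thesis using that by blast
qed

lemma fold_map_le: "x \<le> n + n + 1 \<Longrightarrow> fold_map n x \<le> n"
  by (auto simp: fold_map_def)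

section \<open>Faces of ordered simplices and alternating cochains\<close>

definition drop_nth :: "nat \<Rightarrow> 'a list \<Rightarrow> 'a list" where
  "drop_nth k xs = take k xs @ drop (Suc k) xs"

lemma drop_nth_append:
  "k < length xs \<Longrightarrow> drop_nth k (xs @ ys) = drop_nth k xs @ ys"
  "drop_nth (length xs + k) (xs @ ys) = xs @ drop_nth k ys"
  by (auto simp: drop_nth_def)

lemma drop_nth_Cons: "drop_nth 0 (x # xs) = xs" "drop_nth (Suc k) (x # xs) = x # drop_nth k xs"
  by (auto simp: drop_nth_def)

lemma length_drop_nth: "k < length xs \<Longrightarrow> length (drop_nth k xs) = length xs - 1"
  by (auto simp: drop_nth_def)

lemma set_drop_nth: "set (drop_nth k xs) \<subseteq> set xs"
  using set_take_subset set_drop_subset by (fastforce simp: drop_nth_def)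

lemma drop_nth_map: "drop_nth k (map f xs) = map f (drop_nth k xs)"
  by (simp add: drop_nth_def take_map drop_map)

lemma drop_nth_sorted:
  assumes "sorted xs" "distinct xs" "k < length xs"
  shows "drop_nth k xs = sorted_list_of_set (set xs - {xs ! k})"
proof -
  have xs: "xs = take k xs @ xs ! k # drop (Suc k) xs" using assms(3) by (rule id_take_nth_drop)
  have "remove1 (xs ! k) xs = drop_nth k xs"
    unfolding drop_nth_def using assms(2,3)
    by (subst (2) xs, subst remove1_append) (auto simp: in_set_conv_nth nth_eq_iff_index_eq)
  moreover have "sorted_list_of_set (set xs - {xs ! k}) = remove1 (xs ! k) xs"
    using assms by (simp add: sorted_list_of_set_remove sorted_list_of_set.idem_if_sorted_distinct)
  ultimately show ?thesis by simp
qed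

context simplicial_obj
begin

text \<open>The extension of a cochain on the faces of a simplex to an alternating function of ordered
  simplices. In this form, the cochain condition is invariant under transpositions, so that it need
  only be checked on sorted simplices.\<close>

definition alternating :: "'o \<Rightarrow> (nat set \<Rightarrow> 'm) \<Rightarrow> nat list \<Rightarrow> 'm" where
  "alternating T c ws = (if distinct ws
     then [(sort_sign ws)] \<cdot>\<^bsub>H T (nd C A (length ws - 1))\<^esub> c (set ws)
     else Zer C T (nd C A (length ws - 1)))"

context
  fixes n T c
  assumes T: "T \<in> Obj C" and c: "c \<in> simplex_chain_maps C A n T"
begin

lemma alternating_hom:
  assumes "set ws \<subseteq> {..n}" "ws \<noteq> []"
  shows "alternating T c ws \<in> Homs C T (nd C A (length ws - 1))"
proof (cases "distinct ws")
  case True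
  then have "card (set ws) = length ws" "set ws \<in> faces n" using assms by (auto simp: distinct_card faces_def)
  then show ?thesis using c True scal_hom unfolding simplex_chain_maps_iff alternating_def by fastforce
qed (simp add: alternating_def Zer_hom T nd_obj)

lemma alternating_swap:
  assumes "set (xs @ a # b # ys) \<subseteq> {..n}"
  shows "alternating T c (xs @ a # b # ys) =
    [(-1::int)] \<cdot>\<^bsub>H T (nd C A (length (xs @ a # b # ys) - 1))\<^esub> alternating T c (xs @ b # a # ys)"
proof (cases "distinct (xs @ a # b # ys)")
  case True
  have d: "distinct (xs @ b # a # ys)" and s: "set (xs @ b # a # ys) = set (xs @ a # b # ys)" using True by auto
  let ?S = "set (xs @ a # b # ys)"
  have "?S \<in> faces n" using assms by (auto simp: faces_def)
  moreover have "card ?S = length (xs @ a # b # ys)" using True by (rule distinct_card)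
  ultimately have "c ?S \<in> Homs C T (nd C A (length (xs @ a # b # ys) - 1))"
    using c unfolding simplex_chain_maps_iff by metis
  from scal_scal[OF this, of "-1" "sort_sign (xs @ b # a # ys)"] show ?thesis
    unfolding alternating_def s using True d sort_sign_swap[OF True] by simp
next
  case False
  have d: "\<not> distinct (xs @ b # a # ys)" using False by auto
  have "alternating T c (xs @ a # b # ys) = Zer C T (nd C A (length (xs @ a # b # ys) - 1))"
    "alternating T c (xs @ b # a # ys) = Zer C T (nd C A (length (xs @ a # b # ys) - 1))"
    unfolding alternating_def using False d by (simp_all only: if_False) simp
  then show ?thesis using scal_zero[OF T nd_obj] by simp
qed

text \<open>For sorted lists without repetition this is the chain condition. If two neighbours
  agree, the left side is 0 and the two faces omitting one of them cancel. An adjacent exchange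
  changes the sign of the left side; on the right side it swaps the two faces at that place, whose
  signs differ, and flips the sign of each other face.\<close>

lemma alternating_diff:
  assumes "set ws \<subseteq> {..n}" "length ws = Suc (Suc l)"
  shows "nd_diff C A l \<bullet>\<^bsub>C\<^esub> alternating T c ws = finsum (H T (nd C A l))
    (\<lambda>k. [((-1) ^ k :: int)] \<cdot>\<^bsub>H T (nd C A l)\<^esub> alternating T c (drop_nth k ws)) {..Suc l}"
  using assms
proof (induction ws rule: bubble_induct)
  case (sorted ws)
  have dh: "alternating T c (drop_nth k ws) \<in> Homs C T (nd C A l)" if "k \<le> Suc l" for k
    using that sorted set_drop_nth[of k ws] length_drop_nth[of k ws]
    alternating_hom[of "drop_nth k ws"] by force
  show ?case
  proof (cases "distinct ws")
    case True
    let ?S = "set ws"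
    have S: "?S \<in> faces n" "card ?S = Suc (Suc l)" using sorted True by (auto simp: faces_def distinct_card)
    have L: "sorted_list_of_set ?S = ws" using sorted True by (simp add: sorted_list_of_set.idem_if_sorted_distinct)
    have cS: "c ?S \<in> Homs C T (nd C A (Suc l))" using c S unfolding simplex_chain_maps_iff by force
    have "nd_diff C A (card ?S - 2) \<bullet>\<^bsub>C\<^esub> c ?S = finsum (H T (nd C A (card ?S - 2)))
       (\<lambda>k. [((-1) ^ k :: int)] \<cdot>\<^bsub>H T (nd C A (card ?S - 2))\<^esub> c (?S - {sorted_list_of_set ?S ! k})) {..<card ?S}"
      using c S unfolding simplex_chain_maps_def by fastforce
    then have eq: "nd_diff C A l \<bullet>\<^bsub>C\<^esub> c ?S = finsum (H T (nd C A l))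
       (\<lambda>k. [((-1) ^ k :: int)] \<cdot>\<^bsub>H T (nd C A l)\<^esub> c (?S - {ws ! k})) {..Suc l}"
      unfolding S L by (simp add: lessThan_Suc_atMost)
    have alt: "alternating T c ws = c ?S"
      using True scal_1[OF cS] sort_sign_sorted sorted by (simp add: alternating_def)
    have alt_drop: "alternating T c (drop_nth k ws) = c (?S - {ws ! k})" if "k \<le> Suc l" for k
    proof -
      have k: "k < length ws" using that sorted by simp
      note d = drop_nth_sorted[OF sorted(1) True k]
      have s: "set (drop_nth k ws) = ?S - {ws ! k}" "distinct (drop_nth k ws)" "sorted (drop_nth k ws)"
        unfolding d by auto
      have l: "length (drop_nth k ws) = Suc l" using length_drop_nth[OF k] sorted by simp
      have "card (?S - {ws ! k}) = Suc l" using s l distinct_card by metis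
      moreover from this have "?S - {ws ! k} \<noteq> {}" by (metis card.empty nat.distinct(1))
      then have "?S - {ws ! k} \<in> faces n" using sorted by (auto simp: faces_def)
      ultimately have "c (?S - {ws ! k}) \<in> Homs C T (nd C A l)" using c unfolding simplex_chain_maps_iff by force
      then show ?thesis unfolding alternating_def s l using s sort_sign_sorted scal_1 by simp
    qed
    show ?thesis
      unfolding alt eq by (rule finsum_eqI[OF T nd_obj]) (use alt_drop scal_hom[OF dh] in simp_all)
  next
    case False
    then have "\<not> sorted_wrt (<) ws" using strict_sorted_iff by blast
    \<comment> \<open>A sorted list that is not strictly increasing has two equal
      neighbours.\<close>
    then obtain xs a ys where ws: "ws = xs @ a # a # ys"
      using sorted(1)
    proof (induction ws arbitrary: thesis)
      case (Cons w ws)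
      show ?case
      proof (cases "sorted_wrt (<) ws")
        case False
        then obtain xs a ys where "ws = xs @ a # a # ys" using Cons.IH[OF _ False] Cons.prems(3) by auto
        then show ?thesis using Cons.prems(1)[of "w # xs" a ys] by simp
      next
        case True
        then obtain b ys where b: "ws = b # ys" "\<not> w < b" using Cons.prems(2) by (cases ws) force+
        then have "b = w" using Cons.prems(3) by auto
        then show ?thesis using Cons.prems(1)[of "[]" w ys] b by simp
      qed
    qed simp
    let ?i = "length xs"
    \<comment> \<open>The two faces that omit one of the equal entries are the same list, with
      opposite signs; every other face still contains the repetition.\<close>
    let ?c = "\<lambda>k. (if k = ?i then (-1) ^ ?i else 0) + (if k = Suc ?i then - ((-1) ^ ?i) else 0) :: int"
    let ?x = "alternating T c (xs @ a # ys)"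
    have x: "?x \<in> Homs C T (nd C A l)" using alternating_hom[of "xs @ a # ys"] sorted ws by auto
    have i: "?i \<le> l" using sorted ws by simp
    have "finsum (H T (nd C A l)) (\<lambda>k. [((-1) ^ k :: int)] \<cdot>\<^bsub>H T (nd C A l)\<^esub> alternating T c (drop_nth k ws)) {..Suc l}
       = finsum (H T (nd C A l)) (\<lambda>k. [(?c k)] \<cdot>\<^bsub>H T (nd C A l)\<^esub> ?x) {..Suc l}"
    proof (rule finsum_eqI[OF T nd_obj])
      fix k assume k: "k \<in> {..Suc l}"
      show "[((-1) ^ k :: int)] \<cdot>\<^bsub>H T (nd C A l)\<^esub> alternating T c (drop_nth k ws) = [(?c k)] \<cdot>\<^bsub>H T (nd C A l)\<^esub> ?x"
      proof (cases rule: adjacent_cases[of k ?i])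
        case 1 then show ?thesis
          using drop_nth_append(2)[of xs 0 "a # a # ys"] by (simp add: ws drop_nth_Cons)
      next
        case 2 then show ?thesis
          using drop_nth_append(2)[of xs 1 "a # a # ys"] by (simp add: ws drop_nth_Cons)
      next
        case 3
        have "length (drop_nth k ws) - 1 = l" using 3 length_drop_nth[of k ws] sorted by (simp add: ws)
        moreover have "\<not> distinct (drop_nth k ws)" using 3 by (simp add: ws drop_nth_append)
        ultimately have "alternating T c (drop_nth k ws) = Zer C T (nd C A l)" by (simp add: alternating_def)
        then show ?thesis using 3 by (simp add: scal_zero T nd_obj scal_0)
      next
        case (4 m)
        have "alternating T c (drop_nth k ws) = Zer C T (nd C A l)"
          using 4 length_drop_nth[of k ws] sorted k drop_nth_append(2)[of xs "Suc (Suc m)" "a # a # ys"]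
          by (simp add: alternating_def ws drop_nth_Cons)
        then show ?thesis using 4 by (simp add: scal_zero T nd_obj scal_0)
      qed
    qed (rule scal_hom[OF x])
    also have "\<dots> = [(sum ?c {..Suc l})] \<cdot>\<^bsub>H T (nd C A l)\<^esub> ?x" by (rule finsum_scal[OF x]) simp
    also have "sum ?c {..Suc l} = 0" unfolding sum.distrib using i by (simp del: sum.atMost_Suc)
    finally show ?thesis
      using sorted cmp_zero_right[OF nd_diff_hom T] by (simp add: scal_0 alternating_def False)
  qed
next
  case (swap xs a b ys)
  let ?H = "H T (nd C A l)" and ?i = "length xs"
  let ?u = "xs @ a # b # ys" and ?v = "xs @ b # a # ys"
  let ?\<pi> = "Transposition.transpose ?i (Suc ?i)"
  have v: "set ?v \<subseteq> {..n}" "length ?v = Suc (Suc l)" using swap.prems by auto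
  note IH = swap.IH[OF v]
  have i: "?i \<le> l" using swap.prems by simp
  have dh: "alternating T c (drop_nth k w) \<in> Homs C T (nd C A l)"
    if "k \<le> Suc l" "set w \<subseteq> {..n}" "length w = Suc (Suc l)" for k w
    using that set_drop_nth[of k w] length_drop_nth[of k w] alternating_hom[of "drop_nth k w"] by force
  have vh: "alternating T c ?v \<in> Homs C T (nd C A (Suc l))" using alternating_hom[OF v(1)] v(2) by simp
  let ?f = "\<lambda>k. [((-1) ^ k :: int)] \<cdot>\<^bsub>?H\<^esub> alternating T c (drop_nth k ?u)"
  let ?g = "\<lambda>k. [((-1) ^ k :: int)] \<cdot>\<^bsub>?H\<^esub> alternating T c (drop_nth k ?v)"
  interpret A: abelian_group ?H by (rule hom_abelian_group[OF T nd_obj])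
  have \<pi>: "?\<pi> k \<in> {..Suc l}" if "k \<in> {..Suc l}" for k using that i by (auto simp: transpose_def)
  have fg: "?f (?\<pi> k) = [(-1::int)] \<cdot>\<^bsub>?H\<^esub> ?g k" if k: "k \<in> {..Suc l}" for k
  proof -
    note h = dh[of k ?v] 
    have uh: "alternating T c (drop_nth k ?v) \<in> Homs C T (nd C A l)" using dh[of k ?v] k v by simp
    show ?thesis
    proof (cases rule: adjacent_cases[of k ?i])
      case 1
      have "drop_nth (Suc ?i) ?u = drop_nth ?i ?v"
        using drop_nth_append(2)[of xs 1 "a # b # ys"] drop_nth_append(2)[of xs 0 "b # a # ys"]
        by (simp add: drop_nth_Cons)
      then show ?thesis using 1 uh by (simp add: scal_scal)
    next
      case 2
      have "drop_nth ?i ?u = drop_nth (Suc ?i) ?v"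
        using drop_nth_append(2)[of xs 0 "a # b # ys"] drop_nth_append(2)[of xs 1 "b # a # ys"]
        by (simp add: drop_nth_Cons)
      then show ?thesis using 2 uh by (simp add: scal_scal)
    next
      case 3
      have "alternating T c (drop_nth k ?u) = [(-1::int)] \<cdot>\<^bsub>?H\<^esub> alternating T c (drop_nth k ?v)"
        using 3 alternating_swap[of "drop_nth k xs" a b ys] set_drop_nth[of k ?u] swap.prems
          length_drop_nth[of k ?u] by (force simp: drop_nth_append)
      then show ?thesis using 3 uh by (simp add: scal_scal mult.commute)
    next
      case (4 m)
      have "alternating T c (drop_nth k ?u) = [(-1::int)] \<cdot>\<^bsub>?H\<^esub> alternating T c (drop_nth k ?v)"
        using 4 alternating_swap[of xs a b "drop_nth m ys"] set_drop_nth[of k ?u] swap.prems k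
          length_drop_nth[of k ?u] drop_nth_append(2)[of xs "Suc (Suc m)" "a # b # ys"]
          drop_nth_append(2)[of xs "Suc (Suc m)" "b # a # ys"] by (force simp: drop_nth_Cons)
      then show ?thesis using 4 uh by (simp add: scal_scal mult.commute)
    qed
  qed
  have gh: "?g k \<in> Homs C T (nd C A l)" if "k \<in> {..Suc l}" for k using that dh[of k ?v] v scal_hom by simp
  have fh: "?f k \<in> Homs C T (nd C A l)" if "k \<in> {..Suc l}" for k using that dh[of k ?u] swap.prems scal_hom by simp
  have im: "?\<pi> ` {..Suc l} = {..Suc l}" using i by (intro transpose_image_eq) auto
  \<comment> \<open>Reindexing by the transposition matches each face of one list with a face of the
    other, up to the common sign -1.\<close>
  have "finsum ?H ?f {..Suc l} = finsum ?H ?f (?\<pi> ` {..Suc l})" using im by simp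
  also have "\<dots> = finsum ?H (\<lambda>k. ?f (?\<pi> k)) {..Suc l}"
    by (rule A.finsum_reindex) (use fh im in \<open>auto intro: inj_on_subset[OF inj_transpose]\<close>)
  also have "\<dots> = finsum ?H (\<lambda>k. [(-1::int)] \<cdot>\<^bsub>?H\<^esub> ?g k) {..Suc l}"
    by (rule finsum_eqI[OF T nd_obj fg]) (use gh scal_hom in auto)
  also have "\<dots> = [(-1::int)] \<cdot>\<^bsub>?H\<^esub> finsum ?H ?g {..Suc l}"
    by (rule scal_finsum[OF T nd_obj gh, symmetric])
  also have "\<dots> = [(-1::int)] \<cdot>\<^bsub>?H\<^esub> (nd_diff C A l \<bullet>\<^bsub>C\<^esub> alternating T c ?v)" using IH by simp
  also have "\<dots> = nd_diff C A l \<bullet>\<^bsub>C\<^esub> alternating T c ?u"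
    using alternating_swap[OF swap.prems(1)] cmp_scal_right[OF vh nd_diff_hom] swap.prems(2) by simp
  finally show ?case ..
qed

lemma simplex_pull_alternating:
  assumes "S \<in> faces m"
  shows "simplex_pull C A \<theta> T c S = alternating T c (map \<theta> (sorted_list_of_set S))"
  using facesD[OF assms] by (simp add: simplex_pull_def alternating_def distinct_map)

text \<open>The pulled back cochain is the alternating extension evaluated on image lists, so the
  cochain condition for ordered simplices settles it. No monotonicity of \<theta> enters, and this
  makes the fold map admissible.\<close>

lemma simplex_pull_chain_map:
  assumes \<theta>: "\<And>x. x \<le> m \<Longrightarrow> \<theta> x \<le> n"
  shows "simplex_pull C A \<theta> T c \<in> simplex_chain_maps C A m T"
  unfolding simplex_chain_maps_def
proof (intro CollectI ballI conjI impI)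
  fix S assume S: "S \<in> faces m"
  note SD = facesD[OF S]
  let ?L = "sorted_list_of_set S"
  have L: "length ?L = card S" "set ?L = S" "sorted ?L" "distinct ?L" using SD by auto
  have sub: "set (map \<theta> ?L) \<subseteq> {..n}" using L SD \<theta> by auto
  show "simplex_pull C A \<theta> T c S \<in> Homs C T (nd C A (card S - 1))"
    unfolding simplex_pull_alternating[OF S] using alternating_hom[OF sub] SD by auto
  assume "2 \<le> card S"
  define l where "l = card S - 2"
  have l: "card S = Suc (Suc l)" using \<open>2 \<le> card S\<close> unfolding l_def by simp
  have I: "{..<card S} = {..Suc l}" "card S - 2 = l" using l by auto
  have eq: "simplex_pull C A \<theta> T c (S - {?L ! k}) = alternating T c (drop_nth k (map \<theta> ?L))" if "k \<le> Suc l" for k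
  proof -
    have k: "k < length ?L" using that l L by simp
    define R where "R = S - {?L ! k}"
    have "card R = Suc l" using nth_mem[OF k] L(2) l unfolding R_def by simp
    then have "R \<noteq> {}" by auto
    then have "R \<in> faces m" using SD by (auto simp: faces_def R_def)
    then have "S - {?L ! k} \<in> faces m" by (simp add: R_def)
    then show ?thesis
      unfolding drop_nth_map drop_nth_sorted[OF L(3,4) k] L(2) by (rule simplex_pull_alternating)
  qed
  have dh: "alternating T c (drop_nth k (map \<theta> ?L)) \<in> Homs C T (nd C A l)" if "k \<le> Suc l" for k
    using that set_drop_nth[of k "map \<theta> ?L"] length_drop_nth[of k "map \<theta> ?L"] sub l L
      alternating_hom[of "drop_nth k (map \<theta> ?L)"] by force
  show "nd_diff C A (card S - 2) \<bullet>\<^bsub>C\<^esub> simplex_pull C A \<theta> T c S = finsum (H T (nd C A (card S - 2)))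
    (\<lambda>k. [((-1) ^ k :: int)] \<cdot>\<^bsub>H T (nd C A (card S - 2))\<^esub> simplex_pull C A \<theta> T c (S - {?L ! k})) {..<card S}"
    unfolding I simplex_pull_alternating[OF S]
    using alternating_diff[OF sub, of l] L l
    by (auto intro!: finsum_eqI[OF T nd_obj, symmetric] simp: eq dh scal_hom)
qed

end

text \<open>The choices cancel: the canonical isomorphism at the target undoes the universal chain
  map there, and the one at the source replaces the universal chain map by restriction to faces. The
  signed face of the folded vertices remains.\<close>

lemma canon_gamma:
  assumes S: "S \<in> faces (n + n + 1)"
  shows "canon (n + n + 1) S \<bullet>\<^bsub>C\<^esub> Ez_gamma C A n = simplex_pull C A (fold_map n) (sob A n) (canon n) S"
    and "Ez_gamma C A n \<in> Homs C (sob A n) (sob A (n + n + 1))"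
proof -
  let ?N = "n + n + 1"
  have Ho: "Hob n \<in> Obj C" and Hc: "Huniv n \<in> simplex_chain_maps C A n (Hob n)"
    using simplex_Hom unfolding is_simplex_Hom_def by blast+
  note k = simplex_canon_iso[where n = n] and K = simplex_canon_iso[where n = ?N]
  note pull = simplex_pull_chain_map[OF Ho Hc fold_map_le]
  have a: "simplex_Hom_act C A ?N n (fold_map n) \<in> Homs C (Hob n) (Hob ?N)"
    "Huniv ?N S \<bullet>\<^bsub>C\<^esub> simplex_Hom_act C A ?N n (fold_map n) = simplex_pull C A (fold_map n) (Hob n) (Huniv n) S"
    unfolding simplex_Hom_act_def using simplex_classify[OF Ho pull] S by auto
  have ak: "simplex_Hom_act C A ?N n (fold_map n) \<bullet>\<^bsub>C\<^esub> simplex_canon C A n \<in> Homs C (sob A n) (Hob ?N)"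
    by (rule cmp_hom[OF k(1) a(1)])
  show "Ez_gamma C A n \<in> Homs C (sob A n) (sob A ?N)"
    unfolding Ez_gamma_def by (rule cmp_hom[OF ak K(3)])
  have "canon ?N S \<bullet>\<^bsub>C\<^esub> Ez_gamma C A n
      = (canon ?N S \<bullet>\<^bsub>C\<^esub> inverse_arr C (simplex_canon C A ?N)) \<bullet>\<^bsub>C\<^esub>
        (simplex_Hom_act C A ?N n (fold_map n) \<bullet>\<^bsub>C\<^esub> simplex_canon C A n)"
    unfolding Ez_gamma_def by (rule cmp_assoc[OF ak K(3) canon_hom[OF S], symmetric])
  also have "\<dots> = Huniv ?N S \<bullet>\<^bsub>C\<^esub> simplex_Hom_act C A ?N n (fold_map n) \<bullet>\<^bsub>C\<^esub> simplex_canon C A n"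
    using K(4)[OF S] by simp
  also have "\<dots> = (Huniv ?N S \<bullet>\<^bsub>C\<^esub> simplex_Hom_act C A ?N n (fold_map n)) \<bullet>\<^bsub>C\<^esub> simplex_canon C A n"
  proof (rule cmp_assoc[OF k(1) a(1), symmetric])
    show "Huniv ?N S \<in> Homs C (Hob ?N) (nd C A (card S - 1))"
      using simplex_Hom[of ?N] S unfolding is_simplex_Hom_def simplex_chain_maps_def by blast
  qed
  also have "\<dots> = simplex_pull C A (fold_map n) (Hob n) (Huniv n) S \<bullet>\<^bsub>C\<^esub> simplex_canon C A n"
    using a(2) by simp
  also have "\<dots> = simplex_pull C A (fold_map n) (sob A n) (canon n) S"
  proof (cases "inj_on (fold_map n) S")
    case True
    have f: "fold_map n ` S \<in> faces n" using facesD[OF S] fold_map_le by (auto simp: faces_def)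
    have "card (fold_map n ` S) = card S" using True by (rule card_image)
    then have "Huniv n (fold_map n ` S) \<in> Homs C (Hob n) (nd C A (card S - 1))"
      using Hc f unfolding simplex_chain_maps_def by fastforce
    from cmp_scal_left[OF k(1) this] show ?thesis
      using True k(2)[OF f] by (simp add: simplex_pull_def)
  next
    case False
    then show ?thesis using cmp_zero_left[OF k(1) nd_obj] by (simp add: simplex_pull_def)
  qed
  finally show "canon ?N S \<bullet>\<^bsub>C\<^esub> Ez_gamma C A n = simplex_pull C A (fold_map n) (sob A n) (canon n) S" .
qed

end

subsection \<open>Determinants of fold matrices\<close>

text \<open>The rows are the unit vectors of the entries of ws, so in the Leibniz formula only a
  permutation that coincides with ws can contribute. There is exactly one if the entries are
  distinct, and its sign is the sorting sign; otherwise there is none.\<close>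

lemma det_list_matrix:
  assumes "length ws = m" "set ws \<subseteq> {..<m}"
  shows "det (mat m m (\<lambda>(i, j). of_bool (ws ! i = j) :: int)) = (if distinct ws then sort_sign ws else 0)"
proof -
  let ?A = "mat m m (\<lambda>(i, j). of_bool (ws ! i = j) :: int)"
  have det: "det ?A = (\<Sum>q | q permutes {0..<m}. sign q * (\<Prod>i = 0..<m. ?A $$ (i, q i)))"
    by (simp add: det_def)
  have prod: "(\<Prod>i = 0..<m. ?A $$ (i, q i)) = of_bool (\<forall>i<m. ws ! i = q i)" if "q permutes {0..<m}" for q
  proof -
    have "q i < m" if "i < m" for i using permutes_in_image[OF \<open>q permutes _\<close>, of i] that by simp
    then have "(\<Prod>i = 0..<m. ?A $$ (i, q i)) = (\<Prod>i = 0..<m. of_bool (ws ! i = q i))"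
      by (intro prod.cong) auto
    also have "\<dots> = of_bool (\<forall>i<m. ws ! i = q i)"
      by (induction m) (auto simp: less_Suc_eq)
    finally show ?thesis .
  qed
  show ?thesis
  proof (cases "distinct ws")
    case True
    define p where "p i = (if i < m then ws ! i else i)" for i
    have "inj_on p {0..<m}" using True assms by (auto simp: inj_on_def p_def nth_eq_iff_index_eq)
    moreover have "p ` {0..<m} \<subseteq> {0..<m}"
      using subsetD[OF assms(2) nth_mem] assms(1) by (auto simp: p_def)
    ultimately have "bij_betw p {0..<m} {0..<m}"
      by (auto simp: bij_betw_def endo_inj_surj)
    then have p: "p permutes {0..<m}" by (rule bij_imp_permutes) (simp add: p_def)
    have uniq: "(\<forall>i<m. ws ! i = q i) \<longleftrightarrow> q = p" if "q permutes {0..<m}" for q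
      using that by (auto simp: p_def fun_eq_iff permutes_def)
    have "det ?A = (\<Sum>q | q permutes {0..<m}. if q = p then sign q else 0)"
      unfolding det by (rule sum.cong) (use prod uniq in auto)
    also have "\<dots> = sign p" using p by (simp add: finite_permutations)
    finally have "det ?A = sign p" .
    moreover have "permute_list p [0..<m] = ws"
      by (rule nth_equalityI)
         (use assms p subsetD[OF assms(2) nth_mem] in \<open>auto simp: permute_list_nth atLeast0LessThan p_def\<close>)
    ultimately show ?thesis
      using True sort_sign_permute[of "[0..<m]" p] p by (simp add: sort_sign_sorted atLeast0LessThan)
  next
    case False
    have "\<not> (\<forall>i<m. ws ! i = q i)" if "q permutes {0..<m}" for q
    proof
      assume "\<forall>i<m. ws ! i = q i"
      then have "distinct ws" using assms(1) permutes_inj[OF that] by (auto simp: distinct_conv_nth inj_def)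
      then show False using False by simp
    qed
    then have "det ?A = 0" unfolding det using prod by (intro sum.neutral) auto
    then show ?thesis using False by simp
  qed
qed

lemma det_unitriangular:
  assumes "A \<in> carrier_mat m m" "\<And>i j. i < j \<Longrightarrow> j < m \<Longrightarrow> A $$ (i, j) = 0" "\<And>i. i < m \<Longrightarrow> A $$ (i, i) = (1::int)"
  shows "det A = 1"
proof -
  have "diag_mat A = replicate m 1"
    by (rule nth_equalityI) (use assms in \<open>auto simp: diag_mat_def\<close>)
  then show ?thesis using det_lower_triangular[OF assms(2) assms(1)] by simp
qed

text \<open>Let P have the unit rows of a, let L be the triangular matrix of ones and B the
  bidiagonal matrix of successive differences. The rows of B P L below row 0 are the steps of a, and
  B and L have determinant 1, so the determinant is that of P. Row 0 of the product is the threshold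
  vector of \<open>a ! 0\<close>; it is replaced by a unit vector at the end.\<close>

lemma det_steps_matrix:
  assumes a: "length a = Suc n" "set a \<subseteq> {..n}"
  shows "det (mat (Suc n) (Suc n) (\<lambda>(i, j). if i = 0 then of_bool (j = 0)
      else of_bool (j \<le> a ! i) - of_bool (j \<le> a ! (i - 1)) :: int)) = (if distinct a then sort_sign a else 0)"
proof -
  let ?m = "Suc n"
  let ?R' = "mat ?m ?m (\<lambda>(i, j). if i = 0 then of_bool (j = 0)
      else of_bool (j \<le> a ! i) - of_bool (j \<le> a ! (i - 1)) :: int)"
  let ?R = "mat ?m ?m (\<lambda>(i, j). if i = 0 then of_bool (j \<le> a ! 0)
      else of_bool (j \<le> a ! i) - of_bool (j \<le> a ! (i - 1)) :: int)"
  let ?B = "mat ?m ?m (\<lambda>(i, k). of_bool (k = i) - of_bool (Suc k = i) :: int)"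
  let ?P = "mat ?m ?m (\<lambda>(i, j). of_bool (a ! i = j) :: int)"
  let ?L = "mat ?m ?m (\<lambda>(k, j). of_bool (j \<le> k) :: int)"
  have al: "a ! i \<le> n" if "i < ?m" for i using subsetD[OF a(2) nth_mem, of i] a(1) that by simp
  have PL: "?P * ?L = mat ?m ?m (\<lambda>(i, j). of_bool (j \<le> a ! i))"
  proof (rule eq_matI)
    fix i j assume "i < dim_row (mat ?m ?m (\<lambda>(i, j). of_bool (j \<le> a ! i) :: int))"
      "j < dim_col (mat ?m ?m (\<lambda>(i, j). of_bool (j \<le> a ! i) :: int))"
    then have ij: "i < ?m" "j < ?m" by auto
    have "(?P * ?L) $$ (i, j) = (\<Sum>k = 0..<?m. of_bool (a ! i = k) * of_bool (j \<le> k))"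
      using ij by (simp add: scalar_prod_def del: sum.op_ivl_Suc)
    also have "\<dots> = (\<Sum>k = 0..<?m. if k = a ! i then of_bool (j \<le> k) else 0)"
      by (rule sum.cong) auto
    also have "\<dots> = of_bool (j \<le> a ! i)" using al[OF ij(1)] by (simp del: sum.op_ivl_Suc)
    finally show "(?P * ?L) $$ (i, j) = mat ?m ?m (\<lambda>(i, j). of_bool (j \<le> a ! i)) $$ (i, j)" using ij by simp
  qed auto
  have "?B * (?P * ?L) = ?R"
    unfolding PL
  proof (rule eq_matI)
    fix i j assume "i < dim_row ?R" "j < dim_col ?R"
    then have ij: "i < ?m" "j < ?m" by auto
    have "(?B * mat ?m ?m (\<lambda>(i, j). of_bool (j \<le> a ! i))) $$ (i, j)
      = (\<Sum>k = 0..<?m. (of_bool (k = i) - of_bool (Suc k = i)) * of_bool (j \<le> a ! k))"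
      using ij by (simp add: scalar_prod_def del: sum.op_ivl_Suc)
    also have "\<dots> = (\<Sum>k = 0..<?m. if k = i then of_bool (j \<le> a ! k) else 0)
        - (\<Sum>k = 0..<?m. if Suc k = i then of_bool (j \<le> a ! k) else 0)"
      unfolding sum_subtractf[symmetric] by (rule sum.cong) auto
    also have "(\<Sum>k = 0..<?m. if Suc k = i then of_bool (j \<le> a ! k) else 0)
        = (if i = 0 then 0 else of_bool (j \<le> a ! (i - 1)) :: int)"
    proof (cases i)
      case (Suc i')
      then show ?thesis using ij by (simp del: sum.op_ivl_Suc)
    qed simp
    finally show "(?B * mat ?m ?m (\<lambda>(i, j). of_bool (j \<le> a ! i))) $$ (i, j) = ?R $$ (i, j)"
      using ij by (simp del: sum.op_ivl_Suc)
  qed auto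
  moreover have "det (?B * (?P * ?L)) = det ?B * (det ?P * det ?L)"
  proof -
    have "det (?B * (?P * ?L)) = det ?B * det (?P * ?L)"
      by (rule det_mult[of _ ?m]) (auto intro!: mult_carrier_mat[of _ _ ?m])
    moreover have "det (?P * ?L) = det ?P * det ?L" by (rule det_mult[of _ ?m]) auto
    ultimately show ?thesis by simp
  qed
  moreover have "det ?B = 1" "det ?L = 1" by (rule det_unitriangular[of _ ?m]; auto)+
  ultimately have "det ?R = (if distinct a then sort_sign a else 0)"
    using det_list_matrix[of a ?m] a by (simp add: lessThan_Suc_atMost)
  \<comment> \<open>The step rows vanish in column 0. A contributing permutation must therefore fix
    0, and there both versions of row 0 have the entry 1.\<close>
  moreover have "det ?R' = det ?R"
  proof -
    have "(\<Prod>i = 0..<?m. ?R' $$ (i, q i)) = (\<Prod>i = 0..<?m. ?R $$ (i, q i))" if q: "q permutes {0..<?m}" for q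
    proof -
      have qm: "q i < ?m" if "i < ?m" for i using permutes_in_image[OF q, of i] that by simp
      show ?thesis
      proof (cases "q 0 = 0")
        case True
        then show ?thesis using qm by (intro prod.cong) auto
      next
        case False
        have "0 \<in> q ` {0..<?m}" using permutes_image[OF q] by simp
        then obtain i where i: "i < ?m" "q i = 0" by auto
        then have "i \<noteq> 0" using False by metis
        then have "?R' $$ (i, q i) = 0" "?R $$ (i, q i) = 0" using i by auto
        then show ?thesis using i(1) by (metis (no_types, lifting) atLeastLessThan_iff finite_atLeastLessThan le0 prod_zero_iff)
      qed
    qed
    then show ?thesis by (simp add: det_def)
  qed
  ultimately show ?thesis by simp
qed

section \<open>Least preimages and jumps of a surjection\<close>

definition first_at :: "(nat \<Rightarrow> nat) \<Rightarrow> nat \<Rightarrow> nat" where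
  "first_at \<eta> r = (LEAST x. \<eta> x = r)"

text \<open>A Galois connection: \<open>first_at \<eta>\<close> is left adjoint to \<eta>, which
  turns comparisons of positions into comparisons of values. For r > 0 the least preimage of r is
  the place where \<eta> jumps from r - 1 to r.\<close>

lemma first_at:
  assumes "\<eta> \<in> Delta_surj N n" "r \<le> n"
  shows "first_at \<eta> r \<le> N" "\<eta> (first_at \<eta> r) = r"
    "x \<le> N \<Longrightarrow> first_at \<eta> r \<le> x \<longleftrightarrow> r \<le> \<eta> x"
proof -
  note \<eta> = Delta_surjD[OF assms(1)]
  obtain y where y: "y \<le> N" "\<eta> y = r" using assms(2) \<eta>(2) by (metis atMost_iff imageE)
  show v: "\<eta> (first_at \<eta> r) = r" unfolding first_at_def using y(2) by (rule LeastI)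
  show le: "first_at \<eta> r \<le> N" unfolding first_at_def using y Least_le[of "\<lambda>x. \<eta> x = r" y] by simp
  show "first_at \<eta> r \<le> x \<longleftrightarrow> r \<le> \<eta> x" if x: "x \<le> N"
  proof
    assume "first_at \<eta> r \<le> x" then show "r \<le> \<eta> x" using Delta_mono[OF \<eta>(1) _ x] v by metis
  next
    assume r: "r \<le> \<eta> x"
    show "first_at \<eta> r \<le> x"
    proof (rule ccontr)
      assume "\<not> first_at \<eta> r \<le> x"
      then have "x < first_at \<eta> r" by simp
      then have "\<eta> x \<le> r" "\<eta> x \<noteq> r"
        using Delta_mono[OF \<eta>(1), of x "first_at \<eta> r"] le v not_less_Least[of x "\<lambda>x. \<eta> x = r"]
        by (auto simp: first_at_def)
      then show False using r by simp
    qed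
  qed
qed

lemma first_at_eqI:
  assumes "\<eta> \<in> Delta_surj N n" "r \<le> n" "0 < x" "x \<le> N" "r \<le> \<eta> x" "\<eta> (x - 1) < r"
  shows "first_at \<eta> r = x"
proof -
  have "x - 1 \<le> N" using assms(4) by simp
  then have "\<not> first_at \<eta> r \<le> x - 1" "first_at \<eta> r \<le> x"
    using first_at(3)[OF assms(1,2)] assms by (simp_all add: not_le)
  then show ?thesis by simp
qed

lemma first_at_pred:
  assumes "\<eta> \<in> Delta_surj N n" "r \<le> n" "0 < first_at \<eta> r"
  shows "\<eta> (first_at \<eta> r - 1) < r"
proof -
  have "first_at \<eta> r - 1 \<le> N" using first_at(1)[OF assms(1,2)] by simp
  from first_at(3)[OF assms(1,2) this] show ?thesis using assms(3) by linarith
qed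

lemma Delta_surj_0: "\<eta> \<in> Delta_surj N n \<Longrightarrow> \<eta> 0 = 0"
  using first_at(3)[of \<eta> N n 0 0] first_at(2)[of \<eta> N n 0] by (metis le0 le_zero_eq)

lemma Delta_surj_last: "\<eta> \<in> Delta_surj N n \<Longrightarrow> \<eta> N = n"
  using first_at(1)[of \<eta> N n n] first_at(3)[of \<eta> N n n N] Delta_le[of \<eta> N n N] Delta_surjD(1)[of \<eta> N n] by simp

text \<open>Connects the sets of intervals in the definition of the shuffle sign with the positions
  that index the rows of \<open>fold_mat\<close>.\<close>

lemma jumps_eq_first_at:
  assumes \<eta>: "\<eta> \<in> Delta_surj N n"
  shows "sorted_list_of_set {k \<in> {1..N}. \<eta> (k - 1) \<noteq> \<eta> k} = map (first_at \<eta>) [1..<Suc n]"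
proof -
  have "sorted_wrt (<) (map (first_at \<eta>) [1..<Suc n])"
    unfolding sorted_wrt_map
  proof (rule sorted_wrt_mono_rel[of _ "(<)"])
    fix r r' assume "r \<in> set [1..<Suc n]" "r' \<in> set [1..<Suc n]" "r < r'"
    then show "first_at \<eta> r < first_at \<eta> r'"
      using first_at[OF \<eta>, of r] first_at[OF \<eta>, of r'] by (metis atLeastLessThan_iff less_Suc_eq_le not_less set_upt)
  qed (rule sorted_wrt_upt)
  moreover have "set (map (first_at \<eta>) [1..<Suc n]) = {k \<in> {1..N}. \<eta> (k - 1) \<noteq> \<eta> k}"
  proof (intro equalityI subsetI)
    fix k assume "k \<in> set (map (first_at \<eta>) [1..<Suc n])"
    then obtain r where r: "k = first_at \<eta> r" "1 \<le> r" "r \<le> n" by (auto simp del: upt_Suc)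
    have "0 < k" using first_at(2)[OF \<eta> r(3)] Delta_surj_0[OF \<eta>] r by (cases k) auto
    then show "k \<in> {k \<in> {1..N}. \<eta> (k - 1) \<noteq> \<eta> k}"
      using first_at(1,2)[OF \<eta> r(3)] first_at_pred[OF \<eta> r(3)] r(1) by auto
  next
    fix k assume k: "k \<in> {k \<in> {1..N}. \<eta> (k - 1) \<noteq> \<eta> k}"
    then have "\<eta> (k - 1) < \<eta> k" using Delta_mono[OF Delta_surjD(1)[OF \<eta>], of "k - 1" k] by auto
    moreover have "\<eta> k \<le> n" using Delta_le[OF Delta_surjD(1)[OF \<eta>]] k by auto
    ultimately have "first_at \<eta> (\<eta> k) = k" "\<eta> k \<in> {1..<Suc n}"
      using first_at_eqI[OF \<eta>, of "\<eta> k" k] k by auto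
    then show "k \<in> set (map (first_at \<eta>) [1..<Suc n])" by (metis image_eqI list.set_map set_upt)
  qed
  ultimately show ?thesis
    using sorted_list_of_set_unique[of "{k \<in> {1..N}. \<eta> (k - 1) \<noteq> \<eta> k}" "map (first_at \<eta>) [1..<Suc n]"]
      distinct_card[of "map (first_at \<eta>) [1..<Suc n]"] strict_sorted_iff[of "map (first_at \<eta>) [1..<Suc n]"]
    by (simp del: upt_Suc)
qed

text \<open>The coefficient of the degeneracy \<open>\<eta>\<close> in the map \<open>\<gamma>\<close>. It is multilinear in the jumps of \<open>\<eta>\<close>,
  and the row of a jump at \<open>s\<close> is the edge from \<open>s - 1\<close> to \<open>s\<close>, folded and expressed in the basis of
  elementary intervals of \<open>[n]\<close>.\<close>

definition fold_edge :: "nat \<Rightarrow> nat \<Rightarrow> nat \<Rightarrow> int" where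
  "fold_edge n s j = of_bool (j \<le> fold_map n s) - of_bool (j \<le> fold_map n (s - 1))"

text \<open>Row 0 is padding. Every edge vanishes in column 0, so the unit vector in row 0 leaves
  the determinant of the n by n block, while jumps and intervals keep their numbering from 1 to
  n.\<close>

definition fold_mat :: "nat \<Rightarrow> (nat \<Rightarrow> nat) \<Rightarrow> int mat" where
  "fold_mat n s = mat (Suc n) (Suc n) (\<lambda>(i, j). if i = 0 then of_bool (j = 0) else fold_edge n (s i) j)"

definition fold_coeff :: "nat \<Rightarrow> (nat \<Rightarrow> nat) \<Rightarrow> int" where
  "fold_coeff n \<eta> = det (fold_mat n (first_at \<eta>))"

lemma fold_mat_cong: "(\<And>i. i \<in> {1..n} \<Longrightarrow> s i = t i) \<Longrightarrow> fold_mat n s = fold_mat n t"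
  unfolding fold_mat_def by (rule cong_mat) auto

text \<open>The Leibniz formula with the padding row split off, so that each remaining factor
  depends on a single jump.\<close>

lemma det_fold_mat:
  "det (fold_mat n s) = (\<Sum>p | p permutes {0..<Suc n}. sign p * (of_bool (p 0 = 0) * (\<Prod>i\<in>{1..n}. fold_edge n (s i) (p i))))"
proof -
  have "(\<Prod>i = 0..<Suc n. fold_mat n s $$ (i, p i)) = of_bool (p 0 = 0) * (\<Prod>i\<in>{1..n}. fold_edge n (s i) (p i))"
    if p: "p permutes {0..<Suc n}" for p
  proof -
    have pm: "p i < Suc n" if "i < Suc n" for i using permutes_in_image[OF p, of i] that by simp
    have I: "{0..<Suc n} = insert 0 {1..n}" by auto
    have "(\<Prod>i\<in>{1..n}. fold_mat n s $$ (i, p i)) = (\<Prod>i\<in>{1..n}. fold_edge n (s i) (p i))"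
      by (rule prod.cong) (use pm in \<open>auto simp: fold_mat_def less_Suc_eq_le\<close>)
    then show ?thesis unfolding I using pm[of 0] by (subst prod.insert) (auto simp: fold_mat_def)
  qed
  moreover have "dim_row (fold_mat n s) = Suc n" "dim_col (fold_mat n s) = Suc n" by (auto simp: fold_mat_def)
  ultimately show ?thesis unfolding det_def by (auto intro!: sum.cong simp del: prod.op_ivl_Suc)
qed

text \<open>In the Leibniz formula, the sum over independent choices of jumps becomes a product of
  sums: the determinant is additive in each row. The edges between consecutive vertices of g add up
  to one step from folded vertex i - 1 to folded vertex i, and the matrix of steps is known.\<close>

lemma sum_det_fold_mat:
  assumes g: "g \<in> Delta n (n + n + 1)"
  shows "(\<Sum>s \<in> Pi\<^sub>E {1..n} (\<lambda>i. {Suc (g (i - 1))..g i}). det (fold_mat n s)) =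
    (if distinct (map (\<lambda>k. fold_map n (g k)) [0..<Suc n])
     then sort_sign (map (\<lambda>k. fold_map n (g k)) [0..<Suc n]) else 0)"
proof -
  let ?S = "Pi\<^sub>E {1..n} (\<lambda>i. {Suc (g (i - 1))..g i})"
  let ?a = "map (\<lambda>k. fold_map n (g k)) [0..<Suc n]"
  let ?R = "mat (Suc n) (Suc n) (\<lambda>(i, j). if i = 0 then of_bool (j = 0)
      else of_bool (j \<le> ?a ! i) - of_bool (j \<le> ?a ! (i - 1)) :: int)"
  have a_nth: "?a ! k = fold_map n (g k)" if "k \<le> n" for k using that by (simp del: upt_Suc)
  have "(\<Sum>s\<in>?S. det (fold_mat n s)) = (\<Sum>p | p permutes {0..<Suc n}. \<Sum>s\<in>?S.
      sign p * (of_bool (p 0 = 0) * (\<Prod>i\<in>{1..n}. fold_edge n (s i) (p i))))"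
    unfolding det_fold_mat by (rule sum.swap)
  also have "\<dots> = (\<Sum>p | p permutes {0..<Suc n}. sign p * (\<Prod>i = 0..<Suc n. ?R $$ (i, p i)))"
  proof (rule sum.cong[OF refl])
    fix p assume "p \<in> {p. p permutes {0..<Suc n}}"
    then have pm: "p i < Suc n" if "i < Suc n" for i using permutes_in_image[of p _ i] that by auto
    have I: "{0..<Suc n} = insert 0 {1..n}" by auto
    have "(\<Sum>s\<in>?S. sign p * (of_bool (p 0 = 0) * (\<Prod>i\<in>{1..n}. fold_edge n (s i) (p i))))
       = sign p * (of_bool (p 0 = 0) * (\<Sum>s\<in>?S. \<Prod>i\<in>{1..n}. fold_edge n (s i) (p i)))"
      by (simp add: sum_distrib_left)
    also have "(\<Sum>s\<in>?S. \<Prod>i\<in>{1..n}. fold_edge n (s i) (p i))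
       = (\<Prod>i\<in>{1..n}. \<Sum>x\<in>{Suc (g (i - 1))..g i}. fold_edge n x (p i))"
      by (rule prod_sum_PiE[symmetric]) auto
    also have "\<dots> = (\<Prod>i\<in>{1..n}. ?R $$ (i, p i))"
    proof (rule prod.cong[OF refl])
      fix i assume i: "i \<in> {1..n}"
      have le: "i - 1 \<le> n" using i by auto
      have "g (i - 1) \<le> g i" using Delta_mono[OF g, of "i - 1" i] i by auto
      then have "(\<Sum>x\<in>{Suc (g (i - 1))..g i}. fold_edge n x (p i))
          = of_bool (p i \<le> fold_map n (g i)) - of_bool (p i \<le> fold_map n (g (i - 1)))"
        unfolding fold_edge_def by (rule sum_telescope'')
      then show "(\<Sum>x\<in>{Suc (g (i - 1))..g i}. fold_edge n x (p i)) = ?R $$ (i, p i)"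
        using i pm[of i] a_nth[of i] a_nth[OF le] by (simp del: upt_Suc)
    qed
    also have "of_bool (p 0 = 0) * (\<Prod>i\<in>{1..n}. ?R $$ (i, p i)) = (\<Prod>i = 0..<Suc n. ?R $$ (i, p i))"
      unfolding I using pm[of 0] by (subst prod.insert) (auto simp del: upt_Suc)
    finally show "(\<Sum>s\<in>?S. sign p * (of_bool (p 0 = 0) * (\<Prod>i\<in>{1..n}. fold_edge n (s i) (p i))))
       = sign p * (\<Prod>i = 0..<Suc n. ?R $$ (i, p i))" .
  qed
  also have "\<dots> = det ?R" by (simp add: det_def del: prod.op_ivl_Suc)
  also have "\<dots> = (if distinct ?a then sort_sign ?a else 0)"
  proof (rule det_steps_matrix)
    show "set ?a \<subseteq> {..n}"
      unfolding set_map by (rule image_subsetI, rule atMost_iff[THEN iffD2], rule fold_map_le[OF Delta_le[OF g]]) auto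
  qed simp
  finally show ?thesis .
qed

text \<open>A surjection \<eta> with \<eta> g = id jumps exactly once between consecutive vertices
  of g, and these jumps can be chosen independently. So the sum runs over a product of intervals, as
  \<open>sum_det_fold_mat\<close> requires.\<close>

lemma sum_fold_coeff:
  assumes g: "g \<in> Delta n (n + n + 1)" and inj: "inj_on g {..n}"
  shows "(\<Sum>\<eta> | \<eta> \<in> Delta_surj (n + n + 1) n \<and> compose {..n} \<eta> g = restrict id {..n}. fold_coeff n \<eta>) =
    (if distinct (map (\<lambda>k. fold_map n (g k)) [0..<Suc n])
     then sort_sign (map (\<lambda>k. fold_map n (g k)) [0..<Suc n]) else 0)"
proof -
  let ?N = "n + n + 1"
  let ?S = "Pi\<^sub>E {1..n} (\<lambda>i. {Suc (g (i - 1))..g i})"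
  let ?E = "{\<eta> \<in> Delta_surj ?N n. compose {..n} \<eta> g = restrict id {..n}}"
  \<comment> \<open>Mutually inverse passages: \<open>J\<close> records the jumps of \<eta>, and
    \<open>K\<close> counts how many of the jumps s have been passed at x.\<close>
  define J where "J \<eta> = (\<lambda>i\<in>{1..n}. first_at \<eta> i)" for \<eta>
  define K where "K s = (\<lambda>x\<in>{..?N}. card {i \<in> {1..n}. s i \<le> x})" for s :: "nat \<Rightarrow> nat"
  have id: "\<eta> (g k) = k" if "\<eta> \<in> ?E" "k \<le> n" for \<eta> k
  proof -
    have "compose {..n} \<eta> g k = restrict id {..n} k" using that(1) by simp
    then show ?thesis using that(2) by (simp add: compose_def)
  qed
  have s_bounds: "g (i - 1) < s i" "s i \<le> g i" "s i \<le> ?N" "0 < s i" if "s \<in> ?S" "i \<in> {1..n}" for s i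
    using that Delta_le[OF g, of i] by (force simp: PiE_iff)+
  have s_mono: "s i < s i'" if "s \<in> ?S" "i \<in> {1..n}" "i' \<in> {1..n}" "i < i'" for s i i'
  proof -
    have "i \<le> i' - 1" "i' - 1 \<le> n" using that(3,4) by auto
    from Delta_mono[OF g this] show ?thesis using s_bounds(2)[OF that(1,2)] s_bounds(1)[OF that(1,3)] by simp
  qed
  \<comment> \<open>The Galois connection between a surjection and its jumps, now starting from the
    jumps.\<close>
  have K_iff: "s r \<le> x \<longleftrightarrow> r \<le> K s x" if s: "s \<in> ?S" and r: "r \<in> {1..n}" and x: "x \<le> ?N" for s r x
  proof
    assume "s r \<le> x"
    have "s i \<le> x" if "1 \<le> i" "i \<le> r" for i
      using s_mono[OF s _ r, of i] r that \<open>s r \<le> x\<close> by (cases "i = r") auto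
    then have "{1..r} \<subseteq> {i \<in> {1..n}. s i \<le> x}" using r by auto
    from card_mono[OF _ this] show "r \<le> K s x" using x by (simp add: K_def)
  next
    assume r': "r \<le> K s x"
    show "s r \<le> x"
    proof (rule ccontr)
      assume sr: "\<not> s r \<le> x"
      have "i < r" if "i \<in> {1..n}" "s i \<le> x" for i
        using s_mono[OF s r that(1)] that(2) sr by (cases i r rule: linorder_cases) auto
      then have "{i \<in> {1..n}. s i \<le> x} \<subseteq> {1..<r}" by auto
      from card_mono[OF _ this] show False using r r' x by (auto simp: K_def)
    qed
  qed
  have K_eqI: "K s x = k" if s: "s \<in> ?S" and x: "x \<le> ?N" and k: "k \<le> n" "0 < k \<Longrightarrow> s k \<le> x" "k < n \<Longrightarrow> x < s (Suc k)" for s x k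
  proof -
    have "card {i \<in> {1..n}. s i \<le> x} \<le> card {1..n}" by (rule card_mono) auto
    then have "K s x \<le> n" using x by (simp add: K_def)
    moreover have "k \<le> K s x" using K_iff[OF s _ x, of k] k by (cases "k = 0") auto
    moreover have "\<not> Suc k \<le> K s x" if "k < n" using K_iff[OF s _ x, of "Suc k"] k that by auto
    ultimately show ?thesis using k(1) by (cases "k < n") auto
  qed
  have K_mem: "K s \<in> Delta_surj ?N n" if s: "s \<in> ?S" for s
  proof -
    have "K s \<in> Delta ?N n" unfolding K_def
    proof (rule restrict_Delta)
      fix x show "card {i \<in> {1..n}. s i \<le> x} \<le> n"
      proof -
        have "{i \<in> {1..n}. s i \<le> x} \<subseteq> {1..n}" by blast
        from card_mono[OF _ this] show ?thesis by simp
      qed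
    qed (auto intro!: card_mono)
    moreover have "y \<in> K s ` {..?N}" if y: "y \<le> n" for y
    proof (cases "y = 0")
      case True
      have "K s 0 = 0" by (rule K_eqI[OF s]) (use s_bounds(4)[OF s] in auto)
      then show ?thesis using True by (metis atMost_iff image_eqI le0)
    next
      case False
      then have "K s (s y) = y" using y s_bounds(3)[OF s] s_mono[OF s] by (intro K_eqI[OF s]) auto
      then show ?thesis using s_bounds(3)[OF s, of y] False y by (metis atLeastAtMost_iff atMost_iff image_eqI less_one not_less)
    qed
    ultimately show ?thesis by (auto simp: Delta_surj_def Delta_iff)
  qed
  have "(\<Sum>\<eta>\<in>?E. fold_coeff n \<eta>) = (\<Sum>s\<in>?S. det (fold_mat n s))"
  proof (rule sum.reindex_bij_witness[of _ K J])
    fix \<eta> assume \<eta>: "\<eta> \<in> ?E"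
    then have \<eta>s: "\<eta> \<in> Delta_surj ?N n" by simp
    show JS: "J \<eta> \<in> ?S"
    proof (rule PiE_I)
      fix i assume i: "i \<in> {1..n}"
      have "g i \<le> ?N" "g (i - 1) \<le> ?N" using Delta_le[OF g] i by auto
      then show "J \<eta> i \<in> {Suc (g (i - 1))..g i}"
        using first_at(3)[OF \<eta>s, of i "g i"] first_at(3)[OF \<eta>s, of i "g (i - 1)"] id[OF \<eta>, of i] id[OF \<eta>, of "i - 1"] i
        by (auto simp: J_def)
    qed (auto simp: J_def)
    show "K (J \<eta>) = \<eta>"
    proof (rule Delta_eqI[OF Delta_surjD(1)[OF K_mem[OF JS]] Delta_surjD(1)[OF \<eta>s]])
      fix x assume x: "x \<le> ?N"
      have "\<eta> x \<le> n" using Delta_le[OF Delta_surjD(1)[OF \<eta>s] x] .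
      show "K (J \<eta>) x = \<eta> x"
      proof (rule K_eqI[OF JS x \<open>\<eta> x \<le> n\<close>])
        show "J \<eta> (\<eta> x) \<le> x" if "0 < \<eta> x"
          using first_at(3)[OF \<eta>s \<open>\<eta> x \<le> n\<close> x] that \<open>\<eta> x \<le> n\<close> by (simp add: J_def)
        show "x < J \<eta> (Suc (\<eta> x))" if "\<eta> x < n"
          using first_at(3)[OF \<eta>s _ x, of "Suc (\<eta> x)"] that by (simp add: J_def)
      qed
    qed
    show "det (fold_mat n (J \<eta>)) = fold_coeff n \<eta>"
      unfolding fold_coeff_def by (subst fold_mat_cong[of n "J \<eta>" "first_at \<eta>"]) (auto simp: J_def)
  next
    fix s assume s: "s \<in> ?S"
    note Ks = K_mem[OF s]
    show "J (K s) = s"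
    proof (rule extensionalityI[of _ "{1..n}"])
      fix r assume r: "r \<in> {1..n}"
      have eq: "first_at (K s) r \<le> x \<longleftrightarrow> s r \<le> x" if "x \<le> ?N" for x
        using first_at(3)[OF Ks _ that, of r] K_iff[OF s r that] r by simp
      have "first_at (K s) r \<le> ?N" using first_at(1)[OF Ks] r by auto
      then show "J (K s) r = s r"
        using eq[of "first_at (K s) r"] eq[of "s r"] s_bounds(3)[OF s r] r by (simp add: J_def)
    next
      show "J (K s) \<in> extensional {1..n}" unfolding J_def by (rule restrict_extensional)
      show "s \<in> extensional {1..n}" using s unfolding PiE_def by blast
    qed
    have "compose {..n} (K s) g = restrict id {..n}"
    proof (rule Delta_eqI[OF Delta_compose[OF g Delta_surjD(1)[OF Ks]] Delta_id])
      fix k assume k: "k \<le> n"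
      have "K s (g k) = k"
        by (rule K_eqI[OF s])
           (use k s_bounds(1)[OF s, of "Suc k"] s_bounds(2)[OF s] Delta_le[OF g k] in auto)
      then show "compose {..n} (K s) g k = restrict id {..n} k" using k by (simp add: compose_def)
    qed
    then show "K s \<in> ?E" using Ks by simp
  qed
  then show ?thesis using sum_det_fold_mat[OF g] by simp
qed

subsection \<open>Coefficients of shuffles\<close>

text \<open>The values of \<sigma> on the first copy of [n] end with i, and those on the second copy
  start with i + 0. So the edge between the copies is not a jump.\<close>

definition shuffle_map :: "nat \<Rightarrow> nat \<Rightarrow> (nat \<Rightarrow> nat) \<Rightarrow> (nat \<Rightarrow> nat) \<Rightarrow> nat \<Rightarrow> nat" where
  "shuffle_map i j \<sigma> \<tau> = (\<lambda>x\<in>{..(i + j) + (i + j) + 1}. if x \<le> i + j then \<sigma> x else i + \<tau> (x - (i + j + 1)))"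

text \<open>For the third part: \<sigma> + \<tau> is a strictly increasing self-map of [i + j],
  hence the identity. So each elementary interval is contracted by exactly one of the two
  maps.\<close>

lemma shufflesD:
  assumes "(\<sigma>, \<tau>) \<in> shuffles_of i j"
  shows "\<sigma> \<in> Delta_surj (i + j) i" "\<tau> \<in> Delta_surj (i + j) j"
    "x \<le> i + j \<Longrightarrow> \<sigma> x + \<tau> x = x"
proof -
  show \<sigma>: "\<sigma> \<in> Delta_surj (i + j) i" and \<tau>: "\<tau> \<in> Delta_surj (i + j) j"
    using assms by (auto simp: shuffles_of_def)
  note d = Delta_surjD(1)[OF \<sigma>] Delta_surjD(1)[OF \<tau>]
  have inj: "inj_on (\<lambda>k. (\<sigma> k, \<tau> k)) {..i + j}" using assms by (simp add: shuffles_of_def)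
  let ?f = "\<lambda>x\<in>{..i + j}. \<sigma> x + \<tau> x"
  have "?f \<in> Delta (i + j) (i + j)"
    by (rule restrict_Delta)
       (rule add_mono[OF Delta_le[OF d(1)] Delta_le[OF d(2)]] add_mono[OF Delta_mono[OF d(1)] Delta_mono[OF d(2)]]; assumption)+
  moreover have "inj_on ?f {..i + j}"
  proof (rule linorder_inj_onI)
    fix x y assume xy: "x < y" "x \<in> {..i + j}" "y \<in> {..i + j}"
    have "\<sigma> x \<le> \<sigma> y" "\<tau> x \<le> \<tau> y" using d xy Delta_mono by auto
    moreover have "\<sigma> x \<noteq> \<sigma> y \<or> \<tau> x \<noteq> \<tau> y" using inj_onD[OF inj, of x y] xy by auto
    ultimately show "?f x \<noteq> ?f y" using xy by auto
  qed auto
  ultimately have "?f = restrict id {..i + j}" by (rule Delta_inj_id)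
  from fun_cong[OF this, of x] show "\<sigma> x + \<tau> x = x" if "x \<le> i + j" using that by simp
qed

lemma finite_shuffles: "finite (shuffles_of i j)"
  by (rule finite_subset[of _ "Delta (i + j) i \<times> Delta (i + j) j"])
     (auto simp: shuffles_of_def finite_Delta dest: Delta_surjD)

lemma shuffle_map_surj:
  assumes "(\<sigma>, \<tau>) \<in> shuffles_of i j"
  shows "shuffle_map i j \<sigma> \<tau> \<in> Delta_surj ((i + j) + (i + j) + 1) (i + j)"
proof -
  note s = shufflesD[OF assms]
  note d = Delta_surjD(1)[OF s(1)] Delta_surjD(1)[OF s(2)]
  let ?N = "(i + j) + (i + j) + 1"
  have "shuffle_map i j \<sigma> \<tau> \<in> Delta ?N (i + j)"
    unfolding shuffle_map_def
  proof (rule restrict_Delta)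
    fix x assume "x \<le> ?N"
    then show "(if x \<le> i + j then \<sigma> x else i + \<tau> (x - (i + j + 1))) \<le> i + j"
      using Delta_le[OF d(1), of x] Delta_le[OF d(2), of "x - (i + j + 1)"] by auto
  next
    fix x y assume xy: "x \<le> y" "y \<le> ?N"
    then show "(if x \<le> i + j then \<sigma> x else i + \<tau> (x - (i + j + 1))) \<le> (if y \<le> i + j then \<sigma> y else i + \<tau> (y - (i + j + 1)))"
      using Delta_le[OF d(1), of x] Delta_mono[OF d(1), of x y] Delta_mono[OF d(2), of "x - (i + j + 1)" "y - (i + j + 1)"]
      by auto
  qed
  moreover have "y \<in> shuffle_map i j \<sigma> \<tau> ` {..?N}" if y: "y \<le> i + j" for y
  proof (cases "y \<le> i")
    case True
    then show ?thesis
      using first_at(1,2)[OF s(1) True] by (intro image_eqI[of _ _ "first_at \<sigma> y"]) (auto simp: shuffle_map_def)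
  next
    case False
    then have "y - i \<le> j" using y by simp
    then show ?thesis
      using first_at(1,2)[OF s(2), of "y - i"] False
      by (intro image_eqI[of _ _ "i + j + 1 + first_at \<tau> (y - i)"]) (auto simp: shuffle_map_def)
  qed
  ultimately show ?thesis by (auto simp: Delta_surj_def Delta_iff)
qed

text \<open>Each jump lies inside one copy of [n], so its folded edge is a single elementary
  interval and the matrix has unit rows. They list the jumps of \<sigma> and then those of \<tau>,
  which are the intervals contracted by \<tau> and then those contracted by \<sigma>: the list whose
  sorting sign is \<open>shuffle_sgn\<close>.\<close>

lemma fold_coeff_shuffle:
  assumes "(\<sigma>, \<tau>) \<in> shuffles_of i j"
  shows "fold_coeff (i + j) (shuffle_map i j \<sigma> \<tau>) = shuffle_sgn (i + j) \<sigma> \<tau>"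
proof -
  let ?n = "i + j" and ?\<eta> = "shuffle_map i j \<sigma> \<tau>"
  note s = shufflesD[OF assms] and \<eta> = shuffle_map_surj[OF assms]
  note d = Delta_surjD(1)[OF s(1)] Delta_surjD(1)[OF s(2)]
  have c: "contracted ?n \<tau> = {k \<in> {1..?n}. \<sigma> (k - 1) \<noteq> \<sigma> k}" "contracted ?n \<sigma> = {k \<in> {1..?n}. \<tau> (k - 1) \<noteq> \<tau> k}"
  proof -
    have "\<tau> (k - 1) = \<tau> k \<longleftrightarrow> \<sigma> (k - 1) \<noteq> \<sigma> k" if "k \<in> {1..?n}" for k
    proof -
      have k: "k - 1 \<le> k" "k - 1 \<le> ?n" "k \<le> ?n" "0 < k" using that by auto
      show ?thesis
        using s(3)[OF k(2)] s(3)[OF k(3)] Delta_mono[OF d(1) k(1,3)] Delta_mono[OF d(2) k(1,3)] k(4) by linarith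
    qed
    then show "contracted ?n \<tau> = {k \<in> {1..?n}. \<sigma> (k - 1) \<noteq> \<sigma> k}" "contracted ?n \<sigma> = {k \<in> {1..?n}. \<tau> (k - 1) \<noteq> \<tau> k}"
      unfolding contracted_def by blast+
  qed
  let ?L = "map (first_at \<sigma>) [1..<Suc i] @ map (first_at \<tau>) [1..<Suc j]"
  have L: "sorted_list_of_set (contracted ?n \<tau>) @ sorted_list_of_set (contracted ?n \<sigma>) = ?L"
    unfolding c using jumps_eq_first_at[OF s(1)] jumps_eq_first_at[OF s(2)] by simp
  have fc: "finite (contracted ?n \<tau>)" "finite (contracted ?n \<sigma>)" by (auto simp: contracted_def)
  have setL: "set ?L = contracted ?n \<tau> \<union> contracted ?n \<sigma>"
    unfolding L[symmetric] using fc by simp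
  have dist: "distinct ?L"
  proof -
    have "contracted ?n \<tau> \<inter> contracted ?n \<sigma> = {}"
    proof -
      have "False" if "k \<in> contracted ?n \<tau>" "k \<in> contracted ?n \<sigma>" for k
      proof -
        have k: "k - 1 \<le> ?n" "k \<le> ?n" "0 < k" "\<tau> (k - 1) = \<tau> k" "\<sigma> (k - 1) = \<sigma> k"
          using that by (auto simp: contracted_def)
        then show False using s(3)[OF k(1)] s(3)[OF k(2)] by simp
      qed
      then show ?thesis by blast
    qed
    then show ?thesis unfolding L[symmetric] using fc by simp
  qed
  have L1: "set ?L \<subseteq> {1..?n}" unfolding setL by (auto simp: contracted_def)
  \<comment> \<open>The leading 0 stands for the padding row. It is the smallest entry and comes in
    front, so it does not affect the sign.\<close>
  let ?ws = "0 # ?L"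
  have nth1: "?ws ! r = first_at \<sigma> r" if "1 \<le> r" "r \<le> i" for r
    using that by (auto simp: nth_append nth_Cons' simp del: upt_Suc)
  have nth2: "?ws ! (i + r) = first_at \<tau> r" if "1 \<le> r" "r \<le> j" for r
    using that by (auto simp: nth_append nth_Cons' simp del: upt_Suc)
  have pos: "1 \<le> ?ws ! r \<and> ?ws ! r \<le> ?n" if "1 \<le> r" "r \<le> ?n" for r
  proof -
    have "?ws ! r \<in> set ?L" using that nth_mem[of "r - 1" ?L] by (simp add: nth_Cons' del: upt_Suc)
    then show ?thesis using L1 by auto
  qed
  have edge: "fold_edge ?n (first_at ?\<eta> r) k = of_bool (?ws ! r = k)" if r: "1 \<le> r" "r \<le> ?n" for r k
  proof (cases "r \<le> i")
    case True
    let ?\<rho> = "first_at \<sigma> r"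
    have \<rho>: "1 \<le> ?\<rho>" "?\<rho> \<le> ?n" using pos[OF r] nth1[OF r(1) True] by auto
    have "\<sigma> (?\<rho> - 1) < r" using first_at_pred[OF s(1) True] \<rho> by simp
    then have "first_at ?\<eta> r = ?\<rho>"
      using \<rho> first_at(2)[OF s(1) True] by (intro first_at_eqI[OF \<eta> r(2)]) (auto simp: shuffle_map_def)
    then show ?thesis using nth1[OF r(1) True] \<rho> by (auto simp: fold_edge_def fold_map_def)
  next
    case False
    define q where "q = r - i"
    have q: "r = i + q" "1 \<le> q" "q \<le> j" using False r by (auto simp: q_def)
    let ?\<rho> = "first_at \<tau> q"
    have \<rho>: "1 \<le> ?\<rho>" "?\<rho> \<le> ?n" using pos[OF r] nth2[OF q(2,3)] q(1) by auto
    have "\<tau> (?\<rho> - 1) < q" using first_at_pred[OF s(2) q(3)] \<rho> by simp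
    moreover have "?n + 1 + ?\<rho> - 1 - (?n + 1) = ?\<rho> - 1" using \<rho> by simp
    ultimately have "first_at ?\<eta> r = ?n + 1 + ?\<rho>"
      using \<rho> first_at(2)[OF s(2) q(3)] q(1)
      by (intro first_at_eqI[OF \<eta> r(2)]) (auto simp: shuffle_map_def)
    moreover have "fold_map ?n (?n + 1 + ?\<rho>) = ?\<rho>" "fold_map ?n (?n + 1 + ?\<rho> - 1) = ?\<rho> - 1"
      using \<rho> by (auto simp: fold_map_def)
    ultimately show ?thesis using nth2[OF q(2,3)] q(1) \<rho> by (auto simp: fold_edge_def)
  qed
  have "fold_mat ?n (first_at ?\<eta>) = mat (Suc ?n) (Suc ?n) (\<lambda>(i, j). of_bool (?ws ! i = j))"
    unfolding fold_mat_def by (rule cong_mat) (auto simp: edge simp del: upt_Suc)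
  then have "fold_coeff ?n ?\<eta> = det (mat (Suc ?n) (Suc ?n) (\<lambda>(i, j). of_bool (?ws ! i = j)))"
    unfolding fold_coeff_def by simp
  also have "\<dots> = (if distinct ?ws then sort_sign ?ws else 0)"
    by (rule det_list_matrix) (use L1 in \<open>auto simp del: upt_Suc\<close>)
  also have "\<dots> = sort_sign ?L" using sort_sign_Cons_0[of ?L] dist L1 by (auto simp del: upt_Suc)
  finally show ?thesis unfolding shuffle_sgn_def L .
qed

lemma degeneracy_fold_not_inj:
  assumes "g \<in> Delta l (n + n + 1)" "n < l"
  shows "\<not> inj_on (\<lambda>x. fold_map n (g x)) {..l}"
proof
  assume "inj_on (\<lambda>x. fold_map n (g x)) {..l}"
  then have "card {..l} \<le> card {..n}"
    by (rule card_inj_on_le) (use fold_map_le[OF Delta_le[OF assms(1)]] in auto)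
  then show False using assms(2) by simp
qed

section \<open>The map \<gamma> as a combination of degeneracies\<close>

context simplicial_obj
begin

text \<open>Folding destroys the order of the vertices of g, so the component is expressed by the
  alternating extension of the canonical cochain instead of a face operator.\<close>

lemma gamma_face:
  assumes g: "g \<in> Delta l (n + n + 1)" "inj_on g {..l}"
  shows "nd_prj C A l \<bullet>\<^bsub>C\<^esub> act l (n + n + 1) g \<bullet>\<^bsub>C\<^esub> Ez_gamma C A n =
    alternating (sob A n) (canon n) (map (\<lambda>k. fold_map n (g k)) [0..<Suc l])"
proof -
  have S: "g ` {..l} \<in> faces (n + n + 1)" by (rule face_of_map(1)[OF g])
  have c: "canon n \<in> simplex_chain_maps C A n (sob A n)"
    using canon_simplex_Hom unfolding is_simplex_Hom_def by blast
  have "nd_prj C A l \<bullet>\<^bsub>C\<^esub> act l (n + n + 1) g \<bullet>\<^bsub>C\<^esub> Ez_gamma C A n = canon (n + n + 1) (g ` {..l}) \<bullet>\<^bsub>C\<^esub> Ez_gamma C A n"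
    unfolding canon_face[OF g] by (rule cmp_assoc[OF canon_gamma(2)[OF S] act_hom[OF g(1)] nd_prj_hom, symmetric])
  also have "\<dots> = simplex_pull C A (fold_map n) (sob A n) (canon n) (g ` {..l})" by (rule canon_gamma(1)[OF S])
  also have "\<dots> = alternating (sob A n) (canon n) (map (fold_map n) (sorted_list_of_set (g ` {..l})))"
    by (rule simplex_pull_alternating[OF sob_obj c S])
  finally show ?thesis unfolding sorted_list_of_image[OF g] by (simp add: comp_def del: upt_Suc)
qed

lemma gamma_hom: "Ez_gamma C A n \<in> Homs C (sob A n) (sob A (n + n + 1))"
  by (rule canon_gamma(2)[of "{0}"]) (simp add: faces_def)

definition fold_sum :: "nat \<Rightarrow> 'm" where
  "fold_sum n = finsum (H (sob A n) (sob A (n + n + 1)))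
     (\<lambda>\<eta>. [(fold_coeff n \<eta>)] \<cdot>\<^bsub>H (sob A n) (sob A (n + n + 1))\<^esub> act (n + n + 1) n \<eta>) (Delta_surj (n + n + 1) n)"

lemma fold_sum_hom: "fold_sum n \<in> Homs C (sob A n) (sob A (n + n + 1))"
  unfolding fold_sum_def by (intro finsum_hom sob_obj scal_hom act_hom Delta_surjD(1))

lemma finite_Delta_surj: "finite (Delta_surj m n)"
  by (rule finite_subset[OF _ finite_Delta]) (auto simp: Delta_surj_def)

lemma cmp_fold_sum:
  assumes "h \<in> Homs C (sob A (n + n + 1)) b"
  shows "h \<bullet>\<^bsub>C\<^esub> fold_sum n = finsum (H (sob A n) b)
     (\<lambda>\<eta>. [(fold_coeff n \<eta>)] \<cdot>\<^bsub>H (sob A n) b\<^esub> (h \<bullet>\<^bsub>C\<^esub> act (n + n + 1) n \<eta>)) (Delta_surj (n + n + 1) n)"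
proof -
  have b: "b \<in> Obj C" using Homs_obj[OF assms] by blast
  have a: "act (n + n + 1) n \<eta> \<in> Homs C (sob A n) (sob A (n + n + 1))" if "\<eta> \<in> Delta_surj (n + n + 1) n" for \<eta>
    by (rule act_hom[OF Delta_surjD(1)[OF that]])
  have "h \<bullet>\<^bsub>C\<^esub> fold_sum n = finsum (H (sob A n) b)
     (\<lambda>\<eta>. h \<bullet>\<^bsub>C\<^esub> ([(fold_coeff n \<eta>)] \<cdot>\<^bsub>H (sob A n) (sob A (n + n + 1))\<^esub> act (n + n + 1) n \<eta>)) (Delta_surj (n + n + 1) n)"
    unfolding fold_sum_def by (rule cmp_finsum_right[OF assms sob_obj scal_hom[OF a]])
  also have "\<dots> = finsum (H (sob A n) b)
     (\<lambda>\<eta>. [(fold_coeff n \<eta>)] \<cdot>\<^bsub>H (sob A n) b\<^esub> (h \<bullet>\<^bsub>C\<^esub> act (n + n + 1) n \<eta>)) (Delta_surj (n + n + 1) n)"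
    by (rule finsum_eqI[OF sob_obj b]) (use cmp_scal_right[OF a assms] scal_hom[OF cmp_hom[OF a assms]] in auto)
  finally show ?thesis .
qed

text \<open>The composite of g with a degeneracy \<eta> is an endomorphism of [n] and dies in the
  nondegenerate quotient unless it is the identity. So the component is the integer of
  \<open>sum_fold_coeff\<close> times the projection. For \<gamma> the same integer appears, since n
  + 1 distinct folded vertices exhaust [n].\<close>

lemma fold_sum_top_face:
  assumes g: "g \<in> Delta n (n + n + 1)" "inj_on g {..n}"
  shows "nd_prj C A n \<bullet>\<^bsub>C\<^esub> act n (n + n + 1) g \<bullet>\<^bsub>C\<^esub> fold_sum n =
    nd_prj C A n \<bullet>\<^bsub>C\<^esub> act n (n + n + 1) g \<bullet>\<^bsub>C\<^esub> Ez_gamma C A n"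
proof -
  let ?N = "n + n + 1" and ?H = "H (sob A n) (nd C A n)" and ?p = "nd_prj C A n"
  let ?E = "\<lambda>\<eta>. compose {..n} \<eta> g = restrict id {..n}"
  let ?a = "map (\<lambda>k. fold_map n (g k)) [0..<Suc n]"
  have h: "?p \<bullet>\<^bsub>C\<^esub> act n ?N g \<in> Homs C (sob A ?N) (nd C A n)" by (rule cmp_hom[OF act_hom[OF g(1)] nd_prj_hom])
  have "?p \<bullet>\<^bsub>C\<^esub> act n ?N g \<bullet>\<^bsub>C\<^esub> fold_sum n = (?p \<bullet>\<^bsub>C\<^esub> act n ?N g) \<bullet>\<^bsub>C\<^esub> fold_sum n"
    by (rule cmp_assoc[OF fold_sum_hom act_hom[OF g(1)] nd_prj_hom, symmetric])
  also have "\<dots> = finsum ?H (\<lambda>\<eta>. [(fold_coeff n \<eta>)] \<cdot>\<^bsub>?H\<^esub> ((?p \<bullet>\<^bsub>C\<^esub> act n ?N g) \<bullet>\<^bsub>C\<^esub> act ?N n \<eta>)) (Delta_surj ?N n)"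
    by (rule cmp_fold_sum[OF h])
  also have "\<dots> = finsum ?H (\<lambda>\<eta>. [(if ?E \<eta> then fold_coeff n \<eta> else 0)] \<cdot>\<^bsub>?H\<^esub> ?p) (Delta_surj ?N n)"
  proof (rule finsum_eqI[OF sob_obj nd_obj])
    fix \<eta> assume "\<eta> \<in> Delta_surj ?N n"
    then have \<eta>: "\<eta> \<in> Delta ?N n" by (rule Delta_surjD)
    have "(?p \<bullet>\<^bsub>C\<^esub> act n ?N g) \<bullet>\<^bsub>C\<^esub> act ?N n \<eta> = ?p \<bullet>\<^bsub>C\<^esub> act n n (compose {..n} \<eta> g)"
      using cmp_assoc[OF act_hom[OF \<eta>] act_hom[OF g(1)] nd_prj_hom] act_compose[OF g(1) \<eta>] by simp
    also have "\<dots> = (if ?E \<eta> then ?p else Zer C (sob A n) (nd C A n))"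
    proof (cases "?E \<eta>")
      case True then show ?thesis using act_id cmp_ide[OF nd_prj_hom] by simp
    next
      case False
      have e: "compose {..n} \<eta> g \<in> Delta n n" by (rule Delta_compose[OF g(1) \<eta>])
      then have "\<not> inj_on (compose {..n} \<eta> g) {..n}" using Delta_inj_id False by blast
      then show ?thesis using False nd_degenerate[OF e] by simp
    qed
    finally show "[(fold_coeff n \<eta>)] \<cdot>\<^bsub>?H\<^esub> ((?p \<bullet>\<^bsub>C\<^esub> act n ?N g) \<bullet>\<^bsub>C\<^esub> act ?N n \<eta>) =
       [(if ?E \<eta> then fold_coeff n \<eta> else 0)] \<cdot>\<^bsub>?H\<^esub> ?p"
      using scal_zero[OF sob_obj nd_obj] by (simp add: scal_0)
  qed (rule scal_hom[OF nd_prj_hom])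
  also have "\<dots> = [(\<Sum>\<eta>\<in>Delta_surj ?N n. if ?E \<eta> then fold_coeff n \<eta> else 0)] \<cdot>\<^bsub>?H\<^esub> ?p"
    by (rule finsum_scal[OF nd_prj_hom finite_Delta_surj])
  also have "(\<Sum>\<eta>\<in>Delta_surj ?N n. if ?E \<eta> then fold_coeff n \<eta> else 0)
      = (\<Sum>\<eta> | \<eta> \<in> Delta_surj ?N n \<and> ?E \<eta>. fold_coeff n \<eta>)"
    by (rule sum.inter_filter[symmetric, OF finite_Delta_surj])
  also have "\<dots> = (if distinct ?a then sort_sign ?a else 0)" by (rule sum_fold_coeff[OF g])
  also have "[(if distinct ?a then sort_sign ?a else 0)] \<cdot>\<^bsub>?H\<^esub> ?p = alternating (sob A n) (canon n) ?a"
  proof (cases "distinct ?a")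
    case True
    have sub: "set ?a \<subseteq> {..n}"
      unfolding set_map by (rule image_subsetI, rule atMost_iff[THEN iffD2], rule fold_map_le[OF Delta_le[OF g(1)]]) auto
    have "card (set ?a) = card {..n}" using distinct_card[OF True] by simp
    then have eq: "set ?a = restrict id {..n} ` {..n}" using card_subset_eq[OF _ sub] by simp
    have "inj_on (restrict id {..n}) {..n}" by (simp only: inj_on_restrict_eq inj_on_id)
    from canon_face[OF Delta_id this] have "canon n (set ?a) = ?p"
      unfolding eq using act_id cmp_ide[OF nd_prj_hom] by simp
    then show ?thesis using True by (simp add: alternating_def del: upt_Suc)
  qed (simp add: alternating_def scal_0 del: upt_Suc)
  finally show ?thesis unfolding gamma_face[OF g] .
qed

text \<open>Modulo the \<open>(n - 1)\<close>-skeleton, \<open>\<gamma>\<close> is the combination of degeneracies with coefficients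
  \<^const>\<open>fold_coeff\<close>: both have the same components at all faces of dimension at least \<open>n\<close>.\<close>

lemma gamma_mod_skeleton:
  assumes h: "h \<in> Homs C (sob A (n + n + 1)) b"
    and kill: "\<And>q f. q < n \<Longrightarrow> f \<in> Delta (n + n + 1) q \<Longrightarrow> h \<bullet>\<^bsub>C\<^esub> act (n + n + 1) q f = Zer C (sob A q) b"
  shows "h \<bullet>\<^bsub>C\<^esub> Ez_gamma C A n = h \<bullet>\<^bsub>C\<^esub> fold_sum n"
proof -
  let ?N = "n + n + 1" and ?T = "sob A n"
  note \<gamma> = gamma_hom[of n] and \<phi> = fold_sum_hom[of n]
  have b: "b \<in> Obj C" using Homs_obj[OF h] by blast
  \<comment> \<open>Membership in the (n - 1)-skeleton is encoded by duality: t lies in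
    \<open>P m\<close> if it is killed by every arrow that kills all simplices coming from
    dimensions below n. This avoids constructing the skeleton as a subobject.\<close>
  define P where "P m = {t \<in> Homs C ?T (sob A m). \<forall>h b. h \<in> Homs C (sob A m) b \<and>
      (\<forall>q f. q < n \<and> f \<in> Delta m q \<longrightarrow> h \<bullet>\<^bsub>C\<^esub> act m q f = Zer C (sob A q) b) \<longrightarrow> h \<bullet>\<^bsub>C\<^esub> t = Zer C ?T b}" for m
  have low: "t \<in> P m" if "t \<in> Homs C ?T (sob A m)" "m < n" for t m
    unfolding P_def
  proof (intro CollectI conjI allI impI that(1))
    fix h b assume h: "h \<in> Homs C (sob A m) b \<and>
      (\<forall>q f. q < n \<and> f \<in> Delta m q \<longrightarrow> h \<bullet>\<^bsub>C\<^esub> act m q f = Zer C (sob A q) b)"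
    then have "h \<bullet>\<^bsub>C\<^esub> act m m (restrict id {..m}) = Zer C (sob A m) b" using that(2) Delta_id by blast
    then have "h = Zer C (sob A m) b" using act_id cmp_ide h by metis
    then show "h \<bullet>\<^bsub>C\<^esub> t = Zer C ?T b" using cmp_zero_left[OF that(1)] h Homs_obj by blast
  qed
  have "minus_arr (Ez_gamma C A n) (fold_sum n) \<in> P ?N"
  proof (rule mem_by_faces)
    show "P m \<subseteq> Homs C ?T (sob A m)" for m by (auto simp: P_def)
    show "Zer C ?T (sob A m) \<in> P m" for m
      using Zer_hom sob_obj cmp_zero_right by (auto simp: P_def)
    show "Add C x y \<in> P m" if "x \<in> P m" "y \<in> P m" for m x y
    proof -
      have xy: "x \<in> Homs C ?T (sob A m)" "y \<in> Homs C ?T (sob A m)" using that by (auto simp: P_def)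
      have "h \<bullet>\<^bsub>C\<^esub> Add C x y = Zer C ?T b"
        if "h \<in> Homs C (sob A m) b" "h \<bullet>\<^bsub>C\<^esub> x = Zer C ?T b" "h \<bullet>\<^bsub>C\<^esub> y = Zer C ?T b" for h b
        using that cmp_add_right[OF xy that(1)] add_zero(1)[OF Zer_hom[OF sob_obj]] Homs_obj[OF that(1)] by simp
      then show ?thesis using that Add_hom[OF xy] unfolding P_def by blast
    qed
    show "minus_arr x y \<in> P m" if "x \<in> P m" "y \<in> P m" for m x y
    proof -
      have xy: "x \<in> Homs C ?T (sob A m)" "y \<in> Homs C ?T (sob A m)" using that by (auto simp: P_def)
      have "h \<bullet>\<^bsub>C\<^esub> minus_arr x y = Zer C ?T b"
        if "h \<in> Homs C (sob A m) b" "h \<bullet>\<^bsub>C\<^esub> x = Zer C ?T b" "h \<bullet>\<^bsub>C\<^esub> y = Zer C ?T b" for h b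
        using that cmp_minus_right[OF xy that(1)] minus_zero[OF Zer_hom[OF sob_obj]] Homs_obj[OF that(1)] by simp
      then show ?thesis using that minus_hom[OF xy] unfolding P_def by blast
    qed
    show "act l m g \<bullet>\<^bsub>C\<^esub> x \<in> P l" if "x \<in> P m" "g \<in> Delta l m" for l m g x
    proof -
      have x: "x \<in> Homs C ?T (sob A m)" using that by (auto simp: P_def)
      show ?thesis unfolding P_def
      proof (intro CollectI conjI allI impI act_cmp_hom[OF that(2) x])
        fix h b assume h: "h \<in> Homs C (sob A l) b \<and>
          (\<forall>q f. q < n \<and> f \<in> Delta l q \<longrightarrow> h \<bullet>\<^bsub>C\<^esub> act l q f = Zer C (sob A q) b)"
        then have hg: "h \<bullet>\<^bsub>C\<^esub> act l m g \<in> Homs C (sob A m) b" using cmp_hom act_hom[OF that(2)] by blast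
        have "(h \<bullet>\<^bsub>C\<^esub> act l m g) \<bullet>\<^bsub>C\<^esub> act m q f = Zer C (sob A q) b" if qf: "q < n" "f \<in> Delta m q" for q f
        proof -
          have "h \<bullet>\<^bsub>C\<^esub> act l q (compose {..l} f g) = Zer C (sob A q) b"
            using h Delta_compose[OF \<open>g \<in> Delta l m\<close> qf(2)] qf(1) by blast
          then show ?thesis
            unfolding act_compose[OF \<open>g \<in> Delta l m\<close> qf(2)]
            using cmp_assoc[OF act_hom[OF qf(2)] act_hom[OF \<open>g \<in> Delta l m\<close>], of h b] h by simp
        qed
        then have "(h \<bullet>\<^bsub>C\<^esub> act l m g) \<bullet>\<^bsub>C\<^esub> x = Zer C ?T b" using that(1) hg unfolding P_def by blast
        then show "h \<bullet>\<^bsub>C\<^esub> act l m g \<bullet>\<^bsub>C\<^esub> x = Zer C ?T b"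
          using cmp_assoc[OF x act_hom[OF that(2)], of h b] h by simp
      qed
    qed
    show "minus_arr (Ez_gamma C A n) (fold_sum n) \<in> Homs C ?T (sob A ?N)" by (rule minus_hom[OF \<gamma> \<phi>])
    fix l g assume g: "g \<in> Delta l ?N" "inj_on g {..l}"
    note g\<gamma> = act_cmp_hom[OF g(1) \<gamma>] and g\<phi> = act_cmp_hom[OF g(1) \<phi>]
    have split: "nd_prj C A l \<bullet>\<^bsub>C\<^esub> act l ?N g \<bullet>\<^bsub>C\<^esub> minus_arr (Ez_gamma C A n) (fold_sum n) =
        minus_arr (nd_prj C A l \<bullet>\<^bsub>C\<^esub> act l ?N g \<bullet>\<^bsub>C\<^esub> Ez_gamma C A n) (nd_prj C A l \<bullet>\<^bsub>C\<^esub> act l ?N g \<bullet>\<^bsub>C\<^esub> fold_sum n)"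
      unfolding act_add_minus(2)[OF g(1) \<gamma> \<phi>] by (rule cmp_minus_right[OF g\<gamma> g\<phi> nd_prj_hom])
    \<comment> \<open>Faces of dimension below n lie in the skeleton, in dimension n the two
      components agree by the determinant computation, and above n both vanish.\<close>
    consider "l < n" | "l = n" | "n < l" by linarith
    then show "nd_prj C A l \<bullet>\<^bsub>C\<^esub> act l ?N g \<bullet>\<^bsub>C\<^esub> minus_arr (Ez_gamma C A n) (fold_sum n) = Zer C ?T (nd C A l) \<or>
       act l ?N g \<bullet>\<^bsub>C\<^esub> minus_arr (Ez_gamma C A n) (fold_sum n) \<in> P l"
    proof cases
      case 1
      then show ?thesis using low[OF act_cmp_hom[OF g(1) minus_hom[OF \<gamma> \<phi>]]] by blast
    next
      case 2
      then show ?thesis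
        using split fold_sum_top_face[of g n] g minus_self[OF cmp_hom[OF g\<gamma> nd_prj_hom]] by simp
    next
      case 3
      have "\<not> distinct (map (\<lambda>k. fold_map n (g k)) [0..<Suc l])"
        using degeneracy_fold_not_inj[OF g(1) 3]
        by (simp add: distinct_map atLeast0LessThan lessThan_Suc_atMost del: upt_Suc)
      then have "nd_prj C A l \<bullet>\<^bsub>C\<^esub> act l ?N g \<bullet>\<^bsub>C\<^esub> Ez_gamma C A n = Zer C ?T (nd C A l)"
        unfolding gamma_face[OF g] by (simp add: alternating_def del: upt_Suc)
      moreover have "nd_prj C A l \<bullet>\<^bsub>C\<^esub> act l ?N g \<bullet>\<^bsub>C\<^esub> fold_sum n = Zer C ?T (nd C A l)"
      proof -
        have hp: "nd_prj C A l \<bullet>\<^bsub>C\<^esub> act l ?N g \<in> Homs C (sob A ?N) (nd C A l)"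
          by (rule cmp_hom[OF act_hom[OF g(1)] nd_prj_hom])
        have "(nd_prj C A l \<bullet>\<^bsub>C\<^esub> act l ?N g) \<bullet>\<^bsub>C\<^esub> act ?N n \<eta> = Zer C ?T (nd C A l)"
          if "\<eta> \<in> Delta_surj ?N n" for \<eta>
        proof -
          note \<eta> = Delta_surjD(1)[OF that] and e = Delta_compose[OF g(1) Delta_surjD(1)[OF that]]
          have "\<not> inj_on (compose {..l} \<eta> g) {..l}" using Delta_inj_le[OF e] 3 by auto
          then show ?thesis
            using cmp_assoc[OF act_hom[OF \<eta>] act_hom[OF g(1)] nd_prj_hom] act_compose[OF g(1) \<eta>] nd_degenerate[OF e]
            by simp
        qed
        then have "(nd_prj C A l \<bullet>\<^bsub>C\<^esub> act l ?N g) \<bullet>\<^bsub>C\<^esub> fold_sum n = Zer C ?T (nd C A l)"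
          unfolding cmp_fold_sum[OF hp] using scal_zero[OF sob_obj nd_obj] by (intro finsum_Zer sob_obj nd_obj) auto
        then show ?thesis using cmp_assoc[OF \<phi> act_hom[OF g(1)] nd_prj_hom] by simp
      qed
      ultimately show ?thesis using split minus_self[OF Zer_hom[OF sob_obj nd_obj]] by simp
    qed
  qed
  then have "h \<bullet>\<^bsub>C\<^esub> minus_arr (Ez_gamma C A n) (fold_sum n) = Zer C ?T b"
    using h kill unfolding P_def by blast
  then show ?thesis
    using cmp_minus_right[OF \<gamma> \<phi> h] minus_eq_zero_iff[OF cmp_hom[OF \<gamma> h] cmp_hom[OF \<phi> h]] by simp
qed

end

section \<open>Bisimplicial objects\<close>

lemma bisimplicial_morD:
  assumes "bisimplicial_mor C X Y \<phi>"
  shows "\<phi> m n \<in> Homs C (bob X m n) (bob Y m n)"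
    "f \<in> Delta m m' \<Longrightarrow> g \<in> Delta n n' \<Longrightarrow>
       \<phi> m n \<bullet>\<^bsub>C\<^esub> bact X m m' f n n' g = bact Y m m' f n n' g \<bullet>\<^bsub>C\<^esub> \<phi> m' n'"
  using assms by (auto simp: bisimplicial_mor_def)

definition row :: "('o, 'm) bisimplicial \<Rightarrow> nat \<Rightarrow> ('o, 'm) simplicial" where
  "row X l = \<lparr>sob = (\<lambda>k. bob X k l), sact = (\<lambda>m n f. bact X m n f l l (restrict id {..l}))\<rparr>"

definition col :: "('o, 'm) bisimplicial \<Rightarrow> nat \<Rightarrow> ('o, 'm) simplicial" where
  "col X k = \<lparr>sob = (\<lambda>l. bob X k l), sact = (\<lambda>m n g. bact X k k (restrict id {..k}) m n g)\<rparr>"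

lemma row_simps [simp]: "sob (row X l) k = bob X k l" "sact (row X l) m n f = bact X m n f l l (restrict id {..l})"
  and col_simps [simp]: "sob (col X k) l = bob X k l" "sact (col X k) m n g = bact X k k (restrict id {..k}) m n g"
  and diag_simps [simp]: "sob (diag X) n = bob X n n" "sact (diag X) m n f = bact X m n f m n f"
  by (simp_all add: row_def col_def diag_def)

lemma not_inj_compose_left:
  assumes "f \<in> Delta l m" "\<not> inj_on f {..l}"
  shows "\<exists>k<l. f \<in> Delta l m \<and> (\<exists>h \<in> Delta k m. \<exists>s \<in> Delta_surj l k. f = compose {..l} h s)"
proof -
  obtain a where a: "a < l" "f a = f (Suc a)" using not_inj_adjacent1[OF assms] by blast
  then obtain k where l: "l = Suc k" by (cases l) auto
  have "f = compose {..l} (compose {..k} f (coface k (Suc a))) (codeg k a)"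
    using factor_codeg[of f k m a] assms(1) a l by simp
  moreover have "compose {..k} f (coface k (Suc a)) \<in> Delta k m"
    using Delta_compose[OF coface_Delta, of f k m "Suc a"] assms(1) l by simp
  moreover have "codeg k a \<in> Delta_surj l k" using codeg_Delta[of a k] a l by simp
  ultimately show ?thesis using assms(1) l by blast
qed

lemma id_Delta_surj: "restrict id {..n} \<in> Delta_surj n n"
  using Delta_id by (auto simp: Delta_surj_def)

locale bisimplicial_obj = abelian_category C for C :: "('o, 'm) additive_data" +
  fixes X :: "('o, 'm) bisimplicial"
  assumes X: "bisimplicial_object C X"
begin

abbreviation "idm n \<equiv> restrict id {..n::nat}"

lemma bob_obj: "bob X m n \<in> Obj C"
  using X by (simp add: bisimplicial_object_def)

lemma bact_hom: "f \<in> Delta m m' \<Longrightarrow> g \<in> Delta n n' \<Longrightarrow> bact X m m' f n n' g \<in> Homs C (bob X m' n') (bob X m n)"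
  using X by (simp add: bisimplicial_object_def)

lemma bact_id: "bact X m m (idm m) n n (idm n) = Ide C (bob X m n)"
  using X by (simp add: bisimplicial_object_def)

lemma bact_compose:
  "f \<in> Delta m m' \<Longrightarrow> f' \<in> Delta m' m'' \<Longrightarrow> g \<in> Delta n n' \<Longrightarrow> g' \<in> Delta n' n'' \<Longrightarrow>
   bact X m m'' (compose {..m} f' f) n n'' (compose {..n} g' g) =
     bact X m m' f n n' g \<bullet>\<^bsub>C\<^esub> bact X m' m'' f' n' n'' g'"
  using X by (simp add: bisimplicial_object_def)

lemma bact_split:
  assumes "f \<in> Delta m m'" "g \<in> Delta n n'"
  shows "bact X m m' f n n' g = bact X m m' f n n (idm n) \<bullet>\<^bsub>C\<^esub> bact X m' m' (idm m') n n' g"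
    "bact X m m' f n n' g = bact X m m (idm m) n n' g \<bullet>\<^bsub>C\<^esub> bact X m m' f n' n' (idm n')"
  using bact_compose[OF assms(1) Delta_id Delta_id assms(2)] bact_compose[OF Delta_id assms(1) assms(2) Delta_id]
    Delta_compose_id assms by simp_all

lemma bact_act:
  assumes "f \<in> Delta m m'" "f' \<in> Delta m' m''" "g \<in> Delta n n'" "g' \<in> Delta n' n''" "t \<in> Homs C T (bob X m'' n'')"
  shows "bact X m m' f n n' g \<bullet>\<^bsub>C\<^esub> bact X m' m'' f' n' n'' g' \<bullet>\<^bsub>C\<^esub> t =
    bact X m m'' (compose {..m} f' f) n n'' (compose {..n} g' g) \<bullet>\<^bsub>C\<^esub> t"
  using cmp_assoc[OF assms(5) bact_hom[OF assms(2,4)] bact_hom[OF assms(1,3)]] bact_compose[OF assms(1-4)] by simp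

lemma row_simplicial: "simplicial_object C (row X l)"
  unfolding simplicial_object_def row_simps
proof (intro conjI allI ballI bob_obj bact_hom Delta_id bact_id)
  fix k m n f g assume "f \<in> Delta k m" "g \<in> Delta m n"
  from bact_compose[OF this Delta_id Delta_id]
  show "bact X k n (compose {..k} g f) l l (idm l) = bact X k m f l l (idm l) \<bullet>\<^bsub>C\<^esub> bact X m n g l l (idm l)"
    unfolding Delta_compose_id(1)[OF Delta_id] .
qed

lemma col_simplicial: "simplicial_object C (col X k)"
  unfolding simplicial_object_def col_simps
proof (intro conjI allI ballI bob_obj bact_hom Delta_id bact_id)
  fix l m n f g assume "f \<in> Delta l m" "g \<in> Delta m n"
  from bact_compose[OF Delta_id Delta_id this]
  show "bact X k k (idm k) l n (compose {..l} g f) = bact X k k (idm k) l m f \<bullet>\<^bsub>C\<^esub> bact X k k (idm k) m n g"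
    unfolding Delta_compose_id(1)[OF Delta_id] .
qed

lemma diag_simplicial: "simplicial_object C (diag X)"
  unfolding simplicial_object_def diag_simps
  by (intro conjI allI ballI bob_obj bact_hom bact_id bact_compose)

sublocale row: simplicial_obj C "row X l" for l
  by unfold_locales (rule row_simplicial)

sublocale col: simplicial_obj C "col X k" for k
  by unfold_locales (rule col_simplicial)

sublocale diag: simplicial_obj C "diag X"
  by unfold_locales (rule diag_simplicial)

lemma row_mor:
  assumes "g \<in> Delta l l'"
  shows "simplicial_mor C (row X l') (row X l) (\<lambda>k. bact X k k (idm k) l l' g)"
  unfolding simplicial_mor_def row_simps
  by (intro conjI allI ballI bact_hom[OF Delta_id assms])
     (rule trans[OF bact_split(2)[OF _ assms, symmetric] bact_split(1)[OF _ assms]])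

lemma col_mor:
  assumes "f \<in> Delta k k'"
  shows "simplicial_mor C (col X k') (col X k) (\<lambda>l. bact X k k' f l l (idm l))"
  unfolding simplicial_mor_def col_simps
  by (intro conjI allI ballI bact_hom[OF assms Delta_id])
     (rule trans[OF bact_split(1)[OF assms, symmetric] bact_split(2)[OF assms]])

lemma bidegeneracies_arr:
  assumes "s \<in> bidegeneracies X i j"
  shows "s \<in> Arr C \<and> Cod C s = bob X i j"
proof -
  obtain k l f g where fg: "s = bact X i k f j l g" "f \<in> Delta_surj i k" "g \<in> Delta_surj j l"
    using assms unfolding bidegeneracies_def by blast
  show ?thesis
    unfolding fg(1) using Homs_Dom_Cod[OF bact_hom[OF Delta_surjD(1)[OF fg(2)] Delta_surjD(1)[OF fg(3)]]] by blast
qed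

lemma bnd_quotient: "is_quotient C (bob X i j) (bidegeneracies X i j) (bnd_prj C X i j)"
  unfolding bnd_prj_def
proof (rule quotient_prj[OF _ bob_obj])
  have "bidegeneracies X i j \<subseteq> (\<Union>k\<le>i. \<Union>l\<le>j. (\<lambda>(s, t). bact X i k s j l t) ` (Delta i k \<times> Delta j l))"
  proof
    fix s assume "s \<in> bidegeneracies X i j"
    then obtain k l f g where fg: "s = bact X i k f j l g" "f \<in> Delta_surj i k" "g \<in> Delta_surj j l"
      unfolding bidegeneracies_def by blast
    then have "s \<in> (\<lambda>(s, t). bact X i k s j l t) ` (Delta i k \<times> Delta j l)" "k \<le> i" "l \<le> j"
      using Delta_surjD(1)[OF fg(2)] Delta_surjD(1)[OF fg(3)] Delta_surj_le[OF fg(2)] Delta_surj_le[OF fg(3)]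
      by (auto intro!: image_eqI[of _ _ "(f, g)"])
    then show "s \<in> (\<Union>k\<le>i. \<Union>l\<le>j. (\<lambda>(s, t). bact X i k s j l t) ` (Delta i k \<times> Delta j l))" by blast
  qed
  then show "finite (bidegeneracies X i j)" by (rule finite_subset) (auto intro: finite_Delta)
next
  fix s assume "s \<in> bidegeneracies X i j"
  then show "s \<in> Arr C \<and> Cod C s = bob X i j"
    by (rule bidegeneracies_arr)
qed

lemma bnd_prj_hom: "bnd_prj C X i j \<in> Homs C (bob X i j) (bnd C X i j)"
  using is_quotientD(1)[OF bnd_quotient] by (simp add: bnd_def)

lemma bnd_obj: "bnd C X i j \<in> Obj C"
  using Homs_obj[OF bnd_prj_hom] by blast

lemma bnd_epic:
  assumes "g \<in> Homs C (bnd C X i j) b" "h \<in> Homs C (bnd C X i j) b"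
    "g \<bullet>\<^bsub>C\<^esub> bnd_prj C X i j = h \<bullet>\<^bsub>C\<^esub> bnd_prj C X i j"
  shows "g = h"
proof (rule quotient_epic[OF bnd_quotient[of i j]])
  fix s assume "s \<in> bidegeneracies X i j"
  then show "s \<in> Arr C \<and> Cod C s = bob X i j"
    by (rule bidegeneracies_arr)
qed (use assms in \<open>simp_all add: bnd_def[symmetric]\<close>)

text \<open>Only the variable in which injectivity fails is factored through a smaller simplex; the
  other one keeps the identity as its surjection.\<close>

lemma bnd_degenerate:
  assumes f: "f \<in> Delta i k" and g: "g \<in> Delta j l" and ni: "\<not> inj_on f {..i} \<or> \<not> inj_on g {..j}"
  shows "bnd_prj C X i j \<bullet>\<^bsub>C\<^esub> bact X i k f j l g = Zer C (bob X k l) (bnd C X i j)"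
proof -
  obtain k' l' f' s g' t where st: "s \<in> Delta_surj i k'" "t \<in> Delta_surj j l'" "k' < i \<or> l' < j"
    and fg: "f' \<in> Delta k' k" "g' \<in> Delta l' l" "f = compose {..i} f' s" "g = compose {..j} g' t"
  proof (cases "inj_on f {..i}")
    case False
    then show thesis
      using not_inj_compose_left[OF f] that[OF _ id_Delta_surj _ _ g _ Delta_compose_id(2)[OF g, symmetric]] by metis
  next
    case True
    then show thesis
      using ni not_inj_compose_left[OF g] that[OF id_Delta_surj _ _ f _ Delta_compose_id(2)[OF f, symmetric]] by metis
  qed
  note s = Delta_surjD(1)[OF st(1)] and t = Delta_surjD(1)[OF st(2)]
  have "bact X i k' s j l' t \<in> bidegeneracies X i j" using st unfolding bidegeneracies_def by blast
  from is_quotientD(2)[OF bnd_quotient this]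
  have "bnd_prj C X i j \<bullet>\<^bsub>C\<^esub> bact X i k' s j l' t = Zer C (bob X k' l') (bnd C X i j)"
    using Homs_Dom_Cod[OF bact_hom[OF s t]] by (simp add: bnd_def)
  then show ?thesis
    unfolding fg(3,4) bact_compose[OF s fg(1) t fg(2)]
    using cmp_assoc[OF bact_hom[OF fg(1,2)] bact_hom[OF s t] bnd_prj_hom] cmp_zero_left[OF bact_hom[OF fg(1,2)] bnd_obj]
    by simp
qed

text \<open>The condition to be checked comes with both descriptions of a degenerate operator:
  binormalization uses the failure of injectivity, while the shuffle maps use the drop of
  dimension.\<close>

lemma bnd_descend:
  assumes "t \<in> Homs C (bob X i j) b"
    "\<And>k l f g. f \<in> Delta i k \<Longrightarrow> g \<in> Delta j l \<Longrightarrow> \<not> inj_on f {..i} \<or> \<not> inj_on g {..j} \<Longrightarrow> k < i \<or> l < j \<Longrightarrow> k \<le> i \<Longrightarrow> l \<le> j \<Longrightarrow>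
       t \<bullet>\<^bsub>C\<^esub> bact X i k f j l g = Zer C (bob X k l) b"
  shows "descend C (bnd_prj C X i j) t \<in> Homs C (bnd C X i j) b"
    "descend C (bnd_prj C X i j) t \<bullet>\<^bsub>C\<^esub> bnd_prj C X i j = t"
proof -
  have "t \<bullet>\<^bsub>C\<^esub> s = Zer C (Dom C s) b" if s: "s \<in> bidegeneracies X i j" for s
  proof -
    obtain k l f g where fg: "s = bact X i k f j l g" "f \<in> Delta_surj i k" "g \<in> Delta_surj j l" "k < i \<or> l < j"
      using s unfolding bidegeneracies_def by blast
    note d = Delta_surjD(1)[OF fg(2)] Delta_surjD(1)[OF fg(3)]
    have "\<not> inj_on f {..i} \<or> \<not> inj_on g {..j}"
      using fg(4) Delta_inj_le[OF d(1)] Delta_inj_le[OF d(2)] by auto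
    then show ?thesis
      using assms(2)[OF d _ fg(4) Delta_surj_le[OF fg(2)] Delta_surj_le[OF fg(3)]] fg(1) Homs_Dom_Cod[OF bact_hom[OF d]] by simp
  qed
  from quotient_descend[OF bnd_quotient assms(1) this]
  show "descend C (bnd_prj C X i j) t \<in> Homs C (bnd C X i j) b"
    "descend C (bnd_prj C X i j) t \<bullet>\<^bsub>C\<^esub> bnd_prj C X i j = t" by (simp_all add: bnd_def)
qed

subsection \<open>Binormalization\<close>

definition bnrm :: "nat \<Rightarrow> nat \<Rightarrow> 'm" where
  "bnrm i j = row.nrm j i \<bullet>\<^bsub>C\<^esub> col.nrm i j"

lemma nrm_hom': "row.nrm j i \<in> Homs C (bob X i j) (bob X i j)" "col.nrm i j \<in> Homs C (bob X i j) (bob X i j)"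
  using row.nrm_hom[of j i] col.nrm_hom[of i j] by simp_all

lemma bnrm_hom: "bnrm i j \<in> Homs C (bob X i j) (bob X i j)"
  unfolding bnrm_def by (rule cmp_hom[OF nrm_hom'(2,1)])

lemma row_nrm_natural:
  assumes "g \<in> Delta l l'"
  shows "bact X k k (idm k) l l' g \<bullet>\<^bsub>C\<^esub> row.nrm l' k = row.nrm l k \<bullet>\<^bsub>C\<^esub> bact X k k (idm k) l l' g"
  unfolding row.nrm_def by (rule row.norm_natural[OF row_simplicial row_mor[OF assms] row.admissible_up])

lemma col_nrm_natural:
  assumes "f \<in> Delta k k'"
  shows "bact X k k' f l l (idm l) \<bullet>\<^bsub>C\<^esub> col.nrm k' l = col.nrm k l \<bullet>\<^bsub>C\<^esub> bact X k k' f l l (idm l)"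
  unfolding col.nrm_def by (rule col.norm_natural[OF col_simplicial col_mor[OF assms] row.admissible_up])

text \<open>A degeneracy in the second variable is killed by the column projector directly. For one
  in the first variable, the column projector is moved past it by naturality, and then the row
  projector kills it.\<close>

lemma bnrm_degenerate:
  assumes f: "f \<in> Delta i k" and g: "g \<in> Delta j l" and ni: "\<not> inj_on f {..i} \<or> \<not> inj_on g {..j}"
  shows "bnrm i j \<bullet>\<^bsub>C\<^esub> bact X i k f j l g = Zer C (bob X k l) (bob X i j)"
proof (cases "inj_on f {..i}")
  case True
  then have "col.nrm i j \<bullet>\<^bsub>C\<^esub> bact X i i (idm i) j l g = Zer C (bob X i l) (bob X i j)"
    using col.nrm_degenerate[OF g, of i] ni by simp
  then have "bnrm i j \<bullet>\<^bsub>C\<^esub> bact X i i (idm i) j l g = Zer C (bob X i l) (bob X i j)"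
    unfolding bnrm_def using cmp_assoc[OF bact_hom[OF Delta_id g] nrm_hom'(2) nrm_hom'(1)]
      cmp_zero_right[OF nrm_hom'(1) bob_obj] by simp
  then show ?thesis
    unfolding bact_split(2)[OF f g]
    using cmp_assoc[OF bact_hom[OF f Delta_id] bact_hom[OF Delta_id g] bnrm_hom]
      cmp_zero_left[OF bact_hom[OF f Delta_id] bob_obj] by simp
next
  case False
  have "bnrm i j \<bullet>\<^bsub>C\<^esub> bact X i k f j j (idm j) = (row.nrm j i \<bullet>\<^bsub>C\<^esub> bact X i k f j j (idm j)) \<bullet>\<^bsub>C\<^esub> col.nrm k j"
    unfolding bnrm_def
    using cmp_assoc[OF bact_hom[OF f Delta_id] nrm_hom'(2) nrm_hom'(1)] col_nrm_natural[OF f, of j]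
      cmp_assoc[OF nrm_hom'(2) bact_hom[OF f Delta_id] nrm_hom'(1)] by simp
  also have "\<dots> = Zer C (bob X k j) (bob X i j)"
    using row.nrm_degenerate[OF f False, of j] cmp_zero_left[OF nrm_hom'(2) bob_obj] by simp
  finally show ?thesis
    unfolding bact_split(1)[OF f g]
    using cmp_assoc[OF bact_hom[OF Delta_id g] bact_hom[OF f Delta_id] bnrm_hom]
      cmp_zero_left[OF bact_hom[OF Delta_id g] bob_obj] by simp
qed

lemma bnd_prj_row_absorb:
  assumes "admissible i \<tau> is"
  shows "bnd_prj C X i j \<bullet>\<^bsub>C\<^esub> norm_arr (row X j) i \<tau> is = bnd_prj C X i j"
  by (rule row.norm_absorb[OF assms]) (use bnd_prj_hom bnd_degenerate[OF _ Delta_id] in simp_all)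

lemma bnd_prj_col_absorb:
  assumes "admissible j \<tau> is"
  shows "bnd_prj C X i j \<bullet>\<^bsub>C\<^esub> norm_arr (col X i) j \<tau> is = bnd_prj C X i j"
  by (rule col.norm_absorb[OF assms]) (use bnd_prj_hom bnd_degenerate[OF Delta_id] in simp_all)

lemma bnd_sec:
  shows "descend C (bnd_prj C X i j) (bnrm i j) \<in> Homs C (bnd C X i j) (bob X i j)"
    and "descend C (bnd_prj C X i j) (bnrm i j) \<bullet>\<^bsub>C\<^esub> bnd_prj C X i j = bnrm i j"
  by (rule bnd_descend[OF bnrm_hom]; rule bnrm_degenerate; assumption)+

lemma bnd_prj_sec: "bnd_prj C X i j \<bullet>\<^bsub>C\<^esub> descend C (bnd_prj C X i j) (bnrm i j) = Ide C (bnd C X i j)"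
proof (rule bnd_epic)
  have "bnd_prj C X i j \<bullet>\<^bsub>C\<^esub> bnrm i j = bnd_prj C X i j"
    unfolding bnrm_def
    using cmp_assoc[OF nrm_hom'(2) nrm_hom'(1) bnd_prj_hom] bnd_prj_row_absorb[OF row.admissible_up]
      bnd_prj_col_absorb[OF row.admissible_up] by (simp add: row.nrm_def col.nrm_def del: upt_Suc)
  then show "(bnd_prj C X i j \<bullet>\<^bsub>C\<^esub> descend C (bnd_prj C X i j) (bnrm i j)) \<bullet>\<^bsub>C\<^esub> bnd_prj C X i j
      = Ide C (bnd C X i j) \<bullet>\<^bsub>C\<^esub> bnd_prj C X i j"
    using cmp_assoc[OF bnd_prj_hom bnd_sec(1) bnd_prj_hom] bnd_sec(2) ide_cmp[OF bnd_prj_hom] by simp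
qed (use cmp_hom[OF bnd_sec(1) bnd_prj_hom] ide_hom bnd_obj in auto)

lemma bnrm_kernel:
  assumes "t \<in> Homs C T (bob X i j)" "bnd_prj C X i j \<bullet>\<^bsub>C\<^esub> t = Zer C T (bnd C X i j)"
  shows "bnrm i j \<bullet>\<^bsub>C\<^esub> t = Zer C T (bob X i j)"
  using cmp_assoc[OF assms(1) bnd_prj_hom bnd_sec(1)] bnd_sec(2)[of i j] assms(2)
    cmp_zero_right[OF bnd_sec(1)] Homs_obj[OF assms(1)] by simp

text \<open>Normalizing with respect to all faces but the zeroth in the first variable, and all faces but
  the last in the second, makes the outer faces that are glued in \<open>[i] * [j] \<rightarrow> [i + j]\<close> vanish.\<close>

lemma opposite_section:
  obtains y where "y \<in> Homs C (bnd C X k l) (bob X k l)" "bnd_prj C X k l \<bullet>\<^bsub>C\<^esub> y = Ide C (bnd C X k l)"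
    "\<And>m g j. g \<in> Delta m k \<Longrightarrow> 0 < j \<Longrightarrow> j \<le> k \<Longrightarrow> j \<notin> g ` {..m} \<Longrightarrow>
       bact X m k g l l (idm l) \<bullet>\<^bsub>C\<^esub> y = Zer C (bnd C X k l) (bob X m l)"
    "\<And>m g j. g \<in> Delta m l \<Longrightarrow> j < l \<Longrightarrow> j \<notin> g ` {..m} \<Longrightarrow>
       bact X k k (idm k) m l g \<bullet>\<^bsub>C\<^esub> y = Zer C (bnd C X k l) (bob X k m)"
proof -
  have adm: "admissible l Suc (rev [0..<l])"
  proof -
    have "admissible l Suc (rev [0..<m])" if "m \<le> l" for m
      using that by (induction m) auto
    then show ?thesis by simp
  qed
  define s where "s = descend C (bnd_prj C X k l) (bnrm k l)"
  \<comment> \<open>The second variable is normalized with the successor instead of the predecessor,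
    over the vertices l - 1, ..., 0, so only faces that omit no vertex below l can survive.\<close>
  define M where "M = norm_arr (col X k) l Suc (rev [0..<l])"
  have s: "s \<in> Homs C (bnd C X k l) (bob X k l)" "bnd_prj C X k l \<bullet>\<^bsub>C\<^esub> s = Ide C (bnd C X k l)"
    unfolding s_def using bnd_sec(1) bnd_prj_sec by auto
  have M: "M \<in> Homs C (bob X k l) (bob X k l)" unfolding M_def using col.norm_hom[OF adm, of k] by simp
  have Ms: "M \<bullet>\<^bsub>C\<^esub> s \<in> Homs C (bnd C X k l) (bob X k l)" by (rule cmp_hom[OF s(1) M])
  let ?y = "row.nrm l k \<bullet>\<^bsub>C\<^esub> M \<bullet>\<^bsub>C\<^esub> s"
  show thesis
  proof (rule that[of ?y])
    show "?y \<in> Homs C (bnd C X k l) (bob X k l)" by (rule cmp_hom[OF Ms nrm_hom'(1)])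
    show "bnd_prj C X k l \<bullet>\<^bsub>C\<^esub> ?y = Ide C (bnd C X k l)"
      using cmp_assoc[OF Ms nrm_hom'(1) bnd_prj_hom] bnd_prj_row_absorb[OF row.admissible_up, of k l]
        cmp_assoc[OF s(1) M bnd_prj_hom] bnd_prj_col_absorb[OF adm, of k] s(2)
      by (simp add: row.nrm_def M_def del: upt_Suc)
  next
    fix m g j assume g: "g \<in> Delta m k" "0 < j" "j \<le> k" "j \<notin> g ` {..m}"
    show "bact X m k g l l (idm l) \<bullet>\<^bsub>C\<^esub> ?y = Zer C (bnd C X k l) (bob X m l)"
      using row.nrm_missing[OF g(1,4,2,3), of l] cmp_assoc[OF Ms nrm_hom'(1) bact_hom[OF g(1) Delta_id]]
        cmp_zero_left[OF Ms bob_obj] by simp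
  next
    fix m g j assume g: "g \<in> Delta m l" "j < l" "j \<notin> g ` {..m}"
    \<comment> \<open>The row projector is natural in the second variable, so it does not spoil the
      vanishing arranged by \<open>M\<close>.\<close>
    have "bact X k k (idm k) m l g \<bullet>\<^bsub>C\<^esub> ?y = row.nrm m k \<bullet>\<^bsub>C\<^esub> bact X k k (idm k) m l g \<bullet>\<^bsub>C\<^esub> M \<bullet>\<^bsub>C\<^esub> s"
      using cmp_assoc[OF Ms nrm_hom'(1) bact_hom[OF Delta_id g(1)]] row_nrm_natural[OF g(1), of k]
        cmp_assoc[OF Ms bact_hom[OF Delta_id g(1)] nrm_hom'(1)] by simp
    moreover have "bact X k k (idm k) m l g \<bullet>\<^bsub>C\<^esub> M \<bullet>\<^bsub>C\<^esub> s = Zer C (bnd C X k l) (bob X k m)"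
      unfolding M_def using col.norm_missing[OF adm g(1) _ g(3), of s "bnd C X k l" k] s(1) g(2) by simp
    ultimately show "bact X k k (idm k) m l g \<bullet>\<^bsub>C\<^esub> ?y = Zer C (bnd C X k l) (bob X k m)"
      using cmp_zero_right[OF nrm_hom'(1) bnd_obj] by simp
  qed
qed

end

section \<open>The right adjoint of decalage\<close>

lemma join_Delta:
  assumes "f \<in> Delta i i'" "g \<in> Delta j j'"
  shows "join_map i i' f j g \<in> Delta (i + j + 1) (i' + j' + 1)"
  unfolding join_map_def
proof (rule restrict_Delta)
  fix x assume "x \<le> i + j + 1"
  then show "(if x \<le> i then f x else i' + 1 + g (x - (i + 1))) \<le> i' + j' + 1"
    using Delta_le[OF assms(1), of x] Delta_le[OF assms(2), of "x - (i + 1)"] by auto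
next
  fix x y assume "x \<le> y" "y \<le> i + j + 1"
  then show "(if x \<le> i then f x else i' + 1 + g (x - (i + 1))) \<le> (if y \<le> i then f y else i' + 1 + g (y - (i + 1)))"
    using Delta_le[OF assms(1), of x] Delta_mono[OF assms(1), of x y]
      Delta_mono[OF assms(2), of "x - (i + 1)" "y - (i + 1)"] by auto
qed

lemma s_can_Delta: "s_can i j \<in> Delta (i + j + 1) (i + j)"
  unfolding s_can_def by (rule restrict_Delta) auto

definition left_part :: "nat \<Rightarrow> (nat \<Rightarrow> nat) \<Rightarrow> nat \<Rightarrow> nat" where
  "left_part i f = (\<lambda>x\<in>{..i}. f x)"

definition right_part :: "nat \<Rightarrow> nat \<Rightarrow> nat \<Rightarrow> (nat \<Rightarrow> nat) \<Rightarrow> nat \<Rightarrow> nat" where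
  "right_part i j a f = (\<lambda>y\<in>{..j}. f (i + 1 + y) - a)"

lemma left_part_Delta: "f \<in> Delta (i + j + 1) n \<Longrightarrow> f i \<le> a \<Longrightarrow> left_part i f \<in> Delta i a"
  unfolding left_part_def
  by (rule restrict_Delta) (auto intro: order_trans[OF Delta_mono[of f "i + j + 1" n _ i]] Delta_mono[of f "i + j + 1" n])

lemma right_part_Delta: "f \<in> Delta (i + j + 1) n \<Longrightarrow> n \<le> a + c \<Longrightarrow> right_part i j a f \<in> Delta j c"
  unfolding right_part_def
proof (rule restrict_Delta)
  assume f: "f \<in> Delta (i + j + 1) n" and n: "n \<le> a + c"
  show "f (i + 1 + y) - a \<le> c" if "y \<le> j" for y
    using Delta_le[OF f, of "i + 1 + y"] n that by simp
  show "f (i + 1 + x) - a \<le> f (i + 1 + y) - a" if "x \<le> y" "y \<le> j" for x y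
    using Delta_mono[OF f, of "i + 1 + x" "i + 1 + y"] that by (simp add: diff_le_mono)
qed

text \<open>The vertex a of [a + c] is the one that \<open>s_can a c\<close> takes twice. A map that
  has not passed a before the cut and has reached it after the cut splits there: its left half lands
  in [a], and its right half, shifted by a, in [c].\<close>

lemma factor_s_can:
  assumes f: "f \<in> Delta (i + j + 1) (a + c)" and a: "f i \<le> a" "a \<le> f (i + 1)"
  shows "f = compose {..i + j + 1} (s_can a c) (join_map i a (left_part i f) j (right_part i j a f))"
proof (rule Delta_eqI[OF f Delta_compose[OF join_Delta s_can_Delta]])
  show "left_part i f \<in> Delta i a" by (rule left_part_Delta[OF f a(1)])
  show "right_part i j a f \<in> Delta j c" by (rule right_part_Delta[OF f]) simp
  fix x assume x: "x \<le> i + j + 1"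
  show "f x = compose {..i + j + 1} (s_can a c) (join_map i a (left_part i f) j (right_part i j a f)) x"
  proof (cases "x \<le> i")
    case True
    then show ?thesis using x a Delta_mono[OF f True]
      by (simp add: compose_def join_map_def s_can_def left_part_def)
  next
    case False
    have x': "x - (i + 1) \<le> j" "i + 1 + (x - (i + 1)) = x" using False x by auto
    have "a \<le> f x" using Delta_mono[OF f, of "i + 1" x] False x a(2) by simp
    moreover have "f x \<le> a + c" by (rule Delta_le[OF f x])
    moreover have "join_map i a (left_part i f) j (right_part i j a f) x = a + 1 + (f x - a)"
      using x False x' by (simp add: join_map_def right_part_def)
    ultimately show ?thesis using x by (simp add: compose_def s_can_def)
  qed
qed

lemma finite_bidegrees: "finite (bidegrees n)"
  by (rule finite_subset[of _ "{..n} \<times> {..n}"]) (auto simp: bidegrees_def)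

text \<open>The simplicial object \<open>T \<otimes> \<Delta>\<^sub>n\<close>, which represents generalized elements with domain \<open>T\<close> of
  the object of \<open>n\<close>-simplices.\<close>

definition tensor_simplex :: "('o, 'm) additive_data \<Rightarrow> 'o \<Rightarrow> nat \<Rightarrow> ('o, 'm) simplicial" where
  "tensor_simplex C T n = \<lparr>sob = (\<lambda>m. dsum C (Delta m n) (\<lambda>_. T)),
     sact = (\<lambda>m m' g. from_dsum C (Delta m' n) (\<lambda>_. T) (dsum C (Delta m n) (\<lambda>_. T))
       (\<lambda>f. dsum_inj C (Delta m n) (\<lambda>_. T) (compose {..m} f g)))\<rparr>"

context abelian_category
begin

context
  fixes T :: 'a and n :: nat
  assumes T: "T \<in> Obj C"
begin

abbreviation "tob m \<equiv> dsum C (Delta m n) (\<lambda>_. T)"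
abbreviation "tin m \<equiv> dsum_inj C (Delta m n) (\<lambda>_. T)"
abbreviation "tact \<equiv> sact (tensor_simplex C T n)"

lemma tob_obj: "tob m \<in> Obj C"
  by (rule dsum_obj[OF finite_Delta T])

lemma tin_hom: "f \<in> Delta m n \<Longrightarrow> tin m f \<in> Homs C T (tob m)"
  by (rule dsum_inj_hom[OF finite_Delta T])

lemma tensor_sob: "sob (tensor_simplex C T n) m = tob m"
  by (simp add: tensor_simplex_def)

lemma tact_hom: "g \<in> Delta m m' \<Longrightarrow> tact m m' g \<in> Homs C (tob m') (tob m)"
  unfolding tensor_simplex_def simplicial.simps
  by (rule from_dsum_hom[OF finite_Delta T tob_obj]) (rule tin_hom[OF Delta_compose])

lemma tact_inj: "g \<in> Delta m m' \<Longrightarrow> f \<in> Delta m' n \<Longrightarrow> tact m m' g \<bullet>\<^bsub>C\<^esub> tin m' f = tin m (compose {..m} f g)"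
  unfolding tensor_simplex_def simplicial.simps
  by (rule from_dsum_inj[OF finite_Delta T tob_obj]) (rule tin_hom[OF Delta_compose])

lemma tensor_eqI:
  assumes "\<phi> \<in> Homs C (tob m) b" "\<psi> \<in> Homs C (tob m) b"
    "\<And>f. f \<in> Delta m n \<Longrightarrow> \<phi> \<bullet>\<^bsub>C\<^esub> tin m f = \<psi> \<bullet>\<^bsub>C\<^esub> tin m f"
  shows "\<phi> = \<psi>"
  by (rule dsum_eqI_inj[OF finite_Delta T assms])

lemma tensor_simplicial: "simplicial_object C (tensor_simplex C T n)"
  unfolding simplicial_object_def tensor_sob
proof (intro conjI allI ballI tob_obj tact_hom)
  fix m
  show "tact m m (restrict id {..m}) = Ide C (tob m)"
  proof (rule tensor_eqI[OF tact_hom[OF Delta_id] ide_hom[OF tob_obj]])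
    fix f assume f: "f \<in> Delta m n"
    show "tact m m (restrict id {..m}) \<bullet>\<^bsub>C\<^esub> tin m f = Ide C (tob m) \<bullet>\<^bsub>C\<^esub> tin m f"
      unfolding tact_inj[OF Delta_id f] Delta_compose_id(2)[OF f] ide_cmp[OF tin_hom[OF f]] ..
  qed
next
  fix k l m f g assume f: "f \<in> Delta k l" and g: "g \<in> Delta l m"
  show "tact k m (compose {..k} g f) = tact k l f \<bullet>\<^bsub>C\<^esub> tact l m g"
  proof (rule tensor_eqI[OF tact_hom[OF Delta_compose[OF f g]] cmp_hom[OF tact_hom[OF g] tact_hom[OF f]]])
    fix h assume h: "h \<in> Delta m n"
    show "tact k m (compose {..k} g f) \<bullet>\<^bsub>C\<^esub> tin m h = (tact k l f \<bullet>\<^bsub>C\<^esub> tact l m g) \<bullet>\<^bsub>C\<^esub> tin m h"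
      unfolding cmp_assoc[OF tin_hom[OF h] tact_hom[OF g] tact_hom[OF f]] tact_inj[OF g h]
        tact_inj[OF f Delta_compose[OF g h]] tact_inj[OF Delta_compose[OF f g] h] compose_Delta_assoc[OF f] ..
  qed
qed

lemma tensor_map:
  assumes "b \<in> Obj C" "\<And>f. f \<in> Delta m n \<Longrightarrow> x f \<in> Homs C T b"
  shows "from_dsum C (Delta m n) (\<lambda>_. T) b x \<in> Homs C (tob m) b"
    "f \<in> Delta m n \<Longrightarrow> from_dsum C (Delta m n) (\<lambda>_. T) b x \<bullet>\<^bsub>C\<^esub> tin m f = x f"
  by (rule from_dsum_hom[OF finite_Delta T assms(1)], rule assms(2), assumption)
     (rule from_dsum_inj[OF finite_Delta T assms(1)], rule assms(2), assumption+)

end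

end

locale dec_adjoint = bisimplicial_obj C X for C :: "('o, 'm) additive_data" and X +
  fixes D :: "('o, 'm) simplicial" and \<epsilon> :: "nat \<Rightarrow> nat \<Rightarrow> 'm"
  assumes adj: "is_dec_right_adjoint C X D \<epsilon>"
begin

sublocale D: simplicial_obj C D
  by unfold_locales (use adj in \<open>simp add: is_dec_right_adjoint_def\<close>)

lemma eps_mor: "bisimplicial_mor C (dec D) X \<epsilon>"
  using adj by (simp add: is_dec_right_adjoint_def)

lemma eps_hom: "\<epsilon> i j \<in> Homs C (sob D (i + j + 1)) (bob X i j)"
  using bisimplicial_morD(1)[OF eps_mor, of i j] by (simp add: dec_def)

lemma eps_natural:
  assumes "f \<in> Delta i i'" "g \<in> Delta j j'"
  shows "\<epsilon> i j \<bullet>\<^bsub>C\<^esub> sact D (i + j + 1) (i' + j' + 1) (join_map i i' f j g) = bact X i i' f j j' g \<bullet>\<^bsub>C\<^esub> \<epsilon> i' j'"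
  using bisimplicial_morD(2)[OF eps_mor assms] by (simp add: dec_def)

lemma universal:
  assumes "simplicial_object C A" "bisimplicial_mor C (dec A) X \<alpha>"
  shows "\<exists>!\<phi>. simplicial_mor C A D \<phi> \<and> (\<forall>i j. \<epsilon> i j \<bullet>\<^bsub>C\<^esub> \<phi> (i + j + 1) = \<alpha> i j)"
  using adj assms unfolding is_dec_right_adjoint_def by blast

section \<open>Components and generalized elements of the right adjoint\<close>

definition comp :: "nat \<Rightarrow> nat \<Rightarrow> 'm" where
  "comp i j = \<epsilon> i j \<bullet>\<^bsub>C\<^esub> sact D (i + j + 1) (i + j) (s_can i j)"

lemma comp_hom: "comp i j \<in> Homs C (sob D (i + j)) (bob X i j)"
  unfolding comp_def by (rule cmp_hom[OF D.act_hom[OF s_can_Delta] eps_hom])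

text \<open>By naturality of the counit, an operator of D followed by the counit depends only on the
  component at the place a where the operator is cut. Two different a can be possible for the same
  operator, and this is what glues neighbouring components.\<close>

lemma eps_factor_s_can:
  assumes f: "f \<in> Delta (i + j + 1) (a + c)" and a: "f i \<le> a" "a \<le> f (i + 1)"
  shows "\<epsilon> i j \<bullet>\<^bsub>C\<^esub> sact D (i + j + 1) (a + c) f =
    bact X i a (left_part i f) j c (right_part i j a f) \<bullet>\<^bsub>C\<^esub> comp a c"
proof -
  have l: "left_part i f \<in> Delta i a" by (rule left_part_Delta[OF f a(1)])
  have r: "right_part i j a f \<in> Delta j c" by (rule right_part_Delta[OF f]) simp
  let ?J = "join_map i a (left_part i f) j (right_part i j a f)"
  have "sact D (i + j + 1) (a + c) f = sact D (i + j + 1) (a + c + 1) ?J \<bullet>\<^bsub>C\<^esub> sact D (a + c + 1) (a + c) (s_can a c)"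
    by (subst factor_s_can[OF f a]) (rule D.act_compose[OF join_Delta[OF l r] s_can_Delta])
  then have "\<epsilon> i j \<bullet>\<^bsub>C\<^esub> sact D (i + j + 1) (a + c) f
      = (\<epsilon> i j \<bullet>\<^bsub>C\<^esub> sact D (i + j + 1) (a + c + 1) ?J) \<bullet>\<^bsub>C\<^esub> sact D (a + c + 1) (a + c) (s_can a c)"
    using cmp_assoc[OF D.act_hom[OF s_can_Delta] D.act_hom[OF join_Delta[OF l r]] eps_hom] by simp
  also have "\<dots> = (bact X i a (left_part i f) j c (right_part i j a f) \<bullet>\<^bsub>C\<^esub> \<epsilon> a c) \<bullet>\<^bsub>C\<^esub> sact D (a + c + 1) (a + c) (s_can a c)"
    unfolding eps_natural[OF l r] ..
  also have "\<dots> = bact X i a (left_part i f) j c (right_part i j a f) \<bullet>\<^bsub>C\<^esub> comp a c"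
    unfolding comp_def by (rule cmp_assoc[OF D.act_hom[OF s_can_Delta] eps_hom bact_hom[OF l r]])
  finally show ?thesis .
qed

text \<open>The family a is a map from the decalage of T \<otimes> \<Delta>_n to X, given summand by
  summand. Its transpose under the adjunction, evaluated on the summand of the identity of [n], is
  the wanted element.\<close>

lemma element_exists:
  assumes T: "T \<in> Obj C"
    and a: "\<And>i j f. f \<in> Delta (i + j + 1) n \<Longrightarrow> a i j f \<in> Homs C T (bob X i j)"
    and nat: "\<And>i j i' j' f g h. f \<in> Delta (i' + j' + 1) n \<Longrightarrow> g \<in> Delta i i' \<Longrightarrow> h \<in> Delta j j' \<Longrightarrow>
       bact X i i' g j j' h \<bullet>\<^bsub>C\<^esub> a i' j' f = a i j (compose {..i + j + 1} f (join_map i i' g j h))"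
  shows "\<exists>t \<in> Homs C T (sob D n). \<forall>i j. \<forall>f \<in> Delta (i + j + 1) n.
     \<epsilon> i j \<bullet>\<^bsub>C\<^esub> sact D (i + j + 1) n f \<bullet>\<^bsub>C\<^esub> t = a i j f"
proof -
  note tin = tin_hom[OF T, of _ _ n] and tob = tob_obj[OF T, of n]
  define \<alpha> where "\<alpha> i j = from_dsum C (Delta (i + j + 1) n) (\<lambda>_. T) (bob X i j) (a i j)" for i j
  have \<alpha>1: "\<alpha> i j \<in> Homs C (dsum C (Delta (i + j + 1) n) (\<lambda>_. T)) (bob X i j)" for i j
    unfolding \<alpha>_def by (rule tensor_map(1)[OF T bob_obj a])
  have \<alpha>2: "\<alpha> i j \<bullet>\<^bsub>C\<^esub> dsum_inj C (Delta (i + j + 1) n) (\<lambda>_. T) f = a i j f" if "f \<in> Delta (i + j + 1) n" for i j f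
    unfolding \<alpha>_def by (rule tensor_map(2)[OF T bob_obj a that])
  have "bisimplicial_mor C (dec (tensor_simplex C T n)) X \<alpha>"
    unfolding bisimplicial_mor_def dec_def bisimplicial.simps tensor_sob[OF T]
  proof (intro conjI allI ballI)
    fix i j show "\<alpha> i j \<in> Homs C (dsum C (Delta (i + j + 1) n) (\<lambda>_. T)) (bob X i j)" by (rule \<alpha>1)
  next
    fix i i' j j' g h assume g: "g \<in> Delta i i'" and h: "h \<in> Delta j j'"
    let ?J = "join_map i i' g j h"
    note J = join_Delta[OF g h]
    show "\<alpha> i j \<bullet>\<^bsub>C\<^esub> sact (tensor_simplex C T n) (i + j + 1) (i' + j' + 1) ?J = bact X i i' g j j' h \<bullet>\<^bsub>C\<^esub> \<alpha> i' j'"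
    proof (rule tensor_eqI[OF T cmp_hom[OF tact_hom[OF T J] \<alpha>1] cmp_hom[OF \<alpha>1 bact_hom[OF g h]]])
      fix f assume f: "f \<in> Delta (i' + j' + 1) n"
      show "(\<alpha> i j \<bullet>\<^bsub>C\<^esub> sact (tensor_simplex C T n) (i + j + 1) (i' + j' + 1) ?J) \<bullet>\<^bsub>C\<^esub> dsum_inj C (Delta (i' + j' + 1) n) (\<lambda>_. T) f
        = (bact X i i' g j j' h \<bullet>\<^bsub>C\<^esub> \<alpha> i' j') \<bullet>\<^bsub>C\<^esub> dsum_inj C (Delta (i' + j' + 1) n) (\<lambda>_. T) f"
        unfolding cmp_assoc[OF tin[OF f] tact_hom[OF T J] \<alpha>1] tact_inj[OF T J f] \<alpha>2[OF Delta_compose[OF J f]]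
          cmp_assoc[OF tin[OF f] \<alpha>1 bact_hom[OF g h]] \<alpha>2[OF f] nat[OF f g h] ..
    qed
  qed
  then obtain \<phi> where \<phi>: "simplicial_mor C (tensor_simplex C T n) D \<phi>" "\<And>i j. \<epsilon> i j \<bullet>\<^bsub>C\<^esub> \<phi> (i + j + 1) = \<alpha> i j"
    using universal[OF tensor_simplicial[OF T]] by blast
  have \<phi>h: "\<phi> m \<in> Homs C (dsum C (Delta m n) (\<lambda>_. T)) (sob D m)" for m
    using simplicial_morD(1)[OF \<phi>(1)] unfolding tensor_sob[OF T] .
  let ?t = "\<phi> n \<bullet>\<^bsub>C\<^esub> dsum_inj C (Delta n n) (\<lambda>_. T) (idm n)"
  have t: "?t \<in> Homs C T (sob D n)" by (rule cmp_hom[OF tin[OF Delta_id] \<phi>h])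
  have "\<epsilon> i j \<bullet>\<^bsub>C\<^esub> sact D (i + j + 1) n f \<bullet>\<^bsub>C\<^esub> ?t = a i j f" if f: "f \<in> Delta (i + j + 1) n" for i j f
  proof -
    have "sact D (i + j + 1) n f \<bullet>\<^bsub>C\<^esub> ?t = (\<phi> (i + j + 1) \<bullet>\<^bsub>C\<^esub> sact (tensor_simplex C T n) (i + j + 1) n f) \<bullet>\<^bsub>C\<^esub> dsum_inj C (Delta n n) (\<lambda>_. T) (idm n)"
      unfolding simplicial_morD(2)[OF \<phi>(1) f] by (rule cmp_assoc[OF tin[OF Delta_id] \<phi>h D.act_hom[OF f], symmetric])
    also have "\<dots> = \<phi> (i + j + 1) \<bullet>\<^bsub>C\<^esub> dsum_inj C (Delta (i + j + 1) n) (\<lambda>_. T) f"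
      unfolding cmp_assoc[OF tin[OF Delta_id] tact_hom[OF T f] \<phi>h] tact_inj[OF T f Delta_id] Delta_compose_id(1)[OF f] ..
    finally show ?thesis
      using cmp_assoc[OF tin[OF f] \<phi>h eps_hom] \<phi>(2) \<alpha>2[OF f] by simp
  qed
  then show ?thesis using t by blast
qed

text \<open>Two elements are two maps from T \<otimes> \<Delta>_n to D. Their transposes agree by
  assumption, so uniqueness in the adjunction identifies them.\<close>

lemma element_unique:
  assumes t: "t \<in> Homs C T (sob D n)" "t' \<in> Homs C T (sob D n)"
    and eq: "\<And>i j f. f \<in> Delta (i + j + 1) n \<Longrightarrow>
      \<epsilon> i j \<bullet>\<^bsub>C\<^esub> sact D (i + j + 1) n f \<bullet>\<^bsub>C\<^esub> t = \<epsilon> i j \<bullet>\<^bsub>C\<^esub> sact D (i + j + 1) n f \<bullet>\<^bsub>C\<^esub> t'"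
  shows "t = t'"
proof -
  have T: "T \<in> Obj C" using Homs_obj[OF t(1)] by blast
  note tin = tin_hom[OF T, of _ _ n] and tob = tob_obj[OF T, of n]
  define \<phi> where "\<phi> t m = from_dsum C (Delta m n) (\<lambda>_. T) (sob D m) (\<lambda>f. sact D m n f \<bullet>\<^bsub>C\<^esub> t)" for t m
  have \<phi>h: "\<phi> t m \<in> Homs C (dsum C (Delta m n) (\<lambda>_. T)) (sob D m)" if "t \<in> Homs C T (sob D n)" for t m
    unfolding \<phi>_def by (rule tensor_map(1)[OF T D.sob_obj D.act_cmp_hom[OF _ that]])
  have \<phi>i: "\<phi> t m \<bullet>\<^bsub>C\<^esub> dsum_inj C (Delta m n) (\<lambda>_. T) f = sact D m n f \<bullet>\<^bsub>C\<^esub> t"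
    if "t \<in> Homs C T (sob D n)" "f \<in> Delta m n" for t m f
    unfolding \<phi>_def by (rule tensor_map(2)[OF T D.sob_obj D.act_cmp_hom[OF _ that(1)] that(2)])
  have \<phi>m: "simplicial_mor C (tensor_simplex C T n) D (\<phi> t)" if t: "t \<in> Homs C T (sob D n)" for t
    unfolding simplicial_mor_def tensor_sob[OF T]
  proof (intro conjI allI ballI \<phi>h[OF t])
    fix m m' g assume g: "g \<in> Delta m m'"
    show "\<phi> t m \<bullet>\<^bsub>C\<^esub> sact (tensor_simplex C T n) m m' g = sact D m m' g \<bullet>\<^bsub>C\<^esub> \<phi> t m'"
    proof (rule tensor_eqI[OF T cmp_hom[OF tact_hom[OF T g] \<phi>h[OF t]] cmp_hom[OF \<phi>h[OF t] D.act_hom[OF g]]])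
      fix f assume f: "f \<in> Delta m' n"
      show "(\<phi> t m \<bullet>\<^bsub>C\<^esub> sact (tensor_simplex C T n) m m' g) \<bullet>\<^bsub>C\<^esub> dsum_inj C (Delta m' n) (\<lambda>_. T) f
        = (sact D m m' g \<bullet>\<^bsub>C\<^esub> \<phi> t m') \<bullet>\<^bsub>C\<^esub> dsum_inj C (Delta m' n) (\<lambda>_. T) f"
        unfolding cmp_assoc[OF tin[OF f] tact_hom[OF T g] \<phi>h[OF t]] tact_inj[OF T g f] \<phi>i[OF t Delta_compose[OF g f]]
          cmp_assoc[OF tin[OF f] \<phi>h[OF t] D.act_hom[OF g]] \<phi>i[OF t f] D.act_act[OF g f t] ..
    qed
  qed
  have \<alpha>eq: "\<epsilon> i j \<bullet>\<^bsub>C\<^esub> \<phi> t (i + j + 1) = \<epsilon> i j \<bullet>\<^bsub>C\<^esub> \<phi> t' (i + j + 1)" for i j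
  proof (rule tensor_eqI[OF T cmp_hom[OF \<phi>h[OF t(1)] eps_hom] cmp_hom[OF \<phi>h[OF t(2)] eps_hom]])
    fix f assume f: "f \<in> Delta (i + j + 1) n"
    show "(\<epsilon> i j \<bullet>\<^bsub>C\<^esub> \<phi> t (i + j + 1)) \<bullet>\<^bsub>C\<^esub> dsum_inj C (Delta (i + j + 1) n) (\<lambda>_. T) f
      = (\<epsilon> i j \<bullet>\<^bsub>C\<^esub> \<phi> t' (i + j + 1)) \<bullet>\<^bsub>C\<^esub> dsum_inj C (Delta (i + j + 1) n) (\<lambda>_. T) f"
      unfolding cmp_assoc[OF tin[OF f] \<phi>h[OF t(1)] eps_hom] cmp_assoc[OF tin[OF f] \<phi>h[OF t(2)] eps_hom]
        \<phi>i[OF t(1) f] \<phi>i[OF t(2) f] by (rule eq[OF f])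
  qed
  have "bisimplicial_mor C (dec (tensor_simplex C T n)) X (\<lambda>i j. \<epsilon> i j \<bullet>\<^bsub>C\<^esub> \<phi> t (i + j + 1))"
    unfolding bisimplicial_mor_def dec_def bisimplicial.simps tensor_sob[OF T]
  proof (intro conjI allI ballI cmp_hom[OF \<phi>h[OF t(1)] eps_hom])
    fix i i' j j' g h assume g: "g \<in> Delta i i'" and h: "h \<in> Delta j j'"
    let ?J = "join_map i i' g j h"
    note J = join_Delta[OF g h]
    have "(\<epsilon> i j \<bullet>\<^bsub>C\<^esub> \<phi> t (i + j + 1)) \<bullet>\<^bsub>C\<^esub> sact (tensor_simplex C T n) (i + j + 1) (i' + j' + 1) ?J
       = (\<epsilon> i j \<bullet>\<^bsub>C\<^esub> sact D (i + j + 1) (i' + j' + 1) ?J) \<bullet>\<^bsub>C\<^esub> \<phi> t (i' + j' + 1)"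
      unfolding cmp_assoc[OF tact_hom[OF T J] \<phi>h[OF t(1)] eps_hom] simplicial_morD(2)[OF \<phi>m[OF t(1)] J]
      by (rule cmp_assoc[OF \<phi>h[OF t(1)] D.act_hom[OF J] eps_hom, symmetric])
    then show "(\<epsilon> i j \<bullet>\<^bsub>C\<^esub> \<phi> t (i + j + 1)) \<bullet>\<^bsub>C\<^esub> sact (tensor_simplex C T n) (i + j + 1) (i' + j' + 1) ?J
       = bact X i i' g j j' h \<bullet>\<^bsub>C\<^esub> \<epsilon> i' j' \<bullet>\<^bsub>C\<^esub> \<phi> t (i' + j' + 1)"
      unfolding eps_natural[OF g h] cmp_assoc[OF \<phi>h[OF t(1)] eps_hom bact_hom[OF g h]] .
  qed
  from universal[OF tensor_simplicial[OF T] this] have "\<phi> t = \<phi> t'"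
    using \<phi>m[OF t(1)] \<phi>m[OF t(2)] \<alpha>eq by metis
  then have "sact D n n (idm n) \<bullet>\<^bsub>C\<^esub> t = sact D n n (idm n) \<bullet>\<^bsub>C\<^esub> t'"
    using \<phi>i[OF t(1) Delta_id] \<phi>i[OF t(2) Delta_id] by metis
  then show ?thesis unfolding D.act_id ide_cmp[OF t(1)] ide_cmp[OF t(2)] .
qed

text \<open>These are the gluing conditions of the classical description of \<open>dec\<^sub>*X\<close>: an \<open>n\<close>-simplex is
  a family of components in the \<open>X\<^sub>[\<^sub>k\<^sub>]\<^sub>,\<^sub>[\<^sub>l\<^sub>]\<close> with \<open>k + l = n\<close>, such that the last horizontal face
  of each component is the zeroth vertical face of the next.\<close>

lemma comp_coface:
  "comp k (Suc l) \<in> Homs C (sob D (k + l + 1)) (bob X k (Suc l))"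
  "bact X k k (idm k) l (Suc l) (coface l 0) \<bullet>\<^bsub>C\<^esub> comp k (Suc l) = \<epsilon> k l"
  "comp (Suc k) l \<in> Homs C (sob D (k + l + 1)) (bob X (Suc k) l)"
  "bact X k (Suc k) (coface k (Suc k)) l l (idm l) \<bullet>\<^bsub>C\<^esub> comp (Suc k) l = \<epsilon> k l"
proof -
  show "comp k (Suc l) \<in> Homs C (sob D (k + l + 1)) (bob X k (Suc l))" using comp_hom[of k "Suc l"] by simp
  show "comp (Suc k) l \<in> Homs C (sob D (k + l + 1)) (bob X (Suc k) l)" using comp_hom[of "Suc k" l] by simp
  have id: "idm (k + l + 1) \<in> Delta (k + l + 1) (k + Suc l)" "idm (k + l + 1) \<in> Delta (k + l + 1) (Suc k + l)"
    using Delta_id[of "k + l + 1"] by simp_all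
  have e: "\<epsilon> k l \<bullet>\<^bsub>C\<^esub> sact D (k + l + 1) (k + l + 1) (idm (k + l + 1)) = \<epsilon> k l"
    unfolding D.act_id by (rule cmp_ide[OF eps_hom])
  have l: "left_part k (idm (k + l + 1)) = idm k" "right_part k l k (idm (k + l + 1)) = coface l 0"
    "left_part k (idm (k + l + 1)) = coface k (Suc k)" "right_part k l (Suc k) (idm (k + l + 1)) = idm l"
    by (auto simp: left_part_def right_part_def coface_def intro!: restrict_ext)
  show "bact X k k (idm k) l (Suc l) (coface l 0) \<bullet>\<^bsub>C\<^esub> comp k (Suc l) = \<epsilon> k l"
    using eps_factor_s_can[OF id(1)] e l(1,2) by simp
  show "bact X k (Suc k) (coface k (Suc k)) l l (idm l) \<bullet>\<^bsub>C\<^esub> comp (Suc k) l = \<epsilon> k l"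
    using eps_factor_s_can[OF id(2)] e l(3,4) by simp
qed

text \<open>Every f can be cut at a = f i, so what the counit sees of it factors through the
  component at (a, n - a).\<close>

lemma components_jointly_monic:
  assumes t: "t \<in> Homs C T (sob D n)" and zero: "\<And>k l. k + l = n \<Longrightarrow> comp k l \<bullet>\<^bsub>C\<^esub> t = Zer C T (bob X k l)"
  shows "t = Zer C T (sob D n)"
proof -
  have T: "T \<in> Obj C" using Homs_obj[OF t] by blast
  show ?thesis
  proof (rule element_unique[OF t Zer_hom[OF T D.sob_obj]])
    fix i j f assume f: "f \<in> Delta (i + j + 1) n"
    define a where "a = f i"
    define c where "c = n - a"
    have a: "a \<le> n" "a \<le> f (i + 1)" using Delta_le[OF f, of i] Delta_mono[OF f, of i "i + 1"] by (auto simp: a_def)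
    then have n: "n = a + c" by (simp add: c_def)
    have l: "left_part i f \<in> Delta i a" by (rule left_part_Delta[OF f]) (simp add: a_def)
    have r: "right_part i j a f \<in> Delta j c" by (rule right_part_Delta[OF f]) (simp add: n)
    have "\<epsilon> i j \<bullet>\<^bsub>C\<^esub> sact D (i + j + 1) n f \<bullet>\<^bsub>C\<^esub> t = (\<epsilon> i j \<bullet>\<^bsub>C\<^esub> sact D (i + j + 1) n f) \<bullet>\<^bsub>C\<^esub> t"
      by (rule cmp_assoc[OF t D.act_hom[OF f] eps_hom, symmetric])
    also have "\<dots> = (bact X i a (left_part i f) j c (right_part i j a f) \<bullet>\<^bsub>C\<^esub> comp a c) \<bullet>\<^bsub>C\<^esub> t"
      using eps_factor_s_can[of f i j a c] f a n by (simp add: a_def)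
    also have "\<dots> = bact X i a (left_part i f) j c (right_part i j a f) \<bullet>\<^bsub>C\<^esub> comp a c \<bullet>\<^bsub>C\<^esub> t"
      by (rule cmp_assoc[OF t _ bact_hom[OF l r]]) (use comp_hom n in simp)
    also have "\<dots> = Zer C T (bob X i j)" using zero[of a c] n cmp_zero_right[OF bact_hom[OF l r] T] by simp
    finally show "\<epsilon> i j \<bullet>\<^bsub>C\<^esub> sact D (i + j + 1) n f \<bullet>\<^bsub>C\<^esub> t = \<epsilon> i j \<bullet>\<^bsub>C\<^esub> sact D (i + j + 1) n f \<bullet>\<^bsub>C\<^esub> Zer C T (sob D n)"
      using cmp_zero_right[OF D.act_hom[OF f] T] cmp_zero_right[OF eps_hom T] by simp
  qed
qed

end

context simplicial_obj
begin

lemma descend_eqI: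
  assumes "g \<in> Homs C (nd C A n) b" "g \<bullet>\<^bsub>C\<^esub> nd_prj C A n = f"
  shows "descend C (nd_prj C A n) f = g"
  unfolding descend_def
proof (rule the_equality)
  have b: "Cod C f = b" using Homs_Dom_Cod[OF cmp_hom[OF nd_prj_hom assms(1)]] assms(2) by simp
  show "g \<in> Homs C (Cod C (nd_prj C A n)) (Cod C f) \<and> g \<bullet>\<^bsub>C\<^esub> nd_prj C A n = f"
    unfolding b using assms by simp
  fix h assume "h \<in> Homs C (Cod C (nd_prj C A n)) (Cod C f) \<and> h \<bullet>\<^bsub>C\<^esub> nd_prj C A n = f"
  then have "h \<in> Homs C (nd C A n) b" "h \<bullet>\<^bsub>C\<^esub> nd_prj C A n = g \<bullet>\<^bsub>C\<^esub> nd_prj C A n" unfolding b assms(2) by simp_all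
  then show "h = g" using nd_epic assms(1) by blast
qed

lemma nd_map:
  assumes B: "simplicial_object C B" and \<phi>: "simplicial_mor C A B \<phi>"
  shows "nd_map C A B \<phi> n \<in> Homs C (nd C A n) (nd C B n)"
    "nd_map C A B \<phi> n \<bullet>\<^bsub>C\<^esub> nd_prj C A n = nd_prj C B n \<bullet>\<^bsub>C\<^esub> \<phi> n"
proof -
  interpret B: simplicial_obj C B by unfold_locales (rule B)
  note h = cmp_hom[OF simplicial_morD(1)[OF \<phi>] B.nd_prj_hom]
  have "(nd_prj C B n \<bullet>\<^bsub>C\<^esub> \<phi> n) \<bullet>\<^bsub>C\<^esub> act n m s = Zer C (sob A m) (nd C B n)"
    if s: "s \<in> Delta n m" "\<not> inj_on s {..n}" for m s
    using cmp_assoc[OF act_hom[OF s(1)] simplicial_morD(1)[OF \<phi>] B.nd_prj_hom] simplicial_morD(2)[OF \<phi> s(1)]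
      cmp_assoc[OF simplicial_morD(1)[OF \<phi>] B.act_hom[OF s(1)] B.nd_prj_hom] B.nd_degenerate[OF s]
      cmp_zero_left[OF simplicial_morD(1)[OF \<phi>] B.nd_obj] by simp
  from nd_descend[OF h this]
  show "nd_map C A B \<phi> n \<in> Homs C (nd C A n) (nd C B n)"
    "nd_map C A B \<phi> n \<bullet>\<^bsub>C\<^esub> nd_prj C A n = nd_prj C B n \<bullet>\<^bsub>C\<^esub> \<phi> n" by (simp_all add: nd_map_def)
qed

end

lemma first_incl_Delta: "i \<le> n \<Longrightarrow> first_incl i \<in> Delta i n"
  unfolding first_incl_def by (rule restrict_Delta) auto

lemma last_incl_Delta: "j \<le> n \<Longrightarrow> last_incl n j \<in> Delta j n"
  unfolding last_incl_def by (rule restrict_Delta) auto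

section \<open>Common degeneracies of two monotone maps\<close>

lemma joint_adjacent_or:
  assumes f: "f \<in> Delta n k" and g: "g \<in> Delta n l"
  shows "(\<exists>a<n. f a = f (Suc a) \<and> g a = g (Suc a)) \<or> (\<forall>x y. x \<le> y \<and> y \<le> n \<longrightarrow> f x + g x + (y - x) \<le> f y + g y)"
proof (rule disjCI)
  assume na: "\<not> (\<forall>x y. x \<le> y \<and> y \<le> n \<longrightarrow> f x + g x + (y - x) \<le> f y + g y)"
  show "\<exists>a<n. f a = f (Suc a) \<and> g a = g (Suc a)"
  proof (rule ccontr)
    assume no: "\<not> (\<exists>a<n. f a = f (Suc a) \<and> g a = g (Suc a))"
    have "f x + g x + d \<le> f (x + d) + g (x + d)" if "x + d \<le> n" for x d
      using that
    proof (induction d)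
      case (Suc d)
      have "f (x + d) \<le> f (Suc (x + d))" "g (x + d) \<le> g (Suc (x + d))"
        using Delta_mono[OF f, of "x + d" "Suc (x + d)"] Delta_mono[OF g, of "x + d" "Suc (x + d)"] Suc.prems by auto
      moreover have "f (x + d) \<noteq> f (Suc (x + d)) \<or> g (x + d) \<noteq> g (Suc (x + d))" using no Suc.prems by auto
      ultimately show ?case using Suc by auto
    qed simp
    from this[of x "y - x" for x y] show False using na by (metis le_add_diff_inverse)
  qed
qed

text \<open>Without a common collapse, the sum f + g would increase by at least 1 at each of the n
  steps, but it is bounded by k + l.\<close>

lemma joint_adjacent:
  assumes f: "f \<in> Delta n k" and g: "g \<in> Delta n l" and "k + l < n"
  shows "\<exists>a<n. f a = f (Suc a) \<and> g a = g (Suc a)"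
proof (rule ccontr)
  assume "\<not> ?thesis"
  then have "f 0 + g 0 + (n - 0) \<le> f n + g n" using joint_adjacent_or[OF f g] by blast
  then show False using Delta_le[OF f, of n] Delta_le[OF g, of n] assms(3) by simp
qed

context bisimplicial_obj
begin

lemma factor_common_codeg:
  assumes f: "f \<in> Delta n k" and g: "g \<in> Delta n l" and a: "a < n" "f a = f (Suc a)" "g a = g (Suc a)"
  obtains m s f' g' where "s \<in> Delta n m" "\<not> inj_on s {..n}" "f' \<in> Delta m k" "g' \<in> Delta m l"
    "f = compose {..n} f' s" "g = compose {..n} g' s"
proof -
  obtain m where n: "n = Suc m" using a by (cases n) auto
  have s: "codeg m a \<in> Delta_surj n m" using codeg_Delta[of a m] a n by simp
  show thesis
  proof (rule that[OF Delta_surjD(1)[OF s]])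
    show "\<not> inj_on (codeg m a) {..n}" using diag.degeneracies_not_inj[OF s] n by simp
    show "compose {..m} f (coface m (Suc a)) \<in> Delta m k" "compose {..m} g (coface m (Suc a)) \<in> Delta m l"
      using Delta_compose[OF coface_Delta] f g n by auto
    show "f = compose {..n} (compose {..m} f (coface m (Suc a))) (codeg m a)"
      "g = compose {..n} (compose {..m} g (coface m (Suc a))) (codeg m a)"
      using factor_codeg[of f m k a] factor_codeg[of g m l a] f g a n by auto
  qed
qed

text \<open>A degeneracy of the diagonal acts by the same map in both variables, hence the interval
  has to be collapsed by f and g simultaneously.\<close>

lemma diag_degenerate:
  assumes f: "f \<in> Delta n k" and g: "g \<in> Delta n l" and a: "\<exists>a<n. f a = f (Suc a) \<and> g a = g (Suc a)"
  shows "nd_prj C (diag X) n \<bullet>\<^bsub>C\<^esub> bact X n k f n l g = Zer C (bob X k l) (nd C (diag X) n)"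
proof -
  obtain x where x: "x < n" "f x = f (Suc x)" "g x = g (Suc x)" using a by blast
  obtain m s f' g' where s: "s \<in> Delta n m" "\<not> inj_on s {..n}" and fg: "f' \<in> Delta m k" "g' \<in> Delta m l"
    "f = compose {..n} f' s" "g = compose {..n} g' s"
    by (rule factor_common_codeg[OF f g x])
  have p: "nd_prj C (diag X) n \<in> Homs C (bob X n n) (nd C (diag X) n)" using diag.nd_prj_hom[of n] by simp
  have "nd_prj C (diag X) n \<bullet>\<^bsub>C\<^esub> bact X n m s n m s = Zer C (bob X m m) (nd C (diag X) n)"
    using diag.nd_degenerate[OF s] by simp
  then show ?thesis
    unfolding fg(3,4) bact_compose[OF s(1) fg(1) s(1) fg(2)]
    using cmp_assoc[OF bact_hom[OF fg(1,2)] bact_hom[OF s(1) s(1)] p] cmp_zero_left[OF bact_hom[OF fg(1,2)] diag.nd_obj]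
    by simp
qed

lemma diag_nd_prj_hom: "nd_prj C (diag X) n \<in> Homs C (bob X n n) (nd C (diag X) n)"
  using diag.nd_prj_hom[of n] by simp

section \<open>Direct sums over the bidegrees of a total degree\<close>

abbreviation "bobs \<equiv> (\<lambda>(i, j). bob X i j)"
abbreviation "bnds \<equiv> (\<lambda>(i, j). bnd C X i j)"

lemma bobs_obj: "bobs p \<in> Obj C" and bnds_obj: "bnds p \<in> Obj C"
  using bob_obj bnd_obj by (auto split: prod.splits)

lemma bidegree_prj:
  "bidegree_prj C X n \<in> Homs C (dsum C (bidegrees n) bobs) (dsum C (bidegrees n) bnds)"
  "i + j = n \<Longrightarrow> dsum_prj C (bidegrees n) bnds (i, j) \<bullet>\<^bsub>C\<^esub> bidegree_prj C X n =
     bnd_prj C X i j \<bullet>\<^bsub>C\<^esub> dsum_prj C (bidegrees n) bobs (i, j)"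
  "i + j = n \<Longrightarrow> bidegree_prj C X n \<bullet>\<^bsub>C\<^esub> dsum_inj C (bidegrees n) bobs (i, j) =
     dsum_inj C (bidegrees n) bnds (i, j) \<bullet>\<^bsub>C\<^esub> bnd_prj C X i j"
proof -
  have h: "(case p of (i, j) \<Rightarrow> bnd_prj C X i j) \<in> Homs C (bobs p) (bnds p)" for p
    using bnd_prj_hom by (auto split: prod.splits)
  show "bidegree_prj C X n \<in> Homs C (dsum C (bidegrees n) bobs) (dsum C (bidegrees n) bnds)"
    unfolding bidegree_prj_def by (rule dsum_map_prj(1)[OF finite_bidegrees h])
  assume "i + j = n"
  then have ij: "(i, j) \<in> bidegrees n" by (simp add: bidegrees_def)
  show "dsum_prj C (bidegrees n) bnds (i, j) \<bullet>\<^bsub>C\<^esub> bidegree_prj C X n =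
     bnd_prj C X i j \<bullet>\<^bsub>C\<^esub> dsum_prj C (bidegrees n) bobs (i, j)"
    unfolding bidegree_prj_def using dsum_map_prj(2)[OF finite_bidegrees h ij] by simp
  show "bidegree_prj C X n \<bullet>\<^bsub>C\<^esub> dsum_inj C (bidegrees n) bobs (i, j) =
     dsum_inj C (bidegrees n) bnds (i, j) \<bullet>\<^bsub>C\<^esub> bnd_prj C X i j"
    unfolding bidegree_prj_def using dsum_map_inj[OF finite_bidegrees h ij] by simp
qed

lemma bnds_prj_hom: "i + j = n \<Longrightarrow> dsum_prj C (bidegrees n) bnds (i, j) \<in> Homs C (dsum C (bidegrees n) bnds) (bnd C X i j)"
  and bnds_inj_hom: "i + j = n \<Longrightarrow> dsum_inj C (bidegrees n) bnds (i, j) \<in> Homs C (bnd C X i j) (dsum C (bidegrees n) bnds)"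
  and bobs_prj_hom: "i + j = n \<Longrightarrow> dsum_prj C (bidegrees n) bobs (i, j) \<in> Homs C (dsum C (bidegrees n) bobs) (bob X i j)"
  and bobs_inj_hom: "i + j = n \<Longrightarrow> dsum_inj C (bidegrees n) bobs (i, j) \<in> Homs C (bob X i j) (dsum C (bidegrees n) bobs)"
proof -
  assume "i + j = n"
  then have ij: "(i, j) \<in> bidegrees n" by (simp add: bidegrees_def)
  have "dsum_prj C (bidegrees n) bnds (i, j) \<in> Homs C (dsum C (bidegrees n) bnds) (bnds (i, j))"
    by (rule dsum_prj_hom[OF finite_bidegrees bnds_obj ij])
  then show "dsum_prj C (bidegrees n) bnds (i, j) \<in> Homs C (dsum C (bidegrees n) bnds) (bnd C X i j)" by simp
  have "dsum_inj C (bidegrees n) bnds (i, j) \<in> Homs C (bnds (i, j)) (dsum C (bidegrees n) bnds)"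
    by (rule dsum_inj_hom[OF finite_bidegrees bnds_obj ij])
  then show "dsum_inj C (bidegrees n) bnds (i, j) \<in> Homs C (bnd C X i j) (dsum C (bidegrees n) bnds)" by simp
  have "dsum_prj C (bidegrees n) bobs (i, j) \<in> Homs C (dsum C (bidegrees n) bobs) (bobs (i, j))"
    by (rule dsum_prj_hom[OF finite_bidegrees bobs_obj ij])
  then show "dsum_prj C (bidegrees n) bobs (i, j) \<in> Homs C (dsum C (bidegrees n) bobs) (bob X i j)" by simp
  have "dsum_inj C (bidegrees n) bobs (i, j) \<in> Homs C (bobs (i, j)) (dsum C (bidegrees n) bobs)"
    by (rule dsum_inj_hom[OF finite_bidegrees bobs_obj ij])
  then show "dsum_inj C (bidegrees n) bobs (i, j) \<in> Homs C (bob X i j) (dsum C (bidegrees n) bobs)" by simp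
qed

lemma bnds_dsum_obj: "dsum C (bidegrees n) bnds \<in> Obj C"
  by (rule dsum_obj[OF finite_bidegrees bnds_obj])

lemma into_bnds_eqI:
  assumes "f \<in> Homs C t (dsum C (bidegrees n) bnds)" "g \<in> Homs C t (dsum C (bidegrees n) bnds)"
    "\<And>i j. i + j = n \<Longrightarrow> dsum_prj C (bidegrees n) bnds (i, j) \<bullet>\<^bsub>C\<^esub> f = dsum_prj C (bidegrees n) bnds (i, j) \<bullet>\<^bsub>C\<^esub> g"
  shows "f = g"
  by (rule dsum_eqI_prj[OF finite_bidegrees bnds_obj assms(1,2)]) (use assms(3) in \<open>auto simp: bidegrees_def\<close>)

end

context dec_adjoint
begin

subsection \<open>The chains of the right adjoint\<close>

text \<open>\<open>s_can\<close> doubles the vertex i, so the composite with s can be cut at the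
  value s i. The interval collapsed by s lies before or after i, and accordingly the left or the
  right half fails to be injective.\<close>

lemma comp_degenerate:
  assumes s: "s \<in> Delta (i + j) m" "\<not> inj_on s {..i + j}"
  shows "(bnd_prj C X i j \<bullet>\<^bsub>C\<^esub> comp i j) \<bullet>\<^bsub>C\<^esub> sact D (i + j) m s = Zer C (sob D m) (bnd C X i j)"
proof -
  let ?f = "compose {..i + j + 1} s (s_can i j)"
  define a where "a = s i"
  define c where "c = m - a"
  have "a \<le> m" using Delta_le[OF s(1), of i] by (simp add: a_def)
  then have m: "m = a + c" by (simp add: c_def)
  have f: "?f \<in> Delta (i + j + 1) (a + c)" using Delta_compose[OF s_can_Delta s(1)] m by simp
  have fa: "?f i = a" "?f (i + 1) = a" by (auto simp: compose_def s_can_def a_def)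
  have l: "left_part i ?f \<in> Delta i a" by (rule left_part_Delta[OF f]) (simp only: fa order_refl)
  have r: "right_part i j a ?f \<in> Delta j c" by (rule right_part_Delta[OF f]) simp
  have "comp i j \<bullet>\<^bsub>C\<^esub> sact D (i + j) m s = \<epsilon> i j \<bullet>\<^bsub>C\<^esub> sact D (i + j + 1) (a + c) ?f"
    unfolding comp_def
    using cmp_assoc[OF D.act_hom[OF s(1)] D.act_hom[OF s_can_Delta] eps_hom] D.act_compose[OF s_can_Delta s(1)] m by simp
  also have "\<dots> = bact X i a (left_part i ?f) j c (right_part i j a ?f) \<bullet>\<^bsub>C\<^esub> comp a c"
    by (rule eps_factor_s_can[OF f]) (simp_all only: fa order_refl)
  finally have eq: "comp i j \<bullet>\<^bsub>C\<^esub> sact D (i + j) m s = bact X i a (left_part i ?f) j c (right_part i j a ?f) \<bullet>\<^bsub>C\<^esub> comp a c" .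
  obtain x where x: "x < i + j" "s x = s (Suc x)" using not_inj_adjacent1[OF s] by blast
  have "\<not> inj_on (left_part i ?f) {..i} \<or> \<not> inj_on (right_part i j a ?f) {..j}"
  proof (cases "x < i")
    case True
    then have "left_part i ?f x = left_part i ?f (Suc x)"
      using x by (simp add: left_part_def compose_def s_can_def)
    then show ?thesis using True inj_onD[of "left_part i ?f" "{..i}" x "Suc x"] by auto
  next
    case False
    then have "right_part i j a ?f (x - i) = right_part i j a ?f (Suc (x - i))"
      using x by (simp add: right_part_def compose_def s_can_def)
    moreover have "Suc (x - i) \<le> j" using False x(1) by linarith
    ultimately show ?thesis using inj_onD[of "right_part i j a ?f" "{..j}" "x - i" "Suc (x - i)"] by auto
  qed
  from bnd_degenerate[OF l r this] show ?thesis
    using cmp_assoc[OF D.act_hom[OF s(1)] comp_hom bnd_prj_hom] eq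
      cmp_assoc[OF comp_hom bact_hom[OF l r] bnd_prj_hom] cmp_zero_left[OF comp_hom bnd_obj] m by simp
qed

lemma total_ident:
  "total_ident C X D \<epsilon> n \<in> Homs C (nd C D n) (dsum C (bidegrees n) bnds)"
  "i + j = n \<Longrightarrow> dsum_prj C (bidegrees n) bnds (i, j) \<bullet>\<^bsub>C\<^esub> total_ident C X D \<epsilon> n \<bullet>\<^bsub>C\<^esub> nd_prj C D n =
     bnd_prj C X i j \<bullet>\<^bsub>C\<^esub> comp i j"
proof -
  let ?c = "\<lambda>(i, j). descend C (nd_prj C D n) (bnd_prj C X i j \<bullet>\<^bsub>C\<^esub> \<epsilon> i j \<bullet>\<^bsub>C\<^esub> sact D (i + j + 1) n (s_can i j))"
  have c: "?c (i, j) \<in> Homs C (nd C D n) (bnd C X i j)" "?c (i, j) \<bullet>\<^bsub>C\<^esub> nd_prj C D n = bnd_prj C X i j \<bullet>\<^bsub>C\<^esub> comp i j"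
    if "i + j = n" for i j
  proof -
    have n: "n = i + j" using that by simp
    have "bnd_prj C X i j \<bullet>\<^bsub>C\<^esub> comp i j \<in> Homs C (sob D (i + j)) (bnd C X i j)" by (rule cmp_hom[OF comp_hom bnd_prj_hom])
    from D.nd_descend[OF this comp_degenerate]
    show "?c (i, j) \<in> Homs C (nd C D n) (bnd C X i j)" "?c (i, j) \<bullet>\<^bsub>C\<^esub> nd_prj C D n = bnd_prj C X i j \<bullet>\<^bsub>C\<^esub> comp i j"
      unfolding n comp_def by auto
  qed
  have ch: "?c p \<in> Homs C (nd C D n) (bnds p)" if "p \<in> bidegrees n" for p
    using that c(1) by (auto simp: bidegrees_def)
  show th: "total_ident C X D \<epsilon> n \<in> Homs C (nd C D n) (dsum C (bidegrees n) bnds)"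
    unfolding total_ident_def by (rule into_dsum_hom[OF finite_bidegrees bnds_obj D.nd_obj ch])
  assume ij: "i + j = n"
  then have "(i, j) \<in> bidegrees n" by (simp add: bidegrees_def)
  from prj_into_dsum[OF finite_bidegrees bnds_obj D.nd_obj ch this]
  have "dsum_prj C (bidegrees n) bnds (i, j) \<bullet>\<^bsub>C\<^esub> total_ident C X D \<epsilon> n = ?c (i, j)"
    unfolding total_ident_def by simp
  then show "dsum_prj C (bidegrees n) bnds (i, j) \<bullet>\<^bsub>C\<^esub> total_ident C X D \<epsilon> n \<bullet>\<^bsub>C\<^esub> nd_prj C D n = bnd_prj C X i j \<bullet>\<^bsub>C\<^esub> comp i j"
    using cmp_assoc[OF D.nd_prj_hom th bnds_prj_hom[OF ij]] c(2)[OF ij] by simp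
qed

lemma bact_comp:
  assumes "g \<in> Delta m k" "h \<in> Delta m' l"
  shows "bact X m k g m' l h \<bullet>\<^bsub>C\<^esub> comp k l =
    \<epsilon> m m' \<bullet>\<^bsub>C\<^esub> sact D (m + m' + 1) (k + l) (compose {..m + m' + 1} (s_can k l) (join_map m k g m' h))"
  unfolding comp_def cmp_assoc[OF D.act_hom[OF s_can_Delta] eps_hom bact_hom[OF assms], symmetric]
    eps_natural[OF assms, symmetric] D.act_compose[OF join_Delta[OF assms] s_can_Delta]
  by (rule cmp_assoc[OF D.act_hom[OF s_can_Delta] D.act_hom[OF join_Delta[OF assms]] eps_hom])

text \<open>Lift w to a normalized t. The components of t project to 0, so each of them is 0 once it
  is normalized in both variables. They inherit vanishing faces from t, except at the vertex shared
  by the two blocks, where neighbours are glued along a face u. To see u = 0, use the neighbour of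
  which u is the zeroth vertical face: that component is normalized in the second variable, so the
  row projector kills it and hence u, but u is itself normalized in the first variable.\<close>

lemma total_monic:
  assumes w: "w \<in> Homs C T (nd C D n)" and zero: "total_ident C X D \<epsilon> n \<bullet>\<^bsub>C\<^esub> w = Zer C T (dsum C (bidegrees n) bnds)"
  shows "w = Zer C T (nd C D n)"
proof -
  have T: "T \<in> Obj C" using Homs_obj[OF w] by blast
  define t where "t = D.nd_sec n \<bullet>\<^bsub>C\<^esub> w"
  have t: "t \<in> Homs C T (sob D n)" unfolding t_def by (rule cmp_hom[OF w D.nd_sec_hom])
  have pt: "nd_prj C D n \<bullet>\<^bsub>C\<^esub> t = w"
    unfolding t_def using cmp_assoc[OF w D.nd_sec_hom D.nd_prj_hom] D.nd_prj_sec ide_cmp[OF w] by simp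
  have miss: "sact D m n g \<bullet>\<^bsub>C\<^esub> t = Zer C T (sob D m)" if "g \<in> Delta m n" "j \<notin> g ` {..m}" "0 < j" "j \<le> n" for m g j
    unfolding t_def
    using cmp_assoc[OF w D.nd_sec_hom D.act_hom[OF that(1)]] D.nd_sec_missing[OF that] cmp_zero_left[OF w D.sob_obj] by simp
  have eps_miss: "\<epsilon> i j \<bullet>\<^bsub>C\<^esub> sact D (i + j + 1) n f \<bullet>\<^bsub>C\<^esub> t = Zer C T (bob X i j)"
    if "f \<in> Delta (i + j + 1) n" "x \<notin> f ` {..i + j + 1}" "0 < x" "x \<le> n" for i j f x
    using miss[OF that] cmp_zero_right[OF eps_hom T] by simp
  let ?y = "\<lambda>k l. comp k l \<bullet>\<^bsub>C\<^esub> t"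
  have y: "?y k l \<in> Homs C T (bob X k l)" if "k + l = n" for k l
    using cmp_hom[OF _ comp_hom, of t T k l] t that by simp
  have py: "bnd_prj C X k l \<bullet>\<^bsub>C\<^esub> ?y k l = Zer C T (bnd C X k l)" if kl: "k + l = n" for k l
  proof -
    have c: "comp k l \<in> Homs C (sob D n) (bob X k l)" using comp_hom[of k l] kl by simp
    have "bnd_prj C X k l \<bullet>\<^bsub>C\<^esub> ?y k l = (dsum_prj C (bidegrees n) bnds (k, l) \<bullet>\<^bsub>C\<^esub> total_ident C X D \<epsilon> n \<bullet>\<^bsub>C\<^esub> nd_prj C D n) \<bullet>\<^bsub>C\<^esub> t"
      unfolding total_ident(2)[OF kl] by (rule cmp_assoc[OF t c bnd_prj_hom, symmetric])
    also have "\<dots> = dsum_prj C (bidegrees n) bnds (k, l) \<bullet>\<^bsub>C\<^esub> total_ident C X D \<epsilon> n \<bullet>\<^bsub>C\<^esub> w"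
      using cmp_assoc[OF t cmp_hom[OF D.nd_prj_hom total_ident(1)] bnds_prj_hom[OF kl]]
        cmp_assoc[OF t D.nd_prj_hom total_ident(1)] pt by simp
    finally show ?thesis using zero cmp_zero_right[OF bnds_prj_hom[OF kl] T] by simp
  qed
  have bact_y: "bact X m k g m' l h \<bullet>\<^bsub>C\<^esub> ?y k l =
      \<epsilon> m m' \<bullet>\<^bsub>C\<^esub> sact D (m + m' + 1) n (compose {..m + m' + 1} (s_can k l) (join_map m k g m' h)) \<bullet>\<^bsub>C\<^esub> t"
    if kl: "k + l = n" and g: "g \<in> Delta m k" and h: "h \<in> Delta m' l" for k l m g m' h
  proof -
    have c: "comp k l \<in> Homs C (sob D n) (bob X k l)" using comp_hom[of k l] kl by simp
    have J: "compose {..m + m' + 1} (s_can k l) (join_map m k g m' h) \<in> Delta (m + m' + 1) n"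
      unfolding kl[symmetric] by (rule Delta_compose[OF join_Delta[OF g h] s_can_Delta])
    show ?thesis
      using cmp_assoc[OF t c bact_hom[OF g h]] bact_comp[OF g h] cmp_assoc[OF t D.act_hom[OF J] eps_hom] kl by simp
  qed
  have y_v: "bact X k k (idm k) m l h \<bullet>\<^bsub>C\<^esub> ?y k l = Zer C T (bob X k m)"
    if kl: "k + l = n" and h: "h \<in> Delta m l" "x \<notin> h ` {..m}" "0 < x" "x \<le> l" for k l m h x
  proof (unfold bact_y[OF kl Delta_id h(1)], rule eps_miss[of _ _ _ "k + x"])
    show "compose {..k + m + 1} (s_can k l) (join_map k k (idm k) m h) \<in> Delta (k + m + 1) n"
      unfolding kl[symmetric] by (rule Delta_compose[OF join_Delta[OF Delta_id h(1)] s_can_Delta])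
    have ne: "s_can k l (join_map k k (idm k) m h z) \<noteq> k + x" if z: "z \<le> k + m + 1" for z
    proof (cases "z \<le> k")
      case True then show ?thesis using h(3) by (simp add: join_map_def s_can_def)
    next
      case False
      then have "h (z - (k + 1)) \<noteq> x" "h (z - (k + 1)) \<le> l" using h(2) z Delta_le[OF h(1), of "z - (k + 1)"] by auto
      then show ?thesis using False z by (simp add: join_map_def s_can_def)
    qed
    show "k + x \<notin> compose {..k + m + 1} (s_can k l) (join_map k k (idm k) m h) ` {..k + m + 1}"
    proof
      assume "k + x \<in> compose {..k + m + 1} (s_can k l) (join_map k k (idm k) m h) ` {..k + m + 1}"
      then obtain z where "z \<le> k + m + 1" "k + x = compose {..k + m + 1} (s_can k l) (join_map k k (idm k) m h) z"
        by (metis atMost_iff imageE)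
      then show False using ne[of z] by (simp add: compose_def)
    qed
  qed (use h kl in auto)
  \<comment> \<open>The bound x < k is strict: the vertex k is also the first vertex of the second
    block, so omitting it in [k] does not omit it in [n].\<close>
  have y_h: "bact X m k g l l (idm l) \<bullet>\<^bsub>C\<^esub> ?y k l = Zer C T (bob X m l)"
    if kl: "k + l = n" and g: "g \<in> Delta m k" "x \<notin> g ` {..m}" "0 < x" "x < k" for k l m g x
  proof (unfold bact_y[OF kl g(1) Delta_id], rule eps_miss[of _ _ _ x])
    show "compose {..m + l + 1} (s_can k l) (join_map m k g l (idm l)) \<in> Delta (m + l + 1) n"
      unfolding kl[symmetric] by (rule Delta_compose[OF join_Delta[OF g(1) Delta_id] s_can_Delta])
    have "s_can k l (join_map m k g l (idm l) z) \<noteq> x" if z: "z \<le> m + l + 1" for z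
    proof (cases "z \<le> m")
      case True
      then have "g z \<noteq> x" "g z \<le> k" using g(2) Delta_le[OF g(1), of z] by auto
      then show ?thesis using True z by (simp add: join_map_def s_can_def)
    next
      case False
      define q where "q = z - (m + 1)"
      have q: "z = m + 1 + q" "q \<le> l" using False z by (auto simp: q_def)
      then show ?thesis using g(4) by (simp add: join_map_def s_can_def)
    qed
    then show "x \<notin> compose {..m + l + 1} (s_can k l) (join_map m k g l (idm l)) ` {..m + l + 1}"
      by (auto simp: compose_def)
  qed (use g kl in auto)
  let ?u = "\<lambda>k l. \<epsilon> k l \<bullet>\<^bsub>C\<^esub> t"
  have u0: "?u k l = Zer C T (bob X k l)" if kl: "k + l + 1 = n" for k l
  proof -
    have u: "?u k l \<in> Homs C T (bob X k l)" using cmp_hom[OF _ eps_hom, of t T k l] t kl by simp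
    have kl': "k + Suc l = n" using kl by simp
    let ?v = "?y k (Suc l)"
    note v = y[OF kl']
    have c: "comp k (Suc l) \<in> Homs C (sob D n) (bob X k (Suc l))" using comp_hom[of k "Suc l"] kl by simp
    have v_face: "bact X k k (idm k) l (Suc l) (coface l 0) \<bullet>\<^bsub>C\<^esub> ?v = ?u k l"
      using cmp_assoc[OF t c bact_hom[OF Delta_id coface_Delta[of l 0]]] comp_coface(2)[of k l] by simp
    have "col.nrm k (Suc l) \<bullet>\<^bsub>C\<^esub> ?v = ?v"
      by (rule col.nrm_fix) (use v y_v[OF kl'] in simp_all)
    then have "row.nrm (Suc l) k \<bullet>\<^bsub>C\<^esub> ?v = Zer C T (bob X k (Suc l))"
      using bnrm_kernel[OF v py[OF kl']] cmp_assoc[OF v nrm_hom'(2) nrm_hom'(1)] by (simp add: bnrm_def)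
    then have "bact X k k (idm k) l (Suc l) (coface l 0) \<bullet>\<^bsub>C\<^esub> row.nrm (Suc l) k \<bullet>\<^bsub>C\<^esub> ?v = Zer C T (bob X k l)"
      using cmp_zero_right[OF bact_hom[OF Delta_id coface_Delta[of l 0]] T] by simp
    then have "row.nrm l k \<bullet>\<^bsub>C\<^esub> ?u k l = Zer C T (bob X k l)"
      using cmp_assoc[OF v nrm_hom'(1) bact_hom[OF Delta_id coface_Delta[of l 0]]] row_nrm_natural[OF coface_Delta[of l 0], of k]
        cmp_assoc[OF v bact_hom[OF Delta_id coface_Delta] nrm_hom'(1)] v_face by simp
    moreover have "row.nrm l k \<bullet>\<^bsub>C\<^esub> ?u k l = ?u k l"
    proof (rule row.nrm_fix)
      show "?u k l \<in> Homs C T (sob (row X l) k)" using u by simp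
      fix g x assume g: "g \<in> Delta k k" and x: "0 < x" "x \<le> k" "x \<notin> g ` {..k}"
      have J: "join_map k k g l (idm l) \<in> Delta (k + l + 1) n" using join_Delta[OF g Delta_id[of l]] kl by simp
      have "join_map k k g l (idm l) z \<noteq> x" if z: "z \<le> k + l + 1" for z
      proof (cases "z \<le> k")
        case True then show ?thesis using x z by (auto simp: join_map_def)
      next
        case False
        then have "z - (k + 1) \<le> l" using z by simp
        then show ?thesis using False z x by (simp add: join_map_def)
      qed
      then have "\<epsilon> k l \<bullet>\<^bsub>C\<^esub> sact D (k + l + 1) n (join_map k k g l (idm l)) \<bullet>\<^bsub>C\<^esub> t = Zer C T (bob X k l)"
        by (intro eps_miss[OF J _ x(1)]) (use x kl in auto)
      then show "sact (row X l) k k g \<bullet>\<^bsub>C\<^esub> ?u k l = Zer C T (sob (row X l) k)"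
        using eps_natural[OF g Delta_id[of l]] cmp_assoc[OF t D.act_hom[OF J] eps_hom]
          cmp_assoc[OF _ eps_hom bact_hom[OF g Delta_id], of t T l] t kl by simp
    qed
    ultimately show ?thesis by simp
  qed
  have "?y k l = Zer C T (bob X k l)" if kl: "k + l = n" for k l
  proof -
    have "col.nrm k l \<bullet>\<^bsub>C\<^esub> ?y k l = ?y k l"
      by (rule col.nrm_fix) (use y[OF kl] y_v[OF kl] in simp_all)
    moreover have "row.nrm l k \<bullet>\<^bsub>C\<^esub> ?y k l = ?y k l"
    proof (rule row.nrm_fix)
      show "?y k l \<in> Homs C T (sob (row X l) k)" using y[OF kl] by simp
      fix g x assume g: "g \<in> Delta k k" and x: "0 < x" "x \<le> k" "x \<notin> g ` {..k}"
      show "sact (row X l) k k g \<bullet>\<^bsub>C\<^esub> ?y k l = Zer C T (sob (row X l) k)"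
      proof (cases "x < k")
        case True
        then show ?thesis using y_h[OF kl g x(3,1)] by simp
      next
        case False
        \<comment> \<open>The remaining case x = k is a restriction of the glued face, which
          vanishes by \<open>u0\<close>.\<close>
        then obtain k' where k: "k = Suc k'" "x = Suc k'" using x by (cases k) auto
        obtain h where h: "h \<in> Delta k k'" "g = compose {..k} (coface k' (Suc k')) h"
          using factor_coface[of g k k' "Suc k'"] g x k by auto
        have c: "comp k l \<in> Homs C (sob D n) (bob X k l)" using comp_hom[of k l] kl by simp
        have cf: "coface k' (Suc k') \<in> Delta k' k" using coface_Delta k by simp
        have "bact X k' k (coface k' (Suc k')) l l (idm l) \<bullet>\<^bsub>C\<^esub> ?y k l = ?u k' l"
          using cmp_assoc[OF t c bact_hom[OF cf Delta_id]] comp_coface(4)[of k' l] k by simp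
        then have "bact X k' k (coface k' (Suc k')) l l (idm l) \<bullet>\<^bsub>C\<^esub> ?y k l = Zer C T (bob X k' l)"
          using u0[of k' l] k kl by simp
        then have "bact X k k' h l l (idm l) \<bullet>\<^bsub>C\<^esub> bact X k' k (coface k' (Suc k')) l l (idm l) \<bullet>\<^bsub>C\<^esub> ?y k l = Zer C T (bob X k l)"
          using cmp_zero_right[OF bact_hom[OF h(1) Delta_id] T] by simp
        then show ?thesis
          unfolding bact_act[OF h(1) cf Delta_id Delta_id y[OF kl]] Delta_compose_id(1)[OF Delta_id] h(2)[symmetric] by simp
      qed
    qed
    ultimately show ?thesis
      using bnrm_kernel[OF y[OF kl] py[OF kl]] cmp_assoc[OF y[OF kl] nrm_hom'(2) nrm_hom'(1)] by (simp add: bnrm_def)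
  qed
  then have "t = Zer C T (sob D n)" by (rule components_jointly_monic[OF t])
  then show ?thesis using pt cmp_zero_right[OF D.nd_prj_hom T] by simp
qed

text \<open>Components with vanishing glued faces fit together: the value at f is read off from the
  component at f i if both sides of the cut meet there, and it is 0 otherwise. As for naturality, an
  operator that opens a gap at the cut omits the last vertex of the left block or the first vertex
  of the right block, and then the assumed vanishing of faces applies.\<close>

lemma element_of_components:
  assumes T: "T \<in> Obj C"
    and Y: "\<And>k l. k + l = n \<Longrightarrow> Y k l \<in> Homs C T (bob X k l)"
    and Yh: "\<And>k l m g j. k + l = n \<Longrightarrow> g \<in> Delta m k \<Longrightarrow> 0 < j \<Longrightarrow> j \<le> k \<Longrightarrow> j \<notin> g ` {..m} \<Longrightarrow>
       bact X m k g l l (idm l) \<bullet>\<^bsub>C\<^esub> Y k l = Zer C T (bob X m l)"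
    and Yv: "\<And>k l m g j. k + l = n \<Longrightarrow> g \<in> Delta m l \<Longrightarrow> j < l \<Longrightarrow> j \<notin> g ` {..m} \<Longrightarrow>
       bact X k k (idm k) m l g \<bullet>\<^bsub>C\<^esub> Y k l = Zer C T (bob X k m)"
  shows "\<exists>t \<in> Homs C T (sob D n). \<forall>k l. k + l = n \<longrightarrow> comp k l \<bullet>\<^bsub>C\<^esub> t = Y k l"
proof -
  define b where "b i j f = bact X i (f i) (left_part i f) j (n - f i) (right_part i j (f i) f) \<bullet>\<^bsub>C\<^esub> Y (f i) (n - f i)"
    for i j f
  define a where "a i j f = (if f i = f (i + 1) then b i j f else Zer C T (bob X i j))" for i j f
  have parts: "f i \<le> n" "left_part i f \<in> Delta i (f i)" "right_part i j (f i) f \<in> Delta j (n - f i)" "f i + (n - f i) = n"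
    if f: "f \<in> Delta (i + j + 1) n" for i j f
  proof -
    show n: "f i \<le> n" using Delta_le[OF f, of i] by simp
    then show "f i + (n - f i) = n" by simp
    show "left_part i f \<in> Delta i (f i)" by (rule left_part_Delta[OF f order_refl])
    show "right_part i j (f i) f \<in> Delta j (n - f i)" by (rule right_part_Delta[OF f]) (use n in simp)
  qed
  have bh: "b i j f \<in> Homs C T (bob X i j)" if f: "f \<in> Delta (i + j + 1) n" for i j f
    unfolding b_def by (rule cmp_hom[OF Y[OF parts(4)[OF f]] bact_hom[OF parts(2,3)[OF f]]])
  have ah: "a i j f \<in> Homs C T (bob X i j)" if f: "f \<in> Delta (i + j + 1) n" for i j f
    unfolding a_def using bh[OF f] Zer_hom[OF T bob_obj] by simp
  have "\<exists>t \<in> Homs C T (sob D n). \<forall>i j. \<forall>f \<in> Delta (i + j + 1) n.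
     \<epsilon> i j \<bullet>\<^bsub>C\<^esub> sact D (i + j + 1) n f \<bullet>\<^bsub>C\<^esub> t = a i j f"
  proof (rule element_exists[OF T ah])
    fix i j i' j' f g h
    assume f: "f \<in> Delta (i' + j' + 1) n" and g: "g \<in> Delta i i'" and h: "h \<in> Delta j j'"
    let ?f = "compose {..i + j + 1} f (join_map i i' g j h)"
    have f': "?f \<in> Delta (i + j + 1) n" by (rule Delta_compose[OF join_Delta[OF g h] f])
    have fl: "?f x = f (g x)" if "x \<le> i" for x using that by (simp add: compose_def join_map_def)
    have fr: "?f (i + 1 + y) = f (i' + 1 + h y)" if "y \<le> j" for y using that by (simp add: compose_def join_map_def)
    have le: "?f i \<le> f i'" "f (i' + 1) \<le> ?f (i + 1)" "f i' \<le> f (i' + 1)"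
      using fl[of i] fr[of 0] Delta_mono[OF f, of "g i" i'] Delta_mono[OF f, of "i' + 1" "i' + 1 + h 0"]
        Delta_mono[OF f, of i' "i' + 1"] Delta_le[OF g, of i] Delta_le[OF h, of 0] by auto
    show "bact X i i' g j j' h \<bullet>\<^bsub>C\<^esub> a i' j' f = a i j ?f"
    proof (cases "f i' = f (i' + 1)")
      case False
      then have "a i' j' f = Zer C T (bob X i' j')" "a i j ?f = Zer C T (bob X i j)" using le by (auto simp: a_def)
      then show ?thesis using cmp_zero_right[OF bact_hom[OF g h] T] by simp
    next
      case True
      define A where "A = f i'"
      define c where "c = n - A"
      have Ac: "A + c = n" unfolding A_def c_def by (rule parts(4)[OF f])
      note p = parts(2,3)[OF f, folded A_def, folded c_def]
      let ?l = "compose {..i} (left_part i' f) g" and ?r = "compose {..j} (right_part i' j' A f) h"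
      have l: "?l \<in> Delta i A" and r: "?r \<in> Delta j c" by (rule Delta_compose[OF g p(1)], rule Delta_compose[OF h p(2)])
      have lx: "?l x = ?f x" if "x \<le> i" for x using that fl[OF that] Delta_le[OF g that] by (simp add: compose_def left_part_def)
      have ry: "?r y = ?f (i + 1 + y) - A" if "y \<le> j" for y
        using that fr[OF that] Delta_le[OF h that] by (simp add: compose_def right_part_def)
      have lhs: "bact X i i' g j j' h \<bullet>\<^bsub>C\<^esub> a i' j' f = bact X i A ?l j c ?r \<bullet>\<^bsub>C\<^esub> Y A c"
        using True bact_act[OF g p(1) h p(2) Y[OF Ac]] by (simp add: a_def b_def A_def c_def)
      show ?thesis
      proof (cases "?f i = ?f (i + 1)")
        case eq: True
        have fi: "?f i = A" using eq le True by (simp add: A_def)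
        have "left_part i ?f = ?l" "right_part i j A ?f = ?r"
          using lx ry by (auto simp: left_part_def right_part_def compose_def intro!: restrict_ext)
        then show ?thesis unfolding lhs using eq fi by (simp add: a_def b_def c_def)
      next
        case ne: False
        have "bact X i A ?l j c ?r \<bullet>\<^bsub>C\<^esub> Y A c = Zer C T (bob X i j)"
        proof (cases "?f i < A")
          case True
          have "bact X i A ?l c c (idm c) \<bullet>\<^bsub>C\<^esub> Y A c = Zer C T (bob X i c)"
          proof (rule Yh[OF Ac l])
            show "0 < A" using True by simp
            have "?l x < A" if "x \<le> i" for x using Delta_mono[OF l that order_refl] lx[of i] True by simp
            then show "A \<notin> ?l ` {..i}" by auto
          qed simp
          then show ?thesis
            unfolding bact_split(2)[OF l r] using cmp_assoc[OF Y[OF Ac] bact_hom[OF l Delta_id] bact_hom[OF Delta_id r]]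
              cmp_zero_right[OF bact_hom[OF Delta_id r] T] by simp
        next
          case False
          then have gt: "A < ?f (i + 1)" using le ne True by (auto simp: A_def)
          have "bact X A A (idm A) j c ?r \<bullet>\<^bsub>C\<^esub> Y A c = Zer C T (bob X A j)"
          proof (rule Yv[OF Ac r])
            have "?f (i + 1) \<le> n" by (rule Delta_le[OF f']) simp
            then show "0 < c" using gt by (simp add: c_def)
            have "0 < ?r y" if "y \<le> j" for y using Delta_mono[OF r le0 that] ry[of 0] gt by simp
            then show "0 \<notin> ?r ` {..j}" by force
          qed
          then show ?thesis
            unfolding bact_split(1)[OF l r] using cmp_assoc[OF Y[OF Ac] bact_hom[OF Delta_id r] bact_hom[OF l Delta_id]]
              cmp_zero_right[OF bact_hom[OF l Delta_id] T] by simp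
        qed
        then show ?thesis unfolding lhs using ne by (simp add: a_def)
      qed
    qed
  qed
  then obtain t where t: "t \<in> Homs C T (sob D n)"
    and ta: "\<And>i j f. f \<in> Delta (i + j + 1) n \<Longrightarrow> \<epsilon> i j \<bullet>\<^bsub>C\<^esub> sact D (i + j + 1) n f \<bullet>\<^bsub>C\<^esub> t = a i j f" by blast
  have "comp k l \<bullet>\<^bsub>C\<^esub> t = Y k l" if kl: "k + l = n" for k l
  proof -
    have s: "s_can k l \<in> Delta (k + l + 1) n" unfolding kl[symmetric] by (rule s_can_Delta)
    have v: "s_can k l k = k" "s_can k l (k + 1) = k" by (auto simp: s_can_def)
    have lr: "left_part k (s_can k l) = idm k" "right_part k l k (s_can k l) = idm l"
      by (auto simp: left_part_def right_part_def s_can_def intro!: restrict_ext)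
    have "comp k l \<bullet>\<^bsub>C\<^esub> t = \<epsilon> k l \<bullet>\<^bsub>C\<^esub> sact D (k + l + 1) n (s_can k l) \<bullet>\<^bsub>C\<^esub> t"
      using cmp_assoc[OF t D.act_hom[OF s] eps_hom] kl by (simp add: comp_def)
    also have "\<dots> = bact X k k (idm k) l l (idm l) \<bullet>\<^bsub>C\<^esub> Y k l"
      unfolding ta[OF s] a_def b_def v lr using kl by auto
    finally show ?thesis unfolding bact_id ide_cmp[OF Y[OF kl]] .
  qed
  then show ?thesis using t by blast
qed

text \<open>Sections of the projections with vanishing glued faces are assembled to an element over
  the direct sum, and this gives a right inverse. It is two-sided because the identification is
  monic.\<close>

lemma total_iso:
  shows "inverse_arr C (total_ident C X D \<epsilon> n) \<in> Homs C (dsum C (bidegrees n) bnds) (nd C D n)"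
    and "total_ident C X D \<epsilon> n \<bullet>\<^bsub>C\<^esub> inverse_arr C (total_ident C X D \<epsilon> n) = Ide C (dsum C (bidegrees n) bnds)"
proof -
  let ?T = "dsum C (bidegrees n) bnds" and ?e = "total_ident C X D \<epsilon> n"
  note T = bnds_dsum_obj[of n] and e = total_ident(1)[of n]
  have "\<forall>k l. \<exists>y. y \<in> Homs C (bnd C X k l) (bob X k l) \<and> bnd_prj C X k l \<bullet>\<^bsub>C\<^esub> y = Ide C (bnd C X k l) \<and>
    (\<forall>m g j. g \<in> Delta m k \<and> 0 < j \<and> j \<le> k \<and> j \<notin> g ` {..m} \<longrightarrow>
       bact X m k g l l (idm l) \<bullet>\<^bsub>C\<^esub> y = Zer C (bnd C X k l) (bob X m l)) \<and>
    (\<forall>m g j. g \<in> Delta m l \<and> j < l \<and> j \<notin> g ` {..m} \<longrightarrow>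
       bact X k k (idm k) m l g \<bullet>\<^bsub>C\<^esub> y = Zer C (bnd C X k l) (bob X k m))"
    using opposite_section by metis
  then obtain y where y: "\<And>k l. y k l \<in> Homs C (bnd C X k l) (bob X k l)"
    "\<And>k l. bnd_prj C X k l \<bullet>\<^bsub>C\<^esub> y k l = Ide C (bnd C X k l)"
    "\<And>k l m g j. g \<in> Delta m k \<Longrightarrow> 0 < j \<Longrightarrow> j \<le> k \<Longrightarrow> j \<notin> g ` {..m} \<Longrightarrow>
       bact X m k g l l (idm l) \<bullet>\<^bsub>C\<^esub> y k l = Zer C (bnd C X k l) (bob X m l)"
    "\<And>k l m g j. g \<in> Delta m l \<Longrightarrow> j < l \<Longrightarrow> j \<notin> g ` {..m} \<Longrightarrow>
       bact X k k (idm k) m l g \<bullet>\<^bsub>C\<^esub> y k l = Zer C (bnd C X k l) (bob X k m)"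
    by metis
  let ?p = "\<lambda>k l. dsum_prj C (bidegrees n) bnds (k, l)"
  have "\<exists>t \<in> Homs C ?T (sob D n). \<forall>k l. k + l = n \<longrightarrow> comp k l \<bullet>\<^bsub>C\<^esub> t = y k l \<bullet>\<^bsub>C\<^esub> ?p k l"
  proof (rule element_of_components[OF T])
    fix k l assume kl: "k + l = n"
    note p = bnds_prj_hom[OF kl]
    show "y k l \<bullet>\<^bsub>C\<^esub> ?p k l \<in> Homs C ?T (bob X k l)" by (rule cmp_hom[OF p y(1)])
    show "bact X m k g l l (idm l) \<bullet>\<^bsub>C\<^esub> y k l \<bullet>\<^bsub>C\<^esub> ?p k l = Zer C ?T (bob X m l)"
      if "g \<in> Delta m k" "0 < j" "j \<le> k" "j \<notin> g ` {..m}" for m g j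
      using cmp_assoc[OF p y(1) bact_hom[OF that(1) Delta_id]] y(3)[OF that] cmp_zero_left[OF p bob_obj] by simp
    show "bact X k k (idm k) m l g \<bullet>\<^bsub>C\<^esub> y k l \<bullet>\<^bsub>C\<^esub> ?p k l = Zer C ?T (bob X k m)"
      if "g \<in> Delta m l" "j < l" "j \<notin> g ` {..m}" for m g j
      using cmp_assoc[OF p y(1) bact_hom[OF Delta_id that(1)]] y(4)[OF that] cmp_zero_left[OF p bob_obj] by simp
  qed
  then obtain t where t: "t \<in> Homs C ?T (sob D n)"
    and ty: "\<And>k l. k + l = n \<Longrightarrow> comp k l \<bullet>\<^bsub>C\<^esub> t = y k l \<bullet>\<^bsub>C\<^esub> ?p k l" by blast
  let ?r = "nd_prj C D n \<bullet>\<^bsub>C\<^esub> t"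
  have r: "?r \<in> Homs C ?T (nd C D n)" by (rule cmp_hom[OF t D.nd_prj_hom])
  have er: "?e \<bullet>\<^bsub>C\<^esub> ?r = Ide C ?T"
  proof (rule into_bnds_eqI[OF cmp_hom[OF r e] ide_hom[OF T]])
    fix k l assume kl: "k + l = n"
    note p = bnds_prj_hom[OF kl]
    have c: "comp k l \<in> Homs C (sob D n) (bob X k l)" using comp_hom[of k l] kl by simp
    have "?p k l \<bullet>\<^bsub>C\<^esub> ?e \<bullet>\<^bsub>C\<^esub> ?r = (?p k l \<bullet>\<^bsub>C\<^esub> ?e \<bullet>\<^bsub>C\<^esub> nd_prj C D n) \<bullet>\<^bsub>C\<^esub> t"
      using cmp_assoc[OF t D.nd_prj_hom e] cmp_assoc[OF t cmp_hom[OF D.nd_prj_hom e] p] by simp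
    also have "\<dots> = bnd_prj C X k l \<bullet>\<^bsub>C\<^esub> y k l \<bullet>\<^bsub>C\<^esub> ?p k l"
      unfolding total_ident(2)[OF kl] cmp_assoc[OF t c bnd_prj_hom] ty[OF kl] ..
    also have "\<dots> = ?p k l" using cmp_assoc[OF p y(1) bnd_prj_hom] y(2) ide_cmp[OF p] by simp
    finally show "?p k l \<bullet>\<^bsub>C\<^esub> ?e \<bullet>\<^bsub>C\<^esub> ?r = ?p k l \<bullet>\<^bsub>C\<^esub> Ide C ?T" using cmp_ide[OF p] by simp
  qed
  \<comment> \<open>Monicity in the form of \<open>total_monic\<close> is applied to the difference
    of the two endomorphisms.\<close>
  have re: "?r \<bullet>\<^bsub>C\<^esub> ?e = Ide C (nd C D n)"
  proof -
    note reh = cmp_hom[OF e r] and idh = ide_hom[OF D.nd_obj[of n]]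
    have "?e \<bullet>\<^bsub>C\<^esub> minus_arr (?r \<bullet>\<^bsub>C\<^esub> ?e) (Ide C (nd C D n)) = Zer C (nd C D n) ?T"
      using cmp_minus_right[OF reh idh e] cmp_assoc[OF e r e] er ide_cmp[OF e] cmp_ide[OF e] minus_self[OF e] by simp
    from total_monic[OF minus_hom[OF reh idh] this] show ?thesis using minus_eq_zero_iff[OF reh idh] by simp
  qed
  have "inverse_arr C ?e = ?r" by (rule inverse_arr_eqI[OF e r re er])
  then show "inverse_arr C ?e \<in> Homs C ?T (nd C D n)" "?e \<bullet>\<^bsub>C\<^esub> inverse_arr C ?e = Ide C ?T" using r er by auto
qed

end

context dec_adjoint
begin

section \<open>The map \<open>\<AA>\<ww>\<close>\<close>

text \<open>A join restricts on the two blocks to the maps from which it is formed. So the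
  restrictions to the blocks are a bisimplicial map, and the adjunction makes the definite
  description in \<open>Aw\<close> meaningful.\<close>

lemma Aw:
  shows Aw_mor: "simplicial_mor C (diag X) D (Aw C X D \<epsilon>)"
    and eps_Aw: "\<epsilon> i j \<bullet>\<^bsub>C\<^esub> Aw C X D \<epsilon> (i + j + 1) =
      bact X i (i + j + 1) (first_incl i) j (i + j + 1) (last_incl (i + j + 1) j)"
proof -
  let ?\<alpha> = "\<lambda>i j. bact X i (i + j + 1) (first_incl i) j (i + j + 1) (last_incl (i + j + 1) j)"
  have F: "first_incl i \<in> Delta i (i + j + 1)" and L: "last_incl (i + j + 1) j \<in> Delta j (i + j + 1)" for i j
    by (rule first_incl_Delta, simp, rule last_incl_Delta, simp)
  have "bisimplicial_mor C (dec (diag X)) X ?\<alpha>"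
    unfolding bisimplicial_mor_def dec_def bisimplicial.simps diag_simps
  proof (intro conjI allI ballI bact_hom F L)
    fix i i' j j' g h assume g: "g \<in> Delta i i'" and h: "h \<in> Delta j j'"
    let ?J = "join_map i i' g j h"
    note J = join_Delta[OF g h]
    have "compose {..i} ?J (first_incl i) = compose {..i} (first_incl i') g"
      by (rule Delta_eqI[OF Delta_compose[OF F J] Delta_compose[OF g F]])
         (use Delta_le[OF g] in \<open>auto simp: compose_def first_incl_def join_map_def\<close>)
    moreover have "compose {..j} ?J (last_incl (i + j + 1) j) = compose {..j} (last_incl (i' + j' + 1) j') h"
      by (rule Delta_eqI[OF Delta_compose[OF L J] Delta_compose[OF h L]])
         (use Delta_le[OF h] in \<open>auto simp: compose_def last_incl_def join_map_def\<close>)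
    ultimately show "?\<alpha> i j \<bullet>\<^bsub>C\<^esub> bact X (i + j + 1) (i' + j' + 1) ?J (i + j + 1) (i' + j' + 1) ?J =
        bact X i i' g j j' h \<bullet>\<^bsub>C\<^esub> ?\<alpha> i' j'"
      using bact_compose[OF F J L J] bact_compose[OF g F h L] by metis
  qed
  from theI'[OF universal[OF diag_simplicial this]]
  show "simplicial_mor C (diag X) D (Aw C X D \<epsilon>)" "\<epsilon> i j \<bullet>\<^bsub>C\<^esub> Aw C X D \<epsilon> (i + j + 1) = ?\<alpha> i j"
    unfolding Aw_def by blast+
qed

lemma Aw_hom: "Aw C X D \<epsilon> n \<in> Homs C (bob X n n) (sob D n)"
  using simplicial_morD(1)[OF Aw_mor, of n] by simp

text \<open>Restricted to either block, \<open>s_can\<close> is injective: it is the front face on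
  [i] and the back face on [j] of [i + j].\<close>

lemma comp_Aw:
  "comp i j \<bullet>\<^bsub>C\<^esub> Aw C X D \<epsilon> (i + j) = bact X i (i + j) (first_incl i) j (i + j) (last_incl (i + j) j)"
proof -
  let ?N = "i + j + 1"
  note s = s_can_Delta[of i j]
  have F: "first_incl i \<in> Delta i ?N" and L: "last_incl ?N j \<in> Delta j ?N"
    by (rule first_incl_Delta, simp, rule last_incl_Delta, simp)
  have F': "first_incl i \<in> Delta i (i + j)" and L': "last_incl (i + j) j \<in> Delta j (i + j)"
    by (rule first_incl_Delta, simp, rule last_incl_Delta, simp)
  have "compose {..i} (s_can i j) (first_incl i) = first_incl i"
    by (rule Delta_eqI[OF Delta_compose[OF F s] F']) (auto simp: compose_def first_incl_def s_can_def)
  moreover have "compose {..j} (s_can i j) (last_incl ?N j) = last_incl (i + j) j"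
    by (rule Delta_eqI[OF Delta_compose[OF L s] L']) (auto simp: compose_def last_incl_def s_can_def)
  ultimately have eq: "bact X i ?N (first_incl i) j ?N (last_incl ?N j) \<bullet>\<^bsub>C\<^esub> bact X ?N (i + j) (s_can i j) ?N (i + j) (s_can i j)
      = bact X i (i + j) (first_incl i) j (i + j) (last_incl (i + j) j)"
    using bact_compose[OF F s L s] by simp
  have "comp i j \<bullet>\<^bsub>C\<^esub> Aw C X D \<epsilon> (i + j) = \<epsilon> i j \<bullet>\<^bsub>C\<^esub> sact D ?N (i + j) (s_can i j) \<bullet>\<^bsub>C\<^esub> Aw C X D \<epsilon> (i + j)"
    unfolding comp_def by (rule cmp_assoc[OF Aw_hom D.act_hom[OF s] eps_hom])
  also have "\<dots> = \<epsilon> i j \<bullet>\<^bsub>C\<^esub> Aw C X D \<epsilon> ?N \<bullet>\<^bsub>C\<^esub> bact X ?N (i + j) (s_can i j) ?N (i + j) (s_can i j)"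
    using simplicial_morD(2)[OF Aw_mor s] by simp
  also have "\<dots> = (\<epsilon> i j \<bullet>\<^bsub>C\<^esub> Aw C X D \<epsilon> ?N) \<bullet>\<^bsub>C\<^esub> bact X ?N (i + j) (s_can i j) ?N (i + j) (s_can i j)"
    by (rule cmp_assoc[OF bact_hom[OF s s] Aw_hom eps_hom, symmetric])
  finally show ?thesis unfolding eps_Aw eq .
qed

lemma Aw_chain_hom: "Aw_chain C X D \<epsilon> n \<in> Homs C (nd C (diag X) n) (dsum C (bidegrees n) bnds)"
  unfolding Aw_chain_def by (rule cmp_hom[OF diag.nd_map(1)[OF D.A Aw_mor] total_ident(1)])

lemma prj_Aw_chain:
  assumes ij: "i + j = n"
  shows "dsum_prj C (bidegrees n) bnds (i, j) \<bullet>\<^bsub>C\<^esub> Aw_chain C X D \<epsilon> n \<bullet>\<^bsub>C\<^esub> nd_prj C (diag X) n =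
    bnd_prj C X i j \<bullet>\<^bsub>C\<^esub> bact X i n (first_incl i) j n (last_incl n j)"
proof -
  note m = diag.nd_map[OF D.A Aw_mor, of n] and e = total_ident(1)[of n] and p = bnds_prj_hom[OF ij]
  have c: "comp i j \<in> Homs C (sob D n) (bob X i j)" using comp_hom[of i j] ij by simp
  have "Aw_chain C X D \<epsilon> n \<bullet>\<^bsub>C\<^esub> nd_prj C (diag X) n = total_ident C X D \<epsilon> n \<bullet>\<^bsub>C\<^esub> nd_prj C D n \<bullet>\<^bsub>C\<^esub> Aw C X D \<epsilon> n"
    unfolding Aw_chain_def using cmp_assoc[OF diag_nd_prj_hom m(1) e] m(2) by simp
  also have "\<dots> = (total_ident C X D \<epsilon> n \<bullet>\<^bsub>C\<^esub> nd_prj C D n) \<bullet>\<^bsub>C\<^esub> Aw C X D \<epsilon> n"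
    by (rule cmp_assoc[OF Aw_hom D.nd_prj_hom e, symmetric])
  finally have "dsum_prj C (bidegrees n) bnds (i, j) \<bullet>\<^bsub>C\<^esub> Aw_chain C X D \<epsilon> n \<bullet>\<^bsub>C\<^esub> nd_prj C (diag X) n
      = (bnd_prj C X i j \<bullet>\<^bsub>C\<^esub> comp i j) \<bullet>\<^bsub>C\<^esub> Aw C X D \<epsilon> n"
    using cmp_assoc[OF Aw_hom cmp_hom[OF D.nd_prj_hom e] p] total_ident(2)[OF ij] by simp
  then show ?thesis using cmp_assoc[OF Aw_hom c bnd_prj_hom] comp_Aw[of i j] ij by simp
qed

lemma Aw_square: "Aw_chain C X D \<epsilon> n \<bullet>\<^bsub>C\<^esub> nd_prj C (diag X) n = bidegree_prj C X n \<bullet>\<^bsub>C\<^esub> Aw_top C X n"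
proof -
  let ?f = "\<lambda>(i, j). bact X i n (first_incl i) j n (last_incl n j)"
  have f: "?f p \<in> Homs C (bob X n n) (bobs p)" if "p \<in> bidegrees n" for p
    using that bact_hom[OF first_incl_Delta last_incl_Delta] by (auto simp: bidegrees_def)
  have top: "Aw_top C X n \<in> Homs C (bob X n n) (dsum C (bidegrees n) bobs)"
    unfolding Aw_top_def by (rule into_dsum_hom[OF finite_bidegrees bobs_obj bob_obj f])
  show ?thesis
  proof (rule into_bnds_eqI[OF cmp_hom[OF diag_nd_prj_hom Aw_chain_hom] cmp_hom[OF top bidegree_prj(1)]])
    fix i j assume ij: "i + j = n"
    then have m: "(i, j) \<in> bidegrees n" by (simp add: bidegrees_def)
    have "dsum_prj C (bidegrees n) bobs (i, j) \<bullet>\<^bsub>C\<^esub> Aw_top C X n = ?f (i, j)"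
      unfolding Aw_top_def by (rule prj_into_dsum[OF finite_bidegrees bobs_obj bob_obj f m])
    then show "dsum_prj C (bidegrees n) bnds (i, j) \<bullet>\<^bsub>C\<^esub> Aw_chain C X D \<epsilon> n \<bullet>\<^bsub>C\<^esub> nd_prj C (diag X) n =
        dsum_prj C (bidegrees n) bnds (i, j) \<bullet>\<^bsub>C\<^esub> bidegree_prj C X n \<bullet>\<^bsub>C\<^esub> Aw_top C X n"
      using prj_Aw_chain[OF ij] cmp_assoc[OF top bidegree_prj(1) bnds_prj_hom[OF ij]] bidegree_prj(2)[OF ij]
        cmp_assoc[OF top bobs_prj_hom[OF ij] bnd_prj_hom] by simp
  qed
qed

text \<open>The component at (k, l) survives only if \<sigma> is injective on the front face [k] and
  \<tau> on the back face [l]. Then k \<le> i and l \<le> j, hence k = i and l = j. So \<sigma> is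
  the identity on [i] and stays at i afterwards, and \<tau> is determined by \<sigma> + \<tau> =
  id.\<close>

lemma Aw_chain_shuffle:
  assumes "(\<sigma>, \<tau>) \<in> shuffles_of i j" and ne: "\<not> (\<sigma> = s_left i j \<and> \<tau> = s_right i j)"
  shows "Aw_chain C X D \<epsilon> (i + j) \<bullet>\<^bsub>C\<^esub> nd_prj C (diag X) (i + j) \<bullet>\<^bsub>C\<^esub> bact X (i + j) i \<sigma> (i + j) j \<tau>
    = Zer C (bob X i j) (dsum C (bidegrees (i + j)) bnds)"
proof -
  let ?n = "i + j"
  note s = shufflesD[OF assms(1)]
  note \<sigma> = Delta_surjD(1)[OF s(1)] and \<tau> = Delta_surjD(1)[OF s(2)]
  note b = bact_hom[OF \<sigma> \<tau>]
  show ?thesis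
  proof (rule into_bnds_eqI[OF cmp_hom[OF cmp_hom[OF b diag_nd_prj_hom] Aw_chain_hom] Zer_hom[OF bob_obj bnds_dsum_obj]])
    fix k l assume kl: "k + l = ?n"
    note p = bnds_prj_hom[OF kl]
    have F: "first_incl k \<in> Delta k ?n" and L: "last_incl ?n l \<in> Delta l ?n"
      by (rule first_incl_Delta, use kl in simp, rule last_incl_Delta, use kl in simp)
    let ?f = "compose {..k} \<sigma> (first_incl k)" and ?g = "compose {..l} \<tau> (last_incl ?n l)"
    note f = Delta_compose[OF F \<sigma>] and g = Delta_compose[OF L \<tau>]
    have ni: "\<not> inj_on ?f {..k} \<or> \<not> inj_on ?g {..l}"
    proof (rule ccontr)
      assume "\<not> ?thesis"
      then have inj: "inj_on ?f {..k}" "inj_on ?g {..l}" by auto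
      then have "k \<le> i" "l \<le> j" using Delta_inj_le[OF f] Delta_inj_le[OF g] by auto
      then have kl': "k = i" "l = j" using kl by auto
      have "?f x = idm i x" for x using Delta_inj_id f inj(1) unfolding kl' by metis
      then have v: "\<sigma> x = x" if "x \<le> i" for x
        using \<open>?f x = idm i x\<close> that unfolding kl' by (simp add: compose_def first_incl_def)
      have "\<sigma> x = min x i" if "x \<le> ?n" for x
        using v[of x] v[of i] Delta_mono[OF \<sigma>, of i x] Delta_le[OF \<sigma>, of x] that by (auto simp: min_def)
      then have "\<sigma> = s_left i j"
        unfolding s_left_def by (intro Delta_eqI[OF \<sigma> restrict_Delta[of _ _ i]]) (auto simp: min_def)
      moreover have "\<tau> = s_right i j"
        unfolding s_right_def
      proof (rule Delta_eqI[OF \<tau> restrict_Delta[of _ _ j]])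
        fix x assume "x \<le> ?n"
        then show "\<tau> x = (\<lambda>k\<in>{..?n}. k - i) x"
          using s(3)[of x] \<open>\<And>x. x \<le> ?n \<Longrightarrow> \<sigma> x = min x i\<close>[of x] by (auto simp: min_def split: if_splits)
      qed auto
      ultimately show False using ne by blast
    qed
    have "dsum_prj C (bidegrees ?n) bnds (k, l) \<bullet>\<^bsub>C\<^esub> Aw_chain C X D \<epsilon> ?n \<bullet>\<^bsub>C\<^esub> nd_prj C (diag X) ?n \<bullet>\<^bsub>C\<^esub> bact X ?n i \<sigma> ?n j \<tau>
      = (dsum_prj C (bidegrees ?n) bnds (k, l) \<bullet>\<^bsub>C\<^esub> Aw_chain C X D \<epsilon> ?n \<bullet>\<^bsub>C\<^esub> nd_prj C (diag X) ?n) \<bullet>\<^bsub>C\<^esub> bact X ?n i \<sigma> ?n j \<tau>"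
      using cmp_assoc[OF b diag_nd_prj_hom Aw_chain_hom] cmp_assoc[OF b cmp_hom[OF diag_nd_prj_hom Aw_chain_hom] p] by simp
    also have "\<dots> = bnd_prj C X k l \<bullet>\<^bsub>C\<^esub> bact X k i ?f l j ?g"
      unfolding prj_Aw_chain[OF kl] cmp_assoc[OF b bact_hom[OF F L] bnd_prj_hom] bact_compose[OF F \<sigma> L \<tau>] ..
    also have "\<dots> = Zer C (bob X i j) (bnd C X k l)" by (rule bnd_degenerate[OF f g ni])
    finally show "dsum_prj C (bidegrees ?n) bnds (k, l) \<bullet>\<^bsub>C\<^esub> Aw_chain C X D \<epsilon> ?n \<bullet>\<^bsub>C\<^esub> nd_prj C (diag X) ?n \<bullet>\<^bsub>C\<^esub> bact X ?n i \<sigma> ?n j \<tau>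
      = dsum_prj C (bidegrees ?n) bnds (k, l) \<bullet>\<^bsub>C\<^esub> Zer C (bob X i j) (dsum C (bidegrees ?n) bnds)"
      using cmp_zero_right[OF p bob_obj] by simp
  qed
qed

section \<open>The map \<open>\<EE>\<zz>\<close>\<close>

definition shuffle_sum :: "nat \<Rightarrow> nat \<Rightarrow> 'm" where
  "shuffle_sum i j = finsum (H (bob X i j) (bob X (i + j) (i + j)))
     (\<lambda>(\<sigma>, \<tau>). [(shuffle_sgn (i + j) \<sigma> \<tau>)] \<cdot>\<^bsub>H (bob X i j) (bob X (i + j) (i + j))\<^esub> bact X (i + j) i \<sigma> (i + j) j \<tau>)
     (shuffles_of i j)"

lemma shuffle_bact_hom:
  "p \<in> shuffles_of i j \<Longrightarrow> (case p of (\<sigma>, \<tau>) \<Rightarrow> bact X (i + j) i \<sigma> (i + j) j \<tau>) \<in> Homs C (bob X i j) (bob X (i + j) (i + j))"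
  using bact_hom Delta_surjD(1) shufflesD(1,2) by (auto split: prod.splits)

lemma shuffle_sum_hom: "shuffle_sum i j \<in> Homs C (bob X i j) (bob X (i + j) (i + j))"
  unfolding shuffle_sum_def
  by (rule finsum_hom[OF bob_obj bob_obj]) (use shuffle_bact_hom in \<open>auto intro!: scal_hom\<close>)

lemma finsum_shuffle_sum:
  assumes g: "g \<in> Homs C (bob X (i + j) (i + j)) c" and f: "f \<in> Homs C b (bob X i j)"
  shows "g \<bullet>\<^bsub>C\<^esub> shuffle_sum i j \<bullet>\<^bsub>C\<^esub> f = finsum (H b c)
    (\<lambda>(\<sigma>, \<tau>). [(shuffle_sgn (i + j) \<sigma> \<tau>)] \<cdot>\<^bsub>H b c\<^esub> (g \<bullet>\<^bsub>C\<^esub> bact X (i + j) i \<sigma> (i + j) j \<tau> \<bullet>\<^bsub>C\<^esub> f)) (shuffles_of i j)"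
proof -
  let ?n = "i + j" and ?H = "H (bob X i j) (bob X (i + j) (i + j))"
  have ob: "b \<in> Obj C" "c \<in> Obj C" using Homs_obj f g by auto
  have bh: "bact X ?n i \<sigma> ?n j \<tau> \<in> Homs C (bob X i j) (bob X ?n ?n)" if "(\<sigma>, \<tau>) \<in> shuffles_of i j" for \<sigma> \<tau>
    using shuffle_bact_hom[OF that] by simp
  have sh: "(case p of (\<sigma>, \<tau>) \<Rightarrow> [(shuffle_sgn ?n \<sigma> \<tau>)] \<cdot>\<^bsub>?H\<^esub> bact X ?n i \<sigma> ?n j \<tau>) \<in> Homs C (bob X i j) (bob X ?n ?n)"
    if "p \<in> shuffles_of i j" for p using that bh scal_hom by (cases p) auto
  have "shuffle_sum i j \<bullet>\<^bsub>C\<^esub> f = finsum (H b (bob X ?n ?n))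
      (\<lambda>p. (case p of (\<sigma>, \<tau>) \<Rightarrow> [(shuffle_sgn ?n \<sigma> \<tau>)] \<cdot>\<^bsub>?H\<^esub> bact X ?n i \<sigma> ?n j \<tau>) \<bullet>\<^bsub>C\<^esub> f) (shuffles_of i j)"
    unfolding shuffle_sum_def by (rule cmp_finsum_left[OF f bob_obj sh])
  then have "g \<bullet>\<^bsub>C\<^esub> shuffle_sum i j \<bullet>\<^bsub>C\<^esub> f = finsum (H b c)
      (\<lambda>p. g \<bullet>\<^bsub>C\<^esub> (case p of (\<sigma>, \<tau>) \<Rightarrow> [(shuffle_sgn ?n \<sigma> \<tau>)] \<cdot>\<^bsub>?H\<^esub> bact X ?n i \<sigma> ?n j \<tau>) \<bullet>\<^bsub>C\<^esub> f) (shuffles_of i j)"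
    using cmp_finsum_right[OF g ob(1), of "shuffles_of i j"] cmp_hom[OF f sh] by simp
  also have "\<dots> = finsum (H b c)
    (\<lambda>(\<sigma>, \<tau>). [(shuffle_sgn ?n \<sigma> \<tau>)] \<cdot>\<^bsub>H b c\<^esub> (g \<bullet>\<^bsub>C\<^esub> bact X ?n i \<sigma> ?n j \<tau> \<bullet>\<^bsub>C\<^esub> f)) (shuffles_of i j)"
  proof (rule finsum_eqI[OF ob])
    fix p assume p: "p \<in> shuffles_of i j"
    obtain \<sigma> \<tau> where [simp]: "p = (\<sigma>, \<tau>)" by (cases p)
    have b: "bact X ?n i \<sigma> ?n j \<tau> \<in> Homs C (bob X i j) (bob X ?n ?n)" using bh p by simp
    show "g \<bullet>\<^bsub>C\<^esub> (case p of (\<sigma>, \<tau>) \<Rightarrow> [(shuffle_sgn ?n \<sigma> \<tau>)] \<cdot>\<^bsub>?H\<^esub> bact X ?n i \<sigma> ?n j \<tau>) \<bullet>\<^bsub>C\<^esub> f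
      = (case p of (\<sigma>, \<tau>) \<Rightarrow> [(shuffle_sgn ?n \<sigma> \<tau>)] \<cdot>\<^bsub>H b c\<^esub> (g \<bullet>\<^bsub>C\<^esub> bact X ?n i \<sigma> ?n j \<tau> \<bullet>\<^bsub>C\<^esub> f))"
      using cmp_scal_left[OF f b] cmp_scal_right[OF cmp_hom[OF f b] g] by simp
    show "(case p of (\<sigma>, \<tau>) \<Rightarrow> [(shuffle_sgn ?n \<sigma> \<tau>)] \<cdot>\<^bsub>H b c\<^esub> (g \<bullet>\<^bsub>C\<^esub> bact X ?n i \<sigma> ?n j \<tau> \<bullet>\<^bsub>C\<^esub> f)) \<in> Homs C b c"
      using scal_hom[OF cmp_hom[OF cmp_hom[OF f b] g]] by simp
  qed
  finally show ?thesis .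
qed

lemma finsum_shuffle_sum_left:
  assumes g: "g \<in> Homs C (bob X (i + j) (i + j)) c"
  shows "g \<bullet>\<^bsub>C\<^esub> shuffle_sum i j = finsum (H (bob X i j) c)
    (\<lambda>(\<sigma>, \<tau>). [(shuffle_sgn (i + j) \<sigma> \<tau>)] \<cdot>\<^bsub>H (bob X i j) c\<^esub> (g \<bullet>\<^bsub>C\<^esub> bact X (i + j) i \<sigma> (i + j) j \<tau>)) (shuffles_of i j)"
proof -
  have ob: "c \<in> Obj C" using Homs_obj g by auto
  have bh: "bact X (i + j) i \<sigma> (i + j) j \<tau> \<in> Homs C (bob X i j) (bob X (i + j) (i + j))" if "(\<sigma>, \<tau>) \<in> shuffles_of i j" for \<sigma> \<tau>
    using shuffle_bact_hom[OF that] by simp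
  have "g \<bullet>\<^bsub>C\<^esub> shuffle_sum i j = g \<bullet>\<^bsub>C\<^esub> shuffle_sum i j \<bullet>\<^bsub>C\<^esub> Ide C (bob X i j)"
    using cmp_ide[OF shuffle_sum_hom] by simp
  also have "\<dots> = finsum (H (bob X i j) c)
    (\<lambda>(\<sigma>, \<tau>). [(shuffle_sgn (i + j) \<sigma> \<tau>)] \<cdot>\<^bsub>H (bob X i j) c\<^esub> (g \<bullet>\<^bsub>C\<^esub> bact X (i + j) i \<sigma> (i + j) j \<tau> \<bullet>\<^bsub>C\<^esub> Ide C (bob X i j))) (shuffles_of i j)"
    by (rule finsum_shuffle_sum[OF g ide_hom[OF bob_obj]])
  also have "\<dots> = finsum (H (bob X i j) c)
    (\<lambda>(\<sigma>, \<tau>). [(shuffle_sgn (i + j) \<sigma> \<tau>)] \<cdot>\<^bsub>H (bob X i j) c\<^esub> (g \<bullet>\<^bsub>C\<^esub> bact X (i + j) i \<sigma> (i + j) j \<tau>)) (shuffles_of i j)"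
    by (rule finsum_eqI[OF bob_obj ob]) (use bh cmp_ide[OF bh] in \<open>auto intro!: scal_hom cmp_hom[OF bh g]\<close>)
  finally show ?thesis .
qed

text \<open>The composites with a shuffle end in [k] and [l] with k + l < i + j, so they collapse a
  common interval and the result is degenerate in the diagonal.\<close>

lemma shuffle_sum_degenerate:
  assumes f: "f \<in> Delta i k" and g: "g \<in> Delta j l" and lt: "k + l < i + j"
  shows "(nd_prj C (diag X) (i + j) \<bullet>\<^bsub>C\<^esub> shuffle_sum i j) \<bullet>\<^bsub>C\<^esub> bact X i k f j l g
     = Zer C (bob X k l) (nd C (diag X) (i + j))"
proof -
  have ob: "bob X k l \<in> Obj C" "nd C (diag X) (i + j) \<in> Obj C" using bob_obj diag.nd_obj by auto
  have "nd_prj C (diag X) (i + j) \<bullet>\<^bsub>C\<^esub> bact X (i + j) i \<sigma> (i + j) j \<tau> \<bullet>\<^bsub>C\<^esub> bact X i k f j l g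
     = Zer C (bob X k l) (nd C (diag X) (i + j))" if "(\<sigma>, \<tau>) \<in> shuffles_of i j" for \<sigma> \<tau>
  proof -
    note \<sigma> = Delta_surjD(1)[OF shufflesD(1)[OF that]] and \<tau> = Delta_surjD(1)[OF shufflesD(2)[OF that]]
    show ?thesis
      unfolding bact_compose[OF \<sigma> f \<tau> g, symmetric]
      by (rule diag_degenerate[OF Delta_compose[OF \<sigma> f] Delta_compose[OF \<tau> g]
            joint_adjacent[OF Delta_compose[OF \<sigma> f] Delta_compose[OF \<tau> g] lt]])
  qed
  then show ?thesis
    unfolding cmp_assoc[OF bact_hom[OF f g] shuffle_sum_hom diag_nd_prj_hom]
      finsum_shuffle_sum[OF diag_nd_prj_hom bact_hom[OF f g]]
    by (intro finsum_Zer[OF ob]) (auto simp: scal_zero[OF ob])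
qed

section \<open>The shuffle map on chains\<close>

definition Ez_comp :: "nat \<Rightarrow> nat \<Rightarrow> 'm" where
  "Ez_comp i j = descend C (bnd_prj C X i j) (nd_prj C (diag X) (i + j) \<bullet>\<^bsub>C\<^esub> shuffle_sum i j)"

lemma Ez_comp:
  "Ez_comp i j \<in> Homs C (bnd C X i j) (nd C (diag X) (i + j))"
  "Ez_comp i j \<bullet>\<^bsub>C\<^esub> bnd_prj C X i j = nd_prj C (diag X) (i + j) \<bullet>\<^bsub>C\<^esub> shuffle_sum i j"
  unfolding Ez_comp_def
  by (rule bnd_descend[OF cmp_hom[OF shuffle_sum_hom diag_nd_prj_hom]]; rule shuffle_sum_degenerate; (assumption | linarith))+

text \<open>The asserted description of the chain map, built from shuffles alone without reference
  to \<gamma>; \<open>Ez_chain_eq\<close> identifies it with the chain map of \<EE>\<zz>.\<close>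

definition Ez_total :: "nat \<Rightarrow> 'm" where
  "Ez_total n = from_dsum C (bidegrees n) bnds (nd C (diag X) n) (\<lambda>(i, j). Ez_comp i j)"

lemma Ez_comp_bidegrees: "p \<in> bidegrees n \<Longrightarrow> (case p of (i, j) \<Rightarrow> Ez_comp i j) \<in> Homs C (bnds p) (nd C (diag X) n)"
  using Ez_comp(1) by (auto simp: bidegrees_def)

lemma Ez_total_hom: "Ez_total n \<in> Homs C (dsum C (bidegrees n) bnds) (nd C (diag X) n)"
  unfolding Ez_total_def by (rule from_dsum_hom[OF finite_bidegrees bnds_obj diag.nd_obj Ez_comp_bidegrees])

lemma Ez_total_inj: "i + j = n \<Longrightarrow> Ez_total n \<bullet>\<^bsub>C\<^esub> dsum_inj C (bidegrees n) bnds (i, j) = Ez_comp i j"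
proof -
  assume "i + j = n"
  then have "(i, j) \<in> bidegrees n" by (simp add: bidegrees_def)
  from from_dsum_inj[OF finite_bidegrees bnds_obj diag.nd_obj Ez_comp_bidegrees this]
  show ?thesis unfolding Ez_total_def by simp
qed

lemma Ez_total_square: "Ez_total n \<bullet>\<^bsub>C\<^esub> bidegree_prj C X n = nd_prj C (diag X) n \<bullet>\<^bsub>C\<^esub> Ez_top C X n"
proof -
  let ?f = "\<lambda>(i, j). finsum (hom_group C (bob X i j) (bob X n n))
          (\<lambda>(\<sigma>, \<tau>). [shuffle_sgn n \<sigma> \<tau>] \<cdot>\<^bsub>hom_group C (bob X i j) (bob X n n)\<^esub> bact X n i \<sigma> n j \<tau>)
          (shuffles_of i j)"
  have feq: "?f (i, j) = shuffle_sum i j" if "i + j = n" for i j using that by (auto simp: shuffle_sum_def)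
  have f: "?f p \<in> Homs C (bobs p) (bob X n n)" if pn: "p \<in> bidegrees n" for p
  proof -
    obtain i j where p: "p = (i, j)" "i + j = n" using pn by (auto simp: bidegrees_def)
    show ?thesis unfolding p(1) feq[OF p(2)] using shuffle_sum_hom[of i j] p(2) by simp
  qed
  have top: "Ez_top C X n \<in> Homs C (dsum C (bidegrees n) bobs) (bob X n n)"
    unfolding Ez_top_def by (rule from_dsum_hom[OF finite_bidegrees bobs_obj bob_obj f])
  show ?thesis
  proof (rule dsum_eqI_inj[OF finite_bidegrees bobs_obj cmp_hom[OF bidegree_prj(1) Ez_total_hom] cmp_hom[OF top diag_nd_prj_hom]])
    fix p assume p: "p \<in> bidegrees n"
    then obtain i j where ij: "p = (i, j)" "i + j = n" by (auto simp: bidegrees_def)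
    note inj = bobs_inj_hom[OF ij(2)]
    have "Ez_top C X n \<bullet>\<^bsub>C\<^esub> dsum_inj C (bidegrees n) bobs (i, j) = shuffle_sum i j"
      unfolding Ez_top_def using from_dsum_inj[OF finite_bidegrees bobs_obj bob_obj f p] feq[OF ij(2)] ij(1) by simp
    then have r: "(nd_prj C (diag X) n \<bullet>\<^bsub>C\<^esub> Ez_top C X n) \<bullet>\<^bsub>C\<^esub> dsum_inj C (bidegrees n) bobs (i, j) = nd_prj C (diag X) n \<bullet>\<^bsub>C\<^esub> shuffle_sum i j"
      using cmp_assoc[OF inj top diag_nd_prj_hom] by simp
    have "(Ez_total n \<bullet>\<^bsub>C\<^esub> bidegree_prj C X n) \<bullet>\<^bsub>C\<^esub> dsum_inj C (bidegrees n) bobs (i, j) = Ez_comp i j \<bullet>\<^bsub>C\<^esub> bnd_prj C X i j"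
      using cmp_assoc[OF inj bidegree_prj(1) Ez_total_hom] bidegree_prj(3)[OF ij(2)]
        cmp_assoc[OF bnd_prj_hom bnds_inj_hom[OF ij(2)] Ez_total_hom] Ez_total_inj[OF ij(2)] by simp
    then show "(Ez_total n \<bullet>\<^bsub>C\<^esub> bidegree_prj C X n) \<bullet>\<^bsub>C\<^esub> dsum_inj C (bidegrees n) bobs p =
        (nd_prj C (diag X) n \<bullet>\<^bsub>C\<^esub> Ez_top C X n) \<bullet>\<^bsub>C\<^esub> dsum_inj C (bidegrees n) bobs p"
      using r Ez_comp(2)[of i j] ij by simp
  qed
qed

section \<open>The degeneracies that survive in the diagonal\<close>

lemma shuffle_map_parts:
  assumes "(\<sigma>, \<tau>) \<in> shuffles_of i j"
  shows "left_part (i + j) (shuffle_map i j \<sigma> \<tau>) = \<sigma>" "right_part (i + j) (i + j) i (shuffle_map i j \<sigma> \<tau>) = \<tau>"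
    "shuffle_map i j \<sigma> \<tau> (i + j) = i" "shuffle_map i j \<sigma> \<tau> (i + j + 1) = i"
proof -
  note s = shufflesD[OF assms]
  note d = Delta_surjD(1)[OF s(1)] Delta_surjD(1)[OF s(2)]
  let ?\<eta> = "shuffle_map i j \<sigma> \<tau>"
  note \<eta> = Delta_surjD(1)[OF shuffle_map_surj[OF assms]]
  show last: "?\<eta> (i + j) = i" using Delta_surj_last[OF s(1)] by (simp add: shuffle_map_def)
  show "?\<eta> (i + j + 1) = i" using Delta_surj_0[OF s(2)] by (simp add: shuffle_map_def)
  show "left_part (i + j) ?\<eta> = \<sigma>"
    by (rule Delta_eqI[OF left_part_Delta[OF \<eta> order_refl] d(1)]) (simp add: left_part_def shuffle_map_def)
  show "right_part (i + j) (i + j) i ?\<eta> = \<tau>"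
    by (rule Delta_eqI[OF right_part_Delta[OF \<eta>, of i j] d(2)]) (simp_all add: right_part_def shuffle_map_def)
qed

lemma shuffle_map_inj:
  "inj_on (\<lambda>(\<sigma>, \<tau>). shuffle_map i j \<sigma> \<tau>) (shuffles_of i j)"
  by (rule inj_on_inverseI[where g = "\<lambda>\<eta>. (left_part (i + j) \<eta>, right_part (i + j) (i + j) i \<eta>)"])
     (auto simp: shuffle_map_parts)

text \<open>Cut \<eta> at a = \<eta> n. If the halves had no common collapsed interval, their sum
  would grow by at least 1 at each of n steps, while it is bounded by a + c = n. So the right half
  starts at 0, which means \<eta> (n + 1) = a. Both halves are then onto, and \<eta> is the map of
  the shuffle that they form.\<close>

lemma nonshuffle_degenerate:
  assumes \<eta>: "\<eta> \<in> Delta_surj (n + n + 1) n"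
    and ns: "\<And>i j \<sigma> \<tau>. i + j = n \<Longrightarrow> (\<sigma>, \<tau>) \<in> shuffles_of i j \<Longrightarrow> \<eta> \<noteq> shuffle_map i j \<sigma> \<tau>"
  shows "(nd_prj C (diag X) n \<bullet>\<^bsub>C\<^esub> \<epsilon> n n) \<bullet>\<^bsub>C\<^esub> sact D (n + n + 1) n \<eta> = Zer C (sob D n) (nd C (diag X) n)"
proof -
  define a where "a = \<eta> n"
  define c where "c = n - a"
  note d = Delta_surjD(1)[OF \<eta>]
  have "a \<le> n" using Delta_le[OF d, of n] by (simp add: a_def)
  then have ac: "a + c = n" by (simp add: c_def)
  have d': "\<eta> \<in> Delta (n + n + 1) (a + c)" using d ac by simp
  have le: "\<eta> n \<le> a" "a \<le> \<eta> (n + 1)" using Delta_mono[OF d, of n "n + 1"] by (simp_all add: a_def)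
  let ?l = "left_part n \<eta>" and ?r = "right_part n n a \<eta>"
  have l: "?l \<in> Delta n a" by (rule left_part_Delta[OF d' le(1)])
  have r: "?r \<in> Delta n c" by (rule right_part_Delta[OF d' order_refl])
  have adj: "\<exists>x<n. ?l x = ?l (Suc x) \<and> ?r x = ?r (Suc x)"
  proof (rule ccontr)
    assume na: "\<not> ?thesis"
    then have grow: "?l x + ?r x + (y - x) \<le> ?l y + ?r y" if "x \<le> y" "y \<le> n" for x y
      using joint_adjacent_or[OF l r] that by blast
    have "?l n = a" by (simp add: left_part_def a_def)
    then have "?r 0 = 0" using grow[of 0 n] Delta_le[OF r, of n] ac by simp
    then have \<eta>1: "\<eta> (n + 1) = a" using le(2) by (simp add: right_part_def)
    have inj: "inj_on (\<lambda>k. (?l k, ?r k)) {..n}"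
    proof (rule linorder_inj_onI)
      fix x y assume xy: "x < y" "x \<in> {..n}" "y \<in> {..n}"
      show "(?l x, ?r x) \<noteq> (?l y, ?r y)"
        using not_inj_adjacent[OF l r, of x y] na xy by auto
    qed auto
    have ls: "?l \<in> Delta_surj n a"
    proof -
      have "y \<in> ?l ` {..n}" if "y \<le> a" for y
      proof (rule image_eqI)
        have y: "y \<le> n" using that ac by simp
        \<comment> \<open>Values up to a are first taken in the first copy of [n], since \<eta> n =
          a.\<close>
        have "first_at \<eta> y \<le> n" using first_at(3)[OF \<eta> y, of n] that by (simp add: a_def)
        then show "first_at \<eta> y \<in> {..n}" "y = ?l (first_at \<eta> y)"
          using first_at(2)[OF \<eta> y] by (auto simp: left_part_def)
      qed
      then show ?thesis using l by (auto simp: Delta_surj_def Delta_iff)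
    qed
    have rs: "?r \<in> Delta_surj n c"
    proof -
      have "y \<in> ?r ` {..n}" if "y \<le> c" for y
      proof (cases "y = 0")
        case True
        then show ?thesis using \<open>?r 0 = 0\<close> by (metis atMost_iff image_eqI le0)
      next
        case False
        have y: "a + y \<le> n" using that ac by simp
        have "\<not> first_at \<eta> (a + y) \<le> n" using first_at(3)[OF \<eta> y, of n] False by (simp add: a_def)
        then obtain x where x: "first_at \<eta> (a + y) = n + 1 + x" by (metis Suc_eq_plus1 less_eq_Suc_le not_le le_Suc_ex)
        then have "x \<le> n" "\<eta> (n + 1 + x) = a + y" using first_at(1,2)[OF \<eta> y] by auto
        then show ?thesis by (intro image_eqI[of _ _ x]) (auto simp: right_part_def)
      qed
      then show ?thesis using r by (auto simp: Delta_surj_def Delta_iff)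
    qed
    have sh: "(?l, ?r) \<in> shuffles_of a c" using ls rs inj ac by (simp add: shuffles_of_def)
    have "\<eta> = shuffle_map a c ?l ?r"
    proof (rule Delta_eqI[OF d'])
      show "shuffle_map a c ?l ?r \<in> Delta (n + n + 1) (a + c)"
        using Delta_surjD(1)[OF shuffle_map_surj[OF sh]] unfolding ac .
      fix x assume x: "x \<le> n + n + 1"
      show "\<eta> x = shuffle_map a c ?l ?r x"
      proof (cases "x \<le> n")
        case True
        then show ?thesis using ac by (simp add: shuffle_map_def left_part_def)
      next
        case False
        then obtain y where y: "x = n + 1 + y" by (metis Suc_eq_plus1 less_eq_Suc_le not_le le_Suc_ex)
        have "a \<le> \<eta> x" using Delta_mono[OF d, of "n + 1" x] \<eta>1 x y by simp
        then show ?thesis using ac x y by (simp add: shuffle_map_def right_part_def)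
      qed
    qed
    then show False using ns[OF ac sh] by blast
  qed
  have c: "comp a c \<in> Homs C (sob D n) (bob X a c)" using comp_hom[of a c] ac by simp
  have "\<epsilon> n n \<bullet>\<^bsub>C\<^esub> sact D (n + n + 1) n \<eta> = bact X n a ?l n c ?r \<bullet>\<^bsub>C\<^esub> comp a c"
    using eps_factor_s_can[OF d' le] ac by simp
  then show ?thesis
    using cmp_assoc[OF D.act_hom[OF d] eps_hom diag_nd_prj_hom] cmp_assoc[OF c bact_hom[OF l r] diag_nd_prj_hom]
      diag_degenerate[OF l r adj] cmp_zero_left[OF c diag.nd_obj] by simp
qed

text \<open>The halves of f land in [a] and [c] with a + c = q < n, which is too small for a pair
  without a common collapse. This is the hypothesis under which \<open>gamma_mod_skeleton\<close>
  replaces \<gamma> by \<open>fold_sum\<close>.\<close>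

lemma eps_kills_skeleton:
  assumes f: "f \<in> Delta (n + n + 1) q" and q: "q < n"
  shows "(nd_prj C (diag X) n \<bullet>\<^bsub>C\<^esub> \<epsilon> n n) \<bullet>\<^bsub>C\<^esub> sact D (n + n + 1) q f = Zer C (sob D q) (nd C (diag X) n)"
proof -
  define a where "a = f n"
  define c where "c = q - a"
  have "a \<le> q" using Delta_le[OF f, of n] by (simp add: a_def)
  then have ac: "a + c = q" by (simp add: c_def)
  have f': "f \<in> Delta (n + n + 1) (a + c)" using f ac by simp
  have le: "f n \<le> a" "a \<le> f (n + 1)" using Delta_mono[OF f, of n "n + 1"] by (simp_all add: a_def)
  have l: "left_part n f \<in> Delta n a" by (rule left_part_Delta[OF f' le(1)])
  have r: "right_part n n a f \<in> Delta n c" by (rule right_part_Delta[OF f' order_refl])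
  have c: "comp a c \<in> Homs C (sob D q) (bob X a c)" using comp_hom[of a c] ac by simp
  have "a + c < n" using ac q by simp
  from diag_degenerate[OF l r joint_adjacent[OF l r this]] show ?thesis
    using eps_factor_s_can[OF f' le] ac cmp_assoc[OF D.act_hom[OF f] eps_hom diag_nd_prj_hom]
      cmp_assoc[OF c bact_hom[OF l r] diag_nd_prj_hom] cmp_zero_left[OF c diag.nd_obj] by simp
qed

text \<open>In the combination of degeneracies that replaces \<gamma>, only shuffle maps survive,
  and the coefficient of a shuffle map is the sign of the shuffle. Grouped by bidegree, (i, j)
  contributes the signed shuffle sum applied to the component of D at (i, j).\<close>

lemma Ez_total_ident:
  "Ez_total n \<bullet>\<^bsub>C\<^esub> total_ident C X D \<epsilon> n \<bullet>\<^bsub>C\<^esub> nd_prj C D n = nd_prj C (diag X) n \<bullet>\<^bsub>C\<^esub> Ez C D \<epsilon> n"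
proof -
  let ?N = "n + n + 1" and ?p = "nd_prj C (diag X) n" and ?b = "nd C (diag X) n"
  let ?H = "H (sob D n) ?b" and ?h = "?p \<bullet>\<^bsub>C\<^esub> \<epsilon> n n"
  note p = diag_nd_prj_hom[of n] and e = total_ident(1)[of n] and ob = D.sob_obj[of n] diag.nd_obj[of n]
  interpret G: abelian_group ?H by (rule hom_abelian_group[OF ob])
  have h: "?h \<in> Homs C (sob D ?N) ?b" by (rule cmp_hom[OF eps_hom p])
  let ?F = "\<lambda>\<eta>. [(fold_coeff n \<eta>)] \<cdot>\<^bsub>?H\<^esub> (?h \<bullet>\<^bsub>C\<^esub> sact D ?N n \<eta>)"
  have F: "?F \<eta> \<in> Homs C (sob D n) ?b" if "\<eta> \<in> Delta_surj ?N n" for \<eta>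
    by (rule scal_hom[OF cmp_hom[OF D.act_hom[OF Delta_surjD(1)[OF that]] h]])
  \<comment> \<open>The shuffle maps of one bidegree. Different bidegrees give disjoint sets,
    because such a map takes the value i at n.\<close>
  define S where "S = (\<lambda>(i, j). (\<lambda>(\<sigma>, \<tau>). shuffle_map i j \<sigma> \<tau>) ` shuffles_of i j)"
  have S: "S (i, j) \<subseteq> Delta_surj ?N n" if "i + j = n" for i j
    using shuffle_map_surj that unfolding S_def by fastforce
  have Sval: "\<eta> n = i" if "i + j = n" "\<eta> \<in> S (i, j)" for i j \<eta>
    using that shuffle_map_parts(3) unfolding S_def by fastforce
  have "?p \<bullet>\<^bsub>C\<^esub> Ez C D \<epsilon> n = ?h \<bullet>\<^bsub>C\<^esub> Ez_gamma C D n"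
    unfolding Ez_def by (rule cmp_assoc[OF D.gamma_hom eps_hom p, symmetric])
  also have "\<dots> = ?h \<bullet>\<^bsub>C\<^esub> D.fold_sum n"
    by (rule D.gamma_mod_skeleton[OF h]) (rule eps_kills_skeleton)
  also have "\<dots> = finsum ?H ?F (Delta_surj ?N n)" by (rule D.cmp_fold_sum[OF h])
  also have "\<dots> = finsum ?H ?F (\<Union>(S ` bidegrees n))"
  proof (rule G.add.finprod_mono_neutral_cong_left[symmetric])
    show "finite (Delta_surj ?N n)" by (rule D.finite_Delta_surj)
    show "\<Union>(S ` bidegrees n) \<subseteq> Delta_surj ?N n" using S by (auto simp: bidegrees_def)
    fix \<eta> assume \<eta>: "\<eta> \<in> Delta_surj ?N n - \<Union>(S ` bidegrees n)"
    have "?h \<bullet>\<^bsub>C\<^esub> sact D ?N n \<eta> = Zer C (sob D n) ?b"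
      by (rule nonshuffle_degenerate) (use \<eta> in \<open>force simp: S_def bidegrees_def\<close>)+
    then show "?F \<eta> = \<zero>\<^bsub>?H\<^esub>" using scal_zero[OF ob] by simp
  qed (use F in auto)
  also have "\<dots> = finsum ?H (\<lambda>p. finsum ?H ?F (S p)) (bidegrees n)"
  proof (rule G.add.finprod_UN_disjoint[OF finite_bidegrees])
    show "finite (S p)" if "p \<in> bidegrees n" for p
      using that finite_shuffles by (cases p) (auto simp: S_def)
    show "pairwise (\<lambda>p q. disjnt (S p) (S q)) (bidegrees n)"
    proof (rule pairwiseI)
      fix p q assume pq: "p \<in> bidegrees n" "q \<in> bidegrees n" "p \<noteq> q"
      obtain i j where p: "p = (i, j)" "i + j = n" using pq(1) by (auto simp: bidegrees_def)
      obtain k l where q: "q = (k, l)" "k + l = n" using pq(2) by (auto simp: bidegrees_def)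
      have "i \<noteq> k" using p q pq(3) by auto
      then show "disjnt (S p) (S q)" using Sval[OF p(2)] Sval[OF q(2)] unfolding p(1) q(1) disjnt_iff by metis
    qed
    show "?F \<eta> \<in> carrier ?H" if "p \<in> bidegrees n" "\<eta> \<in> S p" for p \<eta>
      using that S F by (auto simp: bidegrees_def)
  qed
  also have "\<dots> = finsum ?H (\<lambda>q. (case q of (i, j) \<Rightarrow> Ez_comp i j) \<bullet>\<^bsub>C\<^esub> (dsum_prj C (bidegrees n) bnds q \<bullet>\<^bsub>C\<^esub> total_ident C X D \<epsilon> n \<bullet>\<^bsub>C\<^esub> nd_prj C D n)) (bidegrees n)"
  proof (rule finsum_eqI[OF ob])
    fix q assume "q \<in> bidegrees n"
    then obtain i j where q: "q = (i, j)" "i + j = n" by (auto simp: bidegrees_def)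
    have c: "comp i j \<in> Homs C (sob D n) (bob X i j)" using comp_hom[of i j] q by simp
    have pS: "?p \<in> Homs C (bob X (i + j) (i + j)) ?b" using p q by simp
    have "Ez_comp i j \<bullet>\<^bsub>C\<^esub> bnd_prj C X i j \<bullet>\<^bsub>C\<^esub> comp i j = ?p \<bullet>\<^bsub>C\<^esub> shuffle_sum i j \<bullet>\<^bsub>C\<^esub> comp i j"
      using cmp_assoc[OF c bnd_prj_hom Ez_comp(1)] Ez_comp(2)[of i j] cmp_assoc[OF c shuffle_sum_hom pS] q by simp
    also have "\<dots> = finsum ?H (\<lambda>(\<sigma>, \<tau>). [(shuffle_sgn (i + j) \<sigma> \<tau>)] \<cdot>\<^bsub>?H\<^esub>
        (?p \<bullet>\<^bsub>C\<^esub> bact X (i + j) i \<sigma> (i + j) j \<tau> \<bullet>\<^bsub>C\<^esub> comp i j)) (shuffles_of i j)"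
      by (rule finsum_shuffle_sum[OF pS c])
    also have "\<dots> = finsum ?H (\<lambda>s. ?F ((\<lambda>(\<sigma>, \<tau>). shuffle_map i j \<sigma> \<tau>) s)) (shuffles_of i j)"
    proof (rule finsum_eqI[OF ob])
      fix s assume s: "s \<in> shuffles_of i j"
      obtain \<sigma> \<tau> where st: "s = (\<sigma>, \<tau>)" by (cases s)
      have s': "(\<sigma>, \<tau>) \<in> shuffles_of i j" using s st by simp
      let ?\<eta> = "shuffle_map i j \<sigma> \<tau>"
      note \<eta> = Delta_surjD(1)[OF shuffle_map_surj[OF s']]
      note parts = shuffle_map_parts[OF s']
      have b: "bact X (i + j) i \<sigma> (i + j) j \<tau> \<in> Homs C (bob X i j) (bob X (i + j) (i + j))"
        using shuffle_bact_hom[OF s'] by simp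
      have "\<epsilon> (i + j) (i + j) \<bullet>\<^bsub>C\<^esub> sact D (i + j + (i + j) + 1) (i + j) ?\<eta> = bact X (i + j) i \<sigma> (i + j) j \<tau> \<bullet>\<^bsub>C\<^esub> comp i j"
        using eps_factor_s_can[OF \<eta>] parts by simp
      then have "\<epsilon> n n \<bullet>\<^bsub>C\<^esub> sact D ?N n ?\<eta> = bact X n i \<sigma> n j \<tau> \<bullet>\<^bsub>C\<^esub> comp i j" unfolding q(2) .
      then have "?h \<bullet>\<^bsub>C\<^esub> sact D ?N n ?\<eta> = ?p \<bullet>\<^bsub>C\<^esub> bact X n i \<sigma> n j \<tau> \<bullet>\<^bsub>C\<^esub> comp i j"
        using cmp_assoc[OF D.act_hom[OF \<eta>[unfolded q(2)]] eps_hom p] by simp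
      then show "(case s of (\<sigma>, \<tau>) \<Rightarrow> [(shuffle_sgn (i + j) \<sigma> \<tau>)] \<cdot>\<^bsub>?H\<^esub>
        (?p \<bullet>\<^bsub>C\<^esub> bact X (i + j) i \<sigma> (i + j) j \<tau> \<bullet>\<^bsub>C\<^esub> comp i j)) = ?F ((\<lambda>(\<sigma>, \<tau>). shuffle_map i j \<sigma> \<tau>) s)"
        using fold_coeff_shuffle[OF s'] q(2) st by simp
      show "?F ((\<lambda>(\<sigma>, \<tau>). shuffle_map i j \<sigma> \<tau>) s) \<in> Homs C (sob D n) ?b"
        using F shuffle_map_surj[OF s'] q(2) st by simp
    qed
    also have "\<dots> = finsum ?H ?F (S q)"
      unfolding S_def q(1) prod.case
      by (rule G.add.finprod_reindex[symmetric, OF _ shuffle_map_inj])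
         (use F S[OF q(2)] in \<open>auto simp: S_def\<close>)
    finally show "finsum ?H ?F (S q) = (case q of (i, j) \<Rightarrow> Ez_comp i j) \<bullet>\<^bsub>C\<^esub>
        (dsum_prj C (bidegrees n) bnds q \<bullet>\<^bsub>C\<^esub> total_ident C X D \<epsilon> n \<bullet>\<^bsub>C\<^esub> nd_prj C D n)"
      using total_ident(2)[OF q(2)] q(1) by simp
    have "Ez_comp i j \<in> Homs C (bnd C X i j) ?b" using Ez_comp(1)[of i j] q(2) by simp
    from cmp_hom[OF cmp_hom[OF c bnd_prj_hom] this]
    show "(case q of (i, j) \<Rightarrow> Ez_comp i j) \<bullet>\<^bsub>C\<^esub>
        (dsum_prj C (bidegrees n) bnds q \<bullet>\<^bsub>C\<^esub> total_ident C X D \<epsilon> n \<bullet>\<^bsub>C\<^esub> nd_prj C D n) \<in> Homs C (sob D n) ?b"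
      using total_ident(2)[OF q(2)] q(1) by simp
  qed
  also have "\<dots> = Ez_total n \<bullet>\<^bsub>C\<^esub> total_ident C X D \<epsilon> n \<bullet>\<^bsub>C\<^esub> nd_prj C D n"
  proof -
    let ?t = "total_ident C X D \<epsilon> n \<bullet>\<^bsub>C\<^esub> nd_prj C D n"
    have t: "?t \<in> Homs C (sob D n) (dsum C (bidegrees n) bnds)" by (rule cmp_hom[OF D.nd_prj_hom e])
    have pt: "dsum_prj C (bidegrees n) bnds q \<bullet>\<^bsub>C\<^esub> ?t \<in> Homs C (sob D n) (bnds q)" if "q \<in> bidegrees n" for q
      by (rule cmp_hom[OF t dsum_prj_hom[OF finite_bidegrees bnds_obj that]])
    have "Ez_total n \<bullet>\<^bsub>C\<^esub> ?t = Ez_total n \<bullet>\<^bsub>C\<^esub> into_dsum C (bidegrees n) bnds (sob D n) (\<lambda>q. dsum_prj C (bidegrees n) bnds q \<bullet>\<^bsub>C\<^esub> ?t)"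
      using into_dsum_prj[OF finite_bidegrees bnds_obj t] by simp
    also have "\<dots> = finsum ?H (\<lambda>q. (case q of (i, j) \<Rightarrow> Ez_comp i j) \<bullet>\<^bsub>C\<^esub> (dsum_prj C (bidegrees n) bnds q \<bullet>\<^bsub>C\<^esub> ?t)) (bidegrees n)"
      unfolding Ez_total_def
      by (rule from_dsum_into_dsum[OF finite_bidegrees bnds_obj diag.nd_obj Ez_comp_bidegrees D.sob_obj pt])
    finally show ?thesis by simp
  qed
  finally show ?thesis ..
qed

text \<open>By uniqueness of descent, the map of quotients induced by \<EE>\<zz> is the shuffle map
  after \<open>total_ident\<close>; the inverse in the definition of \<open>Ez_chain\<close> cancels
  the second factor.\<close>

lemma Ez_chain_eq: "Ez_chain C X D \<epsilon> n = Ez_total n"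
proof -
  let ?e = "total_ident C X D \<epsilon> n"
  note e = total_ident(1)[of n]
  have "nd_map C D (diag X) (Ez C D \<epsilon>) n = Ez_total n \<bullet>\<^bsub>C\<^esub> ?e"
    unfolding nd_map_def
    by (rule D.descend_eqI[OF cmp_hom[OF e Ez_total_hom]])
       (use cmp_assoc[OF D.nd_prj_hom e Ez_total_hom] Ez_total_ident in simp)
  then show ?thesis
    unfolding Ez_chain_def
    using cmp_assoc[OF total_iso(1) e Ez_total_hom] total_iso(2) cmp_ide[OF Ez_total_hom] by simp
qed

end

section \<open>The smallest filtration steps\<close>

context bisimplicial_obj
begin

context
  fixes i j F u
  assumes step: "is_skeletal_step C X i j F u"
begin

interpretation F: bisimplicial_obj C F
  by unfold_locales (use step in \<open>simp add: is_skeletal_step_def\<close>)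

lemma step_mor:
  shows step_mor_hom: "u m n \<in> Homs C (bob F m n) (bob X m n)"
    and step_mor_natural: "f \<in> Delta m k \<Longrightarrow> g \<in> Delta n l \<Longrightarrow>
      u m n \<bullet>\<^bsub>C\<^esub> bact F m k f n l g = bact X m k f n l g \<bullet>\<^bsub>C\<^esub> u k l"
  using step unfolding is_skeletal_step_def bisimplicial_mor_def by blast+

lemma step_mor_monic:
  assumes "g \<in> Homs C a (bob F m n)" "h \<in> Homs C a (bob F m n)" "u m n \<bullet>\<^bsub>C\<^esub> g = u m n \<bullet>\<^bsub>C\<^esub> h"
  shows "g = h"
proof -
  have "monic C (u m n)" using step unfolding is_skeletal_step_def is_generated_subobject_def by blast
  moreover have "Dom C (u m n) = bob F m n" using step_mor_hom[of m n] by (simp add: Homs_def)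
  ultimately show ?thesis using assms unfolding monic_def by metis
qed

text \<open>The step is generated by these operators, so they factor through u. Since u is monic,
  the factorization is unique, and \<open>lift_along\<close> denotes it.\<close>

lemma step_lift:
  assumes "k \<le> i" "l \<le> j" and f: "f \<in> Delta m k" and g: "g \<in> Delta n l"
  shows "lift_along C (u m n) (bact X m k f n l g) \<in> Homs C (bob X k l) (bob F m n)"
    "u m n \<bullet>\<^bsub>C\<^esub> lift_along C (u m n) (bact X m k f n l g) = bact X m k f n l g"
proof -
  have d: "Dom C (u m n) = bob F m n" "Dom C (bact X m k f n l g) = bob X k l"
    using step_mor_hom[of m n] bact_hom[OF f g] by (simp_all add: Homs_def)
  have "\<exists>h \<in> Homs C (bob X k l) (bob F m n). u m n \<bullet>\<^bsub>C\<^esub> h = bact X m k f n l g"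
    using step assms unfolding is_skeletal_step_def is_generated_subobject_def d(1)[symmetric] d(2)[symmetric] by blast
  then have "\<exists>!h. h \<in> Homs C (bob X k l) (bob F m n) \<and> u m n \<bullet>\<^bsub>C\<^esub> h = bact X m k f n l g"
    using step_mor_monic by metis
  from theI'[OF this]
  show "lift_along C (u m n) (bact X m k f n l g) \<in> Homs C (bob X k l) (bob F m n)"
    "u m n \<bullet>\<^bsub>C\<^esub> lift_along C (u m n) (bact X m k f n l g) = bact X m k f n l g"
    unfolding lift_along_def d by blast+
qed

text \<open>Degenerate elements have to become degenerate in F, not merely in X. The composite
  operator factors through a common degeneracy s, followed by an operator with values in [k] and
  [l], where k \<le> i and l \<le> j; this second factor lifts to F again. As u is monic, the
  factorization holds in F.\<close>

lemma shuffle_incl: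
  assumes "(\<sigma>, \<tau>) \<in> shuffles_of i j"
  shows "shuffle_incl C X i j F u (\<sigma>, \<tau>) \<in> Homs C (bnd C X i j) (nd C (diag F) (i + j))"
    "shuffle_incl C X i j F u (\<sigma>, \<tau>) \<bullet>\<^bsub>C\<^esub> bnd_prj C X i j =
       nd_prj C (diag F) (i + j) \<bullet>\<^bsub>C\<^esub> lift_along C (u (i + j) (i + j)) (bact X (i + j) i \<sigma> (i + j) j \<tau>)"
proof -
  let ?n = "i + j"
  let ?L = "lift_along C (u ?n ?n) (bact X ?n i \<sigma> ?n j \<tau>)"
  note \<sigma> = Delta_surjD(1)[OF shufflesD(1)[OF assms]] and \<tau> = Delta_surjD(1)[OF shufflesD(2)[OF assms]]
  note L = step_lift[OF order_refl order_refl \<sigma> \<tau>]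
  have p: "nd_prj C (diag F) n \<in> Homs C (bob F n n) (nd C (diag F) n)" for n
    using F.diag.nd_prj_hom[of n] by simp
  have "(nd_prj C (diag F) ?n \<bullet>\<^bsub>C\<^esub> ?L) \<bullet>\<^bsub>C\<^esub> bact X i k f j l g = Zer C (bob X k l) (nd C (diag F) ?n)"
    if f: "f \<in> Delta i k" and g: "g \<in> Delta j l" and lt: "k < i \<or> l < j" and le: "k \<le> i" "l \<le> j" for k l f g
  proof -
    note c = Delta_compose[OF \<sigma> f] Delta_compose[OF \<tau> g] and b = bact_hom[OF f g]
    have "k + l < ?n" using lt le by linarith
    then obtain x where x: "x < ?n" "compose {..?n} f \<sigma> x = compose {..?n} f \<sigma> (Suc x)"
        "compose {..?n} g \<tau> x = compose {..?n} g \<tau> (Suc x)"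
      using joint_adjacent[OF c] by blast
    obtain m s f' g' where s: "s \<in> Delta ?n m" "\<not> inj_on s {..?n}" and fg: "f' \<in> Delta m k" "g' \<in> Delta m l"
      and eq: "compose {..?n} f \<sigma> = compose {..?n} f' s" "compose {..?n} g \<tau> = compose {..?n} g' s"
      by (rule factor_common_codeg[OF c x])
    let ?L' = "lift_along C (u m m) (bact X m k f' m l g')"
    note L' = step_lift[OF le fg] and bs = F.bact_hom[OF s(1) s(1)]
    have "?L \<bullet>\<^bsub>C\<^esub> bact X i k f j l g = bact F ?n m s ?n m s \<bullet>\<^bsub>C\<^esub> ?L'"
    proof (rule step_mor_monic[OF cmp_hom[OF b L(1)] cmp_hom[OF L'(1) bs]])
      have "u ?n ?n \<bullet>\<^bsub>C\<^esub> ?L \<bullet>\<^bsub>C\<^esub> bact X i k f j l g = bact X ?n k (compose {..?n} f \<sigma>) ?n l (compose {..?n} g \<tau>)"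
        using cmp_assoc[OF b L(1) step_mor_hom] L(2) bact_compose[OF \<sigma> f \<tau> g] by simp
      also have "\<dots> = bact X ?n m s ?n m s \<bullet>\<^bsub>C\<^esub> bact X m k f' m l g'"
        unfolding eq by (rule bact_compose[OF s(1) fg(1) s(1) fg(2)])
      also have "\<dots> = u ?n ?n \<bullet>\<^bsub>C\<^esub> bact F ?n m s ?n m s \<bullet>\<^bsub>C\<^esub> ?L'"
        using cmp_assoc[OF L'(1) bs step_mor_hom] step_mor_natural[OF s(1) s(1)]
          cmp_assoc[OF L'(1) step_mor_hom bact_hom[OF s(1) s(1)]] L'(2) by simp
      finally show "u ?n ?n \<bullet>\<^bsub>C\<^esub> ?L \<bullet>\<^bsub>C\<^esub> bact X i k f j l g = u ?n ?n \<bullet>\<^bsub>C\<^esub> bact F ?n m s ?n m s \<bullet>\<^bsub>C\<^esub> ?L'" .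
    qed
    then show ?thesis
      using cmp_assoc[OF b L(1) p] cmp_assoc[OF L'(1) bs p] F.diag.nd_degenerate[OF s]
        cmp_zero_left[OF L'(1) F.diag.nd_obj] by simp
  qed
  from bnd_descend[OF cmp_hom[OF L(1) p] this] show
    "shuffle_incl C X i j F u (\<sigma>, \<tau>) \<in> Homs C (bnd C X i j) (nd C (diag F) ?n)"
    "shuffle_incl C X i j F u (\<sigma>, \<tau>) \<bullet>\<^bsub>C\<^esub> bnd_prj C X i j = nd_prj C (diag F) ?n \<bullet>\<^bsub>C\<^esub> ?L"
    unfolding shuffle_incl_def prod.case by blast+
qed

lemma step_incl:
  "step_incl C X F u n \<in> Homs C (nd C (diag F) n) (nd C (diag X) n)"
  "step_incl C X F u n \<bullet>\<^bsub>C\<^esub> nd_prj C (diag F) n = nd_prj C (diag X) n \<bullet>\<^bsub>C\<^esub> u n n"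
proof -
  have "simplicial_mor C (diag F) (diag X) (\<lambda>m. u m m)"
    unfolding simplicial_mor_def by (auto simp: step_mor_hom step_mor_natural)
  from F.diag.nd_map[OF diag_simplicial this, of n]
  show "step_incl C X F u n \<in> Homs C (nd C (diag F) n) (nd C (diag X) n)"
    "step_incl C X F u n \<bullet>\<^bsub>C\<^esub> nd_prj C (diag F) n = nd_prj C (diag X) n \<bullet>\<^bsub>C\<^esub> u n n"
    unfolding step_incl_def .
qed

text \<open>Inside X the lift is undone, and the summand of a shuffle becomes the shuffle operator
  itself.\<close>

lemma step_incl_shuffle_incl:
  assumes "(\<sigma>, \<tau>) \<in> shuffles_of i j"
  shows "step_incl C X F u (i + j) \<bullet>\<^bsub>C\<^esub> shuffle_incl C X i j F u (\<sigma>, \<tau>) \<bullet>\<^bsub>C\<^esub> bnd_prj C X i j =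
    nd_prj C (diag X) (i + j) \<bullet>\<^bsub>C\<^esub> bact X (i + j) i \<sigma> (i + j) j \<tau>"
proof -
  note L = step_lift[OF order_refl order_refl Delta_surjD(1)[OF shufflesD(1)[OF assms]] Delta_surjD(1)[OF shufflesD(2)[OF assms]]]
  have p: "nd_prj C (diag F) n \<in> Homs C (bob F n n) (nd C (diag F) n)"
    "nd_prj C (diag X) n \<in> Homs C (bob X n n) (nd C (diag X) n)" for n
    using F.diag.nd_prj_hom[of n] diag.nd_prj_hom[of n] by simp_all
  show ?thesis
    using shuffle_incl(2)[OF assms] cmp_assoc[OF L(1) p(1) step_incl(1)] step_incl(2)[of "i + j"]
      cmp_assoc[OF L(1) step_mor_hom p(2)] L(2) by simp
qed

lemma step_nd_obj: "nd C (diag F) n \<in> Obj C"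
  by (rule F.diag.nd_obj)

end

end

section \<open>The two maps on the smallest filtration steps\<close>

context dec_adjoint
begin

text \<open>The projection onto \<open>bnd C X i j\<close> is epic, so the claim may be tested on
  \<open>bob X i j\<close>, where it is \<open>Aw_chain_shuffle\<close>.\<close>

lemma Aw_chain_step:
  assumes step: "is_skeletal_step C X i j F u" and st: "(\<sigma>, \<tau>) \<in> shuffles_of i j"
    and ne: "\<not> (\<sigma> = s_left i j \<and> \<tau> = s_right i j)"
  shows "Aw_chain C X D \<epsilon> (i + j) \<bullet>\<^bsub>C\<^esub> step_incl C X F u (i + j) \<bullet>\<^bsub>C\<^esub> shuffle_incl C X i j F u (\<sigma>, \<tau>) =
    Zer C (bnd C X i j) (dsum C (bidegrees (i + j)) bnds)"
proof -
  note s = shuffle_incl(1)[OF step st] and t = step_incl(1)[OF step, of "i + j"]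
  show ?thesis
  proof (rule bnd_epic[OF cmp_hom[OF cmp_hom[OF s t] Aw_chain_hom] Zer_hom[OF bnd_obj bnds_dsum_obj]])
    show "(Aw_chain C X D \<epsilon> (i + j) \<bullet>\<^bsub>C\<^esub> step_incl C X F u (i + j) \<bullet>\<^bsub>C\<^esub> shuffle_incl C X i j F u (\<sigma>, \<tau>)) \<bullet>\<^bsub>C\<^esub> bnd_prj C X i j =
      Zer C (bnd C X i j) (dsum C (bidegrees (i + j)) bnds) \<bullet>\<^bsub>C\<^esub> bnd_prj C X i j"
      using cmp_assoc[OF bnd_prj_hom cmp_hom[OF s t] Aw_chain_hom] cmp_assoc[OF bnd_prj_hom s t]
        step_incl_shuffle_incl[OF step st] Aw_chain_shuffle[OF st ne] cmp_zero_left[OF bnd_prj_hom bnds_dsum_obj] by simp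
  qed
qed

text \<open>Composing \<open>step_ident\<close> with the family of signs gives the sum of the
  summand inclusions weighted by these signs. After the epic projection from
  \<open>bob X i j\<close>, both sides become the signed shuffle sum.\<close>

lemma Ez_chain_step:
  assumes step: "is_skeletal_step C X i j F u"
  defines "e \<equiv> step_ident C X i j F u \<bullet>\<^bsub>C\<^esub>
    into_dsum C (shuffles_of i j) (\<lambda>_. bnd C X i j) (bnd C X i j)
      (\<lambda>(\<sigma>, \<tau>). [(shuffle_sgn (i + j) \<sigma> \<tau>)] \<cdot>\<^bsub>H (bnd C X i j) (bnd C X i j)\<^esub> Ide C (bnd C X i j))"
  shows "e \<in> Homs C (bnd C X i j) (nd C (diag F) (i + j))"
    "Ez_chain C X D \<epsilon> (i + j) \<bullet>\<^bsub>C\<^esub> dsum_inj C (bidegrees (i + j)) bnds (i, j) = step_incl C X F u (i + j) \<bullet>\<^bsub>C\<^esub> e"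
proof -
  let ?n = "i + j" and ?b = "bnd C X i j" and ?S = "shuffles_of i j"
  let ?d = "nd C (diag F) ?n"
  let ?g = "\<lambda>(\<sigma>, \<tau>). [(shuffle_sgn ?n \<sigma> \<tau>)] \<cdot>\<^bsub>H ?b ?b\<^esub> Ide C ?b"
  let ?s = "shuffle_incl C X i j F u"
  have s: "?s p \<in> Homs C ?b ?d" if "p \<in> ?S" for p using shuffle_incl(1)[OF step] that by (cases p) auto
  have g: "?g p \<in> Homs C ?b ?b" for p using scal_hom[OF ide_hom[OF bnd_obj]] by (cases p) auto
  note d = step_nd_obj[OF step, of ?n] and t = step_incl(1)[OF step, of ?n]
  have e: "e = finsum (H ?b ?d) (\<lambda>p. ?s p \<bullet>\<^bsub>C\<^esub> ?g p) ?S"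
    unfolding e_def step_ident_def
    by (rule from_dsum_into_dsum[OF finite_shuffles bnd_obj d s bnd_obj g])
  have sg: "?s p \<bullet>\<^bsub>C\<^esub> ?g p \<in> Homs C ?b ?d" if "p \<in> ?S" for p by (rule cmp_hom[OF g s[OF that]])
  show eh: "e \<in> Homs C ?b ?d" unfolding e by (rule finsum_hom[OF bnd_obj d sg])
  have E: "Ez_comp i j = step_incl C X F u ?n \<bullet>\<^bsub>C\<^esub> e"
  proof (rule bnd_epic[OF Ez_comp(1) cmp_hom[OF eh t]])
    let ?K = "H (bob X i j) (nd C (diag X) ?n)"
    have sgb: "(?s p \<bullet>\<^bsub>C\<^esub> ?g p) \<bullet>\<^bsub>C\<^esub> bnd_prj C X i j \<in> Homs C (bob X i j) ?d" if "p \<in> ?S" for p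
      by (rule cmp_hom[OF bnd_prj_hom sg[OF that]])
    have "(step_incl C X F u ?n \<bullet>\<^bsub>C\<^esub> e) \<bullet>\<^bsub>C\<^esub> bnd_prj C X i j = step_incl C X F u ?n \<bullet>\<^bsub>C\<^esub> e \<bullet>\<^bsub>C\<^esub> bnd_prj C X i j"
      by (rule cmp_assoc[OF bnd_prj_hom eh t])
    also have "e \<bullet>\<^bsub>C\<^esub> bnd_prj C X i j = finsum (H (bob X i j) ?d) (\<lambda>p. (?s p \<bullet>\<^bsub>C\<^esub> ?g p) \<bullet>\<^bsub>C\<^esub> bnd_prj C X i j) ?S"
      unfolding e by (rule cmp_finsum_left[OF bnd_prj_hom d sg])
    also have "step_incl C X F u ?n \<bullet>\<^bsub>C\<^esub> \<dots> = finsum ?K (\<lambda>p. step_incl C X F u ?n \<bullet>\<^bsub>C\<^esub> (?s p \<bullet>\<^bsub>C\<^esub> ?g p) \<bullet>\<^bsub>C\<^esub> bnd_prj C X i j) ?S"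
      by (rule cmp_finsum_right[OF t bob_obj sgb])
    also have "\<dots> = finsum ?K (\<lambda>(\<sigma>, \<tau>). [(shuffle_sgn ?n \<sigma> \<tau>)] \<cdot>\<^bsub>?K\<^esub> (nd_prj C (diag X) ?n \<bullet>\<^bsub>C\<^esub> bact X ?n i \<sigma> ?n j \<tau>)) ?S"
    proof (rule finsum_eqI[OF bob_obj diag.nd_obj])
      fix p assume p: "p \<in> ?S"
      obtain \<sigma> \<tau> where st: "p = (\<sigma>, \<tau>)" by (cases p)
      have sb: "?s (\<sigma>, \<tau>) \<bullet>\<^bsub>C\<^esub> bnd_prj C X i j \<in> Homs C (bob X i j) ?d" using cmp_hom[OF bnd_prj_hom s[OF p]] st by simp
      have "(?s p \<bullet>\<^bsub>C\<^esub> ?g p) \<bullet>\<^bsub>C\<^esub> bnd_prj C X i j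
          = [(shuffle_sgn ?n \<sigma> \<tau>)] \<cdot>\<^bsub>H (bob X i j) ?d\<^esub> (?s (\<sigma>, \<tau>) \<bullet>\<^bsub>C\<^esub> bnd_prj C X i j)"
        using cmp_scal_right[OF ide_hom[OF bnd_obj] s[OF p]] cmp_ide[OF s[OF p]] cmp_scal_left[OF bnd_prj_hom s[OF p]] st by simp
      then show "step_incl C X F u ?n \<bullet>\<^bsub>C\<^esub> (?s p \<bullet>\<^bsub>C\<^esub> ?g p) \<bullet>\<^bsub>C\<^esub> bnd_prj C X i j
          = (case p of (\<sigma>, \<tau>) \<Rightarrow> [(shuffle_sgn ?n \<sigma> \<tau>)] \<cdot>\<^bsub>?K\<^esub> (nd_prj C (diag X) ?n \<bullet>\<^bsub>C\<^esub> bact X ?n i \<sigma> ?n j \<tau>))"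
        using cmp_scal_right[OF sb t] step_incl_shuffle_incl[OF step, of \<sigma> \<tau>] p st by simp
      show "(case p of (\<sigma>, \<tau>) \<Rightarrow> [(shuffle_sgn ?n \<sigma> \<tau>)] \<cdot>\<^bsub>?K\<^esub> (nd_prj C (diag X) ?n \<bullet>\<^bsub>C\<^esub> bact X ?n i \<sigma> ?n j \<tau>))
          \<in> Homs C (bob X i j) (nd C (diag X) ?n)"
        using scal_hom[OF cmp_hom[OF shuffle_bact_hom[OF p] diag_nd_prj_hom]] st by simp
    qed
    also have "\<dots> = nd_prj C (diag X) ?n \<bullet>\<^bsub>C\<^esub> shuffle_sum i j"
      by (rule finsum_shuffle_sum_left[OF diag_nd_prj_hom, symmetric])
    finally show "Ez_comp i j \<bullet>\<^bsub>C\<^esub> bnd_prj C X i j = (step_incl C X F u ?n \<bullet>\<^bsub>C\<^esub> e) \<bullet>\<^bsub>C\<^esub> bnd_prj C X i j"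
      using Ez_comp(2) by simp
  qed
  show "Ez_chain C X D \<epsilon> ?n \<bullet>\<^bsub>C\<^esub> dsum_inj C (bidegrees ?n) bnds (i, j) = step_incl C X F u ?n \<bullet>\<^bsub>C\<^esub> e"
    unfolding Ez_chain_eq Ez_total_inj[OF refl] by (rule E)
qed

end

theorem proposition5p42:
  fixes C :: "('o, 'm) additive_data"
    and X :: "('o, 'm) bisimplicial"
    and D :: "('o, 'm) simplicial"
    and \<epsilon> :: "nat \<Rightarrow> nat \<Rightarrow> 'm"
  assumes "abelian_category C"
    and "bisimplicial_object C X"
    and "is_dec_right_adjoint C X D \<epsilon>"
  shows
    "(\<forall>n. Aw_chain C X D \<epsilon> n \<bullet>\<^bsub>C\<^esub> nd_prj C (diag X) n = bidegree_prj C X n \<bullet>\<^bsub>C\<^esub> Aw_top C X n) \<and>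
     (\<forall>n i j F u \<sigma> \<tau>. i + j = n \<and> is_skeletal_step C X i j F u \<and> (\<sigma>, \<tau>) \<in> shuffles_of i j \<and>
        \<not> (\<sigma> = s_left i j \<and> \<tau> = s_right i j) \<longrightarrow>
        Aw_chain C X D \<epsilon> n \<bullet>\<^bsub>C\<^esub> step_incl C X F u n \<bullet>\<^bsub>C\<^esub> shuffle_incl C X i j F u (\<sigma>, \<tau>) =
          Zer C (bnd C X i j) (dsum C (bidegrees n) (\<lambda>(i, j). bnd C X i j))) \<and>
     (\<forall>n. Ez_chain C X D \<epsilon> n \<bullet>\<^bsub>C\<^esub> bidegree_prj C X n = nd_prj C (diag X) n \<bullet>\<^bsub>C\<^esub> Ez_top C X n) \<and>
     (\<forall>n i j F u. i + j = n \<and> is_skeletal_step C X i j F u \<longrightarrow>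
        (\<exists>e \<in> Homs C (bnd C X i j) (nd C (diag F) n).
           Ez_chain C X D \<epsilon> n \<bullet>\<^bsub>C\<^esub> dsum_inj C (bidegrees n) (\<lambda>(i, j). bnd C X i j) (i, j) =
             step_incl C X F u n \<bullet>\<^bsub>C\<^esub> e \<and>
           e = step_ident C X i j F u \<bullet>\<^bsub>C\<^esub>
             into_dsum C (shuffles_of i j) (\<lambda>_. bnd C X i j) (bnd C X i j)
               (\<lambda>(\<sigma>, \<tau>). [shuffle_sgn n \<sigma> \<tau>] \<cdot>\<^bsub>hom_group C (bnd C X i j) (bnd C X i j)\<^esub>
                            Ide C (bnd C X i j))))"
proof -
  interpret dec_adjoint C X D \<epsilon>
    by (intro dec_adjoint.intro bisimplicial_obj.intro bisimplicial_obj_axioms.intro dec_adjoint_axioms.intro assms)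
  show ?thesis
  proof (intro conjI allI impI; (elim conjE)?; (hypsubst)?)
    fix n show "Aw_chain C X D \<epsilon> n \<bullet>\<^bsub>C\<^esub> nd_prj C (diag X) n = bidegree_prj C X n \<bullet>\<^bsub>C\<^esub> Aw_top C X n"
      by (rule Aw_square)
  next
    fix i j F u \<sigma> \<tau>
    assume "is_skeletal_step C X i j F u" "(\<sigma>, \<tau>) \<in> shuffles_of i j" "\<not> (\<sigma> = s_left i j \<and> \<tau> = s_right i j)"
    then show "Aw_chain C X D \<epsilon> (i + j) \<bullet>\<^bsub>C\<^esub> step_incl C X F u (i + j) \<bullet>\<^bsub>C\<^esub> shuffle_incl C X i j F u (\<sigma>, \<tau>) =
        Zer C (bnd C X i j) (dsum C (bidegrees (i + j)) (\<lambda>(i, j). bnd C X i j))"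
      by (rule Aw_chain_step)
  next
    fix n show "Ez_chain C X D \<epsilon> n \<bullet>\<^bsub>C\<^esub> bidegree_prj C X n = nd_prj C (diag X) n \<bullet>\<^bsub>C\<^esub> Ez_top C X n"
      unfolding Ez_chain_eq by (rule Ez_total_square)
  next
    fix i j F u assume "is_skeletal_step C X i j F u"
    from Ez_chain_step[OF this]
    show "\<exists>e \<in> Homs C (bnd C X i j) (nd C (diag F) (i + j)).
        Ez_chain C X D \<epsilon> (i + j) \<bullet>\<^bsub>C\<^esub> dsum_inj C (bidegrees (i + j)) (\<lambda>(i, j). bnd C X i j) (i, j) =
          step_incl C X F u (i + j) \<bullet>\<^bsub>C\<^esub> e \<and>
        e = step_ident C X i j F u \<bullet>\<^bsub>C\<^esub>
          into_dsum C (shuffles_of i j) (\<lambda>_. bnd C X i j) (bnd C X i j)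
            (\<lambda>(\<sigma>, \<tau>). [shuffle_sgn (i + j) \<sigma> \<tau>] \<cdot>\<^bsub>hom_group C (bnd C X i j) (bnd C X i j)\<^esub> Ide C (bnd C X i j))"
      by blast
  qed
qed

end
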